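(* Let $p=p(n)\in[0,1]$ and $d=p(n-1)$, and suppose that $$\log^5 n \ll d \le n\left(1-\frac{3\log\log n}{\log n}\right).$$ Let $i\ge 0$ be the largest integer such that $d^i=o(n)$, let $c=c(n)=d^{i+1}/n$, and let $$q=\begin{cases}(e^{-c})^2+(1-e^{-c})^2 & \text{if } p=o(1),\\ p^2+(1-p)^2 & \text{if } p=\Theta(1).\end{cases}$$ For $i\ge 1$, let $\eta=\log_n d^i$. Let $G=(V,E)\in G(n,p)$. Then the following hold asymptotically almost surely. (i) If $c=\Theta(1)$, then $\beta(G)=(1+o(1))\frac{2\log n}{\log(1/q)}=\Theta(\log n)$. (ii) If $c\to\infty$ and $e^c\le (\log n)/(3\log\log n)$, then $\beta(G)=(1+o(1))\frac{2\log n}{\log(1/q)}=(1+o(1))e^c\log n\gg \log n$. (iii) If $e^c>(\log n)/(3\log\log n)$, then $$(\eta+o(1))\left(\frac{d^i}{n}+e^{-c}\right)^{-1}\log n\le \beta(G)\le (1+o(1))\left(\frac{d^i}{n}+e^{-c}\right)^{-1}\log n.$$ In particular, $\beta(G)=\Theta(e^c\log n)=\Theta\!\left(\frac{\log n}{\log(1/q)}\right)$ if $e^{-c}=\Omega(d^i/n)$, and $\beta(G)=\Theta\!\left(\frac{n\log n}{d^i}\right)$ if $e^{-c}\ll d^i/n$; hence in all cases of (iii), $\beta(G)\gg\log n$.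
   Context: For a finite connected graph $G=(V,E)$ and $R\subseteq V$ with $R=\{r_1,\dots,r_k\}$, let $d_R(v)$ be the vector whose $j$-th coordinate is the graph distance from $v$ to $r_j$. $R$ is a resolving set if $d_R(v)\ne d_R(w)$ for all distinct $v,w\in V$. The metric dimension $\beta(G)$ is the minimum cardinality of a resolving set. $G(n,p)$ is the binomial random graph on vertex set $\{1,\dots,n\}$ in which each of the $\binom n2$ pairs is an edge independently with probability $p$; $p=p(n)$ may depend on $n$. All asymptotics are as $n\to\infty$; an event holds asymptotically almost surely (a.a.s.) if its probability tends to $1$. $f\ll g$ means $f=o(g)$ and $f\gg g$ means $g=o(f)$. $\log$ is the natural logarithm.
   Formalization: In (i), p is assumed o(1) or Θ(1) so that q is defined, and "=Θ(log n)" is claimed only when 1-p is bounded away from 0; for p→1, e.g. p=1-3loglog n/log n, q→1 and 2log n/log(1/q)≫log n, so that part of the English is false. *)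

theory Defs
  imports
    "HOL-Probability.Probability"
    "HOL-Probability.Product_PMF"
    "HOL-Library.Extended_Nat"
    "HOL-Library.Landau_Symbols"
begin

text \<open>A simple graph is given by a vertex set \<open>V\<close> and a set \<open>E\<close> of two-element subsets of \<open>V\<close>.\<close>

text \<open>Length of a shortest walk; \<open>\<infinity>\<close> if there is none. The metric dimension below is thereby
  also defined for disconnected graphs.\<close>

definition graph_dist :: "'a set set \<Rightarrow> 'a \<Rightarrow> 'a \<Rightarrow> enat" where
  "graph_dist E u v = Inf {enat k | k. (u, v) \<in> {(x, y). {x, y} \<in> E} ^^ k}"

text \<open>The coordinates of \<open>d\<^sub>R(v)\<close> are indexed by the elements of \<open>R\<close> instead of an enumeration of \<open>R\<close>.\<close>

definition dist_vector :: "'a set set \<Rightarrow> 'a set \<Rightarrow> 'a \<Rightarrow> 'a \<Rightarrow> enat" where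
  "dist_vector E R v = (\<lambda>r\<in>R. graph_dist E v r)"

definition resolving_set :: "'a set \<Rightarrow> 'a set set \<Rightarrow> 'a set \<Rightarrow> bool" where
  "resolving_set V E R \<longleftrightarrow>
     R \<subseteq> V \<and> (\<forall>v\<in>V. \<forall>w\<in>V. v \<noteq> w \<longrightarrow> dist_vector E R v \<noteq> dist_vector E R w)"

definition metric_dimension :: "'a set \<Rightarrow> 'a set set \<Rightarrow> nat" where
  "metric_dimension V E = (LEAST k. \<exists>R. resolving_set V E R \<and> card R = k)"

text \<open>The binomial random graph on vertex set {1..n}, represented by its edge set.\<close>

definition vertex_pairs :: "nat \<Rightarrow> nat set set" where
  "vertex_pairs n = {e. e \<subseteq> {1..n} \<and> card e = 2}"

definition random_graph :: "nat \<Rightarrow> real \<Rightarrow> nat set set pmf" where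
  "random_graph n p =
     map_pmf (\<lambda>f. {e \<in> vertex_pairs n. f e})
       (Pi_pmf (vertex_pairs n) False (\<lambda>_. bernoulli_pmf p))"

definition beta :: "nat \<Rightarrow> nat set set \<Rightarrow> real" where
  "beta n E = real (metric_dimension {1..n} E)"

definition aas :: "(nat \<Rightarrow> real) \<Rightarrow> (nat \<Rightarrow> nat set set \<Rightarrow> bool) \<Rightarrow> bool" where
  "aas p Q \<longleftrightarrow> (\<lambda>n. measure_pmf.prob (random_graph n (p n)) {E. Q n E}) \<longlonglongrightarrow> 1"

text \<open>For a graph parameter \<open>X\<close> and deterministic \<open>f\<close>, the next three definitions express that
  \<open>X = (1 + o(1)) f\<close>, \<open>X = \<Theta>(f)\<close> and \<open>X \<ggreater> f\<close>, respectively, hold asymptotically almost surely: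
  the error function and the constants are deterministic and chosen before the event.\<close>

definition aas_asymp_eq ::
  "(nat \<Rightarrow> real) \<Rightarrow> (nat \<Rightarrow> nat set set \<Rightarrow> real) \<Rightarrow> (nat \<Rightarrow> real) \<Rightarrow> bool" where
  "aas_asymp_eq p X f \<longleftrightarrow>
     (\<exists>\<delta>::nat \<Rightarrow> real. \<delta> \<in> o(\<lambda>_. 1) \<and> aas p (\<lambda>n E. \<bar>X n E - f n\<bar> \<le> \<delta> n * \<bar>f n\<bar>))"

definition aas_bigtheta ::
  "(nat \<Rightarrow> real) \<Rightarrow> (nat \<Rightarrow> nat set set \<Rightarrow> real) \<Rightarrow> (nat \<Rightarrow> real) \<Rightarrow> bool" where
  "aas_bigtheta p X f \<longleftrightarrow>
     (\<exists>a b. 0 < a \<and> 0 < b \<and> aas p (\<lambda>n E. a * \<bar>f n\<bar> \<le> \<bar>X n E\<bar> \<and> \<bar>X n E\<bar> \<le> b * \<bar>f n\<bar>))"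

definition aas_much_greater ::
  "(nat \<Rightarrow> real) \<Rightarrow> (nat \<Rightarrow> nat set set \<Rightarrow> real) \<Rightarrow> (nat \<Rightarrow> real) \<Rightarrow> bool" where
  "aas_much_greater p X f \<longleftrightarrow>
     (\<exists>\<delta>::nat \<Rightarrow> real. \<delta> \<in> o(\<lambda>_. 1) \<and> aas p (\<lambda>n E. \<bar>f n\<bar> \<le> \<delta> n * \<bar>X n E\<bar>))"

text \<open>The largest \<open>i\<close> with \<open>d\<^sup>i = o(n)\<close>. Since \<open>d\<close> may be polylogarithmic in \<open>n\<close>, the exponent has
  to be a function of \<open>n\<close>; it is the largest one in the eventual pointwise order.\<close>

definition largest_exponent :: "(nat \<Rightarrow> real) \<Rightarrow> (nat \<Rightarrow> nat) \<Rightarrow> bool" where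
  "largest_exponent d i \<longleftrightarrow>
     (\<lambda>n. d n ^ i n) \<in> o(\<lambda>n. real n) \<and>
     (\<forall>j. (\<lambda>n. d n ^ j n) \<in> o(\<lambda>n. real n) \<longrightarrow> (\<forall>\<^sub>F n in sequentially. j n \<le> i n))"

end

(* Every vertex outside a set R of landmarks sees r in R at distance i+1 or i+2 (up to the few vertices at distance
   at most i, and exceptions), according to whether it is adjacent to the sphere of radius i around r, so a landmark
   separates a pair with probability close to 1 - q + 2 d^i/n. Random landmarks then yield the upper bounds: in the
   random graph every pair is separated by about as many landmarks as expected, and a first moment bound over random
   R suffices. For the lower bounds one fixes R, explores the spheres around R, and uses that the edges towards the
   remaining vertices are still fresh: the distance patterns of these vertices are then nearly independent, and two
   of them coincide unless R is large (a birthday argument if c is bounded, and two vertices avoiding every landmark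
   or seeing all of them at the typical distance if c tends to infinity); the failure probability is small enough for
   a union bound over all R. *)
theory Submission
  imports Defs "HOL-Real_Asymp.Real_Asymp"
begin

text \<open>Everything rests on controlling sphere sizes for all source sets at once. With
  \<open>\<delta> = 10 * sqrt (ln n / d)\<close> a growth step from m sources fails with probability
  of order at most n^(-4m), which beats the number of such sets. After i steps the relative error is
  \<open>e = i * \<delta>\<close>. A sphere is missed with probability about exp(-c), so the error
  becomes a factor exp(c * e); it has to be harmless for c up to 2 ln n, beyond which exp(-c) is
  negligible. Since i \<le> ln n, this asks for d to exceed ln^5 n by a factor tending to infinity.
  When c tends to infinity, put x = d^i / n. About n * exp(-\<rho> * (x + exp(-c))) vertices lie
  outside all balls of radius i around \<rho> landmarks and hit nearly all of their spheres. This
  number must beat \<rho> * ln n, the price of a union bound over n^\<rho> landmark sets. As \<rho>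
  may reach the order ln n / x = n^(1-\<eta>) * ln n, the argument stops at \<rho> about \<eta> * ln
  n / (x + exp(-c)): this is where \<eta> comes from. If exp c is at most ln n, then \<rho> is
  polylogarithmic and the factor is 1.\<close>

definition depends_on :: "'i set \<Rightarrow> (('i \<Rightarrow> bool) \<Rightarrow> 'b) \<Rightarrow> bool" where
  "depends_on C g \<longleftrightarrow> (\<forall>f f'. (\<forall>e\<in>C. f e = f' e) \<longrightarrow> g f = g f')"

lemma depends_onI: "(\<And>f f'. (\<And>e. e \<in> C \<Longrightarrow> f e = f' e) \<Longrightarrow> g f = g f') \<Longrightarrow> depends_on C g"
  unfolding depends_on_def by blast

lemma depends_onD: "depends_on C g \<Longrightarrow> (\<And>e. e \<in> C \<Longrightarrow> f e = f' e) \<Longrightarrow> g f = g f'"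
  unfolding depends_on_def by blast

lemma depends_on_mono: "depends_on C g \<Longrightarrow> C \<subseteq> D \<Longrightarrow> depends_on D g"
  by (rule depends_onI, erule depends_onD, blast)

lemma depends_on_comp: "depends_on C g \<Longrightarrow> depends_on C (\<lambda>f. h (g f))"
  by (rule depends_onI, rule arg_cong[where f = h], erule depends_onD, blast)

section \<open>Products of Bernoulli bits: independence, Chernoff bounds, deferred decisions\<close>

locale bernoulli_bits =
  fixes I :: "'i set" and p :: real
  assumes fin_I [simp]: "finite I" and p_range: "0 \<le> p" "p \<le> 1"
begin

definition M :: "('i \<Rightarrow> bool) pmf" where "M = Pi_pmf I False (\<lambda>_. bernoulli_pmf p)"

definition ex :: "(('i \<Rightarrow> bool) \<Rightarrow> real) \<Rightarrow> real" where "ex X = measure_pmf.expectation M X"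

definition pr :: "(('i \<Rightarrow> bool) \<Rightarrow> bool) \<Rightarrow> real" where "pr A = measure_pmf.prob M {f. A f}"

text \<open>With finite support every expectation is a finite sum, so linearity and monotonicity
  come without integrability conditions.\<close>

lemma finite_support [simp]: "finite (set_pmf M)"
proof -
  have "set_pmf M \<subseteq> PiE_dflt I False (\<lambda>_. UNIV)"
    using set_Pi_pmf_subset'[OF fin_I, of False "\<lambda>_. bernoulli_pmf p"] unfolding M_def
    by (auto simp: PiE_dflt_def)
  thus ?thesis by (rule finite_subset) (auto intro: finite_PiE_dflt)
qed

lemma ex_sum: "ex X = (\<Sum>f\<in>set_pmf M. X f * pmf M f)"
  unfolding ex_def by (rule integral_measure_pmf_real) auto

lemma pr_ex: "pr A = ex (\<lambda>f. of_bool (A f))"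
proof -
  have "(\<lambda>f. of_bool (A f)) = (indicator {f. A f} :: _ \<Rightarrow> real)" by (auto simp: indicator_def)
  thus ?thesis unfolding ex_def pr_def by simp
qed

lemma ex_mono: "(\<And>f. f \<in> set_pmf M \<Longrightarrow> X f \<le> Y f) \<Longrightarrow> ex X \<le> ex Y"
  unfolding ex_sum by (intro sum_mono mult_right_mono) auto

lemma ex_cong: "(\<And>f. f \<in> set_pmf M \<Longrightarrow> X f = Y f) \<Longrightarrow> ex X = ex Y"
  unfolding ex_sum by (intro sum.cong) auto

lemma ex_const [simp]: "ex (\<lambda>_. c) = c"
  unfolding ex_def by simp

lemma ex_cmult: "ex (\<lambda>f. c * X f) = c * ex X"
  unfolding ex_sum by (simp add: sum_distrib_left mult.assoc)

lemma ex_add: "ex (\<lambda>f. X f + Y f) = ex X + ex Y"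
  unfolding ex_sum by (simp add: sum.distrib distrib_right)

lemma ex_diff: "ex (\<lambda>f. X f - Y f) = ex X - ex Y"
  unfolding ex_sum by (simp add: sum_subtractf left_diff_distrib)

lemma ex_setsum: "ex (\<lambda>f. \<Sum>a\<in>A. X a f) = (\<Sum>a\<in>A. ex (X a))"
  unfolding ex_sum by (subst sum.swap) (simp add: sum_distrib_right)

lemma ex_nonneg: "(\<And>f. f \<in> set_pmf M \<Longrightarrow> 0 \<le> X f) \<Longrightarrow> 0 \<le> ex X"
  using ex_mono[of "\<lambda>_. 0" X] by simp

lemma pr_nonneg [simp]: "0 \<le> pr A" unfolding pr_def by simp
lemma pr_le_1 [simp]: "pr A \<le> 1" unfolding pr_def by simp

lemma pr_mono: "(\<And>f. f \<in> set_pmf M \<Longrightarrow> A f \<Longrightarrow> B f) \<Longrightarrow> pr A \<le> pr B"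
  unfolding pr_ex by (intro ex_mono) auto

lemma pr_cong: "(\<And>f. f \<in> set_pmf M \<Longrightarrow> A f \<longleftrightarrow> B f) \<Longrightarrow> pr A = pr B"
  by (intro antisym pr_mono) auto

lemma pr_not: "pr (\<lambda>f. \<not> A f) = 1 - pr A"
proof -
  have "pr (\<lambda>f. \<not> A f) = ex (\<lambda>f. 1 - of_bool (A f))"
    unfolding pr_ex by (intro ex_cong) auto
  thus ?thesis by (simp add: ex_diff pr_ex)
qed

lemma pr_disj: "pr (\<lambda>f. A f \<or> B f) \<le> pr A + pr B"
  unfolding pr_ex ex_add[symmetric] by (intro ex_mono) auto

lemma pr_union:
  assumes "finite S" shows "pr (\<lambda>f. \<exists>s\<in>S. A s f) \<le> (\<Sum>s\<in>S. pr (A s))"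
  using assms
proof (induction S rule: finite_induct)
  case empty thus ?case by (simp add: pr_ex)
next
  case (insert s S)
  have "pr (\<lambda>f. \<exists>s\<in>insert s S. A s f) \<le> pr (\<lambda>f. A s f \<or> (\<exists>s\<in>S. A s f))"
    by (intro pr_mono) auto
  also have "\<dots> \<le> pr (A s) + pr (\<lambda>f. \<exists>s\<in>S. A s f)" by (rule pr_disj)
  finally show ?case using insert by simp
qed

lemma pr_union_card:
  assumes "finite S" "\<And>s. s \<in> S \<Longrightarrow> pr (A s) \<le> b" shows "pr (\<lambda>f. \<exists>s\<in>S. A s f) \<le> real (card S) * b"
  using pr_union[OF assms(1), of A] sum_bounded_above[of S "\<lambda>s. pr (A s)" b] assms(2) by simp

text \<open>The sample is glued from two independent samples, one on \<open>I \<inter> A\<close> and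
  one on \<open>I - A\<close>. \<open>X\<close> sees only the first and \<open>Y\<close> only the
  second.\<close>

lemma ex_mult_disjoint:
  assumes X: "depends_on A X" and Y: "depends_on B Y" and "A \<inter> B = {}"
  shows "ex (\<lambda>f. X f * Y f) = ex X * ex Y"
proof -
  define Q where "Q C = Pi_pmf C False (\<lambda>_. bernoulli_pmf p)" for C :: "'i set"
  have fs: "finite (set_pmf (Q C))" if "finite C" for C
    using that set_Pi_pmf_subset'[of C False "\<lambda>_. bernoulli_pmf p"] unfolding Q_def
    by (intro finite_subset[OF set_Pi_pmf_subset'] finite_PiE_dflt) (auto intro: finite_subset)
  let ?A = "I \<inter> A" and ?B = "I - A"
  have Mu: "M = map_pmf (\<lambda>(f,g) x. if x \<in> ?A then f x else g x) (pair_pmf (Q ?A) (Q ?B))"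
    unfolding M_def Q_def by (subst Pi_pmf_union[symmetric]) (auto intro!: arg_cong2[where f = "\<lambda>a b. Pi_pmf a False b"])
  \<comment> \<open>Off its index set a sample takes the default value False. This settles the
    coordinates of \<open>A\<close> outside \<open>I\<close>, where the glued function is read from
    the other half.\<close>
  have dfA: "\<not> f e" if "f \<in> set_pmf (Q ?A)" "e \<notin> ?A" for f e
    using that set_Pi_pmf_subset[of ?A False "\<lambda>_. bernoulli_pmf p"] unfolding Q_def by auto
  have dfB: "\<not> f e" if "f \<in> set_pmf (Q ?B)" "e \<notin> ?B" for f e
    using that set_Pi_pmf_subset[of ?B False "\<lambda>_. bernoulli_pmf p"] unfolding Q_def by auto
  have XY: "X (\<lambda>x. if x \<in> ?A then f x else g x) = X f \<and> Y (\<lambda>x. if x \<in> ?A then f x else g x) = Y g"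
    if "f \<in> set_pmf (Q ?A)" "g \<in> set_pmf (Q ?B)" for f g
    using dfA[OF that(1)] dfB[OF that(2)] \<open>A \<inter> B = {}\<close>
    by (auto intro!: depends_onD[OF X] depends_onD[OF Y])
  \<comment> \<open>The outer functions \<open>X'\<close> and \<open>Y'\<close> stay arbitrary so
    that the constant 1 in place of one of them yields the marginal expectation of the other from
    the same computation.\<close>
  have gen: "ex (\<lambda>f. X' (X f) * Y' (Y f)) =
      measure_pmf.expectation (Q ?A) (\<lambda>f. X' (X f)) * measure_pmf.expectation (Q ?B) (\<lambda>f. Y' (Y f))"
    for X' Y' :: "real \<Rightarrow> real"
  proof -
    have "ex (\<lambda>f. X' (X f) * Y' (Y f)) = measure_pmf.expectation (pair_pmf (Q ?A) (Q ?B))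
        (\<lambda>(f,g). X' (X (\<lambda>x. if x \<in> ?A then f x else g x)) * Y' (Y (\<lambda>x. if x \<in> ?A then f x else g x)))"
      unfolding ex_def Mu by (simp add: case_prod_unfold)
    also have "\<dots> = measure_pmf.expectation (pair_pmf (Q ?A) (Q ?B)) (\<lambda>(f,g). X' (X f) * Y' (Y g))"
      using XY by (intro integral_cong_AE) (auto simp: AE_measure_pmf_iff simp del: if_split_mem1)
    also have "\<dots> = (\<Sum>z\<in>set_pmf (Q ?A) \<times> set_pmf (Q ?B). (case z of (f,g) \<Rightarrow> X' (X f) * Y' (Y g)) * pmf (pair_pmf (Q ?A) (Q ?B)) z)"
      by (rule integral_measure_pmf_real) (auto intro!: fs)
    also have "\<dots> = (\<Sum>f\<in>set_pmf (Q ?A). \<Sum>g\<in>set_pmf (Q ?B). (X' (X f) * pmf (Q ?A) f) * (Y' (Y g) * pmf (Q ?B) g))"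
      by (subst sum.cartesian_product) (auto intro!: sum.cong simp: pmf_pair)
    also have "\<dots> = (\<Sum>f\<in>set_pmf (Q ?A). X' (X f) * pmf (Q ?A) f) * (\<Sum>g\<in>set_pmf (Q ?B). Y' (Y g) * pmf (Q ?B) g)"
      by (simp add: sum_product)
    also have "\<dots> = measure_pmf.expectation (Q ?A) (\<lambda>f. X' (X f)) * measure_pmf.expectation (Q ?B) (\<lambda>f. Y' (Y f))"
      by (subst (1 2) integral_measure_pmf_real[where A = "set_pmf _"]) (auto intro!: fs)
    finally show ?thesis .
  qed
  show ?thesis using gen[of "\<lambda>x. x" "\<lambda>x. x"] gen[of "\<lambda>x. x" "\<lambda>_. 1"] gen[of "\<lambda>_. 1" "\<lambda>x. x"] by simp
qed

lemma pr_conj_disjoint: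
  assumes "depends_on A X" "depends_on B Y" "A \<inter> B = {}"
  shows "pr (\<lambda>f. X f \<and> Y f) = pr X * pr Y"
proof -
  have "pr (\<lambda>f. X f \<and> Y f) = ex (\<lambda>f. of_bool (X f) * of_bool (Y f))"
    unfolding pr_ex by (intro ex_cong) auto
  thus ?thesis
    using ex_mult_disjoint[OF depends_on_comp[OF assms(1)] depends_on_comp[OF assms(2)] assms(3), of of_bool of_bool]
    by (simp add: pr_ex)
qed

lemma ex_prod_disjoint:
  assumes "finite W" "\<And>w. w \<in> W \<Longrightarrow> depends_on (C w) (X w)"
    and "\<And>v w. v \<in> W \<Longrightarrow> w \<in> W \<Longrightarrow> v \<noteq> w \<Longrightarrow> C v \<inter> C w = {}"
  shows "ex (\<lambda>f. \<Prod>w\<in>W. X w f) = (\<Prod>w\<in>W. ex (X w))"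
  using assms
proof (induction W rule: finite_induct)
  case (insert v W)
  have d: "depends_on (\<Union>w\<in>W. C w) (\<lambda>f. \<Prod>w\<in>W. X w f)"
  proof (intro depends_onI prod.cong refl)
    fix f g :: "'i \<Rightarrow> bool" and w assume "\<And>e. e \<in> (\<Union>w\<in>W. C w) \<Longrightarrow> f e = g e" "w \<in> W"
    thus "X w f = X w g" using depends_onD[OF insert.prems(1)[of w], of f g] by blast
  qed
  have "C v \<inter> C w = {}" if "w \<in> W" for w
    by (rule insert.prems(2)) (use that insert.hyps in auto)
  hence "C v \<inter> (\<Union>w\<in>W. C w) = {}" by blast
  note split = ex_mult_disjoint[OF insert.prems(1)[OF insertI1] d this]
  have IH: "ex (\<lambda>f. \<Prod>w\<in>W. X w f) = (\<Prod>w\<in>W. ex (X w))"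
  proof (rule insert.IH)
    fix w assume "w \<in> W" thus "depends_on (C w) (X w)" by (intro insert.prems(1)) simp
  next
    fix v w assume "v \<in> W" "w \<in> W" "v \<noteq> w"
    thus "C v \<inter> C w = {}" by (intro insert.prems(2)) simp_all
  qed
  show ?case unfolding prod.insert[OF insert.hyps] split IH ..
qed simp

lemma pr_all_disjoint:
  assumes "finite W" "\<And>w. w \<in> W \<Longrightarrow> depends_on (C w) (X w)"
    and "\<And>v w. v \<in> W \<Longrightarrow> w \<in> W \<Longrightarrow> v \<noteq> w \<Longrightarrow> C v \<inter> C w = {}"
  shows "pr (\<lambda>f. \<forall>w\<in>W. X w f) = (\<Prod>w\<in>W. pr (X w))"
proof -
  have "pr (\<lambda>f. \<forall>w\<in>W. X w f) = ex (\<lambda>f. \<Prod>w\<in>W. of_bool (X w f))"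
    unfolding pr_ex using assms(1) by (intro ex_cong) (auto simp: of_bool_def prod_zero_iff)
  also have "\<dots> = (\<Prod>w\<in>W. ex (\<lambda>f. of_bool (X w f)))"
    by (rule ex_prod_disjoint[where C = C], rule assms(1), rule depends_on_comp[where h = of_bool],
        erule assms(2), erule (2) assms(3))
  finally show ?thesis by (simp add: pr_ex)
qed

lemma pr_bit: "e \<in> I \<Longrightarrow> pr (\<lambda>f. f e) = p"
proof -
  assume e: "e \<in> I"
  have "pr (\<lambda>f. f e) = measure_pmf.prob (map_pmf (\<lambda>f. f e) M) {True}"
    unfolding pr_def by (simp add: vimage_def)
  also have "\<dots> = p" unfolding M_def using e p_range
    by (subst Pi_pmf_component) (auto simp: measure_pmf_single)
  finally show ?thesis .
qed

lemma pr_none: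
  assumes "C \<subseteq> I" shows "pr (\<lambda>f. \<forall>e\<in>C. \<not> f e) = (1 - p) ^ card C"
proof -
  have "pr (\<lambda>f. \<forall>e\<in>C. \<not> f e) = (\<Prod>e\<in>C. pr (\<lambda>f. \<not> f e))"
    using assms by (intro pr_all_disjoint[where C = "\<lambda>e. {e}"])
      (auto intro: depends_onI simp: finite_subset[OF assms fin_I])
  also have "\<dots> = (\<Prod>e\<in>C. 1 - p)" using assms by (intro prod.cong) (auto simp: pr_not pr_bit)
  finally show ?thesis by simp
qed

lemma pr_some:
  assumes "C \<subseteq> I" shows "pr (\<lambda>f. \<exists>e\<in>C. f e) = 1 - (1 - p) ^ card C"
  using pr_not[of "\<lambda>f. \<forall>e\<in>C. \<not> f e"] pr_none[OF assms] by simp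

lemma markov_exp:
  assumes "t \<ge> 0" shows "pr (\<lambda>f. Y f \<ge> y) \<le> ex (\<lambda>f. exp (t * Y f)) * exp (- t * y)"
proof -
  have "pr (\<lambda>f. Y f \<ge> y) \<le> ex (\<lambda>f. exp (- t * y) * exp (t * Y f))"
    unfolding pr_ex using assms
    by (intro ex_mono) (auto simp: mult_exp_exp of_bool_def mult_left_mono)
  thus ?thesis unfolding ex_cmult by (simp only: mult.commute)
qed

text \<open>The exponential moment is taken at the parameter \<open>\<delta>\<close> itself, and a
  further deviation \<open>\<delta> * D\<close> then adds \<open>\<delta>\<^sup>2 * D\<close> to the
  exponent. This gives concentration even for \<open>m = 0\<close>, a case that occurs when nearly
  all separating vertices lie in the spheres and a loss of order \<open>D\<close> can be
  afforded.\<close>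

lemma chernoff_lower:
  assumes W: "finite W" "\<And>w. w \<in> W \<Longrightarrow> depends_on (C w) (X w)"
    and disj: "\<And>v w. v \<in> W \<Longrightarrow> w \<in> W \<Longrightarrow> v \<noteq> w \<Longrightarrow> C v \<inter> C w = {}"
    and rng: "\<And>w f. w \<in> W \<Longrightarrow> 0 \<le> X w f \<and> X w f \<le> 1"
    and m: "m \<le> (\<Sum>w\<in>W. ex (X w))" and m0: "0 \<le> m" and \<delta>: "0 \<le> \<delta>" "\<delta> \<le> 1"
  shows "pr (\<lambda>f. (\<Sum>w\<in>W. X w f) \<le> (1 - \<delta>) * m - \<delta> * D) \<le> exp (- \<delta>\<^sup>2 * (m / 2 + D))"
proof -
  have "exp (- \<delta>) \<le> 1 - \<delta> + \<delta>\<^sup>2 / 2"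
  proof -
    \<comment> \<open>Taylor expansion with a remainder of odd order three, which is
      nonpositive.\<close>
    obtain s where s: "\<bar>s\<bar> \<le> \<bar>-\<delta>\<bar>" "exp (-\<delta>) = (\<Sum>m<3. (-\<delta>) ^ m / fact m) + exp s / fact 3 * (-\<delta>) ^ 3"
      using Maclaurin_exp_le[of "-\<delta>" 3] by blast
    have "exp s / fact 3 * (-\<delta>) ^ 3 \<le> 0" using \<delta> by (simp add: power3_eq_cube)
    thus ?thesis using s(2) by (simp add: eval_nat_numeral)
  qed
  hence k: "1 - exp (- \<delta>) \<ge> \<delta> - \<delta>\<^sup>2 / 2" by simp
  have "pr (\<lambda>f. (\<Sum>w\<in>W. X w f) \<le> (1 - \<delta>) * m - \<delta> * D)
     = pr (\<lambda>f. - (\<Sum>w\<in>W. X w f) \<ge> - ((1 - \<delta>) * m - \<delta> * D))" by (simp only: neg_le_iff_le)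
  also have "\<dots> \<le> ex (\<lambda>f. exp (\<delta> * (- (\<Sum>w\<in>W. X w f)))) * exp (- \<delta> * (- ((1 - \<delta>) * m - \<delta> * D)))"
    by (rule markov_exp) (use \<delta> in auto)
  also have "(\<lambda>f. exp (\<delta> * (- (\<Sum>w\<in>W. X w f)))) = (\<lambda>f. \<Prod>w\<in>W. exp (- \<delta> * X w f))"
    using W(1) by (simp add: exp_sum sum_distrib_left sum_negf[symmetric])
  also have "ex \<dots> = (\<Prod>w\<in>W. ex (\<lambda>f. exp (- \<delta> * X w f)))"
    by (intro ex_prod_disjoint[where C = C] depends_on_comp[where h = "\<lambda>x. exp (- \<delta> * x)"] W disj)
  also have "\<dots> \<le> (\<Prod>w\<in>W. exp (- (1 - exp (- \<delta>)) * ex (X w)))"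
  proof (intro prod_mono conjI)
    fix w assume w: "w \<in> W"
    show "0 \<le> ex (\<lambda>f. exp (- \<delta> * X w f))" by (intro ex_nonneg) auto
    have "ex (\<lambda>f. exp (- \<delta> * X w f)) \<le> ex (\<lambda>f. 1 - (1 - exp (- \<delta>)) * X w f)"
    proof (rule ex_mono)
      fix f
      \<comment> \<open>On [0, 1] the convex exponential lies below its chord, so the moment is
        bounded by a linear function of the mean.\<close>
      have "convex_on UNIV (\<lambda>x::real. exp x)" by (intro exp_convex)
      from convex_onD[OF this, of "X w f" 0 "-\<delta>"] rng[OF w, of f]
      show "exp (- \<delta> * X w f) \<le> 1 - (1 - exp (- \<delta>)) * X w f" by (auto simp: algebra_simps)
    qed
    also have "\<dots> = 1 + (- (1 - exp (- \<delta>)) * ex (X w))" unfolding ex_diff ex_cmult ex_const by (simp only: diff_conv_add_uminus mult_minus_left)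
    also have "\<dots> \<le> exp (- (1 - exp (- \<delta>)) * ex (X w))" by (rule exp_ge_add_one_self)
    finally show "ex (\<lambda>f. exp (- \<delta> * X w f)) \<le> exp (- (1 - exp (- \<delta>)) * ex (X w))" .
  qed
  also have "\<dots> = exp (- (1 - exp (- \<delta>)) * (\<Sum>w\<in>W. ex (X w)))"
    using W(1) by (simp add: exp_sum sum_distrib_left)
  also have "\<dots> \<le> exp (- (\<delta> - \<delta>\<^sup>2 / 2) * m)"
  proof -
    have "(\<delta> - \<delta>\<^sup>2 / 2) * m \<le> (1 - exp (- \<delta>)) * (\<Sum>w\<in>W. ex (X w))"
      by (intro mult_mono) (use k m m0 \<delta> in auto)
    thus ?thesis unfolding exp_le_cancel_iff by (simp only: mult_minus_left neg_le_iff_le)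
  qed
  finally have "pr (\<lambda>f. (\<Sum>w\<in>W. X w f) \<le> (1 - \<delta>) * m - \<delta> * D)
     \<le> exp (- (\<delta> - \<delta>\<^sup>2 / 2) * m) * exp (- \<delta> * (- ((1 - \<delta>) * m - \<delta> * D)))"
    by (simp add: mult_right_mono)
  also have "\<dots> = exp (- \<delta>\<^sup>2 * (m / 2 + D))"
    by (simp add: mult_exp_exp algebra_simps power2_eq_square)
  finally show ?thesis .
qed

text \<open>After exp t - 1 \<le> t + t^2 the exponent is m * (t^2 - \<delta> * t), which is
  smallest at t = \<delta> / 2 with value -m * \<delta>^2 / 4.\<close>

lemma chernoff_upper:
  assumes W: "finite W" "\<And>w. w \<in> W \<Longrightarrow> depends_on (C w) (X w)"
    and disj: "\<And>v w. v \<in> W \<Longrightarrow> w \<in> W \<Longrightarrow> v \<noteq> w \<Longrightarrow> C v \<inter> C w = {}"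
    and rng: "\<And>w f. w \<in> W \<Longrightarrow> 0 \<le> X w f \<and> X w f \<le> 1"
    and m: "(\<Sum>w\<in>W. ex (X w)) \<le> m" and \<delta>: "0 \<le> \<delta>" "\<delta> \<le> 1"
  shows "pr (\<lambda>f. (\<Sum>w\<in>W. X w f) \<ge> (1 + \<delta>) * m) \<le> exp (- \<delta>\<^sup>2 * m / 4)"
proof -
  define t where "t = \<delta> / 2"
  have t: "0 \<le> t" "t \<le> 1" using \<delta> by (auto simp: t_def)
  have k: "exp t - 1 \<le> t + t\<^sup>2" using exp_bound[of t] t by simp
  have s0: "0 \<le> (\<Sum>w\<in>W. ex (X w))" using rng by (intro sum_nonneg ex_nonneg) auto
  hence m0: "0 \<le> m" using m by simp
  have "pr (\<lambda>f. (\<Sum>w\<in>W. X w f) \<ge> (1 + \<delta>) * m)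
     \<le> ex (\<lambda>f. exp (t * (\<Sum>w\<in>W. X w f))) * exp (- t * ((1 + \<delta>) * m))"
    by (rule markov_exp) (use t in auto)
  also have "(\<lambda>f. exp (t * (\<Sum>w\<in>W. X w f))) = (\<lambda>f. \<Prod>w\<in>W. exp (t * X w f))"
    using W(1) by (simp add: exp_sum sum_distrib_left)
  also have "ex \<dots> = (\<Prod>w\<in>W. ex (\<lambda>f. exp (t * X w f)))"
    by (intro ex_prod_disjoint[where C = C] depends_on_comp[where h = "\<lambda>x. exp (t * x)"] W disj)
  also have "\<dots> \<le> (\<Prod>w\<in>W. exp ((exp t - 1) * ex (X w)))"
  proof (intro prod_mono conjI)
    fix w assume w: "w \<in> W"
    show "0 \<le> ex (\<lambda>f. exp (t * X w f))" by (intro ex_nonneg) auto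
    have "ex (\<lambda>f. exp (t * X w f)) \<le> ex (\<lambda>f. 1 + (exp t - 1) * X w f)"
    proof (rule ex_mono)
      fix f
      have "convex_on UNIV (\<lambda>x::real. exp x)" by (intro exp_convex)
      from convex_onD[OF this, of "X w f" 0 "t"] rng[OF w, of f]
      show "exp (t * X w f) \<le> 1 + (exp t - 1) * X w f" by (auto simp: algebra_simps)
    qed
    also have "\<dots> = 1 + ((exp t - 1) * ex (X w))" by (simp add: ex_add ex_cmult)
    also have "\<dots> \<le> exp ((exp t - 1) * ex (X w))" by (rule exp_ge_add_one_self)
    finally show "ex (\<lambda>f. exp (t * X w f)) \<le> exp ((exp t - 1) * ex (X w))" .
  qed
  also have "\<dots> = exp ((exp t - 1) * (\<Sum>w\<in>W. ex (X w)))"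
    using W(1) by (simp add: exp_sum sum_distrib_left)
  also have "\<dots> \<le> exp ((t + t\<^sup>2) * m)"
  proof -
    have "(exp t - 1) * (\<Sum>w\<in>W. ex (X w)) \<le> (t + t\<^sup>2) * m"
      by (intro mult_mono) (use k m m0 t s0 in auto)
    thus ?thesis by simp
  qed
  finally have "pr (\<lambda>f. (\<Sum>w\<in>W. X w f) \<ge> (1 + \<delta>) * m) \<le> exp ((t + t\<^sup>2) * m) * exp (- t * ((1 + \<delta>) * m))"
    by (simp add: mult_right_mono)
  also have "\<dots> = exp (- \<delta>\<^sup>2 * m / 4)"
    by (simp add: mult_exp_exp t_def algebra_simps power2_eq_square)
  finally show ?thesis .
qed

text \<open>Deferred decisions: \<open>S f\<close> is what an exploration sees, \<open>F (S f)\<close> the coordinates it has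
  inspected, and the remaining coordinates are still fresh.\<close>

lemma exposure:
  assumes S: "\<And>f g. (\<And>e. e \<in> F (S f) \<Longrightarrow> f e = g e) \<Longrightarrow> S g = S f"
    and B: "\<And>s. G s \<Longrightarrow> depends_on (- F s) (B s)"
    and b: "\<And>s. G s \<Longrightarrow> pr (B s) \<le> b" and "0 \<le> b"
  shows "pr (\<lambda>f. G (S f) \<and> B (S f) f) \<le> b"
proof -
  let ?R = "S ` set_pmf M"
  \<comment> \<open>Whether the exploration ends in \<open>s\<close> is decided by the very
    coordinates that \<open>s\<close> reports as inspected, hence independently of all
    others.\<close>
  have dS: "depends_on (F s) (\<lambda>f. S f = s)" for s
  proof (rule depends_onI)
    fix f g :: "'i \<Rightarrow> bool" assume eq: "\<And>e. e \<in> F s \<Longrightarrow> f e = g e"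
    have "S g = s" if "S f = s" using S[of f g] eq that by simp
    moreover have "S f = s" if "S g = s" using S[of g f] eq that by simp
    ultimately show "(S f = s) = (S g = s)" by blast
  qed
  have "pr (\<lambda>f. G (S f) \<and> B (S f) f) \<le> pr (\<lambda>f. \<exists>s\<in>?R. S f = s \<and> G s \<and> B s f)"
    by (intro pr_mono) auto
  also have "\<dots> \<le> (\<Sum>s\<in>?R. pr (\<lambda>f. S f = s \<and> G s \<and> B s f))"
    by (intro pr_union) auto
  also have "\<dots> \<le> (\<Sum>s\<in>?R. b * pr (\<lambda>f. S f = s))"
  proof (intro sum_mono)
    fix s
    show "pr (\<lambda>f. S f = s \<and> G s \<and> B s f) \<le> b * pr (\<lambda>f. S f = s)"
    proof (cases "G s")
      case True
      have "pr (\<lambda>f. S f = s \<and> B s f) = pr (\<lambda>f. S f = s) * pr (B s)"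
        by (rule pr_conj_disjoint[OF dS B]) (use True in auto)
      also have "\<dots> \<le> pr (\<lambda>f. S f = s) * b" by (intro mult_left_mono b True) auto
      finally show ?thesis using True by (simp add: mult.commute)
    next
      case False thus ?thesis using \<open>0 \<le> b\<close> by (simp add: pr_ex ex_nonneg)
    qed
  qed
  also have "\<dots> = b * ex (\<lambda>f. \<Sum>s\<in>?R. of_bool (S f = s))"
    unfolding pr_ex ex_setsum by (simp only: sum_distrib_left)
  \<comment> \<open>Each outcome of the support ends in exactly one state, so the weights of the
    states add up to 1.\<close>
  also have "ex (\<lambda>f. \<Sum>s\<in>?R. of_bool (S f = s)) = ex (\<lambda>_. 1)"
  proof (rule ex_cong)
    fix f assume "f \<in> set_pmf M"
    hence "?R \<inter> {S f} = {S f}" by auto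
    thus "(\<Sum>s\<in>?R. of_bool (S f = s)) = (1 :: real)" by simp
  qed
  finally show ?thesis by simp
qed

end

section \<open>Positive correlation of increasing events\<close>

lemma (in bernoulli_bits) ex_insert_bit:
  assumes "e \<notin> I"
  shows "bernoulli_bits.ex (insert e I) p X
       = p * ex (\<lambda>f. X (f(e := True))) + (1 - p) * ex (\<lambda>f. X (f(e := False)))"
proof -
  interpret J: bernoulli_bits "insert e I" p by unfold_locales (use p_range in auto)
  have fb: "finite (set_pmf (pair_pmf (bernoulli_pmf p) M))" by auto
  have "J.ex X = measure_pmf.expectation (pair_pmf (bernoulli_pmf p) M) (\<lambda>(y,f). X (f(e := y)))"
    unfolding J.ex_def J.M_def using assms by (subst Pi_pmf_insert) (auto simp: M_def case_prod_unfold)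
  also have "\<dots> = (\<Sum>z\<in>UNIV \<times> set_pmf M. (case z of (y,f) \<Rightarrow> X (f(e := y))) * pmf (pair_pmf (bernoulli_pmf p) M) z)"
    by (rule integral_measure_pmf_real) auto
  also have "\<dots> = (\<Sum>y\<in>UNIV. \<Sum>f\<in>set_pmf M. X (f(e := y)) * (pmf (bernoulli_pmf p) y * pmf M f))"
    by (subst sum.cartesian_product) (auto intro!: sum.cong simp: pmf_pair)
  also have "\<dots> = p * ex (\<lambda>f. X (f(e := True))) + (1 - p) * ex (\<lambda>f. X (f(e := False)))"
    using p_range by (simp add: UNIV_bool ex_sum sum_distrib_left mult_ac)
  finally show ?thesis .
qed

text \<open>Induction on the number of bits: the conditional means of both functions grow when the
  new bit is switched on, so they are positively correlated, and the induction hypothesis handles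
  each value of that bit.\<close>

lemma harris_ex:
  assumes "finite I" "0 \<le> p" "p \<le> 1"
    and "\<And>f g. (\<And>e. f e \<Longrightarrow> g e) \<Longrightarrow> X f \<le> X g" "\<And>f g. (\<And>e. f e \<Longrightarrow> g e) \<Longrightarrow> Y f \<le> (Y g :: real)"
  shows "bernoulli_bits.ex I p X * bernoulli_bits.ex I p Y \<le> bernoulli_bits.ex I p (\<lambda>f. X f * Y f)"
  using assms
proof (induction I arbitrary: X Y rule: finite_induct)
  case empty
  then interpret bernoulli_bits "{}" p by unfold_locales auto
  show ?case by (simp add: ex_def M_def)
next
  case (insert e I)
  then interpret bernoulli_bits I p by unfold_locales auto
  let ?X1 = "ex (\<lambda>f. X (f(e := True)))" and ?X0 = "ex (\<lambda>f. X (f(e := False)))"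
  let ?Y1 = "ex (\<lambda>f. Y (f(e := True)))" and ?Y0 = "ex (\<lambda>f. Y (f(e := False)))"
  have "?X0 \<le> ?X1" "?Y0 \<le> ?Y1" by (auto intro!: ex_mono insert.prems split: if_splits)
  \<comment> \<open>The right-hand side is the covariance of the two conditional means under the new
    bit.\<close>
  hence "0 \<le> p * (1 - p) * ((?X1 - ?X0) * (?Y1 - ?Y0))" using insert.prems by auto
  hence "(p * ?X1 + (1 - p) * ?X0) * (p * ?Y1 + (1 - p) * ?Y0)
      \<le> p * (?X1 * ?Y1) + (1 - p) * (?X0 * ?Y0)"
    by (simp add: algebra_simps)
  also have "\<dots> \<le> p * ex (\<lambda>f. X (f(e := True)) * Y (f(e := True)))
               + (1 - p) * ex (\<lambda>f. X (f(e := False)) * Y (f(e := False)))"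
    by (intro add_mono mult_left_mono insert.IH) (auto intro!: insert.prems split: if_splits simp: insert.prems(1,2))
  finally show ?case unfolding ex_insert_bit[OF insert.hyps(2)] .
qed

context bernoulli_bits begin

text \<open>Serves for landmarks with overlapping spheres: hitting all of them is not a product of
  independent events, but at least as likely as if it were.\<close>

lemma harris_pr:
  assumes "finite W" and "\<And>w f g. w \<in> W \<Longrightarrow> (\<And>e. f e \<Longrightarrow> g e) \<Longrightarrow> A w f \<Longrightarrow> A w g"
  shows "(\<Prod>w\<in>W. pr (A w)) \<le> pr (\<lambda>f. \<forall>w\<in>W. A w f)"
  using assms
proof (induction W rule: finite_induct)
  case empty thus ?case by (simp add: pr_ex)
next
  case (insert v W)
  have "(\<Prod>w\<in>insert v W. pr (A w)) \<le> pr (A v) * pr (\<lambda>f. \<forall>w\<in>W. A w f)"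
  proof -
    have "(\<Prod>w\<in>W. pr (A w)) \<le> pr (\<lambda>f. \<forall>w\<in>W. A w f)"
      by (rule insert.IH) (rule insert.prems, auto)
    thus ?thesis using insert.hyps by (simp add: mult_left_mono)
  qed
  also have "\<dots> \<le> ex (\<lambda>f. of_bool (A v f) * of_bool (\<forall>w\<in>W. A w f))"
    unfolding pr_ex
  proof (intro harris_ex)
    fix f g :: "'i \<Rightarrow> bool" assume le: "\<And>e. f e \<Longrightarrow> g e"
    show "of_bool (A v f) \<le> (of_bool (A v g) :: real)" using insert.prems[OF insertI1 le] by (auto simp: of_bool_def)
    show "of_bool (\<forall>w\<in>W. A w f) \<le> (of_bool (\<forall>w\<in>W. A w g) :: real)"
      using insert.prems[OF insertI2 le] by (auto simp: of_bool_def)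
  qed (use p_range in auto)
  also have "\<dots> = pr (\<lambda>f. \<forall>w\<in>insert v W. A w f)"
    unfolding pr_ex by (intro ex_cong) auto
  finally show ?case .
qed

end

section \<open>Balls (\<open>reach E A (Suc r)\<close> has radius r), distances, resolving
  sets\<close>

fun reach :: "'a set set \<Rightarrow> 'a set \<Rightarrow> nat \<Rightarrow> 'a set" where
  "reach E A 0 = {}"
| "reach E A (Suc j) = A \<union> reach E A j \<union> {w. \<exists>u\<in>reach E A j. {u, w} \<in> E}"

lemma reach_Suc_mono: "reach E A j \<subseteq> reach E A (Suc j)"
  by auto

lemma reach_mono: "j \<le> k \<Longrightarrow> reach E A j \<subseteq> reach E A k"
  by (rule lift_Suc_mono_le[of "reach E A"]) (rule reach_Suc_mono)

lemma reach_source: "A \<subseteq> reach E A (Suc j)"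
  by auto

lemma reach_UN: "reach E A j = (\<Union>a\<in>A. reach E {a} j)"
  by (induction j) auto

lemma reach_subset:
  assumes "E \<subseteq> vertex_pairs n" "A \<subseteq> {1..n}" shows "reach E A j \<subseteq> {1..n}"
proof (induction j)
  case (Suc j)
  have "w \<in> {1..n}" if "{u, w} \<in> E" for u w using that assms(1) by (auto simp: vertex_pairs_def)
  thus ?case using Suc assms(2) by auto
qed simp

text \<open>Finding the next ball inspects only edges with an end in the current one. So
  \<open>reach E A (Suc k)\<close> becomes known while all pairs that avoid
  \<open>reach E A k\<close> are still undecided, including those that leave the outermost
  sphere.\<close>

lemma reach_agree:
  assumes "\<And>e. e \<inter> reach E A k \<noteq> {} \<Longrightarrow> e \<in> E \<longleftrightarrow> e \<in> E'" and "j \<le> Suc k"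
  shows "reach E' A j = reach E A j"
  using assms(2)
proof (induction j)
  case (Suc j)
  hence IH: "reach E' A j = reach E A j" by simp
  have "{u, w} \<in> E \<longleftrightarrow> {u, w} \<in> E'" if "u \<in> reach E A j" for u w
    by (rule assms(1)) (use that reach_mono[of j k E A] Suc.prems in auto)
  thus ?case by (auto simp: IH)
qed simp

text \<open>Neighbours of \<open>reach E A k\<close> are already in
  \<open>reach E A (Suc k)\<close>, hence new vertices arise only from the outermost sphere.\<close>

lemma reach_new:
  "reach E A (Suc (Suc k)) - reach E A (Suc k)
     = {w. w \<notin> reach E A (Suc k) \<and> (\<exists>u\<in>reach E A (Suc k) - reach E A k. {u, w} \<in> E)}"
  by auto

lemma reach_iff_relpow:
  "w \<in> reach E A (Suc j) \<longleftrightarrow> (\<exists>a\<in>A. \<exists>k\<le>j. (a, w) \<in> {(x, y). {x, y} \<in> E} ^^ k)"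
proof (induction j arbitrary: w)
  case (Suc j)
  let ?r = "{(x, y). {x, y} \<in> E}"
  have "w \<in> reach E A (Suc (Suc j)) \<longleftrightarrow>
      w \<in> reach E A (Suc j) \<or> (\<exists>u\<in>reach E A (Suc j). (u, w) \<in> ?r)" by auto
  also have "\<dots> \<longleftrightarrow> (\<exists>a\<in>A. \<exists>k\<le>j. (a, w) \<in> ?r ^^ k) \<or> (\<exists>a\<in>A. \<exists>k\<le>j. (a, w) \<in> ?r ^^ Suc k)"
    unfolding Bex_def Suc by (auto simp: relcomp.simps) blast+
  also have "\<dots> \<longleftrightarrow> (\<exists>a\<in>A. \<exists>k\<le>Suc j. (a, w) \<in> ?r ^^ k)"
  proof -
    have "(\<exists>k\<le>Suc j. (a, w) \<in> ?r ^^ k) \<longleftrightarrow> (\<exists>k\<le>j. (a, w) \<in> ?r ^^ k) \<or> (\<exists>k\<le>j. (a, w) \<in> ?r ^^ Suc k)" for a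
    proof (intro iffI)
      assume "\<exists>k\<le>Suc j. (a, w) \<in> ?r ^^ k"
      then obtain k where k: "k \<le> Suc j" "(a, w) \<in> ?r ^^ k" by blast
      show "(\<exists>k\<le>j. (a, w) \<in> ?r ^^ k) \<or> (\<exists>k\<le>j. (a, w) \<in> ?r ^^ Suc k)"
        using k by (cases "k \<le> j") (auto simp: le_Suc_eq)
    next
      assume "(\<exists>k\<le>j. (a, w) \<in> ?r ^^ k) \<or> (\<exists>k\<le>j. (a, w) \<in> ?r ^^ Suc k)"
      thus "\<exists>k\<le>Suc j. (a, w) \<in> ?r ^^ k" using Suc_le_mono le_SucI by blast
    qed
    thus ?thesis by blast
  qed
  finally show ?case .
qed auto

lemma adj_relpow_sym:
  "(a, w) \<in> {(x, y). {x, y} \<in> E} ^^ k \<Longrightarrow> (w, a) \<in> {(x, y). {x, y} \<in> E} ^^ k"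
proof (induction k arbitrary: w)
  case (Suc k)
  then obtain u where u: "(a, u) \<in> {(x, y). {x, y} \<in> E} ^^ k" "{u, w} \<in> E"
    unfolding relpow.simps by blast
  hence "(w, u) \<in> {(x, y). {x, y} \<in> E}" by (simp add: insert_commute)
  from relpow_Suc_I2[OF this Suc.IH[OF u(1)]] show ?case .
qed simp

lemma graph_dist_le_iff: "graph_dist E w a \<le> enat j \<longleftrightarrow> w \<in> reach E {a} (Suc j)"
proof -
  let ?r = "{(x, y). {x, y} \<in> E}"
  have sym: "(w, a) \<in> ?r ^^ k \<longleftrightarrow> (a, w) \<in> ?r ^^ k" for k
    by (rule iffI; erule adj_relpow_sym)
  have "graph_dist E w a \<le> enat j \<longleftrightarrow> (\<exists>k\<le>j. (w, a) \<in> ?r ^^ k)"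
  proof
    assume le: "graph_dist E w a \<le> enat j"
    \<comment> \<open>The infimum of the empty set is infinity, so a finite distance is attained by
      an actual walk.\<close>
    have ne: "{enat k | k. (w, a) \<in> ?r ^^ k} \<noteq> {}"
    proof
      assume "{enat k | k. (w, a) \<in> ?r ^^ k} = {}"
      hence "graph_dist E w a = \<infinity>" unfolding graph_dist_def by (simp only: Inf_empty top_enat_def)
      thus False using le by simp
    qed
    then obtain z where z: "z \<in> {enat k | k. (w, a) \<in> ?r ^^ k}" by blast
    have "graph_dist E w a \<in> {enat k | k. (w, a) \<in> ?r ^^ k}"
      unfolding graph_dist_def by (rule wellorder_InfI[OF z])
    thus "\<exists>k\<le>j. (w, a) \<in> ?r ^^ k" using le by auto
  next
    assume "\<exists>k\<le>j. (w, a) \<in> ?r ^^ k"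
    then obtain k where k: "k \<le> j" "(w, a) \<in> ?r ^^ k" by blast
    have "graph_dist E w a \<le> enat k" unfolding graph_dist_def by (rule Inf_lower) (use k in blast)
    also have "\<dots> \<le> enat j" using k by simp
    finally show "graph_dist E w a \<le> enat j" .
  qed
  thus ?thesis unfolding reach_iff_relpow sym by auto
qed

lemma reach_sym: "w \<in> reach E {a} j \<longleftrightarrow> a \<in> reach E {w} j"
proof (cases j)
  case (Suc k)
  let ?r = "{(x, y). {x, y} \<in> E}"
  have "(w, a) \<in> ?r ^^ k \<longleftrightarrow> (a, w) \<in> ?r ^^ k" for k
    by (rule iffI; erule adj_relpow_sym)
  thus ?thesis unfolding Suc reach_iff_relpow by auto
qed simp

text \<open>An extended natural is determined by the finite numbers above it; infinity is the one
  with none. Disconnected graphs are thereby covered.\<close>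

lemma graph_dist_eqI:
  assumes "\<And>j. v \<in> reach E {r} j \<longleftrightarrow> w \<in> reach E {r} j"
  shows "graph_dist E v r = graph_dist E w r"
proof -
  have "graph_dist E v r \<le> enat j \<longleftrightarrow> graph_dist E w r \<le> enat j" for j
    using assms unfolding graph_dist_le_iff by blast
  note * = this
  show ?thesis
  proof (cases "graph_dist E v r"; cases "graph_dist E w r")
    fix a b assume "graph_dist E v r = enat a" "graph_dist E w r = enat b"
    thus ?thesis using *[of a] *[of b] by simp
  next
    fix a assume "graph_dist E v r = enat a" "graph_dist E w r = \<infinity>"
    thus ?thesis using *[of a] by simp
  next
    fix a assume "graph_dist E v r = \<infinity>" "graph_dist E w r = enat a"
    thus ?thesis using *[of a] by simp
  qed simp
qed

lemma graph_dist_eqD: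
  "graph_dist E v r = graph_dist E w r \<Longrightarrow> v \<in> reach E {r} j \<longleftrightarrow> w \<in> reach E {r} j"
  by (cases j) (auto simp del: reach.simps(2) simp add: graph_dist_le_iff[symmetric])

lemma resolving_set_iff:
  "resolving_set V E R \<longleftrightarrow> R \<subseteq> V \<and>
     (\<forall>v\<in>V. \<forall>w\<in>V. v \<noteq> w \<longrightarrow> (\<exists>r\<in>R. graph_dist E v r \<noteq> graph_dist E w r))"
proof -
  have "dist_vector E R v \<noteq> dist_vector E R w \<longleftrightarrow> (\<exists>r\<in>R. graph_dist E v r \<noteq> graph_dist E w r)" for v w
    unfolding dist_vector_def by (auto simp: restrict_def fun_eq_iff)
  thus ?thesis unfolding resolving_set_def by simp
qed

text \<open>A vertex is the only one at distance 0 from itself, also in a disconnected graph. So the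
  minimum in \<open>metric_dimension\<close> is taken over a nonempty set.\<close>

lemma resolving_set_univ: "resolving_set V E V"
  unfolding resolving_set_iff
proof (intro conjI ballI impI)
  fix v w assume vw: "v \<in> V" "w \<in> V" "v \<noteq> w"
  have "v \<in> reach E {v} (Suc 0)" "w \<notin> reach E {v} (Suc 0)" using vw by auto
  hence "graph_dist E v v \<noteq> graph_dist E w v" using graph_dist_eqD[of E v v w "Suc 0"] by blast
  thus "\<exists>r\<in>V. graph_dist E v r \<noteq> graph_dist E w r" using vw by blast
qed simp

lemma resolving_set_mono: "resolving_set V E R \<Longrightarrow> R \<subseteq> R' \<Longrightarrow> R' \<subseteq> V \<Longrightarrow> resolving_set V E R'"
  unfolding resolving_set_iff by blast

lemma metric_dimension_le: "resolving_set V E R \<Longrightarrow> card R \<le> k \<Longrightarrow> metric_dimension V E \<le> k"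
  unfolding metric_dimension_def by (rule order.trans[OF Least_le]) auto

text \<open>Supersets of resolving sets resolve, so excluding the sets of exactly \<open>k\<close>
  elements excludes all smaller ones too. A union bound over a single size is then enough.\<close>

lemma metric_dimension_gt:
  assumes "finite V" "k \<le> card V" "\<And>R. R \<subseteq> V \<Longrightarrow> card R = k \<Longrightarrow> \<not> resolving_set V E R"
  shows "k < metric_dimension V E"
proof (rule ccontr)
  assume le: "\<not> k < metric_dimension V E"
  have "\<exists>R. resolving_set V E R \<and> card R = metric_dimension V E"
    unfolding metric_dimension_def
    by (rule LeastI_ex[of "\<lambda>k. \<exists>R. resolving_set V E R \<and> card R = k"]) (use resolving_set_univ in blast)
  then obtain R where R: "resolving_set V E R" "card R \<le> k" using le by auto
  hence "R \<subseteq> V" by (auto simp: resolving_set_iff)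
  then obtain R' where "R \<subseteq> R'" "R' \<subseteq> V" "card R' = k"
    using exists_subset_between[of R k V] R assms by blast
  thus False using assms(3) resolving_set_mono[OF R(1)] by blast
qed

text \<open>A greedy substitute for drawing the vertices at random: in every round some vertex lies
  in at least a fraction \<open>y\<close> of the sets not hit so far, so \<open>k\<close> rounds
  leave at most \<open>card P * (1 - y) ^ k\<close> of them, which is less than one.\<close>

lemma exists_small_hitting_set:
  fixes S :: "'p \<Rightarrow> 'v set" and y :: real
  assumes V: "finite V" "V \<noteq> {}" and P: "finite P" "\<And>q. q \<in> P \<Longrightarrow> S q \<subseteq> V"
    and y: "\<And>q. q \<in> P \<Longrightarrow> y * card V \<le> card (S q)" "y \<le> 1" and k: "card P * (1 - y) ^ k < 1"
  shows "\<exists>R\<subseteq>V. card R \<le> k \<and> (\<forall>q\<in>P. R \<inter> S q \<noteq> {})"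
proof -
  define U where "U R = {q\<in>P. R \<inter> S q = {}}" for R
  have "\<exists>R\<subseteq>V. card R \<le> k \<and> card (U R) \<le> card P * (1 - y) ^ k" for k
  proof (induction k)
    case 0
    show ?case by (rule exI[of _ "{}"]) (auto simp: U_def)
  next
    case (Suc k)
    then obtain R where R: "R \<subseteq> V" "card R \<le> k" "card (U R) \<le> card P * (1 - y) ^ k" by blast
    have fU: "finite (U R)" using P by (auto simp: U_def)
    \<comment> \<open>Double counting: the sets not yet hit have at least \<open>y * card V\<close>
      elements each, so some vertex lies in at least \<open>y * card (U R)\<close> of them.\<close>
    have "\<exists>r\<in>V. y * card (U R) \<le> card {q\<in>U R. r \<in> S q}"
    proof (rule ccontr)
      assume "\<not> ?thesis"
      hence lt: "real (card {q\<in>U R. r \<in> S q}) < y * card (U R)" if "r \<in> V" for r using that by force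
      have "(\<Sum>r\<in>V. real (card {q\<in>U R. r \<in> S q})) < (\<Sum>r\<in>V. y * card (U R))"
        by (intro sum_strict_mono V lt)
      also have "\<dots> = (\<Sum>q\<in>U R. y * card V)" by simp
      also have "\<dots> \<le> (\<Sum>q\<in>U R. real (card (S q)))" by (intro sum_mono y) (auto simp: U_def)
      also have "\<dots> = (\<Sum>q\<in>U R. \<Sum>r\<in>V. if r \<in> S q then 1 else 0)"
      proof (intro sum.cong refl)
        fix q assume "q \<in> U R"
        hence "V \<inter> S q = S q" using P(2) by (auto simp: U_def)
        thus "real (card (S q)) = (\<Sum>r\<in>V. if r \<in> S q then 1 else 0)"
          using V by (simp add: sum.If_cases)
      qed
      also have "\<dots> = (\<Sum>r\<in>V. \<Sum>q\<in>U R. if r \<in> S q then 1 else 0)" by (rule sum.swap)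
      also have "\<dots> = (\<Sum>r\<in>V. real (card {q\<in>U R. r \<in> S q}))"
        using fU by (simp add: sum.If_cases Int_def)
      finally show False by simp
    qed
    then obtain r where r: "r \<in> V" "y * card (U R) \<le> card {q\<in>U R. r \<in> S q}" by blast
    have "U (insert r R) = U R - {q\<in>U R. r \<in> S q}" by (auto simp: U_def)
    hence "real (card (U (insert r R))) = card (U R) - real (card {q\<in>U R. r \<in> S q})"
      using fU by (simp add: card_Diff_subset of_nat_diff card_mono)
    also have "\<dots> \<le> (1 - y) * card (U R)" using r by (simp add: algebra_simps)
    also have "\<dots> \<le> (1 - y) * (card P * (1 - y) ^ k)" using y R by (intro mult_left_mono) auto
    finally have "card (U (insert r R)) \<le> card P * (1 - y) ^ Suc k" by (simp add: mult_ac)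
    moreover have "card (insert r R) \<le> Suc k" using R V card_insert_if[OF finite_subset[OF R(1) V(1)], of r] by simp
    ultimately show ?case using R r by blast
  qed
  then obtain R where R: "R \<subseteq> V" "card R \<le> k" "card (U R) \<le> card P * (1 - y) ^ k" by blast
  hence "card (U R) = 0" using k by linarith
  hence "U R = {}" using P by (auto simp: U_def)
  thus ?thesis using R by (auto simp: U_def)
qed

section \<open>The random graph as a function of its edge bits\<close>

definition gr :: "nat \<Rightarrow> (nat set \<Rightarrow> bool) \<Rightarrow> nat set set" where
  "gr n f = {e \<in> vertex_pairs n. f e}"

lemma gr_subset: "gr n f \<subseteq> vertex_pairs n" by (auto simp: gr_def)

lemma finite_vertex_pairs [simp]: "finite (vertex_pairs n)"
  by (rule finite_subset[of _ "Pow {1..n}"]) (auto simp: vertex_pairs_def)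

lemma reach_gr_subset: "A \<subseteq> {1..n} \<Longrightarrow> reach (gr n f) A j \<subseteq> {1..n}"
  by (rule reach_subset[OF gr_subset])

text \<open>Reads the bits and not the edges of \<open>gr n f\<close>, so that it depends on
  precisely the pairs in \<open>star w S\<close>. For \<open>w\<close> outside \<open>S\<close>, all
  within the vertex set, the two readings agree.\<close>

definition hits :: "('a set \<Rightarrow> bool) \<Rightarrow> 'a \<Rightarrow> 'a set \<Rightarrow> bool" where
  "hits f w S \<longleftrightarrow> (\<exists>u\<in>S. f {u, w})"

definition star :: "'a \<Rightarrow> 'a set \<Rightarrow> 'a set set" where
  "star w S = (\<lambda>u. {u, w}) ` S"

lemma hits_star: "hits f w S \<longleftrightarrow> (\<exists>e\<in>star w S. f e)"
  by (auto simp: hits_def star_def)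

lemma depends_on_hits: "depends_on (star w S) (\<lambda>f. hits f w S)"
  by (intro depends_onI) (auto simp: hits_star)

lemma card_star: "w \<notin> S \<Longrightarrow> card (star w S) = card S"
  unfolding star_def by (intro card_image) (auto simp: inj_on_def doubleton_eq_iff)

lemma star_subset: "w \<notin> S \<Longrightarrow> w \<in> {1..n} \<Longrightarrow> S \<subseteq> {1..n} \<Longrightarrow> star w S \<subseteq> vertex_pairs n"
  by (auto simp: star_def vertex_pairs_def card_insert_if)

text \<open>The source of independence between distinct fresh vertices: they share no pair with the
  explored sets as long as neither belongs to the set of the other.\<close>

lemma star_disjoint: "w \<noteq> w' \<Longrightarrow> w \<notin> S' \<Longrightarrow> w' \<notin> S \<Longrightarrow> star w S \<inter> star w' S' = {}"
  by (auto simp: star_def doubleton_eq_iff)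

lemma star_disjoint': "w \<notin> S \<Longrightarrow> S \<inter> S' = {} \<Longrightarrow> w \<notin> S' \<Longrightarrow> star w S \<inter> star w S' = {}"
  by (auto simp: star_def doubleton_eq_iff)

lemma star_avoids: "w \<notin> N \<Longrightarrow> S \<inter> N = {} \<Longrightarrow> star w S \<subseteq> {e. e \<inter> N = {}}"
  by (auto simp: star_def)

lemma reach_gr_new:
  assumes "A \<subseteq> {1..n}"
  shows "reach (gr n f) A (Suc (Suc k)) - reach (gr n f) A (Suc k)
     = {w \<in> {1..n} - reach (gr n f) A (Suc k). hits f w (reach (gr n f) A (Suc k) - reach (gr n f) A k)}"
proof -
  have "{u, w} \<in> gr n f \<longleftrightarrow> f {u, w}"
    if "u \<in> reach (gr n f) A (Suc k)" "w \<in> {1..n}" "w \<notin> reach (gr n f) A (Suc k)" for u w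
  proof -
    have "u \<in> {1..n}" using reach_gr_subset[OF assms] that(1) by blast
    moreover have "u \<noteq> w" using that by blast
    ultimately show ?thesis using that by (auto simp: gr_def vertex_pairs_def)
  qed
  moreover have "w \<in> {1..n}" if "w \<in> reach (gr n f) A (Suc (Suc k))" for w
    using reach_gr_subset[OF assms] that by blast
  ultimately show ?thesis
    unfolding set_eq_iff reach_new hits_def Diff_iff mem_Collect_eq
    using reach_new[of "gr n f" A k] by blast
qed

section \<open>Exploring balls in the random graph\<close>

locale gnp =
  fixes n :: nat and p :: real
  assumes p01: "0 \<le> p" "p \<le> 1"

sublocale gnp \<subseteq> bernoulli_bits "vertex_pairs n" p
  using p01 by unfold_locales auto

context gnp begin

lemma prob_random_graph: "measure_pmf.prob (random_graph n p) {E. Q E} = pr (\<lambda>f. Q (gr n f))"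
  unfolding random_graph_def pr_def M_def gr_def by (simp add: vimage_def)

lemma pr_hits:
  assumes "w \<notin> S" "w \<in> {1..n}" "S \<subseteq> {1..n}"
  shows "pr (\<lambda>f. hits f w S) = 1 - (1 - p) ^ card S"
  unfolding hits_star using pr_some[OF star_subset[OF assms]] card_star[OF assms(1)] by simp

text \<open>The state of an exploration keeps the ball of each landmark separately. Restriction to
  \<open>R\<close> makes states comparable as values.\<close>

definition st :: "nat set \<Rightarrow> nat \<Rightarrow> (nat set \<Rightarrow> bool) \<Rightarrow> nat \<Rightarrow> nat set" where
  "st R k f = (\<lambda>r\<in>R. reach (gr n f) {r} k)"

lemma st_apply [simp]: "r \<in> R \<Longrightarrow> st R k f r = reach (gr n f) {r} k"
  by (simp add: st_def del: reach.simps)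

lemma st_agree:
  assumes eq: "\<And>e. e \<inter> (\<Union>r\<in>R. st R k f r) \<noteq> {} \<Longrightarrow> f e = g e" and "j \<le> Suc k"
  shows "st R j g = st R j f"
proof
  fix r
  show "st R j g r = st R j f r"
  proof (cases "r \<in> R")
    case True
    have "reach (gr n g) {r} j = reach (gr n f) {r} j"
    proof (rule reach_agree[OF _ assms(2)])
      fix e assume "e \<inter> reach (gr n f) {r} k \<noteq> {}"
      hence "f e = g e" using True by (intro eq) (auto simp del: reach.simps)
      thus "e \<in> gr n f \<longleftrightarrow> e \<in> gr n g" by (simp add: gr_def)
    qed
    thus ?thesis using True by simp
  qed (simp add: st_def)
qed

text \<open>Deferred decisions with the balls of index \<open>k\<close> and \<open>Suc k\<close> as
  the state. The inspected pairs are those meeting a ball of index \<open>k\<close>; every other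
  pair is fresh, in particular those that lead outwards from the part of the outermost spheres lying
  in no smaller ball.\<close>

lemma explore:
  assumes B: "\<And>K K'. G K K' \<Longrightarrow> depends_on {e. e \<inter> (\<Union>r\<in>R. K r) = {}} (B K K')"
    and b: "\<And>K K'. G K K' \<Longrightarrow> pr (B K K') \<le> b" and b0: "0 \<le> b"
  shows "pr (\<lambda>f. G (st R k f) (st R (Suc k) f) \<and> B (st R k f) (st R (Suc k) f) f) \<le> b"
proof -
  let ?F = "\<lambda>s. {e. e \<inter> (\<Union>r\<in>R. fst s r) \<noteq> {}}"
  have "pr (\<lambda>f. G (fst (st R k f, st R (Suc k) f)) (snd (st R k f, st R (Suc k) f))
      \<and> B (fst (st R k f, st R (Suc k) f)) (snd (st R k f, st R (Suc k) f)) f) \<le> b"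
  proof (rule exposure[where F = ?F and S = "\<lambda>f. (st R k f, st R (Suc k) f)"
        and G = "\<lambda>s. G (fst s) (snd s)" and B = "\<lambda>s. B (fst s) (snd s)"])
    fix f g assume eq: "\<And>e. e \<in> ?F (st R k f, st R (Suc k) f) \<Longrightarrow> f e = g e"
    have "st R j g = st R j f" if "j \<le> Suc k" for j
      by (rule st_agree[OF _ that]) (rule eq, simp)
    thus "(st R k g, st R (Suc k) g) = (st R k f, st R (Suc k) f)" by simp
  next
    fix s :: "(nat \<Rightarrow> nat set) \<times> (nat \<Rightarrow> nat set)" assume G: "G (fst s) (snd s)"
    have "- ?F s = {e. e \<inter> (\<Union>r\<in>R. fst s r) = {}}" by auto
    thus "depends_on (- ?F s) (B (fst s) (snd s))" using B[OF G] by simp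
    show "pr (B (fst s) (snd s)) \<le> b" by (rule b[OF G])
  qed (rule b0)
  thus ?thesis by simp
qed

end

section \<open>Counts of independent events and the birthday bound\<close>

context bernoulli_bits begin

lemma count_lower:
  fixes m h \<delta> D :: real
  assumes fO: "finite W" and X: "\<And>w. w \<in> W \<Longrightarrow> depends_on (C w) (X w)"
    and disj: "\<And>v w. v \<in> W \<Longrightarrow> w \<in> W \<Longrightarrow> v \<noteq> w \<Longrightarrow> C v \<inter> C w = {}"
    and h: "\<And>w. w \<in> W \<Longrightarrow> h \<le> pr (X w)" and m: "0 \<le> m" "m \<le> card W * h" and \<delta>: "0 \<le> \<delta>" "\<delta> \<le> 1"
  shows "pr (\<lambda>f. card {w\<in>W. X w f} \<le> (1 - \<delta>) * m - \<delta> * D) \<le> exp (- \<delta>\<^sup>2 * (m / 2 + D))"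
proof -
  have eq: "real (card {w\<in>W. X w f}) = (\<Sum>w\<in>W. of_bool (X w f))" for f
    using fO by (simp add: of_bool_def sum.If_cases Int_def)
  have "card W * h \<le> (\<Sum>w\<in>W. ex (\<lambda>f. of_bool (X w f)))"
    unfolding pr_ex[symmetric] using sum_bounded_below[of W h "\<lambda>w. pr (X w)"] h by simp
  hence m': "m \<le> (\<Sum>w\<in>W. ex (\<lambda>f. of_bool (X w f)))" using m by linarith
  show ?thesis unfolding eq
    by (rule chernoff_lower[where C = C, OF fO _ _ _ m' m(1) \<delta>])
       (auto intro: depends_on_comp[where h = of_bool] X dest: disj)
qed

lemma count_upper:
  fixes m h \<delta> :: real
  assumes fO: "finite W" and X: "\<And>w. w \<in> W \<Longrightarrow> depends_on (C w) (X w)"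
    and disj: "\<And>v w. v \<in> W \<Longrightarrow> w \<in> W \<Longrightarrow> v \<noteq> w \<Longrightarrow> C v \<inter> C w = {}"
    and h: "\<And>w. w \<in> W \<Longrightarrow> pr (X w) \<le> h" and m: "card W * h \<le> m" and \<delta>: "0 \<le> \<delta>" "\<delta> \<le> 1"
  shows "pr (\<lambda>f. (1 + \<delta>) * m \<le> card {w\<in>W. X w f}) \<le> exp (- \<delta>\<^sup>2 * m / 4)"
proof -
  have eq: "real (card {w\<in>W. X w f}) = (\<Sum>w\<in>W. of_bool (X w f))" for f
    using fO by (simp add: of_bool_def sum.If_cases Int_def)
  have "(\<Sum>w\<in>W. ex (\<lambda>f. of_bool (X w f))) \<le> card W * h"
    unfolding pr_ex[symmetric] using sum_bounded_above[of W "\<lambda>w. pr (X w)" h] h by simp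
  hence m': "(\<Sum>w\<in>W. ex (\<lambda>f. of_bool (X w f))) \<le> m" using m by linarith
  show ?thesis unfolding eq
    by (rule chernoff_upper[where C = C, OF fO _ _ _ m' \<delta>])
       (auto intro: depends_on_comp[where h = of_bool] X dest: disj)
qed

lemma pr_in_finite: "finite Y \<Longrightarrow> pr (\<lambda>f. b f \<in> Y) = (\<Sum>x\<in>Y. pr (\<lambda>f. b f = x))"
proof -
  assume Y: "finite Y"
  have "pr (\<lambda>f. b f \<in> Y) = ex (\<lambda>f. \<Sum>x\<in>Y. of_bool (b f = x))"
    unfolding pr_ex using Y by (intro ex_cong) (simp add: of_bool_def sum.delta)
  thus ?thesis by (simp add: ex_setsum pr_ex)
qed

text \<open>Reveal one half of the sample. Its distinct values carry mass at least about
  \<open>N * Q\<close> (the summands \<open>\<mu> (b v)\<close> have mean \<open>Q\<close> and are at most \<open>sqrt Q\<close>, which makes the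
  Chernoff bound effective), and the other half must avoid them.\<close>

lemma no_collision:
  fixes b :: "'v \<Rightarrow> ('i \<Rightarrow> bool) \<Rightarrow> 'x"
  assumes W: "W1 \<inter> W2 = {}" "finite W1" "finite W2" "card W1 = N" "card W2 = N" "N > 0"
    and b: "\<And>v. v \<in> W1 \<union> W2 \<Longrightarrow> depends_on (C v) (b v)"
    and disj: "\<And>v w. v \<in> W1 \<union> W2 \<Longrightarrow> w \<in> W1 \<union> W2 \<Longrightarrow> v \<noteq> w \<Longrightarrow> C v \<inter> C w = {}"
    and law: "\<And>v x. v \<in> W1 \<union> W2 \<Longrightarrow> pr (\<lambda>f. b v f = x) = \<mu> x"
    and Q: "\<And>v w. v \<in> W1 \<Longrightarrow> w \<in> W2 \<Longrightarrow> Q \<le> pr (\<lambda>f. b v f = b w f)" "0 < Q"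
  shows "pr (\<lambda>f. inj_on (\<lambda>v. b v f) (W1 \<union> W2)) \<le> 2 * exp (- (N * sqrt Q) / 8)"
proof -
  obtain v1 where v1: "v1 \<in> W1" using W by fastforce
  obtain v2 where v2: "v2 \<in> W2" using W by fastforce
  define X where "X = b v1 ` set_pmf M"
  have fX: "finite X" by (simp add: X_def)
  have \<mu>0: "0 \<le> \<mu> x" for x using law[of v1 x] v1 by (metis UnI1 pr_nonneg)
  have \<mu>X: "\<mu> x = 0" if "x \<notin> X" for x
  proof -
    have "pr (\<lambda>f. b v1 f = x) = pr (\<lambda>_. False)" by (intro pr_cong) (use that in \<open>auto simp: X_def\<close>)
    thus ?thesis using law[of v1 x] v1 by (simp add: pr_ex)
  qed
  \<comment> \<open>\<open>q\<^sup>2\<close> is the probability that two independent patterns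
    coincide; \<open>X\<close> is a finite set carrying their common law
    \<open>\<mu>\<close>.\<close>
  define q where "q = sqrt (\<Sum>x\<in>X. (\<mu> x)\<^sup>2)"
  have q2: "q\<^sup>2 = (\<Sum>x\<in>X. (\<mu> x)\<^sup>2)" unfolding q_def by (simp add: sum_nonneg)
  have suppX: "b v f \<in> X" if "v \<in> W1 \<union> W2" "f \<in> set_pmf M" for v f
  proof (rule ccontr)
    assume "b v f \<notin> X"
    hence "pr (\<lambda>f'. b v f' = b v f) = 0" using law that \<mu>X by simp
    moreover have "pmf M f \<le> pr (\<lambda>f'. b v f' = b v f)"
      unfolding pr_def measure_pmf_single[symmetric] by (intro measure_pmf.finite_measure_mono) auto
    ultimately have "pmf M f \<le> 0" by simp
    thus False using that(2) by (simp add: set_pmf_iff)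
  qed
  have exmu: "ex (\<lambda>f. \<mu> (b v f)) = q\<^sup>2" if v: "v \<in> W1 \<union> W2" for v
  proof -
    have "ex (\<lambda>f. \<mu> (b v f)) = ex (\<lambda>f. \<Sum>x\<in>X. \<mu> x * of_bool (b v f = x))"
    proof (rule ex_cong)
      fix f assume "f \<in> set_pmf M"
      have "(\<Sum>x\<in>X. \<mu> x * of_bool (b v f = x)) = (\<Sum>x\<in>X. if x = b v f then \<mu> x else 0)"
        by (intro sum.cong) auto
      thus "\<mu> (b v f) = (\<Sum>x\<in>X. \<mu> x * of_bool (b v f = x))"
        using suppX[OF v \<open>f \<in> set_pmf M\<close>] fX by simp
    qed
    also have "\<dots> = (\<Sum>x\<in>X. \<mu> x * pr (\<lambda>f. b v f = x))" by (simp add: ex_setsum ex_cmult pr_ex)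
    also have "\<dots> = q\<^sup>2" unfolding q2 using law[OF v] by (simp add: power2_eq_square)
    finally show ?thesis .
  qed
  have "pr (\<lambda>f. b v1 f = b v2 f) = q\<^sup>2"
  proof -
    have "pr (\<lambda>f. b v1 f = b v2 f) = ex (\<lambda>f. \<Sum>x\<in>X. of_bool (b v1 f = x \<and> b v2 f = x))"
      unfolding pr_ex
    proof (rule ex_cong)
      fix f assume "f \<in> set_pmf M"
      hence "b v1 f \<in> X" using suppX v1 by blast
      have "(\<Sum>x\<in>X. of_bool (b v1 f = x \<and> b v2 f = x)) = (\<Sum>x\<in>X. if x = b v1 f then of_bool (b v2 f = x) else (0::real))"
        by (intro sum.cong) auto
      also have "\<dots> = of_bool (b v1 f = b v2 f)" using \<open>b v1 f \<in> X\<close> fX by (simp add: sum.delta eq_commute)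
      finally show "of_bool (b v1 f = b v2 f) = (\<Sum>x\<in>X. of_bool (b v1 f = x \<and> b v2 f = x) :: real)" ..
    qed
    also have "\<dots> = (\<Sum>x\<in>X. pr (\<lambda>f. b v1 f = x \<and> b v2 f = x))" by (simp add: ex_setsum pr_ex)
    also have "\<dots> = (\<Sum>x\<in>X. pr (\<lambda>f. b v1 f = x) * pr (\<lambda>f. b v2 f = x))"
    proof (intro sum.cong refl pr_conj_disjoint[where A = "C v1" and B = "C v2"])
      fix x
      show "depends_on (C v1) (\<lambda>f. b v1 f = x)" "depends_on (C v2) (\<lambda>f. b v2 f = x)"
        using depends_on_comp[OF b, of v1 "\<lambda>y. y = x"] depends_on_comp[OF b, of v2 "\<lambda>y. y = x"] v1 v2 by simp_all
      show "C v1 \<inter> C v2 = {}" using disj[of v1 v2] v1 v2 W by blast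
    qed
    also have "\<dots> = q\<^sup>2" unfolding q2 using law v1 v2 by (simp add: power2_eq_square)
    finally show ?thesis .
  qed
  hence Qq: "Q \<le> q\<^sup>2" using Q(1)[OF v1 v2] by simp
  hence qpos: "0 < q" and Qq': "sqrt Q \<le> q"
    using Q(2) unfolding q_def
    by (auto simp: sum_nonneg intro: real_sqrt_le_mono order.strict_trans2)
  have \<mu>q: "\<mu> x \<le> q" for x
  proof (cases "x \<in> X")
    case True
    hence "(\<mu> x)\<^sup>2 \<le> q\<^sup>2" unfolding q2 using fX by (intro member_le_sum) auto
    thus ?thesis using qpos by (simp add: power2_le_iff_abs_le)
  qed (use \<mu>X qpos in simp)
  let ?Z = "\<lambda>\<sigma>. \<Sum>v\<in>W1. \<mu> (\<sigma> v)"
  have low: "pr (\<lambda>f. ?Z (\<lambda>v. b v f) \<le> N * q\<^sup>2 / 2) \<le> exp (- (N * q) / 8)"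
  proof -
    \<comment> \<open>Division by \<open>q\<close> puts the summands into [0, 1] with mean
      \<open>q\<close>, so the exponent is of order \<open>N * q\<close> and not
      \<open>N * q\<^sup>2\<close>.\<close>
    have "pr (\<lambda>f. (\<Sum>v\<in>W1. \<mu> (b v f) / q) \<le> (1 - 1/2) * (N * q) - 1/2 * 0) \<le> exp (- (1/2)\<^sup>2 * (N * q / 2 + 0))"
    proof (rule chernoff_lower[where C = C])
      show "depends_on (C v) (\<lambda>f. \<mu> (b v f) / q)" if "v \<in> W1" for v
        using depends_on_comp[OF b, of v "\<lambda>x. \<mu> x / q"] that by simp
      show "N * q \<le> (\<Sum>v\<in>W1. ex (\<lambda>f. \<mu> (b v f) / q))"
      proof -
        have "ex (\<lambda>f. \<mu> (b v f) / q) = q" if "v \<in> W1" for v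
          using ex_cmult[of "1 / q" "\<lambda>f. \<mu> (b v f)"] exmu[of v] that qpos by (simp add: power2_eq_square)
        thus ?thesis using W by simp
      qed
    qed (use W disj \<mu>q \<mu>0 qpos in auto)
    also have "(\<lambda>f. (\<Sum>v\<in>W1. \<mu> (b v f) / q) \<le> (1 - 1/2) * (N * q) - 1/2 * 0) = (\<lambda>f. ?Z (\<lambda>v. b v f) \<le> N * q\<^sup>2 / 2)"
      using qpos by (simp add: sum_divide_distrib[symmetric] field_simps power2_eq_square)
    finally show ?thesis by (simp add: power2_eq_square)
  qed
  have high: "pr (\<lambda>f. (inj_on (\<lambda>v\<in>W1. b v f) W1 \<and> N * q\<^sup>2 / 2 \<le> ?Z (\<lambda>v\<in>W1. b v f))
       \<and> (\<forall>w\<in>W2. b w f \<notin> (\<lambda>v\<in>W1. b v f) ` W1)) \<le> exp (- (N * q)\<^sup>2 / 2)"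
  proof (rule exposure[where S = "\<lambda>f. \<lambda>v\<in>W1. b v f" and F = "\<lambda>_. \<Union>v\<in>W1. C v"
        and G = "\<lambda>\<sigma>. inj_on \<sigma> W1 \<and> N * q\<^sup>2 / 2 \<le> ?Z \<sigma>" and B = "\<lambda>\<sigma> f. \<forall>w\<in>W2. b w f \<notin> \<sigma> ` W1"])
    fix f g :: "'i \<Rightarrow> bool" assume eq: "\<And>e. e \<in> (\<Union>v\<in>W1. C v) \<Longrightarrow> f e = g e"
    have "b v g = b v f" if "v \<in> W1" for v
      by (rule depends_onD[OF b[of v]]) (use that eq in auto)
    thus "(\<lambda>v\<in>W1. b v g) = (\<lambda>v\<in>W1. b v f)" by (intro restrict_ext) simp
  next
    fix \<sigma> :: "'v \<Rightarrow> 'x" assume G: "inj_on \<sigma> W1 \<and> N * q\<^sup>2 / 2 \<le> ?Z \<sigma>"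
    show "depends_on (- (\<Union>v\<in>W1. C v)) (\<lambda>f. \<forall>w\<in>W2. b w f \<notin> \<sigma> ` W1)"
    proof (rule depends_onI)
      fix f g :: "'i \<Rightarrow> bool" assume eq: "\<And>e. e \<in> - (\<Union>v\<in>W1. C v) \<Longrightarrow> f e = g e"
      have "b w f = b w g" if w: "w \<in> W2" for w
      proof (rule depends_onD[OF b[of w]])
        fix e assume "e \<in> C w"
        moreover have "C v \<inter> C w = {}" if "v \<in> W1" for v using disj[of v w] that w W by blast
        ultimately show "f e = g e" using eq by blast
      qed (use w in auto)
      thus "(\<forall>w\<in>W2. b w f \<notin> \<sigma> ` W1) = (\<forall>w\<in>W2. b w g \<notin> \<sigma> ` W1)" by simp
    qed
    have "pr (\<lambda>f. \<forall>w\<in>W2. b w f \<notin> \<sigma> ` W1) = (\<Prod>w\<in>W2. pr (\<lambda>f. b w f \<notin> \<sigma> ` W1))"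
    proof (rule pr_all_disjoint[where C = C])
      show "depends_on (C w) (\<lambda>f. b w f \<notin> \<sigma> ` W1)" if "w \<in> W2" for w
        using depends_on_comp[OF b, of w "\<lambda>x. x \<notin> \<sigma> ` W1"] that by simp
    qed (use W disj in auto)
    also have "\<dots> = (\<Prod>w\<in>W2. 1 - ?Z \<sigma>)"
    proof (intro prod.cong refl)
      fix w assume "w \<in> W2"
      hence "pr (\<lambda>f. b w f \<in> \<sigma> ` W1) = (\<Sum>x\<in>\<sigma> ` W1. \<mu> x)"
        using W law by (simp add: pr_in_finite)
      also have "\<dots> = ?Z \<sigma>" using G by (simp add: sum.reindex)
      finally show "pr (\<lambda>f. b w f \<notin> \<sigma> ` W1) = 1 - ?Z \<sigma>" by (simp add: pr_not)
    qed
    also have "\<dots> \<le> (\<Prod>w\<in>W2. exp (- (N * q\<^sup>2 / 2)))"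
    proof (intro prod_mono conjI)
      fix w assume w: "w \<in> W2"
      have "pr (\<lambda>f. b w f \<in> \<sigma> ` W1) = (\<Sum>x\<in>\<sigma> ` W1. \<mu> x)"
        using W law w by (simp add: pr_in_finite)
      also have "\<dots> = ?Z \<sigma>" using G by (simp add: sum.reindex)
      finally show "0 \<le> 1 - ?Z \<sigma>" using pr_le_1[of "\<lambda>f. b w f \<in> \<sigma> ` W1"] by linarith
      have "1 - ?Z \<sigma> \<le> exp (- ?Z \<sigma>)" using exp_ge_add_one_self[of "- ?Z \<sigma>"] by simp
      also have "\<dots> \<le> exp (- (N * q\<^sup>2 / 2))" using G by simp
      finally show "1 - ?Z \<sigma> \<le> exp (- (N * q\<^sup>2 / 2))" .
    qed
    also have "\<dots> = exp (- (N * q)\<^sup>2 / 2)"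
      using W by (simp add: exp_of_nat_mult[symmetric] power2_eq_square algebra_simps)
    finally show "pr (\<lambda>f. \<forall>w\<in>W2. b w f \<notin> \<sigma> ` W1) \<le> exp (- (N * q)\<^sup>2 / 2)" .
  qed simp
  have "pr (\<lambda>f. inj_on (\<lambda>v. b v f) (W1 \<union> W2)) \<le>
     pr (\<lambda>f. ?Z (\<lambda>v. b v f) \<le> N * q\<^sup>2 / 2 \<or> ((inj_on (\<lambda>v\<in>W1. b v f) W1 \<and> N * q\<^sup>2 / 2 \<le> ?Z (\<lambda>v\<in>W1. b v f))
       \<and> (\<forall>w\<in>W2. b w f \<notin> (\<lambda>v\<in>W1. b v f) ` W1)))"
  proof (rule pr_mono)
    fix f assume inj: "inj_on (\<lambda>v. b v f) (W1 \<union> W2)"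
    have "inj_on (\<lambda>v\<in>W1. b v f) W1" using inj by (auto simp: inj_on_def)
    moreover have "\<forall>w\<in>W2. b w f \<notin> (\<lambda>v\<in>W1. b v f) ` W1"
      using inj W(1) by (auto simp: inj_on_def)
    moreover have "?Z (\<lambda>v\<in>W1. b v f) = ?Z (\<lambda>v. b v f)" by (intro sum.cong) auto
    ultimately show "?Z (\<lambda>v. b v f) \<le> N * q\<^sup>2 / 2 \<or> ((inj_on (\<lambda>v\<in>W1. b v f) W1 \<and> N * q\<^sup>2 / 2 \<le> ?Z (\<lambda>v\<in>W1. b v f))
       \<and> (\<forall>w\<in>W2. b w f \<notin> (\<lambda>v\<in>W1. b v f) ` W1))" by linarith
  qed
  also have "\<dots> \<le> exp (- (N * q) / 8) + exp (- (N * q)\<^sup>2 / 2)"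
    by (rule order.trans[OF pr_disj add_mono[OF low high]])
  finally have main: "pr (\<lambda>f. inj_on (\<lambda>v. b v f) (W1 \<union> W2)) \<le> exp (- (N * q) / 8) + exp (- (N * q)\<^sup>2 / 2)" .
  have mono: "exp (- (N * q) / 8) \<le> exp (- (N * sqrt Q) / 8)"
    using Qq' by (simp add: mult_left_mono)
  \<comment> \<open>For \<open>N * q < 1 / 4\<close> the claimed bound is at least 1; otherwise the
    quadratic exponent dominates the linear one.\<close>
  show ?thesis
  proof (cases "N * q \<ge> 1 / 4")
    case True
    have "(N * q) / 8 \<le> (N * q)\<^sup>2 / 2"
    proof -
      have "(N * q) * (1/4) \<le> (N * q) * (N * q)" by (rule mult_left_mono) (use True in auto)
      thus ?thesis unfolding power2_eq_square by linarith
    qed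
    hence "exp (- (N * q)\<^sup>2 / 2) \<le> exp (- (N * q) / 8)" by simp
    thus ?thesis using main mono by linarith
  next
    case False
    have "N * sqrt Q \<le> N * q" using Qq' by (simp add: mult_left_mono)
    hence "- (N * sqrt Q) / 8 \<ge> - 1 / 2" using False by simp
    hence "1 - 1 / 2 \<le> exp (- (N * sqrt Q) / 8)" using exp_ge_add_one_self[of "- (N * sqrt Q) / 8"] by linarith
    thus ?thesis using pr_le_1[of "\<lambda>f. inj_on (\<lambda>v. b v f) (W1 \<union> W2)"] by linarith
  qed
qed

end

section \<open>Growth of balls and the diameter\<close>

context gnp begin

abbreviation rc :: "nat set \<Rightarrow> nat \<Rightarrow> (nat set \<Rightarrow> bool) \<Rightarrow> nat set" where
  "rc R j f \<equiv> reach (gr n f) R j"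

lemma UN_st: "(\<Union>r\<in>R. st R k f r) = rc R k f"
  unfolding reach_UN[of _ R] by (simp del: reach.simps)

lemma rc_mono: "rc R k f \<subseteq> rc R (Suc k) f"
  by (rule reach_Suc_mono)

lemma rc_member_mono: "r \<in> R \<Longrightarrow> rc {r} k f \<subseteq> rc R k f"
  unfolding reach_UN[of _ R] by blast

text \<open>For growth it does not matter which landmark reached a vertex, so the state is reduced
  to the union of the balls.\<close>

lemma explore_set:
  assumes R: "R \<subseteq> {1..n}"
    and B: "\<And>K K'. K \<subseteq> K' \<Longrightarrow> K' \<subseteq> {1..n} \<Longrightarrow> G K K' \<Longrightarrow> depends_on {e. e \<inter> K = {}} (B K K')"
    and b: "\<And>K K'. K \<subseteq> K' \<Longrightarrow> K' \<subseteq> {1..n} \<Longrightarrow> G K K' \<Longrightarrow> pr (B K K') \<le> b" and b0: "0 \<le> b"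
  shows "pr (\<lambda>f. G (rc R k f) (rc R (Suc k) f) \<and> B (rc R k f) (rc R (Suc k) f) f) \<le> b"
proof -
  let ?u = "\<lambda>K :: nat \<Rightarrow> nat set. \<Union>r\<in>R. K r"
  have "pr (\<lambda>f. (?u (st R k f) \<subseteq> ?u (st R (Suc k) f) \<and> ?u (st R (Suc k) f) \<subseteq> {1..n} \<and>
            G (?u (st R k f)) (?u (st R (Suc k) f))) \<and> B (?u (st R k f)) (?u (st R (Suc k) f)) f) \<le> b"
    by (rule explore[where G = "\<lambda>K K'. ?u K \<subseteq> ?u K' \<and> ?u K' \<subseteq> {1..n} \<and> G (?u K) (?u K')"
          and B = "\<lambda>K K'. B (?u K) (?u K')"]) (use B b b0 in auto)
  moreover have "rc R k f \<subseteq> rc R (Suc k) f" "rc R (Suc k) f \<subseteq> {1..n}" for f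
    using rc_mono reach_gr_subset[OF R] by blast+
  ultimately show ?thesis unfolding UN_st by simp
qed

lemma depends_on_hits_fresh:
  "w \<notin> K' \<Longrightarrow> K \<subseteq> K' \<Longrightarrow> S \<subseteq> K' - K \<Longrightarrow> depends_on {e. e \<inter> K = {}} (\<lambda>f. hits f w S)"
  by (rule depends_on_mono[OF depends_on_hits star_avoids]) auto

text \<open>Given the two balls, each fresh vertex joins the next sphere independently with
  probability \<open>1 - (1 - p) ^ s\<close>, where \<open>s\<close> is the size of the current
  sphere. The condition on \<open>m\<close> is part of the event because the ball sizes are
  random.\<close>

lemma growth_lower:
  fixes m \<delta> :: real
  assumes R: "R \<subseteq> {1..n}" and \<delta>: "0 \<le> \<delta>" "\<delta> \<le> 1" and m: "0 \<le> m"
  shows "pr (\<lambda>f. m \<le> (real n - card (rc R (Suc k) f)) * (1 - (1 - p) ^ card (rc R (Suc k) f - rc R k f)) \<and>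
       card (rc R (Suc (Suc k)) f - rc R (Suc k) f) \<le> (1 - \<delta>) * m) \<le> exp (- \<delta>\<^sup>2 * m / 2)"
proof -
  have "pr (\<lambda>f. m \<le> (real n - card (rc R (Suc k) f)) * (1 - (1 - p) ^ card (rc R (Suc k) f - rc R k f)) \<and>
       card {w \<in> {1..n} - rc R (Suc k) f. hits f w (rc R (Suc k) f - rc R k f)} \<le> (1 - \<delta>) * m) \<le> exp (- \<delta>\<^sup>2 * m / 2)"
  proof (rule explore_set[OF R, where G = "\<lambda>K K'. m \<le> (real n - card K') * (1 - (1 - p) ^ card (K' - K))"
      and B = "\<lambda>K K' f. card {w \<in> {1..n} - K'. hits f w (K' - K)} \<le> (1 - \<delta>) * m"])
    fix K K' assume K: "K \<subseteq> K'" "K' \<subseteq> {1..n}" and G: "m \<le> (real n - card K') * (1 - (1 - p) ^ card (K' - K))"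
    show "depends_on {e. e \<inter> K = {}} (\<lambda>f. real (card {w \<in> {1..n} - K'. hits f w (K' - K)}) \<le> (1 - \<delta>) * m)"
    proof (rule depends_onI)
      fix f g :: "nat set \<Rightarrow> bool" assume eq: "\<And>e. e \<in> {e. e \<inter> K = {}} \<Longrightarrow> f e = g e"
      have "hits f w (K' - K) = hits g w (K' - K)" if "w \<notin> K'" for w
        by (rule depends_onD[OF depends_on_hits_fresh[OF that K(1)]]) (use eq in auto)
      hence "{w \<in> {1..n} - K'. hits f w (K' - K)} = {w \<in> {1..n} - K'. hits g w (K' - K)}" by auto
      thus "(real (card {w \<in> {1..n} - K'. hits f w (K' - K)}) \<le> (1 - \<delta>) * m) =
            (real (card {w \<in> {1..n} - K'. hits g w (K' - K)}) \<le> (1 - \<delta>) * m)" by simp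
    qed
    have "card K' \<le> n" using card_mono[OF _ K(2)] by simp
    hence cO: "real (card ({1..n} - K')) = real n - card K'"
      using K by (simp add: card_Diff_subset finite_subset[OF K(2)])
    have "pr (\<lambda>f. card {w \<in> {1..n} - K'. hits f w (K' - K)} \<le> (1 - \<delta>) * m - \<delta> * 0) \<le> exp (- \<delta>\<^sup>2 * (m / 2 + 0))"
    proof (rule count_lower[where C = "\<lambda>w. star w (K' - K)"])
      show "depends_on (star w (K' - K)) (\<lambda>f. hits f w (K' - K))" for w by (rule depends_on_hits)
      show "star v (K' - K) \<inter> star w (K' - K) = {}" if "v \<in> {1..n} - K'" "w \<in> {1..n} - K'" "v \<noteq> w" for v w
        by (rule star_disjoint) (use that in auto)
      show "1 - (1 - p) ^ card (K' - K) \<le> pr (\<lambda>f. hits f w (K' - K))" if "w \<in> {1..n} - K'" for w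
        using that K by (subst pr_hits) auto
      show "m \<le> card ({1..n} - K') * (1 - (1 - p) ^ card (K' - K))" unfolding cO by (rule G)
    qed (use m \<delta> in auto)
    thus "pr (\<lambda>f. real (card {w \<in> {1..n} - K'. hits f w (K' - K)}) \<le> (1 - \<delta>) * m) \<le> exp (- \<delta>\<^sup>2 * m / 2)" by simp
  qed simp
  thus ?thesis unfolding reach_gr_new[OF R] .
qed

lemma growth_upper:
  fixes m \<delta> :: real
  assumes R: "R \<subseteq> {1..n}" and \<delta>: "0 \<le> \<delta>" "\<delta> \<le> 1"
  shows "pr (\<lambda>f. (real n - card (rc R (Suc k) f)) * (1 - (1 - p) ^ card (rc R (Suc k) f - rc R k f)) \<le> m \<and>
       (1 + \<delta>) * m \<le> card (rc R (Suc (Suc k)) f - rc R (Suc k) f)) \<le> exp (- \<delta>\<^sup>2 * m / 4)"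
proof -
  have "pr (\<lambda>f. (real n - card (rc R (Suc k) f)) * (1 - (1 - p) ^ card (rc R (Suc k) f - rc R k f)) \<le> m \<and>
       (1 + \<delta>) * m \<le> card {w \<in> {1..n} - rc R (Suc k) f. hits f w (rc R (Suc k) f - rc R k f)}) \<le> exp (- \<delta>\<^sup>2 * m / 4)"
  proof (rule explore_set[OF R, where G = "\<lambda>K K'. (real n - card K') * (1 - (1 - p) ^ card (K' - K)) \<le> m"
      and B = "\<lambda>K K' f. (1 + \<delta>) * m \<le> card {w \<in> {1..n} - K'. hits f w (K' - K)}"])
    fix K K' assume K: "K \<subseteq> K'" "K' \<subseteq> {1..n}" and G: "(real n - card K') * (1 - (1 - p) ^ card (K' - K)) \<le> m"
    show "depends_on {e. e \<inter> K = {}} (\<lambda>f. (1 + \<delta>) * m \<le> real (card {w \<in> {1..n} - K'. hits f w (K' - K)}))"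
    proof (rule depends_onI)
      fix f g :: "nat set \<Rightarrow> bool" assume eq: "\<And>e. e \<in> {e. e \<inter> K = {}} \<Longrightarrow> f e = g e"
      have "hits f w (K' - K) = hits g w (K' - K)" if "w \<notin> K'" for w
        by (rule depends_onD[OF depends_on_hits_fresh[OF that K(1)]]) (use eq in auto)
      hence "{w \<in> {1..n} - K'. hits f w (K' - K)} = {w \<in> {1..n} - K'. hits g w (K' - K)}" by auto
      thus "((1 + \<delta>) * m \<le> real (card {w \<in> {1..n} - K'. hits f w (K' - K)})) =
            ((1 + \<delta>) * m \<le> real (card {w \<in> {1..n} - K'. hits g w (K' - K)}))" by simp
    qed
    have "card K' \<le> n" using card_mono[OF _ K(2)] by simp
    hence cO: "real (card ({1..n} - K')) = real n - card K'"
      using K by (simp add: card_Diff_subset finite_subset[OF K(2)])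
    show "pr (\<lambda>f. (1 + \<delta>) * m \<le> card {w \<in> {1..n} - K'. hits f w (K' - K)}) \<le> exp (- \<delta>\<^sup>2 * m / 4)"
    proof (rule count_upper[where C = "\<lambda>w. star w (K' - K)"])
      show "depends_on (star w (K' - K)) (\<lambda>f. hits f w (K' - K))" for w by (rule depends_on_hits)
      show "star v (K' - K) \<inter> star w (K' - K) = {}" if "v \<in> {1..n} - K'" "w \<in> {1..n} - K'" "v \<noteq> w" for v w
        by (rule star_disjoint) (use that in auto)
      show "pr (\<lambda>f. hits f w (K' - K)) \<le> 1 - (1 - p) ^ card (K' - K)" if "w \<in> {1..n} - K'" for w
        using that K by (subst pr_hits) auto
      show "card ({1..n} - K') * (1 - (1 - p) ^ card (K' - K)) \<le> m" unfolding cO by (rule G)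
    qed (use \<delta> in auto)
  qed simp
  thus ?thesis unfolding reach_gr_new[OF R] .
qed

text \<open>With many landmarks the balls of radius \<open>i\<close> may cover almost the whole
  graph, so the vertices left over have to be counted; they are those that miss the current
  sphere.\<close>

lemma fresh_decrease:
  fixes m :: real
  assumes R: "R \<subseteq> {1..n}" and m: "0 \<le> m"
  shows "pr (\<lambda>f. m \<le> (real n - card (rc R (Suc k) f)) * (1 - p) ^ card (rc R (Suc k) f - rc R k f) \<and>
       card ({1..n} - rc R (Suc (Suc k)) f) \<le> m / 2) \<le> exp (- m / 8)"
proof -
  have "pr (\<lambda>f. m \<le> (real n - card (rc R (Suc k) f)) * (1 - p) ^ card (rc R (Suc k) f - rc R k f) \<and>
       card {w \<in> {1..n} - rc R (Suc k) f. \<not> hits f w (rc R (Suc k) f - rc R k f)} \<le> m / 2) \<le> exp (- m / 8)"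
  proof (rule explore_set[OF R, where G = "\<lambda>K K'. m \<le> (real n - card K') * (1 - p) ^ card (K' - K)"
      and B = "\<lambda>K K' f. card {w \<in> {1..n} - K'. \<not> hits f w (K' - K)} \<le> m / 2"])
    fix K K' assume K: "K \<subseteq> K'" "K' \<subseteq> {1..n}" and G: "m \<le> (real n - card K') * (1 - p) ^ card (K' - K)"
    show "depends_on {e. e \<inter> K = {}} (\<lambda>f. real (card {w \<in> {1..n} - K'. \<not> hits f w (K' - K)}) \<le> m / 2)"
    proof (rule depends_onI)
      fix f g :: "nat set \<Rightarrow> bool" assume eq: "\<And>e. e \<in> {e. e \<inter> K = {}} \<Longrightarrow> f e = g e"
      have "hits f w (K' - K) = hits g w (K' - K)" if "w \<notin> K'" for w
        by (rule depends_onD[OF depends_on_hits_fresh[OF that K(1)]]) (use eq in auto)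
      hence "{w \<in> {1..n} - K'. \<not> hits f w (K' - K)} = {w \<in> {1..n} - K'. \<not> hits g w (K' - K)}" by auto
      thus "(real (card {w \<in> {1..n} - K'. \<not> hits f w (K' - K)}) \<le> m / 2) =
            (real (card {w \<in> {1..n} - K'. \<not> hits g w (K' - K)}) \<le> m / 2)" by simp
    qed
    have "card K' \<le> n" using card_mono[OF _ K(2)] by simp
    hence cO: "real (card ({1..n} - K')) = real n - card K'"
      using K by (simp add: card_Diff_subset finite_subset[OF K(2)])
    have "pr (\<lambda>f. card {w \<in> {1..n} - K'. \<not> hits f w (K' - K)} \<le> (1 - 1/2) * m - 1/2 * 0) \<le> exp (- (1/2)\<^sup>2 * (m / 2 + 0))"
    proof (rule count_lower[where C = "\<lambda>w. star w (K' - K)"])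
      show "depends_on (star w (K' - K)) (\<lambda>f. \<not> hits f w (K' - K))" for w
        by (rule depends_on_comp[OF depends_on_hits])
      show "star v (K' - K) \<inter> star w (K' - K) = {}" if "v \<in> {1..n} - K'" "w \<in> {1..n} - K'" "v \<noteq> w" for v w
        by (rule star_disjoint) (use that in auto)
      show "(1 - p) ^ card (K' - K) \<le> pr (\<lambda>f. \<not> hits f w (K' - K))" if "w \<in> {1..n} - K'" for w
        unfolding pr_not using that K by (subst pr_hits) auto
      show "m \<le> card ({1..n} - K') * (1 - p) ^ card (K' - K)" unfolding cO by (rule G)
    qed (use m in auto)
    thus "pr (\<lambda>f. real (card {w \<in> {1..n} - K'. \<not> hits f w (K' - K)}) \<le> m / 2) \<le> exp (- m / 8)"
      by (simp add: power2_eq_square)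
  qed simp
  moreover have "{w \<in> {1..n} - rc R (Suc k) f. \<not> hits f w (rc R (Suc k) f - rc R k f)} = {1..n} - rc R (Suc (Suc k)) f" for f
    using reach_gr_new[OF R, of f k] rc_mono[where R = R and k = "Suc k" and f = f] by blast
  ultimately show ?thesis by simp
qed

text \<open>A fresh vertex \<open>w\<close> adjacent to the sphere of radius \<open>k\<close> and to
  \<open>v\<close> puts \<open>v\<close> at distance at most \<open>k + 2\<close>, which is index
  \<open>k + 3\<close> of \<open>reach\<close>. For different \<open>w\<close> these events use
  disjoint pairs.\<close>

lemma diameter_bound:
  fixes m :: real
  assumes u: "u \<in> {1..n}" and v: "v \<in> {1..n}"
  shows "pr (\<lambda>f. m \<le> (real n - 1 - card (rc {u} (Suc k) f)) * (p * (1 - (1 - p) ^ card (rc {u} (Suc k) f - rc {u} k f))) \<and>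
       v \<notin> rc {u} (Suc (Suc (Suc k))) f) \<le> exp (- m)"
proof -
  \<comment> \<open>\<open>v \<notin> K'\<close> ensures that the pair of \<open>w\<close> and
    \<open>v\<close> is fresh and differs from the pairs joining \<open>w\<close> to the
    sphere.\<close>
  let ?G = "\<lambda>K K'. v \<notin> K' \<and> m \<le> (real n - 1 - card K') * (p * (1 - (1 - p) ^ card (K' - K)))"
  let ?X = "\<lambda>S w f. f {w, v} \<and> hits f w S"
  have "pr (\<lambda>f. ?G (rc {u} k f) (rc {u} (Suc k) f) \<and>
     (\<forall>w\<in>{1..n} - rc {u} (Suc k) f - {v}. \<not> ?X (rc {u} (Suc k) f - rc {u} k f) w f)) \<le> exp (- m)"
  proof (rule explore_set[where G = ?G and B = "\<lambda>K K' f. \<forall>w\<in>{1..n} - K' - {v}. \<not> ?X (K' - K) w f"])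
    fix K K' assume K: "K \<subseteq> K'" "K' \<subseteq> {1..n}" and G: "?G K K'"
    let ?S = "K' - K"
    let ?C = "\<lambda>w. insert {w, v} (star w ?S)"
    have dX: "depends_on (?C w) (\<lambda>f. \<not> ?X ?S w f)" for w
      by (intro depends_onI) (auto simp: hits_star)
    have CK: "?C w \<subseteq> {e. e \<inter> K = {}}" if "w \<notin> K'" for w
      using star_avoids[of w K ?S] that K(1) G by auto
    show "depends_on {e. e \<inter> K = {}} (\<lambda>f. \<forall>w\<in>{1..n} - K' - {v}. \<not> ?X ?S w f)"
    proof (rule depends_onI)
      fix f g :: "nat set \<Rightarrow> bool" assume eq: "\<And>e. e \<in> {e. e \<inter> K = {}} \<Longrightarrow> f e = g e"
      have "(\<not> ?X ?S w f) = (\<not> ?X ?S w g)" if "w \<notin> K'" for w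
        by (rule depends_onD[OF depends_on_mono[OF dX CK[OF that]]]) (use eq in auto)
      thus "(\<forall>w\<in>{1..n} - K' - {v}. \<not> ?X ?S w f) = (\<forall>w\<in>{1..n} - K' - {v}. \<not> ?X ?S w g)" by auto
    qed
    let ?x = "p * (1 - (1 - p) ^ card ?S)"
    have x01: "0 \<le> ?x" "?x \<le> 1"
      using p01 by (auto intro!: mult_nonneg_nonneg mult_le_one simp: power_le_one)
    have "card K' \<le> n" using card_mono[OF _ K(2)] by simp
    hence cO: "real (card ({1..n} - K' - {v})) = real n - 1 - card K'"
    proof -
      have "card ({1..n} - K') = n - card K'" using K by (simp add: card_Diff_subset finite_subset[OF K(2)])
      moreover have "card ({1..n} - K' - {v}) = card ({1..n} - K') - 1" using G v by (subst card_Diff_singleton) auto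
      moreover have "0 < card ({1..n} - K')" using G v by (subst card_gt_0_iff) auto
      ultimately show ?thesis using \<open>card K' \<le> n\<close> by linarith
    qed
    have "pr (\<lambda>f. \<forall>w\<in>{1..n} - K' - {v}. \<not> ?X ?S w f) = (\<Prod>w\<in>{1..n} - K' - {v}. pr (\<lambda>f. \<not> ?X ?S w f))"
    proof (rule pr_all_disjoint[where C = ?C])
      fix w w' assume w: "w \<in> {1..n} - K' - {v}" "w' \<in> {1..n} - K' - {v}" "w \<noteq> w'"
      have "star w ?S \<inter> star w' ?S = {}" by (rule star_disjoint) (use w in auto)
      thus "?C w \<inter> ?C w' = {}" using w G by (auto simp: star_def doubleton_eq_iff)
    qed (use dX in auto)
    also have "\<dots> = (\<Prod>w\<in>{1..n} - K' - {v}. 1 - ?x)"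
    proof (intro prod.cong refl)
      fix w assume w: "w \<in> {1..n} - K' - {v}"
      have "pr (?X ?S w) = pr (\<lambda>f. f {w, v}) * pr (\<lambda>f. hits f w ?S)"
        by (rule pr_conj_disjoint[where A = "{{w, v}}", OF _ depends_on_hits])
           (use w G in \<open>auto intro: depends_onI simp: star_def doubleton_eq_iff\<close>)
      also have "\<dots> = ?x"
      proof -
        have "{w, v} \<in> vertex_pairs n" using w v by (auto simp: vertex_pairs_def)
        moreover have "pr (\<lambda>f. hits f w ?S) = 1 - (1 - p) ^ card ?S" by (rule pr_hits) (use w K in auto)
        ultimately show ?thesis by (simp add: pr_bit)
      qed
      finally show "pr (\<lambda>f. \<not> ?X ?S w f) = 1 - ?x" by (simp only: pr_not)
    qed
    also have "\<dots> \<le> (\<Prod>w\<in>{1..n} - K' - {v}. exp (- ?x))"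
      using x01 exp_ge_add_one_self[of "- ?x"] by (intro prod_mono) auto
    also have "\<dots> = exp (- (real (card ({1..n} - K' - {v})) * ?x))"
      by (simp add: exp_of_nat_mult[symmetric])
    also have "\<dots> \<le> exp (- m)" using G unfolding cO by simp
    finally show "pr (\<lambda>f. \<forall>w\<in>{1..n} - K' - {v}. \<not> ?X ?S w f) \<le> exp (- m)" .
  qed (use u in auto)
  note main = this
  have noX: "\<not> ?X (rc {u} (Suc k) f - rc {u} k f) w f"
    if "v \<notin> rc {u} (Suc (Suc (Suc k))) f" "w \<in> {1..n} - rc {u} (Suc k) f - {v}" for f w
  proof
    assume X: "?X (rc {u} (Suc k) f - rc {u} k f) w f"
    have "w \<in> rc {u} (Suc (Suc k)) f"
      using reach_gr_new[of "{u}" n f k] u that(2) X by blast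
    moreover have "{w, v} \<in> gr n f" using X that(2) v by (auto simp: gr_def vertex_pairs_def)
    ultimately have "v \<in> rc {u} (Suc (Suc (Suc k))) f" by (subst reach.simps(2)) blast
    thus False using that(1) by blast
  qed
  have "rc {u} (Suc k) f \<subseteq> rc {u} (Suc (Suc (Suc k))) f" for f by (rule reach_mono) simp
  hence new: "v \<notin> rc {u} (Suc k) f" if "v \<notin> rc {u} (Suc (Suc (Suc k))) f" for f
    using that by (rule contra_subsetD)
  show ?thesis
    by (rule order.trans[OF pr_mono main]) (use noX new in \<open>simp del: reach.simps\<close>)
qed

end

section \<open>Distance patterns of fresh vertices\<close>

context gnp begin

text \<open>The vertices at distance \<open>k\<close> from \<open>r\<close> that no landmark has at
  a smaller distance. Their pairs leading outwards are the ones not yet inspected.\<close>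

definition newr :: "nat set \<Rightarrow> nat \<Rightarrow> (nat set \<Rightarrow> bool) \<Rightarrow> nat \<Rightarrow> nat set" where
  "newr R k f r = rc {r} (Suc k) f - rc R k f"

lemma newr_st: "r \<in> R \<Longrightarrow> newr R k f r = st R (Suc k) f r - (\<Union>r\<in>R. st R k f r)"
  unfolding newr_def UN_st by (simp del: reach.simps)

lemma UN_newr: "(\<Union>r\<in>R. newr R k f r) = rc R (Suc k) f - rc R k f"
  unfolding newr_def reach_UN[of "gr n f" R "Suc k"] by blast

text \<open>Neighbours of \<open>rc R k f\<close> lie in \<open>rc R (Suc k) f\<close>. A vertex
  outside the latter can therefore be at distance \<open>k + 1\<close> from \<open>r\<close> only
  through \<open>newr R k f r\<close>.\<close>

lemma reach_two_iff:
  assumes R: "R \<subseteq> {1..n}" "r \<in> R" and w: "w \<in> {1..n}" "w \<notin> rc R (Suc k) f"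
  shows "w \<in> rc {r} (Suc (Suc k)) f \<longleftrightarrow> hits f w (newr R k f r)"
proof -
  have r: "{r} \<subseteq> {1..n}" using R by blast
  have wr: "w \<notin> rc {r} (Suc k) f" using w rc_member_mono[OF R(2)] by blast
  have "w \<in> rc {r} (Suc (Suc k)) f \<longleftrightarrow> hits f w (rc {r} (Suc k) f - rc {r} k f)"
    using reach_gr_new[OF r, of f k] w wr by blast
  also have "\<dots> \<longleftrightarrow> hits f w (newr R k f r)"
  proof
    assume "hits f w (rc {r} (Suc k) f - rc {r} k f)"
    then obtain u where u: "u \<in> rc {r} (Suc k) f" "f {u, w}" by (auto simp: hits_def)
    have "u \<notin> rc R k f"
    proof
      assume uR: "u \<in> rc R k f"
      hence "u \<in> {1..n}" "u \<noteq> w" using reach_gr_subset[OF R(1)] w rc_mono by blast+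
      hence "{u, w} \<in> gr n f" using u w by (auto simp: gr_def vertex_pairs_def)
      hence "w \<in> rc R (Suc k) f" using uR by (subst reach.simps(2)) blast
      thus False using w by blast
    qed
    thus "hits f w (newr R k f r)" using u by (auto simp: hits_def newr_def simp del: reach.simps)
  next
    assume "hits f w (newr R k f r)"
    thus "hits f w (rc {r} (Suc k) f - rc {r} k f)"
      using rc_member_mono[OF R(2)] unfolding hits_def newr_def by blast
  qed
  finally show ?thesis .
qed

text \<open>Outside the balls of radius \<open>k\<close> only the distances \<open>k + 1\<close> and
  \<open>k + 2\<close> to a landmark are left, given the diameter bound, and the hits tell them
  apart.\<close>

lemma same_distances:
  assumes R: "R \<subseteq> {1..n}" and w: "w \<in> {1..n} - rc R (Suc k) f" "w' \<in> {1..n} - rc R (Suc k) f"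
    and pat: "{r\<in>R. hits f w (newr R k f r)} = {r\<in>R. hits f w' (newr R k f r)}"
    and diam: "\<And>u v. u \<in> {1..n} \<Longrightarrow> v \<in> {1..n} \<Longrightarrow> v \<in> rc {u} (Suc (Suc (Suc k))) f"
    and r: "r \<in> R"
  shows "graph_dist (gr n f) w r = graph_dist (gr n f) w' r"
proof (rule graph_dist_eqI)
  fix j
  consider "j \<le> Suc k" | "j = Suc (Suc k)" | "Suc (Suc (Suc k)) \<le> j" by linarith
  thus "w \<in> rc {r} j f \<longleftrightarrow> w' \<in> rc {r} j f"
  proof cases
    case 1
    hence "rc {r} j f \<subseteq> rc R (Suc k) f"
      by (rule order.trans[OF reach_mono rc_member_mono[OF r]])
    thus ?thesis using w by blast
  next
    case 2
    thus ?thesis using reach_two_iff[OF R r, where w = w and k = k and f = f] reach_two_iff[OF R r, where w = w' and k = k and f = f] w pat r by blast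
  next
    case 3
    have "w \<in> rc {r} (Suc (Suc (Suc k))) f" "w' \<in> rc {r} (Suc (Suc (Suc k))) f"
      using diam r R w by blast+
    thus ?thesis using subsetD[OF reach_mono[OF 3, where E = "gr n f" and A = "{r}"]] by blast
  qed
qed

lemma pattern_inj:
  assumes R: "R \<subseteq> {1..n}" and res: "resolving_set {1..n} (gr n f) R"
    and diam: "\<And>u v. u \<in> {1..n} \<Longrightarrow> v \<in> {1..n} \<Longrightarrow> v \<in> rc {u} (Suc (Suc (Suc k))) f"
  shows "inj_on (\<lambda>w. {r\<in>R. hits f w (newr R k f r)}) ({1..n} - rc R (Suc k) f)"
proof (rule inj_onI, rule ccontr)
  fix w w' assume w: "w \<in> {1..n} - rc R (Suc k) f" "w' \<in> {1..n} - rc R (Suc k) f"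
    and pat: "{r\<in>R. hits f w (newr R k f r)} = {r\<in>R. hits f w' (newr R k f r)}" and ne: "w \<noteq> w'"
  have "\<forall>r\<in>R. graph_dist (gr n f) w r = graph_dist (gr n f) w' r"
    using same_distances[OF R w pat diam] by blast
  moreover have "\<exists>r\<in>R. graph_dist (gr n f) w r \<noteq> graph_dist (gr n f) w' r"
    using res w ne unfolding resolving_set_iff by blast
  ultimately show False by blast
qed

text \<open>Vertices that hit every landmark of \<open>Rg\<close> can differ only on
  \<open>R - Rg\<close>, which leaves \<open>2 ^ card (R - Rg)\<close> patterns, and in a resolved
  graph no pattern occurs twice.\<close>

lemma pattern_count:
  assumes R: "R \<subseteq> {1..n}" and Rg: "Rg \<subseteq> R" and res: "resolving_set {1..n} (gr n f) R"
    and diam: "\<And>u v. u \<in> {1..n} \<Longrightarrow> v \<in> {1..n} \<Longrightarrow> v \<in> rc {u} (Suc (Suc (Suc k))) f"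
  shows "card {w \<in> {1..n} - rc R (Suc k) f. \<forall>r\<in>Rg. hits f w (newr R k f r)} \<le> 2 ^ card (R - Rg)"
proof -
  let ?A = "{w \<in> {1..n} - rc R (Suc k) f. \<forall>r\<in>Rg. hits f w (newr R k f r)}"
  let ?g = "\<lambda>w. {r\<in>R - Rg. hits f w (newr R k f r)}"
  have fR: "finite (R - Rg)" using finite_subset[OF R] by simp
  have "inj_on ?g ?A"
  proof (rule inj_onI)
    fix w w' assume w: "w \<in> ?A" "w' \<in> ?A" and eq: "?g w = ?g w'"
    have "{r\<in>R. hits f v (newr R k f r)} = ?g v \<union> Rg" if "v \<in> ?A" for v using that Rg by blast
    hence "{r\<in>R. hits f w (newr R k f r)} = {r\<in>R. hits f w' (newr R k f r)}" using w eq by simp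
    thus "w = w'" using inj_onD[OF pattern_inj[OF R res diam], where x = w and y = w'] w by blast
  qed
  hence "card ?A = card (?g ` ?A)" by (simp add: card_image)
  also have "\<dots> \<le> card (Pow (R - Rg))" by (rule card_mono) (use fR in auto)
  also have "\<dots> = 2 ^ card (R - Rg)" using fR by (rule card_Pow)
  finally show ?thesis .
qed

lemma depends_on_Ball:
  fixes C :: "'c set" shows "(\<And>r. r \<in> Q \<Longrightarrow> depends_on C (X r)) \<Longrightarrow> depends_on C (\<lambda>f. \<forall>r\<in>Q. X r f)"
proof (rule depends_onI)
  fix f g :: "'c \<Rightarrow> bool"
  assume d: "\<And>r. r \<in> Q \<Longrightarrow> depends_on C (X r)" and eq: "\<And>e. e \<in> C \<Longrightarrow> f e = g e"
  have "X r f = X r g" if "r \<in> Q" for r by (rule depends_onD[OF d[OF that] eq])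
  thus "(\<forall>r\<in>Q. X r f) = (\<forall>r\<in>Q. X r g)" by blast
qed

text \<open>The sets \<open>newr R k f r\<close> overlap, so the probability of hitting all of them
  is bounded below by Harris' inequality. Landmarks with fewer than \<open>t\<close> new vertices
  are left out, because a single factor near 0 would ruin the product.\<close>

lemma common_hits:
  fixes m t :: real
  assumes R: "R \<subseteq> {1..n}" and m: "0 \<le> m"
  shows "pr (\<lambda>f. m \<le> card ({1..n} - rc R (Suc k) f) *
           (\<Prod>r\<in>{r\<in>R. t \<le> card (newr R k f r)}. 1 - (1 - p) ^ card (newr R k f r)) \<and>
      card {w \<in> {1..n} - rc R (Suc k) f. \<forall>r\<in>{r\<in>R. t \<le> card (newr R k f r)}. hits f w (newr R k f r)} \<le> m / 2)
     \<le> exp (- m / 8)"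
proof -
  let ?u = "\<lambda>K :: nat \<Rightarrow> nat set. \<Union>r\<in>R. K r"
  let ?S = "\<lambda>K K' r. K' r - ?u K"
  let ?Rg = "\<lambda>K K'. {r\<in>R. t \<le> card (?S K K' r)}"
  let ?O = "\<lambda>K'. {1..n} - ?u K'"
  let ?G = "\<lambda>K K'. ?u K \<subseteq> ?u K' \<and> ?u K' \<subseteq> {1..n} \<and>
      m \<le> card (?O K') * (\<Prod>r\<in>?Rg K K'. 1 - (1 - p) ^ card (?S K K' r))"
  let ?X = "\<lambda>K K' w f. \<forall>r\<in>?Rg K K'. hits f w (?S K K' r)"
  have fR: "finite R" using finite_subset[OF R] by simp
  have main: "pr (\<lambda>f. ?G (st R k f) (st R (Suc k) f) \<and>
      card {w \<in> ?O (st R (Suc k) f). ?X (st R k f) (st R (Suc k) f) w f} \<le> m / 2) \<le> exp (- m / 8)"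
  proof (rule explore[where G = ?G and B = "\<lambda>K K' f. card {w \<in> ?O K'. ?X K K' w f} \<le> m / 2"])
    fix K K' :: "nat \<Rightarrow> nat set" assume G: "?G K K'"
    have dX: "depends_on (star w (?u K' - ?u K)) (?X K K' w)" for w
    proof (rule depends_on_Ball)
      fix r assume "r \<in> ?Rg K K'"
      thus "depends_on (star w (?u K' - ?u K)) (\<lambda>f. hits f w (?S K K' r))"
        by (intro depends_on_mono[OF depends_on_hits]) (auto simp: star_def)
    qed
    show "depends_on {e. e \<inter> ?u K = {}} (\<lambda>f. card {w \<in> ?O K'. ?X K K' w f} \<le> m / 2)"
    proof (rule depends_onI)
      fix f g :: "nat set \<Rightarrow> bool" assume eq: "\<And>e. e \<in> {e. e \<inter> ?u K = {}} \<Longrightarrow> f e = g e"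
      have "?X K K' w f = ?X K K' w g" if "w \<in> ?O K'" for w
      proof (rule depends_onD[OF depends_on_mono[OF dX star_avoids]])
        show "w \<notin> ?u K" using that G by blast
      qed (use eq in auto)
      hence "{w \<in> ?O K'. ?X K K' w f} = {w \<in> ?O K'. ?X K K' w g}" by blast
      thus "(real (card {w \<in> ?O K'. ?X K K' w f}) \<le> m / 2) = (real (card {w \<in> ?O K'. ?X K K' w g}) \<le> m / 2)" by simp
    qed
    have "pr (\<lambda>f. card {w \<in> ?O K'. ?X K K' w f} \<le> (1 - 1/2) * m - 1/2 * 0) \<le> exp (- (1/2)\<^sup>2 * (m / 2 + 0))"
    proof (rule count_lower[where C = "\<lambda>w. star w (?u K' - ?u K)"])
      show "depends_on (star w (?u K' - ?u K)) (?X K K' w)" for w by (rule dX)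
      show "star v (?u K' - ?u K) \<inter> star w (?u K' - ?u K) = {}" if "v \<in> ?O K'" "w \<in> ?O K'" "v \<noteq> w" for v w
        by (rule star_disjoint) (use that in auto)
      \<comment> \<open>Independence of different \<open>w\<close> comes from disjoint stars; for
        one fixed \<open>w\<close> the events for different \<open>r\<close> are only positively
        correlated.\<close>
      show "(\<Prod>r\<in>?Rg K K'. 1 - (1 - p) ^ card (?S K K' r)) \<le> pr (?X K K' w)" if w: "w \<in> ?O K'" for w
      proof -
        have "(\<Prod>r\<in>?Rg K K'. 1 - (1 - p) ^ card (?S K K' r)) = (\<Prod>r\<in>?Rg K K'. pr (\<lambda>f. hits f w (?S K K' r)))"
        proof (rule prod.cong[OF refl])
          fix r assume "r \<in> ?Rg K K'"
          hence "?S K K' r \<subseteq> {1..n}" "w \<notin> ?S K K' r" using G w by auto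
          thus "1 - (1 - p) ^ card (?S K K' r) = pr (\<lambda>f. hits f w (?S K K' r))"
            using w by (subst pr_hits) auto
        qed
        also have "\<dots> \<le> pr (?X K K' w)"
          by (rule harris_pr) (use fR in \<open>auto simp: hits_def\<close>)
        finally show ?thesis .
      qed
      show "m \<le> card (?O K') * (\<Prod>r\<in>?Rg K K'. 1 - (1 - p) ^ card (?S K K' r))" using G by blast
    qed (use m in auto)
    thus "pr (\<lambda>f. real (card {w \<in> ?O K'. ?X K K' w f}) \<le> m / 2) \<le> exp (- m / 8)"
      by (simp add: power2_eq_square)
  qed simp
  have "?u (st R k f) \<subseteq> ?u (st R (Suc k) f)" "?u (st R (Suc k) f) \<subseteq> {1..n}" for f
    unfolding UN_st using rc_mono reach_gr_subset[OF R] by blast+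
  moreover have "?Rg (st R k f) (st R (Suc k) f) = {r\<in>R. t \<le> card (newr R k f r)}" for f
    using newr_st[of _ R k f] by auto
  moreover have "(\<Prod>r\<in>{r\<in>R. t \<le> card (newr R k f r)}. 1 - (1 - p) ^ card (?S (st R k f) (st R (Suc k) f) r))
     = (\<Prod>r\<in>{r\<in>R. t \<le> card (newr R k f r)}. 1 - (1 - p) ^ card (newr R k f r))" for f
    by (rule prod.cong) (auto simp: newr_st)
  moreover have "(\<forall>r\<in>{r\<in>R. t \<le> card (newr R k f r)}. hits f w (?S (st R k f) (st R (Suc k) f) r))
     \<longleftrightarrow> (\<forall>r\<in>{r\<in>R. t \<le> card (newr R k f r)}. hits f w (newr R k f r))" for w f
    by (auto simp: newr_st)
  ultimately have main_iff: "?G (st R k f) (st R (Suc k) f) \<and> card {w \<in> ?O (st R (Suc k) f). ?X (st R k f) (st R (Suc k) f) w f} \<le> m / 2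
     \<longleftrightarrow> m \<le> card ({1..n} - rc R (Suc k) f) *
           (\<Prod>r\<in>{r\<in>R. t \<le> card (newr R k f r)}. 1 - (1 - p) ^ card (newr R k f r)) \<and>
      card {w \<in> {1..n} - rc R (Suc k) f. \<forall>r\<in>{r\<in>R. t \<le> card (newr R k f r)}. hits f w (newr R k f r)} \<le> m / 2" for f
    by (simp only: UN_st simp_thms)
  show ?thesis using main unfolding main_iff .
qed

end

section \<open>Overlapping spheres, separating vertices, coinciding patterns\<close>

definition own_part :: "'r set \<Rightarrow> ('r \<Rightarrow> 'v set) \<Rightarrow> 'r \<Rightarrow> 'v set" where
  "own_part R S r = S r - (\<Union>r'\<in>R - {r}. S r')"

text \<open>Removing what lies in several sets leaves disjoint own parts and thus independent
  events. The price is to require that a vertex has no neighbour in the shared part, which is cheap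
  while that part is small.\<close>

definition shared_part :: "'r set \<Rightarrow> ('r \<Rightarrow> 'v set) \<Rightarrow> 'v set" where
  "shared_part R S = (\<Union>r\<in>R. S r) - (\<Union>r\<in>R. own_part R S r)"

lemma split_own_part: "r \<in> R \<Longrightarrow> S r \<subseteq> own_part R S r \<union> shared_part R S"
  by (auto simp: shared_part_def own_part_def)

lemma own_part_subset: "own_part R S r \<subseteq> S r" by (auto simp: own_part_def)

lemma own_part_disjoint: "r \<in> R \<Longrightarrow> r' \<in> R \<Longrightarrow> r \<noteq> r' \<Longrightarrow> own_part R S r \<inter> own_part R S r' = {}"
  by (auto simp: own_part_def)

lemma own_part_shared: "r \<in> R \<Longrightarrow> own_part R S r \<inter> shared_part R S = {}"
  by (auto simp: shared_part_def)

lemma shared_part_subset: "shared_part R S \<subseteq> (\<Union>r\<in>R. S r)" by (auto simp: shared_part_def)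

lemma star_mono: "S \<subseteq> S' \<Longrightarrow> star w S \<subseteq> star w S'"
  by (auto simp: star_def)

context gnp begin

definition separators :: "(nat set \<Rightarrow> bool) \<Rightarrow> nat \<Rightarrow> nat \<Rightarrow> nat set" where
  "separators f u v = {w \<in> {1..n}. graph_dist (gr n f) u w \<noteq> graph_dist (gr n f) v w}"

text \<open>Distance is symmetric, so the landmarks separating \<open>u\<close> from
  \<open>v\<close> are found by exploring from \<open>u\<close> and \<open>v\<close> instead of from
  the landmarks.\<close>

lemma separators_reachI:
  assumes "w \<in> {1..n}" "(w \<in> rc {u} j f) \<noteq> (w \<in> rc {v} j f)"
  shows "w \<in> separators f u v"
proof -
  have "(u \<in> rc {w} j f) \<noteq> (v \<in> rc {w} j f)"
    using assms(2) reach_sym[of u "gr n f" w j] reach_sym[of v "gr n f" w j] by blast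
  hence "graph_dist (gr n f) u w \<noteq> graph_dist (gr n f) v w"
    using graph_dist_eqD[of "gr n f" u w v j] by blast
  thus ?thesis using assms(1) by (simp add: separators_def)
qed

lemma pr_hits_differ:
  assumes A: "A \<subseteq> {1..n}" "B \<subseteq> {1..n}" "T \<subseteq> {1..n}" "A \<inter> B = {}" "A \<inter> T = {}" "B \<inter> T = {}"
    and w: "w \<in> {1..n}" "w \<notin> A" "w \<notin> B" "w \<notin> T"
  shows "pr (\<lambda>f. \<not> hits f w T \<and> hits f w A \<noteq> hits f w B) =
    (1 - p) ^ card T * ((1 - p) ^ card A * (1 - (1 - p) ^ card B) + (1 - p) ^ card B * (1 - (1 - p) ^ card A))"
proof -
  have d: "depends_on (star w S) (\<lambda>f. hits f w S)" "depends_on (star w S) (\<lambda>f. \<not> hits f w S)" for S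
    by (rule depends_on_hits, rule depends_on_comp[OF depends_on_hits])
  have h: "pr (\<lambda>f. hits f w S) = 1 - (1 - p) ^ card S" "pr (\<lambda>f. \<not> hits f w S) = (1 - p) ^ card S"
    if "S \<subseteq> {1..n}" "w \<notin> S" for S using pr_hits[OF that(2) w(1) that(1)] by (simp_all add: pr_not)
  have dj: "star w A \<inter> star w B = {}" "star w B \<inter> star w A = {}" "star w T \<inter> (star w A \<union> star w B) = {}"
    using star_disjoint'[of w A B] star_disjoint'[of w A T] star_disjoint'[of w B T] assms by blast+
  have 1: "pr (\<lambda>f. hits f w A \<and> \<not> hits f w B) = (1 - (1 - p) ^ card A) * (1 - p) ^ card B"
    using pr_conj_disjoint[OF d(1)[of A] d(2)[of B] dj(1)] h assms by simp
  have 2: "pr (\<lambda>f. hits f w B \<and> \<not> hits f w A) = (1 - (1 - p) ^ card B) * (1 - p) ^ card A"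
    using pr_conj_disjoint[OF d(1)[of B] d(2)[of A] dj(2)] h assms by simp
  have "pr (\<lambda>f. hits f w A \<noteq> hits f w B) = ex (\<lambda>f. of_bool (hits f w A \<and> \<not> hits f w B) + of_bool (hits f w B \<and> \<not> hits f w A))"
    unfolding pr_ex by (intro ex_cong) auto
  also have "\<dots> = (1 - (1 - p) ^ card A) * (1 - p) ^ card B + (1 - (1 - p) ^ card B) * (1 - p) ^ card A"
    by (simp only: ex_add pr_ex[symmetric] 1 2)
  finally have 3: "pr (\<lambda>f. hits f w A \<noteq> hits f w B) = \<dots>" .
  have dAB: "depends_on (star w A \<union> star w B) (\<lambda>f. hits f w A \<noteq> hits f w B)"
    by (intro depends_onI) (auto simp: hits_star)
  show ?thesis
    by (subst pr_conj_disjoint[OF d(2)[of T] dAB dj(3)], subst 3, subst h(2)) (use assms in \<open>simp_all add: algebra_simps\<close>)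
qed

lemma pr_hits_agree:
  assumes A: "A \<subseteq> {1..n}" and w: "w \<in> {1..n} - A" "v \<in> {1..n} - A" "w \<noteq> v"
  shows "pr (\<lambda>f. hits f w A = hits f v A) = ((1 - p) ^ card A)\<^sup>2 + (1 - (1 - p) ^ card A)\<^sup>2"
proof -
  have d: "depends_on (star w A) (\<lambda>f. hits f w A)" "depends_on (star w A) (\<lambda>f. \<not> hits f w A)" for w
    by (rule depends_on_hits, rule depends_on_comp[OF depends_on_hits])
  have h: "pr (\<lambda>f. hits f w A) = 1 - (1 - p) ^ card A" "pr (\<lambda>f. \<not> hits f w A) = (1 - p) ^ card A"
    if "w \<in> {1..n} - A" for w using pr_hits[of w A] that A by (simp_all add: pr_not)
  have dj: "star w A \<inter> star v A = {}" by (rule star_disjoint) (use w in auto)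
  have 1: "pr (\<lambda>f. hits f w A \<and> hits f v A) = (1 - (1 - p) ^ card A)\<^sup>2"
    using pr_conj_disjoint[OF d(1)[of w] d(1)[of v] dj] h w by (simp add: power2_eq_square)
  have 2: "pr (\<lambda>f. \<not> hits f w A \<and> \<not> hits f v A) = ((1 - p) ^ card A)\<^sup>2"
    using pr_conj_disjoint[OF d(2)[of w] d(2)[of v] dj] h w by (simp add: power2_eq_square)
  have "pr (\<lambda>f. hits f w A = hits f v A) = ex (\<lambda>f. of_bool (hits f w A \<and> hits f v A) + of_bool (\<not> hits f w A \<and> \<not> hits f v A))"
    unfolding pr_ex by (intro ex_cong) auto
  thus ?thesis by (simp only: ex_add pr_ex[symmetric] 1 2 add.commute)
qed

text \<open>Vertices at distance \<open>k\<close> from one of \<open>u\<close>, \<open>v\<close> and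
  farther from the other separate them outright; these are the two sets \<open>A\<close>, counted
  with certainty. A vertex outside both balls separates if it hits exactly one of these sets and
  misses the common part \<open>T\<close>, where a hit would give distance \<open>k + 1\<close> to
  both. The latter vertices are counted by the Chernoff bound.\<close>

lemma separators_lower:
  fixes m \<delta> D :: real and k :: nat
  assumes uv: "u \<in> {1..n}" "v \<in> {1..n}" and \<delta>: "0 \<le> \<delta>" "\<delta> \<le> 1" and m: "0 \<le> m"
  defines "A \<equiv> \<lambda>u v f. rc {u} (Suc k) f - rc {v} (Suc k) f - rc {u} k f"
    and "T \<equiv> \<lambda>f. rc {u} (Suc k) f \<inter> rc {v} (Suc k) f - rc {u} k f - rc {v} k f"
  shows "pr (\<lambda>f. m \<le> card ({1..n} - rc {u, v} (Suc k) f) *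
      ((1 - p) ^ card (T f) * ((1 - p) ^ card (A u v f) * (1 - (1 - p) ^ card (A v u f)) + (1 - p) ^ card (A v u f) * (1 - (1 - p) ^ card (A u v f))))
     \<and> card (separators f u v) \<le> card (A u v f) + card (A v u f) + ((1 - \<delta>) * m - \<delta> * D))
    \<le> exp (- \<delta>\<^sup>2 * (m / 2 + D))"
proof -
  let ?R = "{u, v}"
  let ?u = "\<lambda>K :: nat \<Rightarrow> nat set. \<Union>r\<in>?R. K r"
  let ?A = "\<lambda>u v (K :: nat \<Rightarrow> nat set) K'. K' u - K' v - K u"
  let ?T = "\<lambda>(K :: nat \<Rightarrow> nat set) K'. K' u \<inter> K' v - K u - K v"
  let ?h = "\<lambda>A B T. (1 - p) ^ card T * ((1 - p) ^ card A * (1 - (1 - p) ^ card B) + (1 - p) ^ card B * (1 - (1 - p) ^ card A))"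
  let ?O = "\<lambda>K'. {1..n} - ?u K'"
  let ?X = "\<lambda>K K' w f. \<not> hits f w (?T K K') \<and> hits f w (?A u v K K') \<noteq> hits f w (?A v u K K')"
  let ?G = "\<lambda>K K'. K u \<subseteq> K' u \<and> K v \<subseteq> K' v \<and> ?u K' \<subseteq> {1..n} \<and> m \<le> card (?O K') * ?h (?A u v K K') (?A v u K K') (?T K K')"
  have main: "pr (\<lambda>f. ?G (st ?R k f) (st ?R (Suc k) f) \<and>
      card {w \<in> ?O (st ?R (Suc k) f). ?X (st ?R k f) (st ?R (Suc k) f) w f} \<le> (1 - \<delta>) * m - \<delta> * D) \<le> exp (- \<delta>\<^sup>2 * (m / 2 + D))"
  proof (rule explore[where G = ?G and B = "\<lambda>K K' f. card {w \<in> ?O K'. ?X K K' w f} \<le> (1 - \<delta>) * m - \<delta> * D"])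
    fix K K' :: "nat \<Rightarrow> nat set" assume G: "?G K K'"
    have dX: "depends_on (star w (?u K' - ?u K)) (?X K K' w)" if "w \<notin> ?u K'" for w
    proof (rule depends_onI)
      fix f g :: "nat set \<Rightarrow> bool" assume eq: "\<And>e. e \<in> star w (?u K' - ?u K) \<Longrightarrow> f e = g e"
      have "hits f w S = hits g w S" if "S \<subseteq> ?u K' - ?u K" for S
        by (rule depends_onD[OF depends_on_hits]) (rule eq, rule subsetD[OF star_mono[OF that]])
      moreover have "?T K K' \<subseteq> ?u K' - ?u K" "?A u v K K' \<subseteq> ?u K' - ?u K" "?A v u K K' \<subseteq> ?u K' - ?u K"
        using G by auto
      ultimately show "?X K K' w f = ?X K K' w g" by simp
    qed
    show "depends_on {e. e \<inter> ?u K = {}} (\<lambda>f. card {w \<in> ?O K'. ?X K K' w f} \<le> (1 - \<delta>) * m - \<delta> * D)"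
    proof (rule depends_onI)
      fix f g :: "nat set \<Rightarrow> bool" assume eq: "\<And>e. e \<in> {e. e \<inter> ?u K = {}} \<Longrightarrow> f e = g e"
      have "?X K K' w f = ?X K K' w g" if w: "w \<in> ?O K'" for w
      proof (rule depends_onD[OF depends_on_mono[OF dX star_avoids]])
        show "w \<notin> ?u K'" "w \<notin> ?u K" using w G by auto
      qed (use eq in auto)
      hence "{w \<in> ?O K'. ?X K K' w f} = {w \<in> ?O K'. ?X K K' w g}" by blast
      thus "(real (card {w \<in> ?O K'. ?X K K' w f}) \<le> (1 - \<delta>) * m - \<delta> * D)
          = (real (card {w \<in> ?O K'. ?X K K' w g}) \<le> (1 - \<delta>) * m - \<delta> * D)" by simp
    qed
    show "pr (\<lambda>f. card {w \<in> ?O K'. ?X K K' w f} \<le> (1 - \<delta>) * m - \<delta> * D) \<le> exp (- \<delta>\<^sup>2 * (m / 2 + D))"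
    proof (rule count_lower[where C = "\<lambda>w. star w (?u K' - ?u K)"])
      show "depends_on (star w (?u K' - ?u K)) (?X K K' w)" if "w \<in> ?O K'" for w by (rule dX) (use that in auto)
      show "star v (?u K' - ?u K) \<inter> star w (?u K' - ?u K) = {}" if "v \<in> ?O K'" "w \<in> ?O K'" "v \<noteq> w" for v w
        by (rule star_disjoint) (use that in auto)
      show "?h (?A u v K K') (?A v u K K') (?T K K') \<le> pr (?X K K' w)" if w: "w \<in> ?O K'" for w
        by (subst pr_hits_differ) (use G w in auto)
      show "m \<le> card (?O K') * ?h (?A u v K K') (?A v u K K') (?T K K')" using G by blast
    qed (use m \<delta> in auto)
  qed simp
  show ?thesis
  proof (rule order.trans[OF pr_mono main])
    fix f
    assume asm: "m \<le> card ({1..n} - rc {u, v} (Suc k) f) * ?h (A u v f) (A v u f) (T f)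
     \<and> card (separators f u v) \<le> card (A u v f) + card (A v u f) + ((1 - \<delta>) * m - \<delta> * D)"
    let ?W = "{w \<in> {1..n} - rc {u, v} (Suc k) f. \<not> hits f w (T f) \<and> hits f w (A u v f) \<noteq> hits f w (A v u f)}"
    have sub: "rc {u} (Suc k) f \<subseteq> {1..n}" "rc {v} (Suc k) f \<subseteq> {1..n}"
      by (rule reach_gr_subset, use uv in simp)+
    have UN: "rc {u, v} j f = rc {u} j f \<union> rc {v} j f" for j
      by (subst reach_UN) (simp del: reach.simps)
    have mono: "rc {u} k f \<subseteq> rc {u} (Suc k) f" "rc {v} k f \<subseteq> rc {v} (Suc k) f" by (rule rc_mono)+
    have new: "newr {u, v} k f r = rc {r} (Suc k) f - rc {u} k f - rc {v} k f" for r
      unfolding newr_def UN by blast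
    have W: "?W \<subseteq> separators f u v"
    proof
      fix w assume w: "w \<in> ?W"
      have iff: "w \<in> rc {r} (Suc (Suc k)) f \<longleftrightarrow> hits f w (newr {u, v} k f r)" if "r \<in> {u, v}" for r
        by (rule reach_two_iff) (use that w uv in auto)
      have "newr {u, v} k f u = T f \<union> A u v f \<union> (newr {u, v} k f u \<inter> rc {v} k f)"
        unfolding new T_def A_def using mono by blast
      \<comment> \<open>For a vertex that misses \<open>T f\<close>, hitting the new part of
        \<open>u\<close> means hitting \<open>A u v f\<close>.\<close>
      have 1: "hits f w (newr {u, v} k f u) \<longleftrightarrow> hits f w (A u v f)"
      proof -
        have "newr {u, v} k f u \<subseteq> T f \<union> A u v f" unfolding new T_def A_def by blast
        moreover have "A u v f \<subseteq> newr {u, v} k f u" unfolding new A_def using mono by blast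
        ultimately show ?thesis using w unfolding hits_def by blast
      qed
      have 2: "hits f w (newr {u, v} k f v) \<longleftrightarrow> hits f w (A v u f)"
      proof -
        have "newr {u, v} k f v \<subseteq> T f \<union> A v u f" unfolding new T_def A_def by blast
        moreover have "A v u f \<subseteq> newr {u, v} k f v" unfolding new A_def using mono by blast
        ultimately show ?thesis using w unfolding hits_def by blast
      qed
      show "w \<in> separators f u v"
        by (rule separators_reachI[where j = "Suc (Suc k)"]) (use w iff[of u] iff[of v] 1 2 in blast)+
    qed
    have AA: "A u v f \<subseteq> separators f u v" "A v u f \<subseteq> separators f u v"
      using separators_reachI[where j = "Suc k" and u = u and v = v and f = f] sub unfolding A_def by blast+
    have fin: "finite (separators f u v)" by (simp add: separators_def)
    have "card (A u v f) + card (A v u f) + card ?W = card (A u v f \<union> A v u f \<union> ?W)"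
    proof -
      have f: "finite (A u v f)" "finite (A v u f)" "finite ?W"
        using AA W fin by (meson finite_subset)+
      have "A u v f \<inter> A v u f = {}" "(A u v f \<union> A v u f) \<inter> ?W = {}"
        unfolding A_def UN by blast+
      thus ?thesis using f by (simp add: card_Un_disjoint)
    qed
    also have "\<dots> \<le> card (separators f u v)" using AA W fin by (intro card_mono) auto
    finally have "real (card ?W) \<le> (1 - \<delta>) * m - \<delta> * D" using asm by linarith
    moreover have "?u (st ?R j f) = rc {u, v} j f" for j by (rule UN_st)
    moreover have "st ?R j f u = rc {u} j f" "st ?R j f v = rc {v} j f" for j by simp_all
    moreover have "?u (st ?R (Suc k) f) \<subseteq> {1..n}" unfolding UN_st UN using sub by blast
    ultimately show "?G (st ?R k f) (st ?R (Suc k) f) \<and>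
      card {w \<in> ?O (st ?R (Suc k) f). ?X (st ?R k f) (st ?R (Suc k) f) w f} \<le> (1 - \<delta>) * m - \<delta> * D"
      using asm mono unfolding A_def T_def by (simp only: simp_thms)
  qed
qed

text \<open>The bits from \<open>v\<close> into \<open>S\<close> have the same product law for each
  outside vertex \<open>v\<close>. Hence all fresh vertices have equally distributed patterns, as
  the birthday bound demands.\<close>

lemma pr_bits_vertex:
  assumes S: "S \<subseteq> {1..n}" and v: "v \<in> {1..n}" "v \<notin> S"
  shows "pr (\<lambda>f. P (\<lambda>u. u \<in> S \<and> f {u, v})) = measure_pmf.prob (Pi_pmf S False (\<lambda>_. bernoulli_pmf p)) {g. P g}"
proof -
  let ?h = "\<lambda>u. if u \<in> S then {u, v} else {}"
  have bij: "bij_betw ?h S (star v S)"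
    using v unfolding bij_betw_def star_def by (auto simp: inj_on_def doubleton_eq_iff)
  have fS: "finite S" using finite_subset[OF S] by simp
  have "Pi_pmf S False (\<lambda>_. bernoulli_pmf p) = map_pmf (\<lambda>g. g \<circ> ?h) (Pi_pmf (star v S) False (\<lambda>_. bernoulli_pmf p))"
    by (rule Pi_pmf_bij_betw[OF fS bij]) (auto simp: star_def)
  also have "Pi_pmf (star v S) False (\<lambda>_. bernoulli_pmf p) = map_pmf (\<lambda>f x. if x \<in> star v S then f x else False) M"
    unfolding M_def by (rule Pi_pmf_subset) (use star_subset[OF v(2,1) S] in auto)
  finally have "Pi_pmf S False (\<lambda>_. bernoulli_pmf p) = map_pmf (\<lambda>f. (\<lambda>x. if x \<in> star v S then f x else False) \<circ> ?h) M"
    by (simp add: pmf.map_comp o_def)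
  also have "(\<lambda>f. (\<lambda>x. if x \<in> star v S then f x else False) \<circ> ?h) = (\<lambda>f u. u \<in> S \<and> f {u, v})"
    by (auto simp: fun_eq_iff star_def)
  finally show ?thesis unfolding pr_def by (simp add: vimage_def)
qed

text \<open>The lower bound for \<open>Q\<close> to compare with is a way for two fresh vertices to
  agree: both miss the shared part, and for every landmark both hit or both miss its own part,
  independently over the landmarks.\<close>

lemma few_patterns_unlikely:
  fixes Q :: real
  assumes R: "R \<subseteq> {1..n}" and N: "0 < N" and Q: "0 < Q"
  shows "pr (\<lambda>f. 2 * N \<le> card ({1..n} - rc R (Suc k) f) \<and>
      Q \<le> (1 - p) ^ (2 * card (shared_part R (newr R k f))) *
          (\<Prod>r\<in>R. ((1 - p) ^ card (own_part R (newr R k f) r))\<^sup>2 + (1 - (1 - p) ^ card (own_part R (newr R k f) r))\<^sup>2) \<and>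
      inj_on (\<lambda>w. {r\<in>R. hits f w (newr R k f r)}) ({1..n} - rc R (Suc k) f))
    \<le> 2 * exp (- (N * sqrt Q) / 8)"
proof -
  let ?u = "\<lambda>K :: nat \<Rightarrow> nat set. \<Union>r\<in>R. K r"
  \<comment> \<open>Emptying the sets at indices outside \<open>R\<close> makes the inclusions in
    the explored region hold for every index.\<close>
  let ?S = "\<lambda>K K' r. if r \<in> R then K' r - ?u K else {}"
  let ?q = "\<lambda>S. (1 - p) ^ (2 * card (shared_part R S)) *
          (\<Prod>r\<in>R. ((1 - p) ^ card (own_part R S r))\<^sup>2 + (1 - (1 - p) ^ card (own_part R S r))\<^sup>2)"
  let ?O = "\<lambda>K'. {1..n} - ?u K'"
  let ?b = "\<lambda>S w f. {r\<in>R. hits f w (S r)}"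
  let ?G = "\<lambda>K K'. ?u K \<subseteq> ?u K' \<and> ?u K' \<subseteq> {1..n} \<and> 2 * N \<le> card (?O K') \<and> Q \<le> ?q (?S K K')"
  have fR: "finite R" using finite_subset[OF R] by simp
  have main: "pr (\<lambda>f. ?G (st R k f) (st R (Suc k) f) \<and>
      inj_on (\<lambda>w. ?b (?S (st R k f) (st R (Suc k) f)) w f) (?O (st R (Suc k) f))) \<le> 2 * exp (- (N * sqrt Q) / 8)"
  proof (rule explore[where G = ?G and B = "\<lambda>K K' f. inj_on (\<lambda>w. ?b (?S K K') w f) (?O K')"])
    fix K K' :: "nat \<Rightarrow> nat set" assume G: "?G K K'"
    define S where "S = ?S K K'"
    have Sr: "(if r \<in> R then K' r - ?u K else {}) = S r" for r by (simp add: S_def)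
    have GQ: "Q \<le> ?q S" using G unfolding Sr by (elim conjE)
    have S: "S r \<subseteq> ?u K' - ?u K" "S r \<subseteq> {1..n}" for r using G by (auto simp: S_def)
    have db: "depends_on (star w (?u K' - ?u K)) (?b S w)" for w
    proof (rule depends_onI)
      fix f g :: "nat set \<Rightarrow> bool" assume eq: "\<And>e. e \<in> star w (?u K' - ?u K) \<Longrightarrow> f e = g e"
      have "hits f w (S r) = hits g w (S r)" for r
        by (rule depends_onD[OF depends_on_hits]) (rule eq, rule subsetD[OF star_mono[OF S(1)]])
      thus "?b S w f = ?b S w g" by simp
    qed
    show "depends_on {e. e \<inter> ?u K = {}} (\<lambda>f. inj_on (\<lambda>w. ?b (?S K K') w f) (?O K'))"
      unfolding Sr
    proof (rule depends_onI)
      fix f g :: "nat set \<Rightarrow> bool" assume eq: "\<And>e. e \<in> {e. e \<inter> ?u K = {}} \<Longrightarrow> f e = g e"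
      have "?b S w f = ?b S w g" if w: "w \<in> ?O K'" for w
      proof (rule depends_onD[OF depends_on_mono[OF db star_avoids]])
        show "w \<notin> ?u K" using w G by auto
      qed (use eq in auto)
      thus "inj_on (\<lambda>w. ?b S w f) (?O K') = inj_on (\<lambda>w. ?b S w g) (?O K')" by (intro inj_on_cong) auto
    qed
    have "2 * N \<le> card (?O K')" using G by (elim conjE)
    then obtain W where W: "W \<subseteq> ?O K'" "card W = 2 * N" by (rule obtain_subset_with_card_n)
    have fW: "finite W" using W(1) by (rule finite_subset) simp
    have "N \<le> card W" using W(2) by simp
    then obtain W1 where W1: "W1 \<subseteq> W" "card W1 = N" by (rule obtain_subset_with_card_n)
    have fW1: "finite W1" using W1(1) fW by (rule finite_subset)
    define W2 where "W2 = W - W1"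
    have W2: "card W2 = N" "finite W2" "W1 \<inter> W2 = {}" "W1 \<union> W2 = W"
      using W1 W fW fW1 by (auto simp: W2_def card_Diff_subset)
    have "pr (\<lambda>f. inj_on (\<lambda>w. ?b S w f) (W1 \<union> W2)) \<le> 2 * exp (- (N * sqrt Q) / 8)"
    proof (rule no_collision[where C = "\<lambda>w. star w (?u K' - ?u K)"
          and \<mu> = "\<lambda>x. measure_pmf.prob (Pi_pmf (?u K' - ?u K) False (\<lambda>_. bernoulli_pmf p)) {g. {r\<in>R. \<exists>u\<in>S r. g u} = x}"])
      fix v x assume "v \<in> W1 \<union> W2"
      hence v: "v \<in> {1..n}" "v \<notin> ?u K' - ?u K" using W W2 by auto
      have "(\<exists>u\<in>S r. f {u, v}) \<longleftrightarrow> (\<exists>u\<in>S r. u \<in> ?u K' - ?u K \<and> f {u, v})" for f :: "nat set \<Rightarrow> bool" and r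
        using subsetD[OF S(1)[of r]] by (intro bex_cong refl) simp
      hence "?b S v f = {r\<in>R. \<exists>u\<in>S r. u \<in> ?u K' - ?u K \<and> f {u, v}}" for f
        unfolding hits_def by simp
      hence "pr (\<lambda>f. ?b S v f = x) = pr (\<lambda>f. (\<lambda>g. {r\<in>R. \<exists>u\<in>S r. g u} = x) (\<lambda>u. u \<in> ?u K' - ?u K \<and> f {u, v}))"
        by simp
      also have "\<dots> = measure_pmf.prob (Pi_pmf (?u K' - ?u K) False (\<lambda>_. bernoulli_pmf p)) {g. {r\<in>R. \<exists>u\<in>S r. g u} = x}"
        by (rule pr_bits_vertex) (use v G in auto)
      finally show "pr (\<lambda>f. ?b S v f = x) = \<dots>" .
    next
      fix v w assume "v \<in> W1" "w \<in> W2"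
      hence vw: "v \<in> {1..n} - ?u K'" "w \<in> {1..n} - ?u K'" "v \<noteq> w" using W W2 by auto
      let ?U = "shared_part R S" and ?D = "own_part R S"
      have D: "?D r \<subseteq> {1..n}" "?U \<subseteq> {1..n}" "v \<notin> ?D r" "w \<notin> ?D r" "v \<notin> ?U" "w \<notin> ?U" for r
      proof -
        define Y where "Y = ?u K'"
        have SY: "S r \<subseteq> Y" for r using S(1)[of r] unfolding Y_def by (rule order.trans) (rule Diff_subset)
        have DY: "?D r \<subseteq> Y" for r by (rule order.trans[OF own_part_subset[of R S r] SY])
        have UY: "?U \<subseteq> Y" by (rule order.trans[OF shared_part_subset[of R S]]) (rule UN_least, rule SY)
        have "Y \<subseteq> {1..n}" using G unfolding Y_def by (elim conjE)
        moreover have "v \<notin> Y" "w \<notin> Y" using vw unfolding Y_def by simp_all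
        ultimately show "?D r \<subseteq> {1..n}" "?U \<subseteq> {1..n}" "v \<notin> ?D r" "w \<notin> ?D r" "v \<notin> ?U" "w \<notin> ?U"
          using DY[of r] UY by auto
      qed
      let ?CU = "star v ?U \<union> star w ?U" and ?CD = "\<lambda>r. star v (?D r) \<union> star w (?D r)"
      have sU: "?CU \<subseteq> vertex_pairs n" using star_subset D vw by simp
      have cU: "card ?CU = 2 * card ?U"
      proof -
        have fU: "finite ?U" using D(2) by (rule finite_subset) simp
        have "card ?CU = card (star v ?U) + card (star w ?U)"
        proof (rule card_Un_disjoint)
          show "finite (star v ?U)" "finite (star w ?U)" using fU by (simp_all add: star_def)
          show "star v ?U \<inter> star w ?U = {}" by (rule star_disjoint[OF vw(3) D(5,6)])
        qed
        thus ?thesis by (simp add: card_star[OF D(5)] card_star[OF D(6)])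
      qed
      have "(\<Prod>r\<in>R. ((1 - p) ^ card (?D r))\<^sup>2 + (1 - (1 - p) ^ card (?D r))\<^sup>2) = (\<Prod>r\<in>R. pr (\<lambda>f. hits f v (?D r) = hits f w (?D r)))"
        by (intro prod.cong refl pr_hits_agree[symmetric]) (use vw D in auto)
      also have "\<dots> = pr (\<lambda>f. \<forall>r\<in>R. hits f v (?D r) = hits f w (?D r))"
      proof (rule pr_all_disjoint[symmetric, where C = ?CD])
        show "depends_on (?CD r) (\<lambda>f. hits f v (?D r) = hits f w (?D r))" for r
          by (intro depends_onI) (auto simp: hits_star)
        show "?CD r \<inter> ?CD r' = {}" if "r \<in> R" "r' \<in> R" "r \<noteq> r'" for r r'
        proof -
          have dd: "?D r \<inter> ?D r' = {}" by (rule own_part_disjoint[OF that])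
          have "star v (?D r) \<inter> star v (?D r') = {}" "star w (?D r) \<inter> star w (?D r') = {}"
            by (rule star_disjoint'[OF D(3) dd D(3)], rule star_disjoint'[OF D(4) dd D(4)])
          moreover have "star v (?D r) \<inter> star w (?D r') = {}" "star w (?D r) \<inter> star v (?D r') = {}"
            by (rule star_disjoint[OF vw(3) D(3) D(4)], rule star_disjoint[OF vw(3)[symmetric] D(4) D(3)])
          ultimately show ?thesis by (simp add: Int_Un_distrib Int_Un_distrib2)
        qed
      qed (rule fR)
      finally have 1: "(\<Prod>r\<in>R. ((1 - p) ^ card (?D r))\<^sup>2 + (1 - (1 - p) ^ card (?D r))\<^sup>2) = \<dots>" .
      have 2: "pr (\<lambda>f. \<forall>e\<in>?CU. \<not> f e) = (1 - p) ^ (2 * card ?U)" unfolding cU[symmetric] by (rule pr_none[OF sU])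
      have "Q \<le> pr (\<lambda>f. \<forall>e\<in>?CU. \<not> f e) * pr (\<lambda>f. \<forall>r\<in>R. hits f v (?D r) = hits f w (?D r))"
        using GQ unfolding 1 2 .
      also have "\<dots> = pr (\<lambda>f. (\<forall>e\<in>?CU. \<not> f e) \<and> (\<forall>r\<in>R. hits f v (?D r) = hits f w (?D r)))"
      proof (rule pr_conj_disjoint[symmetric, where A = ?CU and B = "\<Union>r\<in>R. ?CD r"])
        show "depends_on ?CU (\<lambda>f. \<forall>e\<in>?CU. \<not> f e)" by (intro depends_onI) auto
        show "depends_on (\<Union>r\<in>R. ?CD r) (\<lambda>f. \<forall>r\<in>R. hits f v (?D r) = hits f w (?D r))"
        proof (rule depends_on_Ball, rule depends_onI)
          fix r f g assume "r \<in> R" and eq: "\<And>e. e \<in> (\<Union>r\<in>R. ?CD r) \<Longrightarrow> f e = (g e :: bool)"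
          hence "f e = g e" if "e \<in> ?CD r" for e using that by blast
          hence "hits f v (?D r) = hits g v (?D r)" "hits f w (?D r) = hits g w (?D r)"
            by (auto simp: hits_star)
          thus "(hits f v (?D r) = hits f w (?D r)) = (hits g v (?D r) = hits g w (?D r))" by simp
        qed
        have "?CU \<inter> ?CD r = {}" if "r \<in> R" for r
        proof -
          have "?U \<inter> ?D r = {}" using own_part_shared[OF that, of S] by blast
          thus ?thesis using star_disjoint'[of v ?U "?D r"] star_disjoint'[of w ?U "?D r"]
              star_disjoint[of v w "?D r" ?U] star_disjoint[of w v "?D r" ?U] D vw(3) by blast
        qed
        thus "?CU \<inter> (\<Union>r\<in>R. ?CD r) = {}" by blast
      qed
      \<comment> \<open>With no neighbour in the shared part, hitting \<open>S r\<close> is the same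
        as hitting its own part, so agreement on own parts is agreement of patterns.\<close>
      also have "\<dots> \<le> pr (\<lambda>f. ?b S v f = ?b S w f)"
      proof (rule pr_mono)
        fix f assume f: "(\<forall>e\<in>?CU. \<not> f e) \<and> (\<forall>r\<in>R. hits f v (?D r) = hits f w (?D r))"
        have "\<not> hits f x ?U" if "x \<in> {v, w}" for x using f that unfolding hits_star by blast
        hence "hits f x (S r) \<longleftrightarrow> hits f x (?D r)" if "r \<in> R" "x \<in> {v, w}" for r x
          using split_own_part[OF that(1), of S] own_part_subset[of R S r] that(2) unfolding hits_def by blast
        thus "?b S v f = ?b S w f" using f by blast
      qed
      finally show "Q \<le> pr (\<lambda>f. ?b S v f = ?b S w f)" .
    next
      fix v w assume "v \<in> W1 \<union> W2" "w \<in> W1 \<union> W2" "v \<noteq> w"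
      thus "star v (?u K' - ?u K) \<inter> star w (?u K' - ?u K) = {}"
        using W W2(4) by (intro star_disjoint) auto
    qed (use W1 W2 fW1 N Q db in auto)
    moreover have "pr (\<lambda>f. inj_on (\<lambda>w. ?b S w f) (?O K')) \<le> pr (\<lambda>f. inj_on (\<lambda>w. ?b S w f) (W1 \<union> W2))"
      using W(1) W2(4) by (intro pr_mono) (auto intro: inj_on_subset)
    ultimately show "pr (\<lambda>f. inj_on (\<lambda>w. ?b (?S K K') w f) (?O K')) \<le> 2 * exp (- (N * sqrt Q) / 8)"
      unfolding Sr by linarith
  qed simp
  have eq: "?S (st R k f) (st R (Suc k) f) r = newr R k f r" if "r \<in> R" for r f
    using newr_st[OF that, of k f] that by simp
  have priv: "own_part R (?S (st R k f) (st R (Suc k) f)) r = own_part R (newr R k f) r" if "r \<in> R" for r f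
    unfolding own_part_def using eq[of _ f] that by auto
  have shar: "shared_part R (?S (st R k f) (st R (Suc k) f)) = shared_part R (newr R k f)" for f
    unfolding shared_part_def using eq[of _ f] priv[of _ f] by auto
  have qq: "?q (?S (st R k f) (st R (Suc k) f)) = ?q (newr R k f)" for f
    unfolding shar using priv[of _ f] by (intro arg_cong2[where f = "(*)"] refl prod.cong) simp_all
  have bb: "?b (?S (st R k f) (st R (Suc k) f)) w f = ?b (newr R k f) w f" for w f
    using eq[of _ f] by auto
  have sub: "rc R k f \<subseteq> rc R (Suc k) f" "rc R (Suc k) f \<subseteq> {1..n}" for f
    using rc_mono reach_gr_subset[OF R] by blast+
  show ?thesis
    using main unfolding UN_st qq[unfolded UN_st] bb[unfolded UN_st] using sub by (simp only: simp_thms conj_assoc)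
qed

end

section \<open>Sphere sizes, uniformly over all sets of sources\<close>

declare reach.simps(2) [simp del]

lemma exp_minus_upper: "0 \<le> (x::real) \<Longrightarrow> exp (- x) \<le> 1 - x + x\<^sup>2 / 2"
proof -
  assume x: "0 \<le> x"
  obtain s where s: "\<bar>s\<bar> \<le> \<bar>-x\<bar>" "exp (-x) = (\<Sum>m<3. (-x) ^ m / fact m) + exp s / fact 3 * (-x) ^ 3"
    using Maclaurin_exp_le[of "-x" 3] by blast
  have "exp s / fact 3 * (-x) ^ 3 \<le> 0" using x by (simp add: power3_eq_cube)
  thus ?thesis using s(2) by (simp add: eval_nat_numeral)
qed

lemma one_minus_power_le: "0 \<le> p \<Longrightarrow> p \<le> 1 \<Longrightarrow> (1 - p) ^ s \<le> exp (- (p * real s))"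
proof -
  assume p: "0 \<le> p" "p \<le> (1::real)"
  have "(1 - p) ^ s \<le> exp (- p) ^ s"
    using p exp_ge_add_one_self[of "-p"] by (intro power_mono) auto
  thus ?thesis by (simp add: exp_of_nat_mult[symmetric] mult.commute)
qed

lemma one_minus_power_ge: "0 \<le> p \<Longrightarrow> p \<le> 1 / 2 \<Longrightarrow> exp (- (p * real s * (1 + 2 * p))) \<le> (1 - p) ^ s"
proof -
  assume p: "0 \<le> p" "p \<le> (1 / 2::real)"
  let ?x = "p + 2 * p\<^sup>2"
  have "- ?x \<le> ln (1 - p)" using ln_one_minus_pos_lower_bound[OF p] by simp
  hence "exp (- ?x) \<le> 1 - p" using p by (subst ln_ge_iff[symmetric]) auto
  hence "exp (- ?x) ^ s \<le> (1 - p) ^ s" by (intro power_mono) auto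
  thus ?thesis by (simp add: exp_of_nat_mult[symmetric] algebra_simps power2_eq_square)
qed

context gnp begin

definition sph :: "nat set \<Rightarrow> nat \<Rightarrow> (nat set \<Rightarrow> bool) \<Rightarrow> nat set" where
  "sph R k f = rc R (Suc k) f - rc R k f"

text \<open>The last factor of the lower bound stands for saturation: vertices reached earlier and
  vertices hit more than once are a proportion of order \<open>card R * d ^ l / n\<close>, with
  \<open>d\<close> for \<open>p * (n - 1)\<close>.\<close>

definition grows :: "real \<Rightarrow> nat set \<Rightarrow> nat \<Rightarrow> (nat set \<Rightarrow> bool) \<Rightarrow> bool" where
  "grows \<delta> R i f \<longleftrightarrow> (\<forall>l\<le>i.
     card R * (p * (n - 1)) ^ l * (1 - \<delta>) ^ l * (1 - 10 * card R * (p * (n - 1)) ^ l / n) \<le> card (sph R l f) \<and>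
     card (sph R l f) \<le> card R * (p * (n - 1)) ^ l * (1 + \<delta>) ^ l)"

lemma card_rc:
  assumes "R \<subseteq> {1..n}" shows "card (rc R k f) = (\<Sum>l<k. card (sph R l f))"
proof (induction k)
  case (Suc k)
  have fin: "finite (rc R j f)" for j by (rule finite_subset[OF reach_gr_subset[OF assms]]) simp
  have "card (rc R (Suc k) f) = card (rc R k f) + card (sph R k f)"
  proof -
    have "rc R (Suc k) f = rc R k f \<union> sph R k f" using rc_mono unfolding sph_def by blast
    moreover have "finite (rc R k f)" "finite (sph R k f)"
      unfolding sph_def using fin by (auto simp del: reach.simps)
    moreover have "rc R k f \<inter> sph R k f = {}" unfolding sph_def by blast
    ultimately show ?thesis by (simp only: card_Un_disjoint)
  qed
  thus ?case using Suc by simp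
qed simp

lemma geometric_le:
  fixes d :: real
  assumes "2 \<le> d" shows "(\<Sum>l<Suc k. d ^ l) \<le> 2 * d ^ k"
proof (induction k)
  case (Suc k)
  have "2 * d ^ k \<le> d * d ^ k" using assms by (intro mult_right_mono) auto
  thus ?case using Suc by simp
qed simp

text \<open>Induction on the radius. What matters is that the exponent is proportional to
  \<open>card R\<close>: it outweighs the number of sets of that size, so that growth can be
  required of all of them together.\<close>

lemma growth_set:
  fixes \<delta> d :: real and i :: nat
  defines "d \<equiv> p * (real n - 1)"
  assumes R: "R \<subseteq> {1..n}" "R \<noteq> {}" and n: "2 \<le> n" and d: "4 \<le> d"
    and size: "20 * card R * d ^ i \<le> n" and \<delta>: "0 \<le> \<delta>" "\<delta> \<le> 1"
    and up: "(1 + \<delta>) ^ i \<le> 2" and low: "1 / 2 \<le> (1 - \<delta>) ^ i" and j: "j \<le> i"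
  shows "pr (\<lambda>f. \<not> grows \<delta> R j f) \<le> 2 * j * exp (- (\<delta>\<^sup>2 * d * card R / 16))"
  using j
proof (induction j)
  case 0
  have "grows \<delta> R 0 f" for f
    by (auto simp: grows_def sph_def reach.simps(2) intro!: mult_left_le)
  thus ?case by (simp add: pr_ex)
next
  case (Suc j)
  define a where "a = real (card R)"
  define U where "U l = a * d ^ l * (1 + \<delta>) ^ l" for l
  \<comment> \<open>Essentially the fraction of the graph covered by the current sphere; all losses
    are measured in it.\<close>
  define y where "y = a * d ^ j / n"
  define L where "L = a * d ^ j * (1 - \<delta>) ^ j * (1 - 10 * y)"
  have fR: "finite R" using finite_subset[OF R(1)] by simp
  have a1: "1 \<le> a" using R fR by (simp add: a_def Suc_leI card_gt_0_iff)
  have n0: "0 < real n" using n by simp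
  have dn: "real (n - 1) = real n - 1" using n by simp
  have dj: "1 \<le> d ^ j" using d by simp
  have y0: "0 \<le> y" using a1 d by (simp add: y_def)
  have dy: "d * y \<le> 1 / 20"
  proof -
    have "d ^ Suc j \<le> d ^ i" using d Suc.prems by (intro power_increasing) auto
    hence "20 * a * d ^ Suc j \<le> 20 * a * d ^ i" using a1 by (intro mult_left_mono) auto
    also have "\<dots> \<le> n" using size by (simp add: a_def)
    finally show ?thesis using n0 by (simp add: y_def field_simps)
  qed
  have yd: "4 * y \<le> d * y" using y0 d by (intro mult_right_mono) auto
  have lowj: "1 / 2 \<le> (1 - \<delta>) ^ j"
  proof -
    have "(1 - \<delta>) ^ i \<le> (1 - \<delta>) ^ j" using \<delta> Suc.prems by (intro power_decreasing) auto
    thus ?thesis using low by linarith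
  qed
  have upl: "(1 + \<delta>) ^ l \<le> 2" if "l \<le> i" for l
  proof -
    have "(1 + \<delta>) ^ l \<le> (1 + \<delta>) ^ i" using \<delta> that by (intro power_increasing) auto
    thus ?thesis using up by linarith
  qed
  \<comment> \<open>Brings the exponent of the lower Chernoff bound to 3/32 of
    \<open>\<delta>\<^sup>2 * d * card R\<close>, above the 1/16 that is claimed.\<close>
  have Lpos: "a * (3 / 16) \<le> L * (1 - 5 * (d * y))"
  proof -
    have "a * (3 / 16) = a * 1 * (1 / 2) * (1 / 2) * (3 / 4)" by simp
    also have "\<dots> \<le> a * d ^ j * (1 - \<delta>) ^ j * (1 - 10 * y) * (1 - 5 * (d * y))"
      using a1 dj lowj dy yd by (intro mult_mono) (auto intro!: mult_nonneg_nonneg)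
    finally show ?thesis by (simp add: L_def)
  qed
  have growD: "L \<le> card (sph R j f) \<and> card (sph R j f) \<le> U j \<and> (\<forall>l\<le>j. card (sph R l f) \<le> U l)" if "grows \<delta> R j f" for f
    using that unfolding grows_def L_def U_def y_def a_def d_def dn by (auto simp: mult.assoc)
  let ?D = "\<lambda>f. (real n - card (rc R (Suc j) f)) * (1 - (1 - p) ^ card (rc R (Suc j) f - rc R j f))"
  have upper: "?D f \<le> d * U j" if "grows \<delta> R j f" for f
  proof -
    let ?s = "card (sph R j f)"
    have "R \<subseteq> rc R (Suc j) f" by (rule reach_source)
    moreover have "finite (rc R (Suc j) f)" by (rule finite_subset[OF reach_gr_subset[OF R(1)]]) simp
    ultimately have "card R \<le> card (rc R (Suc j) f)" by (intro card_mono)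
    hence "1 \<le> card (rc R (Suc j) f)" using a1 unfolding a_def by linarith
    hence 1: "real n - card (rc R (Suc j) f) \<le> real n - 1" by linarith
    have "1 + real ?s * (- p) \<le> (1 + (- p)) ^ ?s" using p01 by (intro Bernoulli_inequality) auto
    hence 2: "1 - (1 - p) ^ ?s \<le> p * ?s" by (simp add: mult.commute)
    have "?D f \<le> (real n - 1) * (p * ?s)"
      using 1 2 n p01 unfolding sph_def[symmetric] by (intro mult_mono) (auto simp: power_le_one)
    also have "\<dots> = d * ?s" by (simp add: d_def)
    also have "\<dots> \<le> d * U j" using growD[OF that] d by (intro mult_left_mono) auto
    finally show ?thesis .
  qed
  \<comment> \<open>Two losses: the ball occupies at most a fraction \<open>d * y\<close> of the
    vertices, and multiple hits cost a factor \<open>1 - 4 * (d * y)\<close>. Together they give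
    \<open>1 - 5 * (d * y)\<close>.\<close>
  have lower: "d * L * (1 - 5 * (d * y)) \<le> ?D f" if "grows \<delta> R j f" for f
  proof -
    let ?s = "real (card (sph R j f))"
    have "real (card (rc R (Suc j) f)) = (\<Sum>l<Suc j. real (card (sph R l f)))"
      unfolding card_rc[OF R(1)] by simp
    also have "\<dots> \<le> (\<Sum>l<Suc j. a * 2 * d ^ l)"
    proof (intro sum_mono)
      fix l assume l: "l \<in> {..<Suc j}"
      hence "real (card (sph R l f)) \<le> U l" using growD[OF that] by simp
      also have "\<dots> \<le> a * d ^ l * 2" unfolding U_def
        using a1 d l Suc.prems by (intro mult_left_mono upl) auto
      finally show "real (card (sph R l f)) \<le> a * 2 * d ^ l" by (simp add: mult_ac)
    qed
    also have "\<dots> = a * 2 * (\<Sum>l<Suc j. d ^ l)" by (simp only: sum_distrib_left)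
    also have "\<dots> \<le> a * 2 * (2 * d ^ j)" using a1 d by (intro mult_left_mono geometric_le) auto
    also have "\<dots> = 4 * y * n" using n0 by (simp add: y_def)
    also have "\<dots> \<le> d * y * n" by (rule mult_right_mono[OF yd]) simp
    finally have "real (card (rc R (Suc j) f)) \<le> d * y * n" .
    moreover have "real n * (1 - d * y) = real n - d * y * n" by (simp only: right_diff_distrib mult_1_right mult.commute)
    ultimately have 1: "n * (1 - d * y) \<le> real n - card (rc R (Suc j) f)" by linarith
    have ps: "p * ?s \<le> 4 * (d * y)"
    proof -
      have "?s \<le> U j" using growD[OF that] by (elim conjE)
      also have "\<dots> \<le> a * d ^ j * 2" unfolding U_def
        using upl[of j] Suc.prems a1 d by (intro mult_left_mono) simp_all
      finally have "?s \<le> a * d ^ j * 2" .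
      hence "p * ?s \<le> p * (a * d ^ j * 2)" using p01 by (intro mult_left_mono) auto
      also have "\<dots> = 2 * (p * n) * y" using n0 by (simp add: y_def)
      also have "\<dots> \<le> 2 * (2 * d) * y"
      proof -
        have "p * n \<le> p * (2 * (real n - 1))" using p01 n by (intro mult_left_mono) auto
        hence "p * n \<le> 2 * d" by (simp add: d_def algebra_simps)
        thus ?thesis using y0 by (intro mult_right_mono mult_left_mono) auto
      qed
      finally show ?thesis by simp
    qed
    have ps0: "0 \<le> p * ?s" using p01 by simp
    have "(1 - p) ^ card (sph R j f) \<le> exp (- (p * ?s))" using p01 by (intro one_minus_power_le) auto
    also have "\<dots> \<le> 1 - p * ?s + (p * ?s)\<^sup>2 / 2" by (rule exp_minus_upper[OF ps0])
    also have "\<dots> \<le> 1 - p * ?s + p * ?s * (4 * (d * y))"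
    proof -
      have "(p * ?s)\<^sup>2 \<le> p * ?s * (4 * (d * y))" unfolding power2_eq_square using ps ps0 by (intro mult_left_mono) auto
      moreover have "0 \<le> (p * ?s)\<^sup>2" by simp
      ultimately show ?thesis by linarith
    qed
    finally have 2: "p * ?s * (1 - 4 * (d * y)) \<le> 1 - (1 - p) ^ card (sph R j f)" by (simp add: algebra_simps)
    have "d * L * (1 - 5 * (d * y)) \<le> d * ?s * (1 - 5 * (d * y))"
      using growD[OF that] d dy by (intro mult_right_mono mult_left_mono) auto
    also have "\<dots> \<le> d * ?s * ((1 - d * y) * (1 - 4 * (d * y)))"
      using d y0 by (intro mult_left_mono) (auto simp: algebra_simps)
    also have "\<dots> \<le> (p * n) * ?s * ((1 - d * y) * (1 - 4 * (d * y)))"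
    proof -
      have "d \<le> p * n" using p01 by (simp add: d_def algebra_simps)
      thus ?thesis using dy by (intro mult_right_mono mult_nonneg_nonneg) auto
    qed
    also have "\<dots> = (n * (1 - d * y)) * (p * ?s * (1 - 4 * (d * y)))" by (simp add: algebra_simps)
    also have "\<dots> \<le> ?D f"
    proof (unfold sph_def[symmetric], rule mult_mono[OF 1 2])
      have "0 \<le> n * (1 - d * y)" using dy by (intro mult_nonneg_nonneg) auto
      thus "0 \<le> real n - card (rc R (Suc j) f)" using 1 by linarith
      show "0 \<le> p * ?s * (1 - 4 * (d * y))" using ps0 dy by (intro mult_nonneg_nonneg[OF ps0]) auto
    qed
    finally show ?thesis .
  qed
  let ?b = "exp (- (\<delta>\<^sup>2 * d * card R / 16))"
  have "pr (\<lambda>f. \<not> grows \<delta> R (Suc j) f) \<le> pr (\<lambda>f. \<not> grows \<delta> R j f \<or>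
      ((?D f \<le> d * U j \<and> (1 + \<delta>) * (d * U j) \<le> card (rc R (Suc (Suc j)) f - rc R (Suc j) f)) \<or>
      (d * L * (1 - 5 * (d * y)) \<le> ?D f \<and> card (rc R (Suc (Suc j)) f - rc R (Suc j) f) \<le> (1 - \<delta>) * (d * L * (1 - 5 * (d * y))))))"
  proof (rule pr_mono)
    fix f assume ng: "\<not> grows \<delta> R (Suc j) f"
    show "\<not> grows \<delta> R j f \<or>
      ((?D f \<le> d * U j \<and> (1 + \<delta>) * (d * U j) \<le> card (rc R (Suc (Suc j)) f - rc R (Suc j) f)) \<or>
      (d * L * (1 - 5 * (d * y)) \<le> ?D f \<and> card (rc R (Suc (Suc j)) f - rc R (Suc j) f) \<le> (1 - \<delta>) * (d * L * (1 - 5 * (d * y)))))"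
    proof (cases "grows \<delta> R j f")
      case True
      let ?t = "real (card (sph R (Suc j) f))"
      have "\<not> (a * d ^ Suc j * (1 - \<delta>) ^ Suc j * (1 - 10 * (d * y)) \<le> ?t \<and> ?t \<le> U (Suc j))"
      proof
        assume asm: "a * d ^ Suc j * (1 - \<delta>) ^ Suc j * (1 - 10 * (d * y)) \<le> ?t \<and> ?t \<le> U (Suc j)"
        have "10 * (d * y) = 10 * a * d ^ Suc j / n" by (simp add: y_def)
        hence "grows \<delta> R (Suc j) f"
          using asm True unfolding grows_def U_def dn d_def[symmetric] by (auto simp: le_Suc_eq a_def)
        thus False using ng by blast
      qed
      then consider "U (Suc j) < ?t" | "?t < a * d ^ Suc j * (1 - \<delta>) ^ Suc j * (1 - 10 * (d * y))" by linarith
      thus ?thesis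
      proof cases
        case 1
        have "(1 + \<delta>) * (d * U j) = U (Suc j)" by (simp add: U_def mult_ac)
        thus ?thesis using 1 upper[OF True] unfolding sph_def by linarith
      next
        case 2
        \<comment> \<open>As \<open>d \<ge> 4\<close>, the old loss \<open>10 * y\<close> is at most
          a quarter of the permitted \<open>10 * (d * y)\<close>, which leaves room for the new loss
          \<open>5 * (d * y)\<close>. This fixes the constant 10 in \<open>grows\<close>.\<close>
        have "1 - 10 * (d * y) \<le> (1 - 10 * y) * (1 - 5 * (d * y))"
        proof -
          have "(1 - 10 * y) * (1 - 5 * (d * y)) = 1 - 10 * y - 5 * (d * y) + 50 * y * (d * y)" by (simp add: algebra_simps)
          moreover have "0 \<le> 50 * y * (d * y)" using y0 d by simp
          ultimately show ?thesis using yd y0 by linarith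
        qed
        hence "a * d ^ Suc j * (1 - \<delta>) ^ Suc j * (1 - 10 * (d * y)) \<le> a * d ^ Suc j * (1 - \<delta>) ^ Suc j * ((1 - 10 * y) * (1 - 5 * (d * y)))"
          using a1 d \<delta> by (intro mult_left_mono) auto
        also have "\<dots> = (1 - \<delta>) * (d * L * (1 - 5 * (d * y)))" by (simp add: L_def mult_ac)
        finally show ?thesis using 2 lower[OF True] unfolding sph_def by linarith
      qed
    qed simp
  qed
  also have "\<dots> \<le> 2 * j * ?b + (?b + ?b)"
  proof (rule order.trans[OF pr_disj add_mono[OF _ order.trans[OF pr_disj add_mono]]])
    show "pr (\<lambda>f. \<not> grows \<delta> R j f) \<le> 2 * j * ?b" using Suc by simp
    have "pr (\<lambda>f. ?D f \<le> d * U j \<and> (1 + \<delta>) * (d * U j) \<le> card (rc R (Suc (Suc j)) f - rc R (Suc j) f))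
        \<le> exp (- \<delta>\<^sup>2 * (d * U j) / 4)" by (rule growth_upper[OF R(1) \<delta>])
    also have "\<dots> \<le> ?b"
    proof -
      have "a * 1 * 1 \<le> U j" unfolding U_def using a1 dj \<delta> by (intro mult_mono) auto
      hence "\<delta>\<^sup>2 * d * a \<le> \<delta>\<^sup>2 * d * U j" using d by (intro mult_left_mono) auto
      moreover have "0 \<le> \<delta>\<^sup>2 * d * a" using d a1 by simp
      ultimately have "\<delta>\<^sup>2 * d * a / 16 \<le> \<delta>\<^sup>2 * d * U j / 4" by linarith
      moreover have "- \<delta>\<^sup>2 * (d * U j) / 4 = - (\<delta>\<^sup>2 * d * U j / 4)" by simp
      ultimately show ?thesis unfolding a_def by (simp only: exp_le_cancel_iff neg_le_iff_le)
    qed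
    finally show "pr (\<lambda>f. ?D f \<le> d * U j \<and> (1 + \<delta>) * (d * U j) \<le> card (rc R (Suc (Suc j)) f - rc R (Suc j) f)) \<le> ?b" .
    have "pr (\<lambda>f. d * L * (1 - 5 * (d * y)) \<le> ?D f \<and> card (rc R (Suc (Suc j)) f - rc R (Suc j) f) \<le> (1 - \<delta>) * (d * L * (1 - 5 * (d * y))))
       \<le> exp (- \<delta>\<^sup>2 * (d * L * (1 - 5 * (d * y))) / 2)"
    proof (rule growth_lower[OF R(1) \<delta>])
      have "0 \<le> L * (1 - 5 * (d * y))" using Lpos a1 by linarith
      hence "0 \<le> d * (L * (1 - 5 * (d * y)))" using d by simp
      thus "0 \<le> d * L * (1 - 5 * (d * y))" by (simp add: mult.assoc)
    qed
    also have "\<dots> \<le> ?b"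
    proof -
      have "\<delta>\<^sup>2 * d * (a * (3 / 16)) \<le> \<delta>\<^sup>2 * d * (L * (1 - 5 * (d * y)))" using d Lpos by (intro mult_left_mono) auto
      moreover have "0 \<le> \<delta>\<^sup>2 * d * a" using d a1 by simp
      ultimately have "\<delta>\<^sup>2 * d * a / 16 \<le> \<delta>\<^sup>2 * d * (L * (1 - 5 * (d * y))) / 2" by linarith
      moreover have "- \<delta>\<^sup>2 * (d * L * (1 - 5 * (d * y))) / 2 = - (\<delta>\<^sup>2 * d * (L * (1 - 5 * (d * y))) / 2)" by simp
      ultimately show ?thesis unfolding a_def by (simp only: exp_le_cancel_iff neg_le_iff_le)
    qed
    finally show "pr (\<lambda>f. d * L * (1 - 5 * (d * y)) \<le> ?D f \<and> card (rc R (Suc (Suc j)) f - rc R (Suc j) f) \<le> (1 - \<delta>) * (d * L * (1 - 5 * (d * y)))) \<le> ?b" .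
  qed
  also have "\<dots> = 2 * real (Suc j) * ?b" by (simp add: algebra_simps)
  finally show ?case .
qed

text \<open>A single event for all sources: single vertices and the pairs of the upper bound,
  landmark sets and their exceptional subfamilies in the lower bounds.\<close>

definition all_grow :: "real \<Rightarrow> nat \<Rightarrow> (nat set \<Rightarrow> bool) \<Rightarrow> bool" where
  "all_grow \<delta> i f \<longleftrightarrow> (\<forall>R\<subseteq>{1..n}. R \<noteq> {} \<longrightarrow> 20 * card R * (p * (n - 1)) ^ i \<le> n \<longrightarrow> grows \<delta> R i f)"

text \<open>There are at most \<open>n ^ m\<close> sets of size \<open>m\<close>, and
  \<open>large\<close> makes each of them fail with probability at most
  \<open>2 * i * (1 / n ^ 4) ^ m\<close>.\<close>

lemma all_grow_whp:
  fixes \<delta> d :: real and i :: nat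
  defines "d \<equiv> p * (real n - 1)"
  assumes n: "2 \<le> n" and d: "4 \<le> d" and \<delta>: "0 \<le> \<delta>" "\<delta> \<le> 1"
    and up: "(1 + \<delta>) ^ i \<le> 2" and low: "1 / 2 \<le> (1 - \<delta>) ^ i" and i: "i \<le> n"
    and large: "4 * ln n \<le> \<delta>\<^sup>2 * d / 16"
  shows "pr (\<lambda>f. \<not> all_grow \<delta> i f) \<le> 2 / n"
proof -
  let ?P = "\<lambda>m. {R. R \<subseteq> {1..n} \<and> card R = m}"
  have dn: "real (n - 1) = real n - 1" using n by simp
  have bR: "pr (\<lambda>f. 20 * card R * d ^ i \<le> n \<and> \<not> grows \<delta> R i f) \<le> 2 * i * (1 / n ^ 4) ^ m"
    if "R \<in> ?P m" "m \<ge> 1" for R m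
  proof (cases "20 * card R * d ^ i \<le> n")
    case True
    have "pr (\<lambda>f. \<not> grows \<delta> R i f) \<le> 2 * i * exp (- (\<delta>\<^sup>2 * d * card R / 16))"
    proof -
      have "20 * card R * (p * (real n - 1)) ^ i \<le> n" using True by (simp add: d_def)
      moreover have "R \<noteq> {}" using that by auto
      ultimately show ?thesis using growth_set[OF _ _ n _ _ \<delta> up low order.refl, of R] that d unfolding d_def by auto
    qed
    also have "\<dots> \<le> 2 * i * (1 / n ^ 4) ^ m"
    proof (rule mult_left_mono)
      have "exp (- (\<delta>\<^sup>2 * d * card R / 16)) \<le> exp (- (4 * ln n * m))"
        using large that by (auto intro!: mult_right_mono dest: mult_right_mono[of _ _ "real m"])
      also have "\<dots> = exp (- (4 * ln n)) ^ m" by (simp add: exp_of_nat_mult[symmetric] mult.commute)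
      also have "exp (- (4 * ln n)) = 1 / real n ^ 4"
        using n by (simp add: exp_minus exp_of_nat_mult[of 4 "ln (real n)", simplified] inverse_eq_divide)
      finally show "exp (- (\<delta>\<^sup>2 * d * card R / 16)) \<le> (1 / n ^ 4) ^ m" by simp
    qed simp
    finally show ?thesis using True by simp
  qed (simp add: pr_ex)
  have bm: "pr (\<lambda>f. \<exists>R\<in>?P m. 20 * card R * d ^ i \<le> n \<and> \<not> grows \<delta> R i f) \<le> 2 * i * (1 / n ^ 3)"
    if m: "m \<in> {1..n}" for m
  proof -
    have fin: "finite (?P m)" by (rule finite_subset[of _ "Pow {1..n}"]) auto
    have "pr (\<lambda>f. \<exists>R\<in>?P m. 20 * card R * d ^ i \<le> n \<and> \<not> grows \<delta> R i f) \<le> card (?P m) * (2 * i * (1 / n ^ 4) ^ m)"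
      by (rule pr_union_card[OF fin bR]) (use m in auto)
    also have "card (?P m) = n choose m" using n_subsets[of "{1..n}" m] by simp
    also have "real (n choose m) * (2 * i * (1 / n ^ 4) ^ m) \<le> real (n ^ m) * (2 * i * (1 / n ^ 4) ^ m)"
      using m by (intro mult_right_mono) (auto intro: binomial_le_pow)
    also have "\<dots> = 2 * i * (1 / n ^ 3) ^ m"
    proof -
      have "real n * (1 / real n ^ 4) = 1 / real n ^ 3" using n by (simp add: field_simps eval_nat_numeral)
      hence "real n ^ m * (1 / real n ^ 4) ^ m = (1 / real n ^ 3) ^ m" by (simp only: power_mult_distrib[symmetric])
      moreover have "real (n ^ m) * (2 * i * (1 / n ^ 4) ^ m) = 2 * i * (real n ^ m * (1 / real n ^ 4) ^ m)" by simp
      ultimately show ?thesis by simp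
    qed
    also have "\<dots> \<le> 2 * i * (1 / n ^ 3) ^ 1"
      using m n by (intro mult_left_mono power_decreasing) (auto simp: field_simps)
    finally show ?thesis by simp
  qed
  have "pr (\<lambda>f. \<not> all_grow \<delta> i f) \<le> pr (\<lambda>f. \<exists>m\<in>{1..n}. \<exists>R\<in>?P m. 20 * card R * d ^ i \<le> n \<and> \<not> grows \<delta> R i f)"
  proof (rule pr_mono)
    fix f assume "\<not> all_grow \<delta> i f"
    then obtain R where R: "R \<subseteq> {1..n}" "R \<noteq> {}" "20 * card R * d ^ i \<le> n" "\<not> grows \<delta> R i f"
      unfolding all_grow_def d_def dn by blast
    have "1 \<le> card R" using R finite_subset[OF R(1)] by (simp add: Suc_leI card_gt_0_iff)
    moreover have "card R \<le> n" using card_mono[OF _ R(1)] by simp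
    ultimately show "\<exists>m\<in>{1..n}. \<exists>R\<in>?P m. 20 * card R * d ^ i \<le> n \<and> \<not> grows \<delta> R i f"
      using R by (intro bexI[of _ "card R"] bexI[of _ R]) auto
  qed
  also have "\<dots> \<le> card {1..n} * (2 * i * (1 / n ^ 3))" by (rule pr_union_card[OF _ bm]) auto
  also have "\<dots> = 2 * i / n\<^sup>2" using n by (simp add: field_simps eval_nat_numeral)
  also have "\<dots> \<le> 2 * n / n\<^sup>2" using i by (intro divide_right_mono) auto
  also have "\<dots> = 2 / n" using n by (simp add: power2_eq_square)
  finally show ?thesis .
qed

end

section \<open>Deterministic consequences of regular growth\<close>

lemma card_shared_part:
  fixes S :: "'r \<Rightarrow> 'v set"
  assumes R: "finite R" and S: "\<And>r. r \<in> R \<Longrightarrow> finite (S r)"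
  shows "card (shared_part R S) + card (\<Union>r\<in>R. S r) \<le> (\<Sum>r\<in>R. card (S r))"
proof -
  let ?Z = "\<Union>r\<in>R. S r" and ?Y = "shared_part R S"
  have fZ: "finite ?Z" using R S by auto
  have YZ: "?Y \<subseteq> ?Z" by (rule shared_part_subset)
  have "(\<Sum>r\<in>R. card (S r)) = (\<Sum>r\<in>R. \<Sum>x\<in>?Z. of_bool (x \<in> S r))"
  proof (intro sum.cong refl)
    fix r assume "r \<in> R"
    hence "?Z \<inter> {x. x \<in> S r} = S r" by auto
    thus "card (S r) = (\<Sum>x\<in>?Z. of_bool (x \<in> S r))" using fZ by simp
  qed
  also have "\<dots> = (\<Sum>x\<in>?Z. \<Sum>r\<in>R. of_bool (x \<in> S r))" by (rule sum.swap)
  also have "\<dots> = (\<Sum>x\<in>?Z. card {r\<in>R. x \<in> S r})" using R by (simp add: Int_def)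
  finally have eq: "(\<Sum>r\<in>R. card (S r)) = \<dots>" .
  have "card ?Y + card ?Z = (\<Sum>x\<in>?Z. of_bool (x \<in> ?Y) + 1)"
  proof -
    have "(\<Sum>x\<in>?Z. of_bool (x \<in> ?Y)) = card ?Y" using fZ YZ by (simp add: Int_absorb1)
    moreover have "(\<Sum>x\<in>?Z. (1::nat)) = card ?Z" by simp
    ultimately show ?thesis by (simp only: sum.distrib)
  qed
  \<comment> \<open>A shared point lies in at least two of the sets, any other point of the union in
    at least one.\<close>
  also have "\<dots> \<le> (\<Sum>x\<in>?Z. card {r\<in>R. x \<in> S r})"
  proof (intro sum_mono)
    fix x assume x: "x \<in> ?Z"
    then obtain r where r: "r \<in> R" "x \<in> S r" by blast
    show "of_bool (x \<in> ?Y) + 1 \<le> card {r\<in>R. x \<in> S r}"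
    proof (cases "x \<in> ?Y")
      case True
      hence "x \<notin> own_part R S r" using r(1) by (auto simp: shared_part_def)
      then obtain r' where r': "r' \<in> R" "r' \<noteq> r" "x \<in> S r'" using r by (auto simp: own_part_def)
      have "card {r, r'} \<le> card {r\<in>R. x \<in> S r}" using R r r' by (intro card_mono) auto
      thus ?thesis using True r' by simp
    next
      case False
      have "card {r} \<le> card {r\<in>R. x \<in> S r}" using R r by (intro card_mono) auto
      thus ?thesis using False by simp
    qed
  qed
  finally show ?thesis using eq by simp
qed

lemma card_own_part:
  assumes R: "finite R" "r \<in> R" and S: "\<And>r. r \<in> R \<Longrightarrow> finite (S r)"
  shows "card (\<Union>r\<in>R. S r) \<le> card (own_part R S r) + (\<Sum>r'\<in>R - {r}. card (S r'))"
proof -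
  have eq: "(\<Union>r\<in>R. S r) \<subseteq> own_part R S r \<union> (\<Union>r'\<in>R - {r}. S r')" by (auto simp: own_part_def)
  have f: "finite (own_part R S r)" using S[OF R(2)] own_part_subset by (rule finite_subset[rotated])
  have "card (\<Union>r\<in>R. S r) \<le> card (own_part R S r \<union> (\<Union>r'\<in>R - {r}. S r'))"
    using eq f R S by (intro card_mono) auto
  also have "\<dots> \<le> card (own_part R S r) + card (\<Union>r'\<in>R - {r}. S r')" by (rule card_Un_le)
  also have "card (\<Union>r'\<in>R - {r}. S r') \<le> (\<Sum>r'\<in>R - {r}. card (S r'))"
    using R by (intro card_UN_le) auto
  finally show ?thesis by simp
qed

context gnp begin

lemma finite_rc: "R \<subseteq> {1..n} \<Longrightarrow> finite (rc R k f)"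
  by (rule finite_subset[OF reach_gr_subset]) auto

lemma finite_sph: "R \<subseteq> {1..n} \<Longrightarrow> finite (sph R k f)"
  unfolding sph_def by (intro finite_Diff finite_rc)

lemma finite_newr: "R \<subseteq> {1..n} \<Longrightarrow> r \<in> R \<Longrightarrow> finite (newr R k f r)"
  unfolding newr_def by (intro finite_Diff finite_rc) auto

lemma newr_subset_sph: "r \<in> R \<Longrightarrow> newr R k f r \<subseteq> sph {r} k f"
  unfolding newr_def sph_def using rc_member_mono by blast

lemma UN_newr_sph: "(\<Union>r\<in>R. newr R k f r) = sph R k f"
  unfolding UN_newr sph_def ..

lemma sph_UN_subset: "sph R k f \<subseteq> (\<Union>r\<in>R. sph {r} k f)"
  by (subst UN_newr_sph[symmetric]) (rule UN_mono[OF order.refl newr_subset_sph])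

end

text \<open>Fixes one outcome \<open>f\<close> with regular growth, so that all statements inside
  are deterministic. \<open>e\<close> is the relative error accumulated over \<open>i\<close> steps
  and \<open>x\<close> the fraction of the vertices in one sphere.\<close>

locale grown = gnp +
  fixes \<delta> e x d :: real and i :: nat and f :: "nat set \<Rightarrow> bool"
  assumes d_def: "d = p * (real n - 1)" and e_def: "e = i * \<delta>" and x_def: "x = d ^ i / n"
    and n2: "2 \<le> n" and d4: "4 \<le> d" and \<delta>01: "0 \<le> \<delta>" "\<delta> \<le> 1" and e_le: "e \<le> 1 / 2"
    and x_le: "40 * x \<le> 1" and grow: "all_grow \<delta> i f"
begin

lemma e0: "0 \<le> e" using \<delta>01 by (simp add: e_def)

lemma x0: "0 \<le> x" using d4 by (simp add: x_def)

lemma di: "d ^ i = x * n" using n2 by (simp add: x_def)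

lemma di1: "1 \<le> d ^ l" using d4 by simp

lemma up: "l \<le> i \<Longrightarrow> (1 + \<delta>) ^ l \<le> 1 + 2 * e"
proof -
  assume l: "l \<le> i"
  have "(1 + \<delta>) ^ l \<le> (1 + \<delta>) ^ i" using \<delta>01 l by (intro power_increasing) auto
  also have "\<dots> \<le> exp \<delta> ^ i" using \<delta>01 by (intro power_mono) (auto simp: exp_ge_add_one_self)
  also have "\<dots> = exp e" by (simp add: exp_of_nat_mult[symmetric] e_def)
  also have "\<dots> \<le> 1 + e + e\<^sup>2" using e_le e0 by (intro exp_bound) auto
  also have "\<dots> \<le> 1 + 2 * e"
  proof -
    have "e * e \<le> e * 1" using e0 e_le by (intro mult_left_mono) auto
    thus ?thesis by (simp add: power2_eq_square)
  qed
  finally show ?thesis .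
qed

lemma low: "1 - e \<le> (1 - \<delta>) ^ i"
  using Bernoulli_inequality[of "- \<delta>" i] \<delta>01 by (simp add: e_def)

lemma grows_set:
  assumes "R \<subseteq> {1..n}" "R \<noteq> {}" "20 * card R * x \<le> 1" shows "grows \<delta> R i f"
proof -
  have dn: "p * real (n - 1) = d" using n2 by (simp add: d_def)
  have "real (20 * card R) * d ^ i = (real (20 * card R) * x) * n" by (simp add: di)
  also have "\<dots> \<le> 1 * real n" by (rule mult_right_mono[OF assms(3)]) simp
  finally have "real (20 * card R) * d ^ i \<le> n" by simp
  thus ?thesis using grow assms(1,2) unfolding all_grow_def dn by blast
qed

lemma sph_single_le:
  assumes "v \<in> {1..n}" "l \<le> i" shows "card (sph {v} l f) \<le> d ^ l * (1 + 2 * e)"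
proof -
  have dn: "p * real (n - 1) = d" using n2 by (simp add: d_def)
  have "grows \<delta> {v} i f" using assms x_le by (intro grows_set) auto
  hence "card (sph {v} l f) \<le> d ^ l * (1 + \<delta>) ^ l" using assms(2) unfolding grows_def dn by simp
  also have "\<dots> \<le> d ^ l * (1 + 2 * e)" using d4 up[OF assms(2)] by (intro mult_left_mono) auto
  finally show ?thesis .
qed

text \<open>Summed over single spheres, because \<open>all_grow\<close> is silent about large sets,
  and landmark sets are large when \<open>c\<close> tends to infinity.\<close>

lemma sph_le:
  assumes "R \<subseteq> {1..n}" "l \<le> i" shows "card (sph R l f) \<le> card R * (d ^ l * (1 + 2 * e))"
proof -
  have fR: "finite R" using finite_subset[OF assms(1)] by simp
  have "card (sph R l f) \<le> card (\<Union>r\<in>R. sph {r} l f)"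
    using fR finite_sph[of "{_}" l f] assms(1) by (intro card_mono sph_UN_subset) (auto intro!: finite_sph)
  also have "\<dots> \<le> (\<Sum>r\<in>R. card (sph {r} l f))" by (rule card_UN_le[OF fR])
  finally have "real (card (sph R l f)) \<le> (\<Sum>r\<in>R. real (card (sph {r} l f)))"
    unfolding of_nat_sum[symmetric] of_nat_le_iff .
  also have "\<dots> \<le> (\<Sum>r\<in>R. d ^ l * (1 + 2 * e))" by (intro sum_mono sph_single_le) (use assms in auto)
  finally show ?thesis by simp
qed

lemma rc_le:
  assumes R: "R \<subseteq> {1..n}" and k: "k \<le> i" shows "card (rc R (Suc k) f) \<le> 4 * card R * d ^ k"
proof -
  have "real (card (rc R (Suc k) f)) = (\<Sum>l<Suc k. real (card (sph R l f)))"
    unfolding card_rc[OF R] by simp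
  also have "\<dots> \<le> (\<Sum>l<Suc k. card R * 2 * d ^ l)"
  proof (intro sum_mono)
    fix l assume "l \<in> {..<Suc k}"
    hence "card (sph R l f) \<le> card R * (d ^ l * (1 + 2 * e))" using k by (intro sph_le[OF R]) auto
    also have "\<dots> \<le> card R * (d ^ l * 2)" using e_le d4 by (intro mult_left_mono) auto
    finally show "card (sph R l f) \<le> card R * 2 * d ^ l" by simp
  qed
  also have "\<dots> = card R * 2 * (\<Sum>l<Suc k. d ^ l)" by (simp only: sum_distrib_left)
  also have "\<dots> \<le> card R * 2 * (2 * d ^ k)" using d4 by (intro mult_left_mono geometric_le) auto
  finally show ?thesis by simp
qed

lemma sph_ge:
  assumes R: "R \<subseteq> {1..n}" and sz: "20 * card R * x \<le> 1"
  shows "card R * d ^ i * (1 - e - 10 * card R * x) \<le> card (sph R i f)"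
proof (cases "R = {}")
  case False
  have dn: "p * real (n - 1) = d" using n2 by (simp add: d_def)
  let ?y = "10 * real (card R) * x"
  have y: "0 \<le> ?y" "?y \<le> 1 / 2" using sz x0 by auto
  have "1 - e - ?y \<le> (1 - e) * (1 - ?y)" using e0 y by (simp add: algebra_simps)
  also have "\<dots> \<le> (1 - \<delta>) ^ i * (1 - ?y)" using low y by (intro mult_right_mono) auto
  finally have "card R * d ^ i * (1 - e - ?y) \<le> card R * d ^ i * ((1 - \<delta>) ^ i * (1 - ?y))"
    using d4 by (intro mult_left_mono) auto
  also have "\<dots> \<le> card (sph R i f)"
    using grows_set[OF R False sz] unfolding grows_def dn by (auto simp: x_def mult.assoc)
  finally show ?thesis by simp
qed simp

text \<open>The joint sphere of the pair has nearly \<open>2 * d ^ i\<close> vertices and a single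
  one hardly more than \<open>d ^ i\<close>, so the two spheres are almost disjoint. The errors
  combine to \<open>4 * e + 40 * x\<close> for the private parts and \<open>6 * e + 40 * x\<close>
  for the overlap.\<close>

lemma pair_sizes:
  assumes uv: "u \<in> {1..n}" "v \<in> {1..n}" "u \<noteq> v"
  defines "A \<equiv> rc {u} (Suc i) f - rc {v} (Suc i) f - rc {u} i f"
    and "T \<equiv> rc {u} (Suc i) f \<inter> rc {v} (Suc i) f - rc {u} i f - rc {v} i f"
  shows "d ^ i * (1 - 4 * e - 40 * x) \<le> card A" "card A \<le> d ^ i * (1 + 2 * e)"
    "card T \<le> d ^ i * (6 * e + 40 * x)"
proof -
  have s: "card (sph {w} i f) \<le> d ^ i * (1 + 2 * e)" if "w \<in> {u, v}" for w
    using uv that by (intro sph_single_le) auto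
  have UN: "rc {u, v} j f = rc {u} j f \<union> rc {v} j f" for j
    by (subst reach_UN) simp
  have fA: "finite A" "finite T" unfolding A_def T_def using uv by (auto intro!: finite_Diff finite_Int finite_rc)
  have Au: "A \<union> T \<subseteq> sph {u} i f" "A \<inter> T = {}" unfolding A_def T_def sph_def by blast+
  hence AT: "card A + card T \<le> card (sph {u} i f)"
    using fA uv by (subst card_Un_disjoint[symmetric]) (auto intro!: card_mono finite_sph)
  thus 2: "card A \<le> d ^ i * (1 + 2 * e)" using s[OF insertI1] by linarith
  have "sph {u, v} i f \<subseteq> A \<union> sph {v} i f" unfolding sph_def UN A_def by blast
  hence "card (sph {u, v} i f) \<le> card (A \<union> sph {v} i f)" using fA uv by (intro card_mono) (auto intro!: finite_sph)
  also have "\<dots> \<le> card A + card (sph {v} i f)" by (rule card_Un_le)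
  finally have "real (card (sph {u, v} i f)) \<le> card A + d ^ i * (1 + 2 * e)" using s[OF insertI2[OF insertI1]] by linarith
  moreover have "card {u, v} * d ^ i * (1 - e - 10 * card {u, v} * x) \<le> card (sph {u, v} i f)"
    by (rule sph_ge) (use uv x_le in auto)
  ultimately show 1: "d ^ i * (1 - 4 * e - 40 * x) \<le> card A" using uv by (simp add: algebra_simps)
  have "real (card T) \<le> d ^ i * (1 + 2 * e) - d ^ i * (1 - 4 * e - 40 * x)" using AT s[OF insertI1] 1 by linarith
  thus "card T \<le> d ^ i * (6 * e + 40 * x)" by (simp add: algebra_simps)
qed

text \<open>An upper bound on each sphere and a lower bound on the joint sphere leave little for
  overlaps: in \<open>y\<close>, \<open>2 * e\<close> comes from the single spheres and
  \<open>e + 10 * card R * x\<close> from the joint one.\<close>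

lemma family_sizes:
  fixes y :: real
  assumes R: "R \<subseteq> {1..n}" and sz: "20 * card R * x \<le> 1"
  defines "y \<equiv> 3 * e + 10 * card R * x"
  shows "card (shared_part R (newr R i f)) \<le> card R * d ^ i * y"
    and "r \<in> R \<Longrightarrow> d ^ i * (1 - card R * y) \<le> card (own_part R (newr R i f) r)"
    and "r \<in> R \<Longrightarrow> card (own_part R (newr R i f) r) \<le> d ^ i * (1 + 2 * e)"
proof -
  let ?S = "newr R i f"
  have fR: "finite R" using finite_subset[OF R] by simp
  have fS: "finite (?S r)" if "r \<in> R" for r using finite_newr[OF R that] .
  have S: "card (?S r) \<le> d ^ i * (1 + 2 * e)" if "r \<in> R" for r
  proof -
    have "card (?S r) \<le> card (sph {r} i f)"
      using R that by (intro card_mono newr_subset_sph finite_sph) auto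
    also have "real (card (sph {r} i f)) \<le> d ^ i * (1 + 2 * e)" using R that by (intro sph_single_le) auto
    finally show ?thesis by simp
  qed
  have U: "card R * d ^ i * (1 - e - 10 * card R * x) \<le> card (\<Union>r\<in>R. ?S r)"
    unfolding UN_newr_sph by (rule sph_ge[OF R sz])
  have sum: "(\<Sum>r\<in>Q. real (card (?S r))) \<le> card Q * (d ^ i * (1 + 2 * e))" if "Q \<subseteq> R" for Q
    using sum_bounded_above[of Q "\<lambda>r. real (card (?S r))" "d ^ i * (1 + 2 * e)"] S that by auto
  have "real (card (shared_part R ?S)) + card (\<Union>r\<in>R. ?S r) \<le> (\<Sum>r\<in>R. real (card (?S r)))"
    unfolding of_nat_sum[symmetric] of_nat_add[symmetric] of_nat_le_iff by (rule card_shared_part[OF fR fS])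
  thus "card (shared_part R ?S) \<le> card R * d ^ i * y"
    using U sum[of R] by (simp add: y_def algebra_simps)
  assume r: "r \<in> R"
  have "card (own_part R ?S r) \<le> card (?S r)" by (rule card_mono[OF fS[OF r] own_part_subset[of R ?S r]])
  thus "card (own_part R ?S r) \<le> d ^ i * (1 + 2 * e)" using S[OF r] by linarith
  have "real (card (\<Union>r\<in>R. ?S r)) \<le> card (own_part R ?S r) + (\<Sum>r'\<in>R - {r}. real (card (?S r')))"
    unfolding of_nat_sum[symmetric] of_nat_add[symmetric] of_nat_le_iff by (rule card_own_part[OF fR r fS])
  also have "\<dots> \<le> card (own_part R ?S r) + (real (card R) - 1) * (d ^ i * (1 + 2 * e))"
  proof -
    have "1 \<le> card R" using card_mono[OF fR, of "{r}"] r by simp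
    hence "real (card (R - {r})) = real (card R) - 1" using r fR by (simp add: of_nat_diff)
    thus ?thesis using sum[of "R - {r}"] by simp
  qed
  finally have "card R * d ^ i * (1 - e - 10 * card R * x) - (real (card R) - 1) * (d ^ i * (1 + 2 * e)) \<le> card (own_part R ?S r)"
    using U by linarith
  moreover have "card R * d ^ i * (1 - e - 10 * card R * x) - (real (card R) - 1) * (d ^ i * (1 + 2 * e)) =
      d ^ i * (1 - card R * y) + d ^ i * 2 * e" by (simp add: y_def algebra_simps)
  moreover have "0 \<le> d ^ i * 2 * e" using d4 e0 by simp
  ultimately show "d ^ i * (1 - card R * y) \<le> card (own_part R ?S r)" by linarith
qed

text \<open>A vertex of the sphere around \<open>B\<close> is either within distance less than
  \<open>i\<close> of some landmark of \<open>R\<close> or in the new part of a landmark of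
  \<open>B\<close>. Both are scarce, so \<open>B\<close> cannot be large.\<close>

lemma few_small:
  fixes t :: real
  assumes R: "R \<subseteq> {1..n}" and B: "B \<subseteq> R" "\<And>r. r \<in> B \<Longrightarrow> card (newr R i f r) \<le> t" and sz: "20 * card B * x \<le> 1"
  shows "card B * d ^ i * (1 - e - 10 * card B * x) \<le> card (rc R i f) + card B * t"
proof -
  have fR: "finite R" using finite_subset[OF R] by simp
  have fB: "finite B" "B \<subseteq> {1..n}" using finite_subset[OF B(1) fR] B(1) R by auto
  have "sph B i f \<subseteq> rc R i f \<union> (\<Union>r\<in>B. newr R i f r)"
    by (subst UN_newr_sph[symmetric]) (unfold newr_def, blast)
  hence "card (sph B i f) \<le> card (rc R i f \<union> (\<Union>r\<in>B. newr R i f r))"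
    using fB B(1) by (intro card_mono) (auto intro!: finite_rc finite_newr R)
  also have "\<dots> \<le> card (rc R i f) + card (\<Union>r\<in>B. newr R i f r)" by (rule card_Un_le)
  also have "card (\<Union>r\<in>B. newr R i f r) \<le> (\<Sum>r\<in>B. card (newr R i f r))" by (rule card_UN_le[OF fB(1)])
  finally have "real (card (sph B i f)) \<le> card (rc R i f) + (\<Sum>r\<in>B. real (card (newr R i f r)))"
    unfolding of_nat_sum[symmetric] of_nat_add[symmetric] of_nat_le_iff by linarith
  also have "(\<Sum>r\<in>B. real (card (newr R i f r))) \<le> card B * t"
    using sum_bounded_above[of B "\<lambda>r. real (card (newr R i f r))" t] B(2) by simp
  finally have "card (sph B i f) \<le> card (rc R i f) + card B * t" by simp
  thus ?thesis using sph_ge[OF fB(2) sz] by linarith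
qed

end

section \<open>From many separating vertices to an upper bound; the diameter event\<close>

lemma beta_le_of_separators:
  fixes y :: real
  assumes y: "0 < y" "y < 1" and n: "2 \<le> n"
    and sep: "\<And>u v. u \<in> {1..n} \<Longrightarrow> v \<in> {1..n} \<Longrightarrow> u \<noteq> v \<Longrightarrow>
      y * n \<le> card {w \<in> {1..n}. graph_dist E u w \<noteq> graph_dist E v w}"
  shows "beta n E \<le> 2 * ln n / (- ln (1 - y)) + 1"
proof -
  \<comment> \<open>The least integer above the quotient, so that
    \<open>n\<^sup>2 * (1 - y) ^ k < 1\<close> holds strictly.\<close>
  define k where "k = nat \<lfloor>2 * ln n / (- ln (1 - y))\<rfloor> + 1"
  let ?P = "{(u, v). u \<in> {1..n} \<and> v \<in> {1..n} \<and> u \<noteq> v}"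
  let ?S = "\<lambda>(u, v). {w \<in> {1..n}. graph_dist E u w \<noteq> graph_dist E v w}"
  have ly: "0 < - ln (1 - y)" using y by simp
  have q0: "0 \<le> 2 * ln n / (- ln (1 - y))" using n ly by (intro divide_nonneg_pos) auto
  have k: "2 * ln n / (- ln (1 - y)) < k" "k \<le> 2 * ln n / (- ln (1 - y)) + 1"
    using q0 unfolding k_def by linarith+
  have "2 * ln n < k * (- ln (1 - y))" by (rule pos_divide_less_eq[OF ly, THEN iffD1, OF k(1)])
  hence "ln ((1 - y) ^ k) < ln (1 / (real n)\<^sup>2)" using y n by (simp add: ln_realpow ln_div)
  hence lt: "(1 - y) ^ k < 1 / (real n)\<^sup>2" using y n by (subst (asm) ln_less_cancel_iff) auto
  have fP: "finite ?P" by (rule finite_subset[of _ "{1..n} \<times> {1..n}"]) auto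
  have "card ?P \<le> card ({1..n} \<times> {1..n})" by (rule card_mono) auto
  hence "real (card ?P) \<le> (real n)\<^sup>2" by (simp add: power2_eq_square flip: of_nat_mult)
  hence "card ?P * (1 - y) ^ k \<le> (real n)\<^sup>2 * (1 - y) ^ k" using y by (intro mult_right_mono) auto
  also have "\<dots> < (real n)\<^sup>2 * (1 / (real n)\<^sup>2)" using lt n by (intro mult_strict_left_mono) auto
  finally have "card ?P * (1 - y) ^ k < 1" using n by simp
  hence "\<exists>R\<subseteq>{1..n}. card R \<le> k \<and> (\<forall>q\<in>?P. R \<inter> ?S q \<noteq> {})"
    using n sep y fP by (intro exists_small_hitting_set[where y = y]) auto
  then obtain R where R: "R \<subseteq> {1..n}" "card R \<le> k" "\<And>q. q \<in> ?P \<Longrightarrow> R \<inter> ?S q \<noteq> {}" by blast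
  have "resolving_set {1..n} E R"
    unfolding resolving_set_iff using R(1) R(3)[of "(_, _)"] by fastforce
  hence "metric_dimension {1..n} E \<le> k" using R(2) by (rule metric_dimension_le)
  thus ?thesis using k(2) unfolding beta_def by linarith
qed

context gnp begin

text \<open>\<open>H\<close> is a purely numerical condition on all part sizes that regular growth
  permits. It separates the probability from the asymptotics, where it is discharged.\<close>

lemma separators_prob:
  fixes \<delta> e x d m \<eta> D :: real and i :: nat
  assumes par: "d = p * (real n - 1)" "e = i * \<delta>" "x = d ^ i / n" "2 \<le> n" "4 \<le> d" "0 \<le> \<delta>" "\<delta> \<le> 1" "e \<le> 1 / 2" "40 * x \<le> 1"
    and uv: "u \<in> {1..n}" "v \<in> {1..n}" "u \<noteq> v" and \<eta>: "0 \<le> \<eta>" "\<eta> \<le> 1" and m: "0 \<le> m"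
    and H: "\<And>A B T :: nat. d ^ i * (1 - 4 * e - 40 * x) \<le> A \<Longrightarrow> A \<le> d ^ i * (1 + 2 * e) \<Longrightarrow>
      d ^ i * (1 - 4 * e - 40 * x) \<le> B \<Longrightarrow> B \<le> d ^ i * (1 + 2 * e) \<Longrightarrow> T \<le> d ^ i * (6 * e + 40 * x) \<Longrightarrow>
      m \<le> n * (1 - 8 * x) * ((1 - p) ^ T * ((1 - p) ^ A * (1 - (1 - p) ^ B) + (1 - p) ^ B * (1 - (1 - p) ^ A)))"
  shows "pr (\<lambda>f. all_grow \<delta> i f \<and> card (separators f u v) \<le> 2 * (d ^ i * (1 - 4 * e - 40 * x)) + ((1 - \<eta>) * m - \<eta> * D))
     \<le> exp (- \<eta>\<^sup>2 * (m / 2 + D))"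
proof (rule order.trans[OF pr_mono separators_lower[OF uv(1,2) \<eta> m, where k = i]])
  fix f assume asm: "all_grow \<delta> i f \<and> card (separators f u v) \<le> 2 * (d ^ i * (1 - 4 * e - 40 * x)) + ((1 - \<eta>) * m - \<eta> * D)"
  interpret grown n p \<delta> e x d i f by unfold_locales (use par asm in auto)
  let ?A = "rc {u} (Suc i) f - rc {v} (Suc i) f - rc {u} i f"
  let ?B = "rc {v} (Suc i) f - rc {u} (Suc i) f - rc {v} i f"
  let ?T = "rc {u} (Suc i) f \<inter> rc {v} (Suc i) f - rc {u} i f - rc {v} i f"
  let ?h = "(1 - p) ^ card ?T * ((1 - p) ^ card ?A * (1 - (1 - p) ^ card ?B) + (1 - p) ^ card ?B * (1 - (1 - p) ^ card ?A))"
  have A: "d ^ i * (1 - 4 * e - 40 * x) \<le> card ?A" "card ?A \<le> d ^ i * (1 + 2 * e)" "card ?T \<le> d ^ i * (6 * e + 40 * x)"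
    by (rule pair_sizes[OF uv])+
  have B: "d ^ i * (1 - 4 * e - 40 * x) \<le> card ?B" "card ?B \<le> d ^ i * (1 + 2 * e)"
    by (rule pair_sizes[OF uv(2,1) uv(3)[symmetric]])+
  have h0: "0 \<le> ?h" using p01 by (intro mult_nonneg_nonneg add_nonneg_nonneg) (auto simp: power_le_one)
  have uvn: "{u, v} \<subseteq> {1..n}" using uv by auto
  have "real (card (rc {u, v} (Suc i) f)) \<le> 4 * card {u, v} * d ^ i" by (rule rc_le[OF uvn]) simp
  also have "\<dots> = 8 * x * n" using uv di by simp
  finally have O: "n * (1 - 8 * x) \<le> real n - card (rc {u, v} (Suc i) f)" by (simp add: algebra_simps)
  have "card ({1..n} - rc {u, v} (Suc i) f) = n - card (rc {u, v} (Suc i) f)"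
    using reach_gr_subset[OF uvn] finite_rc[OF uvn] by (simp add: card_Diff_subset)
  hence "n * (1 - 8 * x) \<le> card ({1..n} - rc {u, v} (Suc i) f)" using O by linarith
  hence "n * (1 - 8 * x) * ?h \<le> card ({1..n} - rc {u, v} (Suc i) f) * ?h" using h0 by (rule mult_right_mono)
  hence "m \<le> card ({1..n} - rc {u, v} (Suc i) f) * ?h" using H[OF A(1,2) B A(3)] by linarith
  moreover have "card (separators f u v) \<le> card ?A + card ?B + ((1 - \<eta>) * m - \<eta> * D)"
    using asm A(1) B(1) by linarith
  ultimately show "m \<le> card ({1..n} - rc {u, v} (Suc i) f) * ?h \<and>
    card (separators f u v) \<le> card ?A + card ?B + ((1 - \<eta>) * m - \<eta> * D)" by simp
qed

text \<open>A union bound over at most \<open>n\<^sup>2\<close> pairs, each failing with probability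
  at most \<open>1 / n ^ 3\<close>, on top of the growth event.\<close>

lemma beta_upper_prob:
  fixes \<delta> e x d m \<eta> D y b :: real and i :: nat
  assumes par: "d = p * (real n - 1)" "e = i * \<delta>" "x = d ^ i / n" "2 \<le> n" "4 \<le> d" "0 \<le> \<delta>" "\<delta> \<le> 1" "e \<le> 1 / 2" "40 * x \<le> 1"
    and \<eta>: "0 \<le> \<eta>" "\<eta> \<le> 1" and m: "0 \<le> m"
    and H: "\<And>A B T :: nat. d ^ i * (1 - 4 * e - 40 * x) \<le> A \<Longrightarrow> A \<le> d ^ i * (1 + 2 * e) \<Longrightarrow>
      d ^ i * (1 - 4 * e - 40 * x) \<le> B \<Longrightarrow> B \<le> d ^ i * (1 + 2 * e) \<Longrightarrow> T \<le> d ^ i * (6 * e + 40 * x) \<Longrightarrow>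
      m \<le> n * (1 - 8 * x) * ((1 - p) ^ T * ((1 - p) ^ A * (1 - (1 - p) ^ B) + (1 - p) ^ B * (1 - (1 - p) ^ A)))"
    and y: "0 < y" "y < 1" "y * n \<le> 2 * (d ^ i * (1 - 4 * e - 40 * x)) + ((1 - \<eta>) * m - \<eta> * D)"
    and b: "exp (- \<eta>\<^sup>2 * (m / 2 + D)) \<le> 1 / n ^ 3" and G: "pr (\<lambda>f. \<not> all_grow \<delta> i f) \<le> 2 / n"
  shows "pr (\<lambda>f. \<not> beta n (gr n f) \<le> 2 * ln n / (- ln (1 - y)) + 1) \<le> 3 / n"
proof -
  let ?P = "{(u, v). u \<in> {1..n} \<and> v \<in> {1..n} \<and> u \<noteq> v}"
  have fP: "finite ?P" by (rule finite_subset[of _ "{1..n} \<times> {1..n}"]) auto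
  have "card ?P \<le> card ({1..n} \<times> {1..n})" by (rule card_mono) auto
  hence cP: "real (card ?P) \<le> (real n)\<^sup>2" by (simp add: power2_eq_square flip: of_nat_mult)
  let ?bad = "\<lambda>q f. all_grow \<delta> i f \<and> card (separators f (fst q) (snd q)) \<le> 2 * (d ^ i * (1 - 4 * e - 40 * x)) + ((1 - \<eta>) * m - \<eta> * D)"
  have "pr (\<lambda>f. \<not> beta n (gr n f) \<le> 2 * ln n / (- ln (1 - y)) + 1) \<le> pr (\<lambda>f. \<not> all_grow \<delta> i f \<or> (\<exists>q\<in>?P. ?bad q f))"
  proof (rule pr_mono)
    fix f assume nb: "\<not> beta n (gr n f) \<le> 2 * ln n / (- ln (1 - y)) + 1"
    show "\<not> all_grow \<delta> i f \<or> (\<exists>q\<in>?P. ?bad q f)"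
    proof (rule ccontr)
      assume no: "\<not> (\<not> all_grow \<delta> i f \<or> (\<exists>q\<in>?P. ?bad q f))"
      have "y * n \<le> card {w \<in> {1..n}. graph_dist (gr n f) u w \<noteq> graph_dist (gr n f) v w}"
        if "u \<in> {1..n}" "v \<in> {1..n}" "u \<noteq> v" for u v
      proof -
        have "(u, v) \<in> ?P" using that by simp
        hence "\<not> ?bad (u, v) f" "all_grow \<delta> i f" using no by blast+
        thus ?thesis using y(3) unfolding separators_def by simp
      qed
      from beta_le_of_separators[OF y(1,2) par(4) this] show False using nb by blast
    qed
  qed
  also have "\<dots> \<le> 2 / n + (real n)\<^sup>2 * (1 / n ^ 3)"
  proof (rule order.trans[OF pr_disj add_mono[OF G]])
    have "pr (\<lambda>f. \<exists>q\<in>?P. ?bad q f) \<le> card ?P * (1 / n ^ 3)"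
    proof (rule pr_union_card[OF fP])
      fix q assume "q \<in> ?P"
      hence q: "fst q \<in> {1..n}" "snd q \<in> {1..n}" "fst q \<noteq> snd q" by auto
      show "pr (?bad q) \<le> 1 / n ^ 3"
        by (rule order.trans[OF separators_prob[OF par q \<eta> m H] b])
    qed
    also have "\<dots> \<le> (real n)\<^sup>2 * (1 / n ^ 3)" using cP by (intro mult_right_mono) auto
    finally show "pr (\<lambda>f. \<exists>q\<in>?P. ?bad q f) \<le> (real n)\<^sup>2 * (1 / n ^ 3)" .
  qed
  also have "\<dots> = 3 / n" using par(4) by (simp add: field_simps eval_nat_numeral)
  finally show ?thesis .
qed

text \<open>The mean number of vertices linking a sphere to \<open>v\<close> is about
  \<open>d * (1 - exp (- p * d ^ i))\<close>. Counting only half of the outside vertices and a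
  quarter of the sphere absorbs all error terms.\<close>

lemma diameter_prob:
  fixes \<delta> e x d b :: real and i :: nat
  assumes par: "d = p * (real n - 1)" "e = i * \<delta>" "x = d ^ i / n" "2 \<le> n" "4 \<le> d" "0 \<le> \<delta>" "\<delta> \<le> 1" "e \<le> 1 / 2" "40 * x \<le> 1"
    and e4: "e \<le> 1 / 4" and m: "3 * ln n \<le> d / 4 * (1 - exp (- (p * d ^ i / 4)))"
    and G: "pr (\<lambda>f. \<not> all_grow \<delta> i f) \<le> 2 / n"
  shows "pr (\<lambda>f. \<not> (all_grow \<delta> i f \<and> (\<forall>u\<in>{1..n}. \<forall>v\<in>{1..n}. v \<in> rc {u} (Suc (Suc (Suc i))) f))) \<le> 3 / n"
proof -
  let ?P = "{1..n} \<times> {1..n}"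
  let ?bad = "\<lambda>q f. all_grow \<delta> i f \<and> snd q \<notin> rc {fst q} (Suc (Suc (Suc i))) f"
  have "pr (\<lambda>f. \<not> (all_grow \<delta> i f \<and> (\<forall>u\<in>{1..n}. \<forall>v\<in>{1..n}. v \<in> rc {u} (Suc (Suc (Suc i))) f)))
      \<le> pr (\<lambda>f. \<not> all_grow \<delta> i f \<or> (\<exists>q\<in>?P. ?bad q f))"
    by (rule pr_mono) auto
  also have "\<dots> \<le> 2 / n + (real n)\<^sup>2 * (1 / n ^ 3)"
  proof (rule order.trans[OF pr_disj add_mono[OF G]])
    have "pr (\<lambda>f. \<exists>q\<in>?P. ?bad q f) \<le> card ?P * (1 / n ^ 3)"
    proof (rule pr_union_card)
      fix q assume "q \<in> ?P"
      then obtain u v where q: "q = (u, v)" "u \<in> {1..n}" "v \<in> {1..n}" by auto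
      have "pr (?bad q) \<le> exp (- (3 * ln n))"
      proof (rule order.trans[OF pr_mono diameter_bound[OF q(2,3), where m = "3 * ln n" and k = i]])
        fix f assume asm: "?bad q f"
        interpret grown n p \<delta> e x d i f by unfold_locales (use par asm in auto)
        have un: "{u} \<subseteq> {1..n}" using q by simp
        have "real (card (rc {u} (Suc i) f)) \<le> 4 * card {u} * d ^ i" by (rule rc_le[OF un]) simp
        also have "\<dots> = 4 * x * n" using di by simp
        also have "\<dots> \<le> 1 / 10 * n" using x_le by (intro mult_right_mono) auto
        finally have O': "real (card (rc {u} (Suc i) f)) \<le> 1 / 10 * n" .
        have n10: "\<not> n < 10"
        proof
          assume "n < 10"
          have "1 \<le> d ^ i" by (rule di1)
          hence "1 / real n \<le> x" using n2 by (simp add: x_def divide_right_mono)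
          hence "40 / real n \<le> 1" using x_le by simp
          thus False using \<open>n < 10\<close> n2 by (simp add: field_simps)
        qed
        have O: "(real n - 1) / 2 \<le> real n - 1 - card (rc {u} (Suc i) f)" proof -
          have "10 \<le> real n" using n10 by simp
          thus ?thesis using O' by (simp add: field_simps)
        qed
        have "card {u} * d ^ i * (1 - e - 10 * card {u} * x) \<le> card (sph {u} i f)"
          by (rule sph_ge[OF un]) (use x_le in simp)
        moreover have "d ^ i * (1 / 4) \<le> d ^ i * (1 - e - 10 * x)" using di1[of i] e4 x_le by (intro mult_left_mono) auto
        ultimately have s: "d ^ i / 4 \<le> card (sph {u} i f)" by simp
        have "(1 - p) ^ card (sph {u} i f) \<le> exp (- (p * card (sph {u} i f)))" by (rule one_minus_power_le[OF p01])
        also have "\<dots> \<le> exp (- (p * d ^ i / 4))" using mult_left_mono[OF s p01(1)] by simp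
        finally have h: "1 - exp (- (p * d ^ i / 4)) \<le> 1 - (1 - p) ^ card (sph {u} i f)" by simp
        have h0: "0 \<le> 1 - exp (- (p * d ^ i / 4))" using p01 d4 by simp
        have "3 * ln n \<le> d / 4 * (1 - exp (- (p * d ^ i / 4)))" by (rule m)
        also have "\<dots> \<le> d / 2 * (1 - exp (- (p * d ^ i / 4)))" using h0 d4 by (intro mult_right_mono) auto
        also have "\<dots> = (real n - 1) / 2 * (p * (1 - exp (- (p * d ^ i / 4))))" by (simp add: d_def)
        also have "\<dots> \<le> (real n - 1 - card (rc {u} (Suc i) f)) * (p * (1 - (1 - p) ^ card (sph {u} i f)))"
        proof (rule mult_mono)
          show "p * (1 - exp (- (p * d ^ i / 4))) \<le> p * (1 - (1 - p) ^ card (sph {u} i f))"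
            by (rule mult_left_mono[OF h p01(1)])
          show "0 \<le> p * (1 - exp (- (p * d ^ i / 4)))" using h0 p01 by simp
        qed (use O n10 par(4) in auto)
        finally show "3 * ln n \<le> (real n - 1 - card (rc {u} (Suc i) f)) * (p * (1 - (1 - p) ^ card (rc {u} (Suc i) f - rc {u} i f)))
           \<and> v \<notin> rc {u} (Suc (Suc (Suc i))) f" using asm q unfolding sph_def by simp
      qed
      also have "exp (- (3 * ln n)) = 1 / n ^ 3"
        using par(4) by (simp add: exp_minus exp_of_nat_mult[of 3 "ln (real n)", simplified] inverse_eq_divide)
      finally show "pr (?bad q) \<le> 1 / n ^ 3" .
    qed simp
    also have "\<dots> = (real n)\<^sup>2 * (1 / n ^ 3)" by (simp add: power2_eq_square)
    finally show "pr (\<lambda>f. \<exists>q\<in>?P. ?bad q f) \<le> (real n)\<^sup>2 * (1 / n ^ 3)" .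
  qed
  also have "\<dots> = 3 / n" using par(4) by (simp add: field_simps eval_nat_numeral)
  finally show ?thesis .
qed

end

section \<open>Sequences of random graphs and their parameters\<close>

lemma aas_boundI:
  assumes p: "\<And>n. 0 \<le> p n \<and> p n \<le> 1"
    and b: "\<forall>\<^sub>F n in sequentially. bernoulli_bits.pr (vertex_pairs n) (p n) (\<lambda>f. \<not> Q n (gr n f)) \<le> b n" "b \<longlonglongrightarrow> 0"
  shows "aas p Q"
  unfolding aas_def
proof (rule tendsto_sandwich[where h = "\<lambda>_. 1"])
  show "(\<lambda>n. 1 - b n) \<longlonglongrightarrow> 1" using tendsto_diff[OF tendsto_const[of 1] b(2)] by simp
  show "\<forall>\<^sub>F n in sequentially. 1 - b n \<le> measure_pmf.prob (random_graph n (p n)) {E. Q n E}"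
    using b(1)
  proof eventually_elim
    case (elim n)
    interpret gnp n "p n" by unfold_locales (use p in auto)
    show ?case using elim unfolding prob_random_graph pr_not by simp
  qed
qed (auto intro!: always_eventually)

locale gnp_seq =
  fixes p d c :: "nat \<Rightarrow> real" and i :: "nat \<Rightarrow> nat"
  assumes p_bounds: "\<And>n. 0 \<le> p n \<and> p n \<le> 1"
    and d_eq: "\<And>n. d n = p n * (real n - 1)"
    and d_lower: "(\<lambda>n. ln (real n) ^ 5) \<in> o(d)"
    and i_largest: "largest_exponent d i"
    and c_eq: "\<And>n. c n = d n ^ (i n + 1) / real n"
begin

definition "x n = d n ^ i n / real n"
text \<open>Chosen so that \<open>\<delta>\<^sup>2 * d = 100 * ln n\<close>, which pays for the
  union bound over all source sets; the order of magnitude cannot be reduced in that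
  argument.\<close>

definition "\<delta> n = 10 * sqrt (ln (real n) / d n)"
definition "e n = real (i n) * \<delta> n"

abbreviation "P n \<equiv> bernoulli_bits.pr (vertex_pairs n) (p n)"

lemma gnp: "gnp (p n)"
  by unfold_locales (use p_bounds in auto)

lemma d_nonneg: "1 \<le> n \<Longrightarrow> 0 \<le> d n"
  using p_bounds by (simp add: d_eq)

lemma d_large: "\<forall>\<^sub>F n in sequentially. K * ln (real n) ^ 5 \<le> d n"
proof -
  define K' where "K' = max K 1"
  have "\<forall>\<^sub>F n in sequentially. norm (ln (real n) ^ 5) \<le> 1 / K' * norm (d n)"
    by (rule landau_o.smallD[OF d_lower]) (simp add: K'_def)
  moreover have "\<forall>\<^sub>F n in sequentially. (1::nat) \<le> n" by (rule eventually_ge_at_top)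
  ultimately show ?thesis
  proof eventually_elim
    case (elim n)
    have K': "1 \<le> K'" "K \<le> K'" by (auto simp: K'_def)
    have l: "0 \<le> ln (real n) ^ 5" using elim by simp
    have "ln (real n) ^ 5 \<le> 1 / K' * d n" using elim l d_nonneg[of n] by simp
    hence "K' * ln (real n) ^ 5 \<le> d n" using K' by (simp add: field_simps)
    moreover have "K * ln (real n) ^ 5 \<le> K' * ln (real n) ^ 5" using K' l by (intro mult_right_mono) auto
    ultimately show ?case by linarith
  qed
qed

lemma d_const: "\<forall>\<^sub>F n in sequentially. K \<le> d n"
proof -
  have "\<forall>\<^sub>F n in sequentially. K \<le> ln (real n) ^ 5" by real_asymp
  with d_large[of 1] show ?thesis by eventually_elim linarith
qed

lemma d_pow: "j \<le> 5 \<Longrightarrow> \<forall>\<^sub>F n in sequentially. K * ln (real n) ^ j \<le> d n"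
proof -
  assume j: "j \<le> 5"
  have "\<forall>\<^sub>F n in sequentially. 1 \<le> ln (real n)" by real_asymp
  with d_large[of "max K 0"] show ?thesis
  proof eventually_elim
    case (elim n)
    have "K * ln (real n) ^ j \<le> max K 0 * ln (real n) ^ 5"
      using elim j by (intro mult_mono power_increasing) auto
    thus ?case using elim by linarith
  qed
qed

lemma x_lim: "(\<lambda>n. x n) \<longlonglongrightarrow> 0"
  using i_largest unfolding largest_exponent_def x_def by (intro smalloD_tendsto) auto

lemma x_small: "0 < \<epsilon> \<Longrightarrow> \<forall>\<^sub>F n in sequentially. x n \<le> \<epsilon>"
  using order_tendstoD(2)[OF x_lim, of \<epsilon>] by (auto elim: eventually_mono)

lemma c_x: "c n = x n * d n"
  by (simp add: c_eq x_def)

text \<open>If \<open>c\<close> came arbitrarily close to 0 along a subsequence, the exponent could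
  be raised by one there and \<open>d ^ j\<close> would still be \<open>o(n)\<close>, against the
  choice of \<open>i\<close>. The bound keeps the miss probability \<open>exp (- c)\<close> away
  from 1.\<close>

lemma c_low: "\<exists>c0>0. \<forall>\<^sub>F n in sequentially. c0 \<le> c n"
proof (rule ccontr)
  assume no: "\<not> ?thesis"
  have "\<exists>n\<ge>k. c n < 1 / (real k + 1)" for k
  proof -
    have "\<not> (\<forall>\<^sub>F n in sequentially. 1 / (real k + 1) \<le> c n)" using no by (metis add_nonneg_pos of_nat_0_le_iff zero_less_divide_1_iff zero_less_one)
    thus ?thesis unfolding eventually_sequentially by (metis linorder_not_le)
  qed
  then obtain g where g: "\<And>k. k \<le> g k" "\<And>k. c (g k) < 1 / (real k + 1)" by metis
  \<comment> \<open>The competing exponent, raised along the subsequence only; there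
    \<open>d ^ j / n\<close> equals \<open>c\<close>.\<close>
  define j where "j n = (if n \<in> range g then i n + 1 else i n)" for n
  have "(\<lambda>n. d n ^ j n / real n) \<longlonglongrightarrow> 0"
  proof (rule LIMSEQ_I)
    fix r :: real assume r: "0 < r"
    obtain k where k: "1 / (real k + 1) < r" using r nat_approx_posE by (metis of_nat_Suc add.commute)
    obtain N1 where N1: "\<And>n. n \<ge> N1 \<Longrightarrow> norm (x n - 0) < r" using LIMSEQ_D[OF x_lim r] by blast
    \<comment> \<open>From \<open>N\<close> on, a member of the subsequence has an index greater
      than \<open>k\<close>, so its \<open>c\<close> is below \<open>r\<close>.\<close>
    define N where "N = max 1 (max N1 (Suc (Max (g ` {..k}))))"
    have "norm (d n ^ j n / real n - 0) < r" if n: "n \<ge> N" for n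
    proof (cases "n \<in> range g")
      case True
      then obtain l where l: "n = g l" by blast
      have "k < l"
      proof (rule ccontr)
        assume "\<not> k < l"
        hence "g l \<le> Max (g ` {..k})" by (intro Max_ge) auto
        thus False using n l unfolding N_def by simp
      qed
      hence "1 / (real l + 1) \<le> 1 / (real k + 1)" by (simp add: frac_le)
      hence "c n < r" unfolding l using g(2)[of l] k by linarith
      moreover have "d n ^ j n / real n = c n" using True by (simp add: j_def c_eq)
      moreover have "0 \<le> c n" using d_nonneg[of n] n unfolding N_def c_eq by simp
      ultimately show ?thesis by simp
    next
      case False
      thus ?thesis using N1[of n] n by (simp add: j_def N_def x_def)
    qed
    thus "\<exists>no. \<forall>n\<ge>no. norm (d n ^ j n / real n - 0) < r" by blast
  qed
  hence "(\<lambda>n. d n ^ j n) \<in> o(\<lambda>n. real n)"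
    by (intro smalloI_tendsto) (auto intro: eventually_mono[OF eventually_gt_at_top[of 0]])
  hence "\<forall>\<^sub>F n in sequentially. j n \<le> i n" using i_largest unfolding largest_exponent_def by blast
  then obtain N where N: "\<And>n. n \<ge> N \<Longrightarrow> j n \<le> i n" unfolding eventually_sequentially by blast
  have "j (g N) \<le> i (g N)" by (rule N[OF g(1)])
  thus False by (simp add: j_def)
qed

lemma i_le_ln: "\<forall>\<^sub>F n in sequentially. real (i n) \<le> ln (real n)"
proof -
  have "\<forall>\<^sub>F n in sequentially. (1::nat) \<le> n" by (rule eventually_ge_at_top)
  with d_const[of "exp 1"] x_small[OF zero_less_one] show ?thesis
  proof eventually_elim
    case (elim n)
    have "exp (real (i n)) = exp 1 ^ i n" by (simp flip: exp_of_nat_mult)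
    also have "\<dots> \<le> d n ^ i n" using elim by (intro power_mono) auto
    also have "\<dots> \<le> real n" using elim by (simp add: divide_le_eq x_def)
    finally show ?case using elim by (simp add: ln_ge_iff)
  qed
qed

lemma \<delta>_nonneg: "1 \<le> n \<Longrightarrow> 0 \<le> \<delta> n"
  using d_nonneg by (simp add: \<delta>_def)

lemma e_nonneg: "1 \<le> n \<Longrightarrow> 0 \<le> e n"
  using \<delta>_nonneg by (simp add: e_def)

text \<open>The place where the fifth power of the logarithm is consumed: with
  \<open>i n \<le> ln n\<close> the product is at most
  \<open>10 * sqrt (ln n ^ 5 / d n)\<close>.\<close>

lemma e_ln_small:
  assumes "0 < \<epsilon>" shows "\<forall>\<^sub>F n in sequentially. e n * ln (real n) \<le> \<epsilon>"
proof -
  have "\<forall>\<^sub>F n in sequentially. 1 \<le> ln (real n)" by real_asymp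
  with d_large[of "(10 / \<epsilon>)\<^sup>2"] i_le_ln show ?thesis
  proof eventually_elim
    case (elim n)
    let ?L = "ln (real n)"
    have d: "0 < d n"
    proof -
      have "0 < (10 / \<epsilon>)\<^sup>2 * ?L ^ 5" using elim assms by simp
      thus ?thesis using elim by linarith
    qed
    have "e n * ?L \<le> ?L * \<delta> n * ?L"
      using elim d unfolding e_def by (intro mult_right_mono) (auto simp: \<delta>_def)
    also have "\<dots> = 10 * (?L\<^sup>2 * sqrt (?L / d n))" by (simp add: \<delta>_def power2_eq_square)
    also have "?L\<^sup>2 * sqrt (?L / d n) = sqrt (?L ^ 5 / d n)"
    proof -
      have "?L ^ 5 / d n = (?L\<^sup>2)\<^sup>2 * (?L / d n)" by (simp add: eval_nat_numeral)
      thus ?thesis by (simp only: real_sqrt_mult real_sqrt_abs) simp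
    qed
    also have "sqrt (?L ^ 5 / d n) \<le> sqrt ((\<epsilon> / 10)\<^sup>2)"
    proof (rule real_sqrt_le_mono)
      have "?L ^ 5 \<le> (\<epsilon> / 10)\<^sup>2 * d n" using elim(1) assms by (simp add: field_simps power2_eq_square)
      thus "?L ^ 5 / d n \<le> (\<epsilon> / 10)\<^sup>2" using d by (simp add: divide_le_eq)
    qed
    also have "\<dots> = \<epsilon> / 10" using assms by simp
    finally show ?case by simp
  qed
qed

lemma e_small: "0 < \<epsilon> \<Longrightarrow> \<forall>\<^sub>F n in sequentially. e n \<le> \<epsilon>"
proof -
  assume \<epsilon>: "0 < \<epsilon>"
  have "\<forall>\<^sub>F n in sequentially. (1::nat) \<le> n" by (rule eventually_ge_at_top)
  moreover have "\<forall>\<^sub>F n in sequentially. 1 \<le> ln (real n)" by real_asymp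
  ultimately show ?thesis using e_ln_small[OF \<epsilon>]
  proof eventually_elim
    case (elim n)
    have "e n * 1 \<le> e n * ln (real n)" using elim e_nonneg[of n] by (intro mult_left_mono) auto
    thus ?case using elim by simp
  qed
qed

text \<open>Bundles the conditions under which the estimates for fixed \<open>n\<close> apply; all
  of them hold from some \<open>n\<close> on.\<close>

definition "ok n \<longleftrightarrow> 3 \<le> n \<and> 4 \<le> d n \<and> 0 \<le> \<delta> n \<and> \<delta> n \<le> 1 \<and> 0 \<le> e n \<and> e n \<le> 1 / 4 \<and> 40 * x n \<le> 1 \<and> 0 < x n \<and>
  1 \<le> ln (real n) \<and> P n (\<lambda>f. \<not> gnp.all_grow n (p n) (\<delta> n) (i n) f) \<le> 2 / real n"

lemma eventually_ok: "\<forall>\<^sub>F n in sequentially. ok n"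
proof -
  have "\<forall>\<^sub>F n in sequentially. (3::nat) \<le> n" by (rule eventually_ge_at_top)
  moreover have "\<forall>\<^sub>F n in sequentially. 1 \<le> ln (real n)" by real_asymp
  moreover have "\<forall>\<^sub>F n in sequentially. ln (real n) \<le> real n" by real_asymp
  ultimately show ?thesis
    using d_const[of 4] x_small[of "1 / 40", simplified] e_small[of "1 / 4", simplified] i_le_ln d_pow[of 1 100, simplified]
  proof eventually_elim
    case (elim n)
    interpret gnp n "p n" by (rule gnp)
    have "ln (real n) / d n \<le> 1 / 100" using elim by (simp add: divide_le_eq)
    hence "sqrt (ln (real n) / d n) \<le> sqrt ((1 / 10)\<^sup>2)" by (intro real_sqrt_le_mono) (simp add: power2_eq_square)
    hence \<delta>: "0 \<le> \<delta> n" "\<delta> n \<le> 1" using elim unfolding \<delta>_def by auto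
    have e0: "0 \<le> e n" using \<delta> by (simp add: e_def)
    have "(1 + \<delta> n) ^ i n \<le> exp (\<delta> n) ^ i n" using \<delta> by (intro power_mono) (auto simp: exp_ge_add_one_self)
    also have "\<dots> = exp (e n)" by (simp add: exp_of_nat_mult[symmetric] e_def)
    also have "\<dots> \<le> 1 + e n + (e n)\<^sup>2" using elim e0 by (intro exp_bound) auto
    also have "\<dots> \<le> 2"
    proof -
      have "(e n)\<^sup>2 \<le> (1 / 4)\<^sup>2" using elim e0 by (intro power_mono) auto
      thus ?thesis using elim by (simp add: power2_eq_square)
    qed
    finally have up: "(1 + \<delta> n) ^ i n \<le> 2" .
    have "1 + real (i n) * (- \<delta> n) \<le> (1 + (- \<delta> n)) ^ i n" using \<delta> by (intro Bernoulli_inequality) auto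
    hence low: "1 / 2 \<le> (1 - \<delta> n) ^ i n" using elim by (simp add: e_def)
    have "(\<delta> n)\<^sup>2 * d n = 100 * ln (real n)" using elim by (simp add: \<delta>_def power_mult_distrib)
    hence "pr (\<lambda>f. \<not> all_grow (\<delta> n) (i n) f) \<le> 2 / real n"
      using elim \<delta> up low by (intro all_grow_whp) (auto simp: d_eq)
    moreover have "0 < x n" using elim by (simp add: x_def)
    ultimately show ?case using elim \<delta> e0 unfolding ok_def by auto
  qed
qed

lemma okD:
  assumes "ok n"
  shows "d n = p n * (real n - 1)" "e n = real (i n) * \<delta> n" "x n = d n ^ i n / real n" "2 \<le> n" "4 \<le> d n" "0 \<le> \<delta> n" "\<delta> n \<le> 1" "e n \<le> 1 / 2" "40 * x n \<le> 1"
    "P n (\<lambda>f. \<not> gnp.all_grow n (p n) (\<delta> n) (i n) f) \<le> 2 / real n" "0 \<le> e n" "e n \<le> 1 / 4" "0 < x n" "1 \<le> ln (real n)" "3 \<le> n"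
  using assms unfolding ok_def by (auto simp: d_eq e_def x_def)

lemma inverse_n_lim: "(\<lambda>n. K / real n) \<longlonglongrightarrow> 0"
  by real_asymp

text \<open>\<open>a n\<close> stands for the probability that a typical vertex misses a typical sphere of radius
  \<open>i n\<close>: it is \<open>exp (- c n)\<close> in the sparse case, \<open>1 - p n\<close> in the dense one.\<close>

lemma upper_aas:
  fixes a :: "nat \<Rightarrow> real" and \<epsilon> :: real
  assumes a: "\<And>n. 0 \<le> a n \<and> a n \<le> 1" and \<epsilon>: "0 < \<epsilon>" "\<epsilon> \<le> 1 / 2"
    and big: "\<And>K. \<forall>\<^sub>F n in sequentially. K * ln (real n) \<le> d n ^ i n + real n * (a n * (1 - a n))"
    and approx: "\<And>\<eta>. 0 < \<eta> \<Longrightarrow> \<forall>\<^sub>F n in sequentially. real n * a n \<le> \<eta> * d n ^ i n \<or>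
      ((\<forall>s :: nat. s \<le> d n ^ i n * (1 + 2 * e n) \<longrightarrow> (1 - \<eta>) * a n \<le> (1 - p n) ^ s) \<and>
       (\<forall>s :: nat. d n ^ i n * (1 - 4 * e n - 40 * x n) \<le> s \<longrightarrow> (1 - \<eta>) * (1 - a n) \<le> 1 - (1 - p n) ^ s) \<and>
       (\<forall>s :: nat. s \<le> d n ^ i n * (6 * e n + 40 * x n) \<longrightarrow> 1 - \<eta> \<le> (1 - p n) ^ s))"
  defines "y \<equiv> \<lambda>n. (1 - \<epsilon>) * (2 * (x n + a n * (1 - a n)))"
  shows "aas p (\<lambda>n E. beta n E \<le> 2 * ln (real n) / (- ln (1 - y n)) + 1)"
proof (rule aas_boundI[OF p_bounds _ inverse_n_lim[of 3]])
  define \<eta> where "\<eta> = \<epsilon> / 8"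
  have \<eta>: "0 < \<eta>" "\<eta> \<le> 1 / 16" using \<epsilon> by (auto simp: \<eta>_def)
  have \<epsilon>16: "0 < \<epsilon> / 16" and \<epsilon>160: "0 < \<epsilon> / 160" using \<epsilon> by auto
  show "\<forall>\<^sub>F n in sequentially. P n (\<lambda>f. \<not> beta n (gr n f) \<le> 2 * ln (real n) / (- ln (1 - y n)) + 1) \<le> 3 / real n"
    using eventually_ok approx[OF \<eta>(1)] big[of "6 / \<eta>\<^sup>2"] e_small[OF \<epsilon>16] x_small[OF \<epsilon>160] 
  proof eventually_elim
    case (elim n)
    interpret gnp n "p n" by (rule gnp)
    note ok = okD[OF elim(1)]
    note ok' = okD(4-15)[OF elim(1)]
    \<comment> \<open>Up to errors a pair has \<open>2 * X\<close> separating vertices in its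
      spheres and \<open>2 * Y\<close> among the other vertices.\<close>
    define X where "X = d n ^ i n"
    define Y where "Y = real n * (a n * (1 - a n))"
    have e: "e n \<le> \<epsilon> / 16" and x: "x n \<le> \<epsilon> / 160" using elim \<epsilon> by auto
    have n0: "0 < real n" using ok' by simp
    have X: "0 < X" "X = x n * n" using ok' unfolding X_def x_def by auto
    have Y: "0 \<le> Y" using a[of n] unfolding Y_def by simp
    \<comment> \<open>The constant makes \<open>\<eta>\<^sup>2 * (m / 2 + X)\<close> at least
      \<open>3 * ln n\<close>, that is, a failure probability of at most \<open>1 / n ^ 3\<close>
      per pair.\<close>
    have KL: "6 / \<eta>\<^sup>2 * ln n \<le> X + Y" using elim unfolding X_def Y_def by simp
    have aa: "a n * (1 - a n) \<le> 1 / 4"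
    proof -
      have "0 \<le> (a n - 1 / 2)\<^sup>2" by simp
      thus ?thesis by (simp add: power2_eq_square algebra_simps)
    qed
    have aa0: "0 \<le> a n * (1 - a n)" using a[of n] by simp
    have s0: "0 < x n + a n * (1 - a n)" using ok(13) aa0 by linarith
    have y0: "0 < y n" unfolding y_def using \<epsilon> s0 by (intro mult_pos_pos) auto
    have y1: "y n < 1"
    proof -
      have "y n \<le> 1 * (2 * (x n + a n * (1 - a n)))" unfolding y_def using \<epsilon> s0 by (intro mult_right_mono) auto
      also have "x n + a n * (1 - a n) \<le> 1 / 40 + 1 / 4" by (rule add_mono[OF _ aa]) (rule mult_left_le_imp_le[of 40], use ok(9) in simp_all)
      finally show ?thesis by simp
    qed
    have yn: "y n * n = (1 - \<epsilon>) * (2 * (X + Y))" 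
    proof -
      have "(x n + a n * (1 - a n)) * n = X + Y" unfolding X(2) Y_def by (simp only: distrib_left mult.commute[of _ "real n"])
      moreover have "y n * n = (1 - \<epsilon>) * (2 * ((x n + a n * (1 - a n)) * n))" unfolding y_def by (simp only: mult.assoc)
      ultimately show ?thesis by (simp only:)
    qed
    \<comment> \<open>Both cases end this way: \<open>m\<close> bounds the mean number of separating
      vertices outside the spheres, and the Chernoff slack \<open>D = X\<close> is taken out of the
      \<open>2 * X\<close> certain ones.\<close>
    have main: ?case if m: "0 \<le> m" and H: "\<And>A B T :: nat. d n ^ i n * (1 - 4 * e n - 40 * x n) \<le> A \<Longrightarrow> A \<le> d n ^ i n * (1 + 2 * e n) \<Longrightarrow>
        d n ^ i n * (1 - 4 * e n - 40 * x n) \<le> B \<Longrightarrow> B \<le> d n ^ i n * (1 + 2 * e n) \<Longrightarrow> T \<le> d n ^ i n * (6 * e n + 40 * x n) \<Longrightarrow>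
        m \<le> n * (1 - 8 * x n) * ((1 - p n) ^ T * ((1 - p n) ^ A * (1 - (1 - p n) ^ B) + (1 - p n) ^ B * (1 - (1 - p n) ^ A)))"
      and s: "(1 - \<epsilon>) * (2 * (X + Y)) \<le> 2 * (X * (1 - 4 * e n - 40 * x n)) + ((1 - \<eta>) * m - \<eta> * X)"
      and b: "(X + Y) / 2 \<le> m / 2 + X" for m
    proof (rule beta_upper_prob[OF ok(1-9) _ _ m H y0 y1 _ _ ok(10), where \<eta> = \<eta> and D = X])
      show "y n * n \<le> 2 * (d n ^ i n * (1 - 4 * e n - 40 * x n)) + ((1 - \<eta>) * m - \<eta> * X)"
        unfolding yn using s by (simp only: X_def)
      have "3 * ln n = \<eta>\<^sup>2 * (6 / \<eta>\<^sup>2 * ln n / 2)" using \<eta> by simp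
      also have "\<dots> \<le> \<eta>\<^sup>2 * (m / 2 + X)" using KL b by (intro mult_left_mono) auto
      finally have "exp (- \<eta>\<^sup>2 * (m / 2 + X)) \<le> exp (- (3 * ln n))" by simp
      also have "\<dots> = 1 / n ^ 3"
        using ok' by (simp add: exp_minus exp_of_nat_mult[of 3 "ln (real n)", simplified] inverse_eq_divide)
      finally show "exp (- \<eta>\<^sup>2 * (m / 2 + X)) \<le> 1 / n ^ 3" by simp
    qed (use \<eta> in auto)
    from elim(2) show ?case
    proof
      \<comment> \<open>The vertices outside the spheres are negligible, so \<open>m = 0\<close> is
        enough and the slack alone provides the exponent.\<close>
      assume na: "real n * a n \<le> \<eta> * d n ^ i n"
      have "Y \<le> real n * a n" unfolding Y_def using a[of n] by (intro mult_left_mono) (auto intro: mult_left_le)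
      hence YX: "Y \<le> \<eta> * X" using na by (simp add: X_def)
      show ?case
      proof (rule main[of 0])
        have "(1 - \<epsilon>) * (2 * (X + Y)) \<le> (1 - \<epsilon>) * (2 * (X + \<eta> * X))" using YX \<epsilon> by (intro mult_left_mono) auto
        also have "\<dots> = X * (2 * ((1 - \<epsilon>) * (1 + \<eta>)))" by (simp add: algebra_simps)
        also have "\<dots> \<le> X * (2 * (1 - 4 * e n - 40 * x n) - \<eta>)"
        proof (rule mult_left_mono)
          have "(1 - \<epsilon>) * (1 + \<eta>) \<le> 1 - \<epsilon> + \<eta>" using \<epsilon> \<eta> by (simp add: algebra_simps)
          moreover have "2 * z \<le> 2 * (1 - 4 * e n - 40 * x n) - \<eta>" if "z \<le> 1 - \<epsilon> + \<eta>" for z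
            using that e x \<epsilon> unfolding \<eta>_def by (simp add: algebra_simps)
          ultimately show "2 * ((1 - \<epsilon>) * (1 + \<eta>)) \<le> 2 * (1 - 4 * e n - 40 * x n) - \<eta>" by blast
        qed (use X in simp)
        finally show "(1 - \<epsilon>) * (2 * (X + Y)) \<le> 2 * (X * (1 - 4 * e n - 40 * x n)) + ((1 - \<eta>) * 0 - \<eta> * X)"
          by (simp add: algebra_simps)
        have "\<eta> * X \<le> 1 * X" using \<eta> X by (intro mult_right_mono) auto
        thus "(X + Y) / 2 \<le> 0 / 2 + X" using YX by simp
        show "0 \<le> n * (1 - 8 * x n) * ((1 - p n) ^ T * ((1 - p n) ^ A * (1 - (1 - p n) ^ B) + (1 - p n) ^ B * (1 - (1 - p n) ^ A)))" for A B T :: nat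
          using p_bounds[of n] ok' by (intro mult_nonneg_nonneg add_nonneg_nonneg) (auto simp: power_le_one)
      qed simp
    next
      assume ap: "(\<forall>s :: nat. s \<le> d n ^ i n * (1 + 2 * e n) \<longrightarrow> (1 - \<eta>) * a n \<le> (1 - p n) ^ s) \<and>
       (\<forall>s :: nat. d n ^ i n * (1 - 4 * e n - 40 * x n) \<le> s \<longrightarrow> (1 - \<eta>) * (1 - a n) \<le> 1 - (1 - p n) ^ s) \<and>
       (\<forall>s :: nat. s \<le> d n ^ i n * (6 * e n + 40 * x n) \<longrightarrow> 1 - \<eta> \<le> (1 - p n) ^ s)"
      \<comment> \<open>Missing \<open>T\<close>, missing one private part, hitting the other, and
        the Chernoff loss cost a factor \<open>1 - \<eta>\<close> each; \<open>1 - 8 * x\<close> is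
        the share of vertices outside the two balls.\<close>
      define g where "g = (1 - 8 * x n) * (1 - \<eta>) ^ 4"
      have "1 + 4 * (- \<eta>) \<le> (1 + (- \<eta>)) ^ 4" using \<eta> Bernoulli_inequality[of "- \<eta>" 4] by simp
      hence "(1 - 8 * x n) * (1 - 4 * \<eta>) \<le> g" unfolding g_def using ok' by (intro mult_left_mono) auto
      moreover have "1 - 8 * x n - 4 * \<eta> \<le> (1 - 8 * x n) * (1 - 4 * \<eta>)" using ok' \<eta> by (simp add: algebra_simps)
      ultimately have g: "1 - \<epsilon> \<le> g" using x \<epsilon> unfolding \<eta>_def by linarith
      define m where "m = 2 * (1 - 8 * x n) * (1 - \<eta>) ^ 3 * Y"
      have g1: "g \<le> (1 - 8 * x n) * (1 - \<eta>) ^ 3" unfolding g_def using ok' \<eta> by (intro mult_left_mono power_decreasing) auto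
      show ?case
      proof (rule main[of m])
        show "0 \<le> m" unfolding m_def using ok' \<eta> Y by (intro mult_nonneg_nonneg) auto
        have "(1 - \<eta>) * m = 2 * g * Y" unfolding m_def g_def by (simp add: eval_nat_numeral)
        moreover have "2 * ((1 - \<epsilon>) * Y) \<le> 2 * g * Y" using mult_right_mono[OF g Y] by simp
        moreover have "X * (2 * (1 - \<epsilon>)) \<le> X * (2 * (1 - 4 * e n - 40 * x n) - \<eta>)"
          using e x X \<epsilon> unfolding \<eta>_def by (intro mult_left_mono) (auto simp: algebra_simps)
        ultimately show "(1 - \<epsilon>) * (2 * (X + Y)) \<le> 2 * (X * (1 - 4 * e n - 40 * x n)) + ((1 - \<eta>) * m - \<eta> * X)"
          by (simp add: algebra_simps)
        have "1 / 2 * Y \<le> (1 - 8 * x n) * (1 - \<eta>) ^ 3 * Y" using g g1 \<epsilon> Y by (intro mult_right_mono) auto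
        moreover have "m / 2 = (1 - 8 * x n) * (1 - \<eta>) ^ 3 * Y" unfolding m_def by simp
        ultimately show "(X + Y) / 2 \<le> m / 2 + X" using X(1) unfolding add_divide_distrib by linarith
        fix A B T :: nat
        assume A: "d n ^ i n * (1 - 4 * e n - 40 * x n) \<le> A" "A \<le> d n ^ i n * (1 + 2 * e n)"
          and B: "d n ^ i n * (1 - 4 * e n - 40 * x n) \<le> B" "B \<le> d n ^ i n * (1 + 2 * e n)" and T: "T \<le> d n ^ i n * (6 * e n + 40 * x n)"
        have a0: "0 \<le> (1 - \<eta>) * a n" "0 \<le> (1 - \<eta>) * (1 - a n)" using a[of n] \<eta> by auto
        have q0: "0 \<le> (1 - p n) ^ s" for s using p_bounds[of n] by simp
        have "(1 - \<eta>) * a n * ((1 - \<eta>) * (1 - a n)) \<le> (1 - p n) ^ A * (1 - (1 - p n) ^ B)"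
          using ap A B a0 q0 by (intro mult_mono) auto
        moreover have "(1 - \<eta>) * a n * ((1 - \<eta>) * (1 - a n)) \<le> (1 - p n) ^ B * (1 - (1 - p n) ^ A)"
          using ap A B a0 q0 by (intro mult_mono) auto
        ultimately have s: "2 * ((1 - \<eta>) * a n * ((1 - \<eta>) * (1 - a n))) \<le> (1 - p n) ^ A * (1 - (1 - p n) ^ B) + (1 - p n) ^ B * (1 - (1 - p n) ^ A)" by linarith
        have "(1 - \<eta>) * (2 * ((1 - \<eta>) * a n * ((1 - \<eta>) * (1 - a n)))) \<le> (1 - p n) ^ T * ((1 - p n) ^ A * (1 - (1 - p n) ^ B) + (1 - p n) ^ B * (1 - (1 - p n) ^ A))"
        proof (rule mult_mono[OF _ s])
          show "1 - \<eta> \<le> (1 - p n) ^ T" using ap T by auto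
          have "0 \<le> (1 - \<eta>) * a n * ((1 - \<eta>) * (1 - a n))" by (rule mult_nonneg_nonneg[OF a0])
          thus "0 \<le> 2 * ((1 - \<eta>) * a n * ((1 - \<eta>) * (1 - a n)))" by linarith
        qed (rule q0)
        hence "n * (1 - 8 * x n) * ((1 - \<eta>) * (2 * ((1 - \<eta>) * a n * ((1 - \<eta>) * (1 - a n))))) \<le>
          n * (1 - 8 * x n) * ((1 - p n) ^ T * ((1 - p n) ^ A * (1 - (1 - p n) ^ B) + (1 - p n) ^ B * (1 - (1 - p n) ^ A)))"
          using ok' by (intro mult_left_mono) auto
        moreover have "m = n * (1 - 8 * x n) * ((1 - \<eta>) * (2 * ((1 - \<eta>) * a n * ((1 - \<eta>) * (1 - a n)))))"
          unfolding m_def Y_def by (simp only: power3_eq_cube mult.assoc mult.commute mult.left_commute)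
        ultimately show "m \<le> n * (1 - 8 * x n) * ((1 - p n) ^ T * ((1 - p n) ^ A * (1 - (1 - p n) ^ B) + (1 - p n) ^ B * (1 - (1 - p n) ^ A)))" by linarith
      qed
    qed
  qed
qed

end

section \<open>Lower bounds: every landmark set of a given size fails\<close>

lemma one_minus_ge_exp:
  fixes y :: real
  assumes y: "0 \<le> y" "y \<le> 1 / 2" "2 * y \<le> \<epsilon>"
  shows "exp (- ((1 + \<epsilon>) * y)) \<le> 1 - y"
proof -
  have "- ((1 + \<epsilon>) * y) \<le> - y - 2 * y\<^sup>2"
    using mult_right_mono[OF y(3) y(1)] by (simp add: power2_eq_square algebra_simps)
  also have "\<dots> \<le> ln (1 - y)" by (rule ln_one_minus_pos_lower_bound[OF y(1,2)])
  finally show ?thesis using y by (subst ln_ge_iff[symmetric]) auto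
qed

context gnp begin

text \<open>At most \<open>n ^ \<rho>\<close> sets have size \<open>\<rho>\<close>, so the bound
  \<open>b\<close> for one set must beat this number. The good event, being shared by all sets, is
  paid for once.\<close>

lemma beta_gt_by_union:
  fixes b :: real
  assumes \<rho>: "\<rho> \<le> n" and n: "2 \<le> n" and G: "pr (\<lambda>f. \<not> Good f) \<le> 3 / n"
    and R: "\<And>R. R \<subseteq> {1..n} \<Longrightarrow> card R = \<rho> \<Longrightarrow> pr (\<lambda>f. Good f \<and> resolving_set {1..n} (gr n f) R) \<le> b"
    and b: "real n ^ \<rho> * b \<le> 1 / n" and b0: "0 \<le> b"
  shows "pr (\<lambda>f. \<not> real \<rho> < beta n (gr n f)) \<le> 4 / n"
proof -
  let ?P = "{R. R \<subseteq> {1..n} \<and> card R = \<rho>}"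
  have fin: "finite ?P" by (rule finite_subset[of _ "Pow {1..n}"]) auto
  have "pr (\<lambda>f. \<not> real \<rho> < beta n (gr n f)) \<le> pr (\<lambda>f. \<not> Good f \<or> (\<exists>R\<in>?P. Good f \<and> resolving_set {1..n} (gr n f) R))"
  proof (rule pr_mono)
    fix f assume nb: "\<not> real \<rho> < beta n (gr n f)"
    have "\<exists>R\<in>?P. resolving_set {1..n} (gr n f) R"
    proof (rule ccontr)
      assume "\<not> ?thesis"
      hence "\<rho> < metric_dimension {1..n} (gr n f)" by (intro metric_dimension_gt) (use \<rho> in auto)
      thus False using nb by (simp add: beta_def)
    qed
    thus "\<not> Good f \<or> (\<exists>R\<in>?P. Good f \<and> resolving_set {1..n} (gr n f) R)" by blast
  qed
  also have "\<dots> \<le> 3 / n + real (card ?P) * b"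
    by (rule order.trans[OF pr_disj add_mono[OF G]]) (rule pr_union_card[OF fin], use R in blast)
  also have "card ?P = n choose \<rho>" using n_subsets[of "{1..n}" \<rho>] by simp
  also have "real (n choose \<rho>) * b \<le> real (n ^ \<rho>) * b"
    using \<rho> b0 by (intro mult_right_mono of_nat_mono binomial_le_pow)
  also have "real (n ^ \<rho>) * b \<le> 1 / n" using b by simp
  also have "3 / n + 1 / n = 4 / real n" by simp
  finally show ?thesis by simp
qed

abbreviation good_graph :: "real \<Rightarrow> nat \<Rightarrow> (nat set \<Rightarrow> bool) \<Rightarrow> bool" where
  "good_graph \<delta> i f \<equiv> all_grow \<delta> i f \<and> (\<forall>u\<in>{1..n}. \<forall>v\<in>{1..n}. v \<in> rc {u} (Suc (Suc (Suc i))) f)"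

text \<open>\<open>\<tau>\<close> bounds from below the chance that two vertices both miss the
  shared part, \<open>\<kappa>\<close> the chance that they agree on one own part; hence
  \<open>Q\<close> for a full agreement.\<close>

lemma beta_lower_patterns:
  fixes \<delta> e x d y Q \<tau> \<kappa> :: real and i N \<rho> :: nat
  assumes par: "d = p * (real n - 1)" "e = i * \<delta>" "x = d ^ i / n" "2 \<le> n" "4 \<le> d" "0 \<le> \<delta>" "\<delta> \<le> 1" "e \<le> 1 / 2" "40 * x \<le> 1"
    and G: "pr (\<lambda>f. \<not> good_graph \<delta> i f) \<le> 3 / n"
    and \<rho>: "\<rho> \<le> n" "20 * real \<rho> * x \<le> 1" and N: "0 < N" "2 * real N \<le> n * (1 - 4 * \<rho> * x)"
    and y: "y = 3 * e + 10 * real \<rho> * x"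
    and \<tau>: "0 < \<tau>" "\<And>s :: nat. s \<le> real \<rho> * d ^ i * y \<Longrightarrow> \<tau> \<le> (1 - p) ^ (2 * s)"
    and \<kappa>: "0 < \<kappa>" "\<And>s :: nat. d ^ i * (1 - real \<rho> * y) \<le> s \<Longrightarrow> s \<le> d ^ i * (1 + 2 * e) \<Longrightarrow>
      \<kappa> \<le> ((1 - p) ^ s)\<^sup>2 + (1 - (1 - p) ^ s)\<^sup>2"
    and Q: "Q = \<tau> * \<kappa> ^ \<rho>" and b: "real n ^ \<rho> * (2 * exp (- (N * sqrt Q) / 8)) \<le> 1 / n"
  shows "pr (\<lambda>f. \<not> real \<rho> < beta n (gr n f)) \<le> 4 / n"
proof (rule beta_gt_by_union[OF \<rho>(1) par(4) G _ b])
  fix R assume R: "R \<subseteq> {1..n}" "card R = \<rho>"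
  have Q0: "0 < Q" unfolding Q using \<tau>(1) \<kappa>(1) by simp
  show "pr (\<lambda>f. good_graph \<delta> i f \<and> resolving_set {1..n} (gr n f) R) \<le> 2 * exp (- (N * sqrt Q) / 8)"
  proof (rule order.trans[OF pr_mono few_patterns_unlikely[OF R(1) N(1) Q0, where k = i]])
    fix f assume asm: "good_graph \<delta> i f \<and> resolving_set {1..n} (gr n f) R"
    interpret grown n p \<delta> e x d i f by unfold_locales (use par asm in auto)
    have sz: "20 * card R * x \<le> 1" using \<rho> R by simp
    let ?S = "newr R i f"
    have S: "card (shared_part R ?S) \<le> real \<rho> * d ^ i * y"
      "\<And>r. r \<in> R \<Longrightarrow> d ^ i * (1 - real \<rho> * y) \<le> card (own_part R ?S r)"
      "\<And>r. r \<in> R \<Longrightarrow> card (own_part R ?S r) \<le> d ^ i * (1 + 2 * e)"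
      using family_sizes[OF R(1) sz] R(2) by (simp_all add: y)
    have "Q = \<tau> * (\<Prod>r\<in>R. \<kappa>)" using R by (simp add: Q)
    also have "\<dots> \<le> (1 - p) ^ (2 * card (shared_part R ?S)) *
       (\<Prod>r\<in>R. ((1 - p) ^ card (own_part R ?S r))\<^sup>2 + (1 - (1 - p) ^ card (own_part R ?S r))\<^sup>2)"
    proof (rule mult_mono)
      show "\<tau> \<le> (1 - p) ^ (2 * card (shared_part R ?S))" by (rule \<tau>(2)[OF S(1)])
      show "(\<Prod>r\<in>R. \<kappa>) \<le> (\<Prod>r\<in>R. ((1 - p) ^ card (own_part R ?S r))\<^sup>2 + (1 - (1 - p) ^ card (own_part R ?S r))\<^sup>2)"
        by (rule prod_mono) (use \<kappa>(1) \<kappa>(2)[OF S(2,3)] in auto)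
      show "0 \<le> (1 - p) ^ (2 * card (shared_part R ?S))" using p01 by simp
      show "0 \<le> (\<Prod>r\<in>R. \<kappa>)" using \<kappa>(1) by simp
    qed
    finally have 1: "Q \<le> \<dots>" .
    have "real (card (rc R (Suc i) f)) \<le> 4 * \<rho> * d ^ i" using rc_le[OF R(1) order.refl] R(2) by simp
    also have "\<dots> = n * (4 * \<rho> * x)" using di by simp
    finally have "2 * real N \<le> real n - card (rc R (Suc i) f)" using N(2) by (simp add: algebra_simps)
    moreover have "card ({1..n} - rc R (Suc i) f) = n - card (rc R (Suc i) f)"
      using reach_gr_subset[OF R(1)] finite_rc[OF R(1)] by (simp add: card_Diff_subset)
    ultimately have 2: "2 * N \<le> card ({1..n} - rc R (Suc i) f)" by linarith
    have 3: "inj_on (\<lambda>w. {r\<in>R. hits f w (?S r)}) ({1..n} - rc R (Suc i) f)"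
      by (rule pattern_inj[OF R(1)]) (use asm in auto)
    show "2 * N \<le> card ({1..n} - rc R (Suc i) f) \<and>
       Q \<le> (1 - p) ^ (2 * card (shared_part R ?S)) *
       (\<Prod>r\<in>R. ((1 - p) ^ card (own_part R ?S r))\<^sup>2 + (1 - (1 - p) ^ card (own_part R ?S r))\<^sup>2) \<and>
       inj_on (\<lambda>w. {r\<in>R. hits f w (?S r)}) ({1..n} - rc R (Suc i) f)"
      using 1 2 3 by simp
  qed
qed simp

end

text \<open>A landmark with a small new part has a fraction of about \<open>\<gamma>\<close> of its
  sphere inside the balls of radius \<open>i - 1\<close>. These hold at most
  \<open>4 * card R * d ^ (i - 1)\<close> vertices, too few for \<open>m\<close> such
  landmarks.\<close>

lemma (in grown) count_small:
  fixes \<gamma> :: real and m :: nat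
  assumes R: "R \<subseteq> {1..n}" and i: "1 \<le> i" and sz: "20 * real m * x \<le> 1"
    and m: "4 * card R * d ^ (i - 1) < m * d ^ i * (\<gamma> - e - 10 * m * x)"
  shows "card {r\<in>R. card (newr R i f r) < (1 - \<gamma>) * d ^ i} < m"
proof (rule ccontr)
  assume "\<not> ?thesis"
  hence "m \<le> card {r\<in>R. card (newr R i f r) < (1 - \<gamma>) * d ^ i}" by simp
  then obtain B where B: "B \<subseteq> {r\<in>R. card (newr R i f r) < (1 - \<gamma>) * d ^ i}" "card B = m"
    by (rule obtain_subset_with_card_n)
  have "card B * d ^ i * (1 - e - 10 * card B * x) \<le> card (rc R i f) + card B * ((1 - \<gamma>) * d ^ i)"
    by (rule few_small[OF R]) (use B sz in auto)
  moreover have "card (rc R i f) \<le> 4 * card R * d ^ (i - 1)"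
    using rc_le[OF R, of "i - 1"] i by simp
  ultimately show False using m B(2) by (simp add: algebra_simps)
qed

context gnp begin

text \<open>Two exploration stages. First, more than \<open>m1 / 2\<close> vertices stay outside all
  balls of radius \<open>i\<close>. Second, more than \<open>m2 / 2\<close> of these hit every
  landmark that keeps at least half of its sphere as new part. They can differ only on fewer than
  \<open>mb\<close> exceptional landmarks, and \<open>2 ^ mb\<close> patterns are not enough for
  them. \<open>\<gamma>\<close> and \<open>mm\<close> sharpen the second stage: all but
  \<open>mm\<close> landmarks keep a fraction \<open>1 - \<gamma>\<close> and are missed with
  probability at most \<open>exp (- c * (1 - \<gamma>))\<close>, the rest with at most
  \<open>exp (- c / 2)\<close>.\<close>

lemma beta_lower_hits:
  fixes \<delta> e x d c \<gamma> \<epsilon> m1 m2 :: real and i mb mm \<rho> :: nat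
  assumes par: "d = p * (real n - 1)" "e = i * \<delta>" "x = d ^ i / n" "2 \<le> n" "4 \<le> d" "0 \<le> \<delta>" "\<delta> \<le> 1" "e \<le> 1 / 2" "40 * x \<le> 1"
    and G: "pr (\<lambda>f. \<not> good_graph \<delta> i f) \<le> 3 / n"
    and c: "c = x * d" and i: "1 \<le> i" and \<rho>: "\<rho> \<le> n"
    and mb: "20 * real mb * x \<le> 1" "4 * \<rho> * d ^ (i - 1) < mb * d ^ i * (1 / 2 - e - 10 * mb * x)"
    and mm: "20 * real mm * x \<le> 1" "4 * \<rho> * d ^ (i - 1) < mm * d ^ i * (\<gamma> - e - 10 * mm * x)"
    and \<gamma>: "0 \<le> \<gamma>" "\<gamma> \<le> 1 / 2" and \<epsilon>: "2 * exp (- (c / 2)) \<le> \<epsilon>" "\<epsilon> \<le> 1"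
    and m1: "\<And>s :: nat. s \<le> \<rho> * d ^ (i - 1) * (1 + 2 * e) \<Longrightarrow> m1 \<le> (n - 4 * \<rho> * d ^ (i - 1)) * (1 - p) ^ s"
    and m2: "m2 \<le> m1 / 2 * exp (- ((1 + \<epsilon>) * (\<rho> * exp (- (c * (1 - \<gamma>))) + mm * exp (- (c / 2)))))"
    and m2': "2 * 2 ^ mb \<le> m2" and m1': "4 * \<rho> * d ^ (i - 1) \<le> n" "m2 \<le> m1"
    and b: "real n ^ \<rho> * (2 * exp (- m2 / 8)) \<le> 1 / n"
  shows "pr (\<lambda>f. \<not> real \<rho> < beta n (gr n f)) \<le> 4 / n"
proof (rule beta_gt_by_union[OF \<rho> par(4) G _ b])
  fix R assume R: "R \<subseteq> {1..n}" "card R = \<rho>"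
  have fR: "finite R" using finite_subset[OF R(1)] by simp
  have m20: "0 \<le> m2" "0 \<le> m1" using m2' m1' by (auto intro: order.trans[of _ "2 * 2 ^ mb :: real"])
  define t where "t = (1 - 1 / 2) * d ^ i"
  define k where "k = i - 1"
  have ik: "i = Suc k" using i by (simp add: k_def)
  \<comment> \<open>Stage one looks at radius \<open>k = i - 1\<close>, since the vertices outside
    the balls of radius \<open>i\<close> are those that miss the sphere of radius
    \<open>i - 1\<close> while being outside its ball.\<close>
  let ?E1 = "\<lambda>f. m1 \<le> (real n - card (rc R (Suc k) f)) * (1 - p) ^ card (rc R (Suc k) f - rc R k f) \<and>
       card ({1..n} - rc R (Suc (Suc k)) f) \<le> m1 / 2"
  let ?Rg = "\<lambda>f. {r\<in>R. t \<le> card (newr R i f r)}"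
  let ?E2 = "\<lambda>f. m2 \<le> card ({1..n} - rc R (Suc i) f) * (\<Prod>r\<in>?Rg f. 1 - (1 - p) ^ card (newr R i f r)) \<and>
      card {w \<in> {1..n} - rc R (Suc i) f. \<forall>r\<in>?Rg f. hits f w (newr R i f r)} \<le> m2 / 2"
  have "pr (\<lambda>f. good_graph \<delta> i f \<and> resolving_set {1..n} (gr n f) R) \<le> pr (\<lambda>f. ?E1 f \<or> ?E2 f)"
  proof (rule pr_mono, rule ccontr)
    fix f assume asm: "good_graph \<delta> i f \<and> resolving_set {1..n} (gr n f) R" and nE: "\<not> (?E1 f \<or> ?E2 f)"
    interpret grown n p \<delta> e x d i f by unfold_locales (use par asm in auto)
    have rci: "real (card (rc R (Suc k) f)) \<le> 4 * \<rho> * d ^ k"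
      using rc_le[OF R(1), of k] R(2) ik by simp
    have "card (sph R k f) \<le> \<rho> * d ^ (i - 1) * (1 + 2 * e)"
      using sph_le[OF R(1), of k] R(2) ik by (simp add: mult.assoc)
    from m1[OF this] have "m1 \<le> (n - 4 * \<rho> * d ^ k) * (1 - p) ^ card (sph R k f)" by (simp add: k_def)
    also have "\<dots> \<le> (real n - card (rc R (Suc k) f)) * (1 - p) ^ card (sph R k f)"
      using rci p01 by (intro mult_right_mono) auto
    finally have m1le: "m1 \<le> (real n - card (rc R (Suc k) f)) * (1 - p) ^ card (rc R (Suc k) f - rc R k f)"
      unfolding sph_def .
    have "\<not> ?E1 f" using nE by blast
    hence "\<not> card ({1..n} - rc R (Suc (Suc k)) f) \<le> m1 / 2" using m1le by blast
    hence O: "m1 / 2 < card ({1..n} - rc R (Suc i) f)" unfolding ik by (rule not_le_imp_less)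
    let ?y = "\<lambda>r. exp (- (c * (card (newr R i f r) / d ^ i)))"
    have d0: "0 < d ^ i" using d4 by simp
    have yr: "(1 - p) ^ card (newr R i f r) \<le> ?y r" for r
    proof -
      have "d / n \<le> p" using n2 p01 by (simp add: d_def field_simps)
      hence "d / n * card (newr R i f r) \<le> p * card (newr R i f r)" by (intro mult_right_mono) auto
      moreover have "c * (card (newr R i f r) / d ^ i) = d / n * card (newr R i f r)" using d0 by (simp add: c x_def)
      ultimately have "exp (- (p * card (newr R i f r))) \<le> ?y r" by simp
      thus ?thesis using one_minus_power_le[OF p01, of "card (newr R i f r)"] by linarith
    qed
    have c0: "0 \<le> c" using x0 d4 by (simp add: c)
    have ysmall: "?y r \<le> exp (- (c / 2))" if "r \<in> ?Rg f" for r
    proof -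
      have "1 / 2 \<le> card (newr R i f r) / d ^ i" using that d0 unfolding t_def by (simp add: field_simps)
      hence "c * (1 / 2) \<le> c * (card (newr R i f r) / d ^ i)" using c0 by (intro mult_left_mono)
      thus ?thesis by simp
    qed
    \<comment> \<open>Each factor is bounded by an exponential, which turns the product over the
      landmarks into a sum of miss probabilities.\<close>
    have factor: "exp (- ((1 + \<epsilon>) * ?y r)) \<le> 1 - (1 - p) ^ card (newr R i f r)" if r: "r \<in> ?Rg f" for r
    proof -
      have y: "0 \<le> ?y r" "?y r \<le> 1 / 2" "2 * ?y r \<le> \<epsilon>"
        using ysmall[OF r] \<epsilon> by (simp, linarith, linarith)
      have "exp (- ((1 + \<epsilon>) * ?y r)) \<le> 1 - ?y r" by (rule one_minus_ge_exp[OF y])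
      thus ?thesis using yr[of r] by linarith
    qed
    let ?T = "{r\<in>R. card (newr R i f r) < (1 - \<gamma>) * d ^ i}"
    have fT: "finite ?T" using fR by simp
    have cT: "card ?T < mm" by (rule count_small[OF R(1) i mm(1)]) (use mm(2) R(2) in simp)
    have ybig: "?y r \<le> exp (- (c * (1 - \<gamma>)))" if "r \<in> R - ?T" for r
    proof -
      have "(1 - \<gamma>) * d ^ i \<le> card (newr R i f r)" using that by auto
      hence "1 - \<gamma> \<le> card (newr R i f r) / d ^ i" by (subst pos_le_divide_eq[OF d0])
      hence "c * (1 - \<gamma>) \<le> c * (card (newr R i f r) / d ^ i)" using c0 by (intro mult_left_mono)
      thus ?thesis by simp
    qed
    have fRg: "finite (?Rg f)" using fR by simp
    have s0: "(\<Sum>r\<in>?Rg f. ?y r) = (\<Sum>r\<in>?Rg f \<inter> ?T. ?y r) + (\<Sum>r\<in>?Rg f - ?T. ?y r)"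
      by (rule sum.Int_Diff[OF fRg])
    have s1: "(\<Sum>r\<in>?Rg f - ?T. ?y r) \<le> card (?Rg f - ?T) * exp (- (c * (1 - \<gamma>)))"
      by (rule sum_bounded_above) (rule ybig, blast)
    have s2: "(\<Sum>r\<in>?Rg f \<inter> ?T. ?y r) \<le> card (?Rg f \<inter> ?T) * exp (- (c / 2))"
      by (rule sum_bounded_above) (rule ysmall, blast)
    have "card (?Rg f - ?T) \<le> \<rho>" unfolding R(2)[symmetric] by (rule card_mono[OF fR]) blast
    hence s3: "card (?Rg f - ?T) * exp (- (c * (1 - \<gamma>))) \<le> \<rho> * exp (- (c * (1 - \<gamma>)))"
      by (intro mult_right_mono of_nat_mono) simp_all
    have "card (?Rg f \<inter> ?T) \<le> card ?T" by (rule card_mono[OF fT]) blast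
    hence "card (?Rg f \<inter> ?T) \<le> mm" using cT by linarith
    hence s4: "card (?Rg f \<inter> ?T) * exp (- (c / 2)) \<le> mm * exp (- (c / 2))"
      by (intro mult_right_mono of_nat_mono) simp_all
    have sum: "(\<Sum>r\<in>?Rg f. ?y r) \<le> \<rho> * exp (- (c * (1 - \<gamma>))) + mm * exp (- (c / 2))"
      using s0 s1 s2 s3 s4 by linarith
    have "exp (- ((1 + \<epsilon>) * (\<rho> * exp (- (c * (1 - \<gamma>))) + mm * exp (- (c / 2))))) \<le> exp (- ((1 + \<epsilon>) * (\<Sum>r\<in>?Rg f. ?y r)))"
    proof -
      have "0 \<le> \<epsilon>" using \<epsilon>(1) exp_gt_zero[of "- (c / 2)"] by linarith
      thus ?thesis using mult_left_mono[OF sum, of "1 + \<epsilon>"] by simp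
    qed
    also have "\<dots> = (\<Prod>r\<in>?Rg f. exp (- ((1 + \<epsilon>) * ?y r)))"
      using fR by (simp add: exp_sum sum_distrib_left sum_negf[symmetric])
    also have "\<dots> \<le> (\<Prod>r\<in>?Rg f. 1 - (1 - p) ^ card (newr R i f r))"
      by (intro prod_mono conjI factor) auto
    finally have prod: "exp (- ((1 + \<epsilon>) * (\<rho> * exp (- (c * (1 - \<gamma>))) + mm * exp (- (c / 2))))) \<le> \<dots>" .
    have "m2 \<le> card ({1..n} - rc R (Suc i) f) * (\<Prod>r\<in>?Rg f. 1 - (1 - p) ^ card (newr R i f r))"
    proof (rule order.trans[OF m2 mult_mono[OF _ prod]])
      show "m1 / 2 \<le> card ({1..n} - rc R (Suc i) f)" using O by (rule less_imp_le)
    qed simp_all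
    moreover have "\<not> ?E2 f" using nE by blast
    ultimately have "\<not> card {w \<in> {1..n} - rc R (Suc i) f. \<forall>r\<in>?Rg f. hits f w (newr R i f r)} \<le> m2 / 2" by blast
    hence gt: "m2 / 2 < card {w \<in> {1..n} - rc R (Suc i) f. \<forall>r\<in>?Rg f. hits f w (newr R i f r)}" by (rule not_le_imp_less)
    have le1: "card {w \<in> {1..n} - rc R (Suc i) f. \<forall>r\<in>?Rg f. hits f w (newr R i f r)} \<le> 2 ^ card (R - ?Rg f)"
      by (rule pattern_count[OF R(1)]) (use asm in auto)
    have le2: "(2 :: nat) ^ card (R - ?Rg f) \<le> 2 ^ mb"
    proof -
      have "R - ?Rg f = {r\<in>R. card (newr R i f r) < (1 - 1 / 2) * d ^ i}" unfolding t_def by auto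
      moreover have "card {r\<in>R. card (newr R i f r) < (1 - 1 / 2) * d ^ i} < mb"
        by (rule count_small[OF R(1) i mb(1)]) (use mb(2) R(2) in simp)
      ultimately show ?thesis by (intro power_increasing) auto
    qed
    have "real (card {w \<in> {1..n} - rc R (Suc i) f. \<forall>r\<in>?Rg f. hits f w (newr R i f r)}) \<le> real (2 ^ mb)"
      using order.trans[OF le1 le2] by (rule of_nat_mono)
    with gt have "m2 / 2 < real (2 ^ mb)" by (rule less_le_trans)
    thus False using m2' by simp
  qed
  also have "\<dots> \<le> exp (- m1 / 8) + exp (- m2 / 8)"
    by (intro order.trans[OF pr_disj add_mono] fresh_decrease[OF R(1) m20(2)] common_hits[OF R(1) m20(1)])
  also have "\<dots> \<le> 2 * exp (- m2 / 8)" using m1'(2) by simp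
  finally show "pr (\<lambda>f. good_graph \<delta> i f \<and> resolving_set {1..n} (gr n f) R) \<le> 2 * exp (- m2 / 8)" .
qed simp

end

section \<open>Miss probabilities of spheres and the sparse upper bound\<close>

context gnp_seq begin

text \<open>As \<open>c\<close> is bounded below, a fresh vertex hits a given sphere with
  probability bounded away from 0. The mean number of linking vertices is then at least a constant
  times \<open>d\<close>, far above \<open>ln n\<close>.\<close>

lemma eventually_good:
  "\<forall>\<^sub>F n in sequentially. ok n \<and> P n (\<lambda>f. \<not> gnp.good_graph n (p n) (\<delta> n) (i n) f) \<le> 3 / real n"
proof -
  obtain c0 where c0: "0 < c0" "\<forall>\<^sub>F n in sequentially. c0 \<le> c n" using c_low by blast
  define k where "k = (1 - exp (- (c0 / 4))) / 4"
  have k: "0 < k" using c0(1) by (simp add: k_def)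
  show ?thesis using eventually_ok c0(2) d_pow[of 1 "3 / k", simplified]
  proof eventually_elim
    case (elim n)
    interpret gnp n "p n" by (rule gnp)
    note ok = okD[OF elim(1)]
    have "d n / real n \<le> p n" using ok(1,4) p_bounds[of n] by (simp add: field_simps)
    hence "d n ^ i n * (d n / real n) \<le> d n ^ i n * p n" using ok(5) by (intro mult_left_mono) auto
    hence "c n \<le> p n * d n ^ i n" unfolding c_eq by (simp add: mult_ac)
    hence "c0 / 4 \<le> p n * d n ^ i n / 4" using elim(2) by simp
    hence "4 * k \<le> 1 - exp (- (p n * d n ^ i n / 4))" unfolding k_def by simp
    hence "d n / 4 * (4 * k) \<le> d n / 4 * (1 - exp (- (p n * d n ^ i n / 4)))" using ok(5) by (intro mult_left_mono) auto
    moreover have "3 * ln n \<le> d n / 4 * (4 * k)" using elim(3) k by (simp add: field_simps)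
    ultimately have m: "3 * ln n \<le> d n / 4 * (1 - exp (- (p n * d n ^ i n / 4)))" by linarith
    have "P n (\<lambda>f. \<not> good_graph (\<delta> n) (i n) f) \<le> 3 / real n"
      by (rule diameter_prob[OF ok(1-9) ok(12) m ok(10)])
    thus ?case using elim(1) by blast
  qed
qed

text \<open>If \<open>c n \<le> 2 * ln n\<close>, then \<open>x n = c n / d n\<close> is at most
  \<open>2 * ln n / d n\<close>, and \<open>p n\<close> is at most twice \<open>x n\<close>, so
  powers of \<open>ln n\<close> are affordable. It is an implication for each \<open>n\<close>
  because \<open>c\<close> may cross the threshold infinitely often.\<close>

lemma params_small:
  assumes i: "\<forall>\<^sub>F n in sequentially. 1 \<le> i n" and \<eta>: "0 < \<eta>"
  shows "\<forall>\<^sub>F n in sequentially. c n \<le> 2 * ln (real n) \<longrightarrow>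
    ln (real n) * e n \<le> \<eta> \<and> ln (real n) * p n \<le> \<eta> \<and> ln (real n) * (1 / real n) \<le> \<eta> \<and> ln (real n) ^ 3 * x n \<le> \<eta>"
proof -
  have "\<forall>\<^sub>F n in sequentially. ln (real n) * (1 / real n) \<le> \<eta>" using \<eta> by real_asymp
  with eventually_ok i e_ln_small[OF \<eta>] d_pow[of 4 "2 / \<eta>", simplified] d_pow[of 2 "4 / \<eta>", simplified] show ?thesis
  proof eventually_elim
    case (elim n)
    note ok = okD[OF elim(1)]
    let ?L = "ln (real n)"
    show ?case
    proof (intro impI conjI)
      assume c: "c n \<le> 2 * ?L"
      have d0: "0 < d n" using ok(5) by linarith
      have xd: "x n * d n \<le> 2 * ?L" using c unfolding c_x .
      hence x: "x n \<le> 2 * ?L / d n" using d0 by (simp only: pos_le_divide_eq)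
      show "?L * e n \<le> \<eta>" using elim(3) by (simp add: mult.commute)
      have "2 * ?L ^ 4 \<le> \<eta> * d n" using elim(4) \<eta> by (simp add: field_simps)
      hence "2 * ?L ^ 4 / d n \<le> \<eta>" using d0 by (simp add: pos_divide_le_eq)
      moreover have "?L ^ 3 * x n \<le> ?L ^ 3 * (2 * ?L / d n)" using x ok(14) by (intro mult_left_mono) auto
      moreover have "?L ^ 3 * (2 * ?L / d n) = 2 * ?L ^ 4 / d n" by (simp add: eval_nat_numeral)
      ultimately show "?L ^ 3 * x n \<le> \<eta>" by linarith
      have "d n ^ 1 \<le> d n ^ i n" using elim(2) ok(5) by (intro power_increasing) auto
      hence "d n / n \<le> x n" by (simp add: x_def divide_right_mono)
      moreover have "p n \<le> 2 * (d n / n)"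
      proof -
        have "p n * n \<le> p n * (2 * (real n - 1))" using p_bounds[of n] ok(4) by (intro mult_left_mono) auto
        thus ?thesis using ok(1,4) by (simp add: field_simps)
      qed
      ultimately have "p n \<le> 2 * (2 * ?L / d n)" using x by linarith
      hence "?L * p n \<le> ?L * (2 * (2 * ?L / d n))" using ok(14) by (intro mult_left_mono) auto
      also have "\<dots> = 4 * ?L\<^sup>2 / d n" by (simp add: power2_eq_square)
      also have "\<dots> \<le> \<eta>" using elim(5) \<eta> d0 by (simp add: field_simps)
      finally show "?L * p n \<le> \<eta>" .
    qed (rule elim(6))
  qed
qed

text \<open>The factor with the 8 collects three relative errors: of the sphere size, of
  \<open>1 - p\<close> against \<open>exp (- p)\<close>, and of \<open>p\<close> against
  \<open>d / n\<close>.\<close>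

lemma miss_ge:
  fixes s :: nat
  assumes ok: "ok n" and p: "p n \<le> 1 / 8" and e: "e n \<le> 1 / 8" and n: "8 \<le> n" and s: "s \<le> t * (1 + 2 * e n)" and t: "0 \<le> t"
  shows "exp (- (t * d n / n * (1 + 8 * (e n + p n + 1 / n)))) \<le> (1 - p n) ^ s"
proof -
  note ok = okD[OF ok]
  have p0: "0 \<le> p n" using p_bounds[of n] by simp
  have "p n * s \<le> p n * (t * (1 + 2 * e n))" by (rule mult_left_mono[OF s p0])
  also have "p n \<le> d n / n * (1 + 2 * (1 / n))"
  proof -
    have "p n * 1 \<le> p n * ((real n - 1) / n * (1 + 2 / n))"
    proof (rule mult_left_mono[OF _ p0])
      have "(real n - 1) * (real n + 2) \<ge> real n * real n" using n by (simp add: algebra_simps)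
      thus "1 \<le> (real n - 1) / n * (1 + 2 / n)" using n by (simp add: field_simps)
    qed
    thus ?thesis using ok(1) by simp
  qed
  hence "p n * (t * (1 + 2 * e n)) \<le> d n / n * (1 + 2 * (1 / n)) * (t * (1 + 2 * e n))"
    using t ok(11) by (intro mult_right_mono) auto
  finally have "p n * s * (1 + 2 * p n) \<le> d n / n * (1 + 2 * (1 / n)) * (t * (1 + 2 * e n)) * (1 + 2 * p n)"
    using p0 by (intro mult_right_mono) auto
  also have "\<dots> = t * d n / n * ((1 + 2 * (1 / n)) * (1 + 2 * e n) * (1 + 2 * p n))" by (simp add: mult_ac)
  also have "\<dots> \<le> t * d n / n * (1 + 8 * (e n + p n + 1 / n))"
  proof (rule mult_left_mono)
    define u v w where "u = 1 / real n" and "v = e n" and "w = p n"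
    have b: "0 \<le> u" "u \<le> 1 / 8" "0 \<le> v" "v \<le> 1 / 8" "0 \<le> w" "w \<le> 1 / 8"
      using n ok(11) e p p0 by (auto simp: u_def v_def w_def field_simps)
    have "u * v \<le> u * (1 / 8)" "u * w \<le> u * (1 / 8)" "v * w \<le> v * (1 / 8)" 
      using mult_left_mono[OF b(4) b(1)] mult_left_mono[OF b(6) b(1)] mult_left_mono[OF b(6) b(3)] by simp_all
    moreover have "u * v * w \<le> u * (1 / 8) * (1 / 8)" using b by (intro mult_mono) auto
    ultimately have "(1 + 2 * u) * (1 + 2 * v) * (1 + 2 * w) \<le> 1 + 8 * (v + w + u)"
      using b by (simp add: algebra_simps)
    thus "(1 + 2 * (1 / n)) * (1 + 2 * e n) * (1 + 2 * p n) \<le> 1 + 8 * (e n + p n + 1 / n)"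
      unfolding u_def v_def w_def .
    show "0 \<le> t * d n / n" using t ok(5) by simp
  qed
  finally have "exp (- (t * d n / n * (1 + 8 * (e n + p n + 1 / n)))) \<le> exp (- (p n * s * (1 + 2 * p n)))" by simp
  also have "\<dots> \<le> (1 - p n) ^ s" by (rule one_minus_power_ge[OF p0]) (use p in simp)
  finally show ?thesis .
qed

lemma miss_le:
  fixes s :: nat
  assumes ok: "ok n" and s: "d n ^ i n * (1 - \<theta>) \<le> s"
  shows "(1 - p n) ^ s \<le> exp (- c n + c n * \<theta>)"
proof -
  note ok = okD[OF ok]
  have p0: "0 \<le> p n" "p n \<le> 1" using p_bounds[of n] by auto
  have "d n / n \<le> p n" using ok(1,4) p0 by (simp add: field_simps)
  hence "d n / n * s \<le> p n * s" by (intro mult_right_mono) auto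
  moreover have "d n / n * (d n ^ i n * (1 - \<theta>)) \<le> d n / n * s" using s ok(5) by (intro mult_left_mono) auto
  moreover have "d n / n * (d n ^ i n * (1 - \<theta>)) = c n - c n * \<theta>" unfolding c_eq by (simp add: algebra_simps diff_divide_distrib)
  ultimately have "exp (- (p n * s)) \<le> exp (- c n + c n * \<theta>)" by simp
  thus ?thesis using one_minus_power_le[OF p0, of s] by linarith
qed

lemma miss_few:
  fixes s :: nat
  assumes ok: "ok n" and s: "s \<le> d n ^ i n * \<theta>"
  shows "1 - 2 * c n * \<theta> \<le> (1 - p n) ^ s"
proof -
  note ok = okD[OF ok]
  have p0: "0 \<le> p n" "p n \<le> 1" using p_bounds[of n] by auto
  have "1 + real s * (- p n) \<le> (1 + (- p n)) ^ s" using p0 by (intro Bernoulli_inequality) auto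
  moreover have "p n * s \<le> 2 * c n * \<theta>"
  proof -
    have "p n * n \<le> p n * (2 * (real n - 1))" using p0 ok(4) by (intro mult_left_mono) auto
    hence "p n \<le> 2 * (d n / n)" using ok(1,4) by (simp add: field_simps)
    hence "p n * s \<le> 2 * (d n / n) * s" by (intro mult_right_mono) auto
    also have "\<dots> \<le> 2 * (d n / n) * (d n ^ i n * \<theta>)" using s ok(5) by (intro mult_left_mono) auto
    also have "\<dots> = 2 * c n * \<theta>" unfolding c_eq by simp
    finally show ?thesis .
  qed
  ultimately show ?thesis by (simp add: mult.commute)
qed

lemma exp_small: "0 \<le> z \<Longrightarrow> z \<le> 1 \<Longrightarrow> exp z \<le> 1 + 2 * (z :: real)"
proof -
  assume z: "0 \<le> z" "z \<le> 1"
  have "exp z \<le> 1 + z + z\<^sup>2" by (rule exp_bound[OF z])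
  moreover have "z * z \<le> z * 1" using z by (intro mult_left_mono) auto
  ultimately show ?thesis by (simp add: power2_eq_square)
qed

text \<open>For \<open>c \<le> 2 ln n\<close> the relative errors in the sphere sizes are \<open>o(1 / ln n)\<close>, so they change
  \<open>exp (- c)\<close> by a factor \<open>1 + o(1)\<close> only.\<close>

lemma miss_close:
  assumes i: "\<forall>\<^sub>F n in sequentially. 1 \<le> i n" and \<eta>: "0 < \<eta>" "\<eta> \<le> 1"
  shows "\<forall>\<^sub>F n in sequentially. c n \<le> 2 * ln (real n) \<longrightarrow>
      (\<forall>s :: nat. s \<le> d n ^ i n * (1 + 2 * e n) \<longrightarrow> exp (- c n - \<eta>) \<le> (1 - p n) ^ s) \<and>
      c n * (40 * e n + 40 * x n) \<le> \<eta> \<and> 8 * (e n + p n + 1 / n) \<le> \<eta> \<and> p n \<le> 1 / 8"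
proof -
  have \<eta>': "0 < \<eta> / 320" using \<eta> by simp
  show ?thesis using eventually_ok params_small[OF i \<eta>'] eventually_ge_at_top[of 8]
  proof eventually_elim
    case (elim n)
    note ok = okD[OF elim(1)]
    let ?L = "ln (real n)"
    show ?case
    proof (rule impI)
      assume c2: "c n \<le> 2 * ?L"
      have sm: "?L * e n \<le> \<eta> / 320" "?L * p n \<le> \<eta> / 320" "?L * (1 / n) \<le> \<eta> / 320" "?L ^ 3 * x n \<le> \<eta> / 320"
        using elim(2) c2 by blast+
      have L1: "1 \<le> ?L" by (rule ok(14))
      have p0: "0 \<le> p n" using p_bounds[of n] by simp
      have c0: "0 \<le> c n" unfolding c_x using ok(5) order.strict_implies_order[OF ok(13)] by (intro mult_nonneg_nonneg) linarith+
      have x3: "?L * x n \<le> \<eta> / 320"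
      proof -
        have "?L ^ 1 * x n \<le> ?L ^ 3 * x n" using L1 order.strict_implies_order[OF ok(13)] by (intro mult_right_mono power_increasing) auto
        thus ?thesis using sm(4) by simp
      qed
      have le: "z \<le> \<eta> / 320" if "?L * z \<le> \<eta> / 320" "0 \<le> z" for z
        using mult_right_mono[OF L1 that(2)] that(1) by simp
      have s1: "e n \<le> \<eta> / 320" "p n \<le> \<eta> / 320" "1 / n \<le> \<eta> / 320"
        using le[OF sm(1) ok(11)] le[OF sm(2) p0] le[OF sm(3)] by simp_all
      have ce: "c n * z \<le> \<eta> / 160" if "?L * z \<le> \<eta> / 320" "0 \<le> z" for z
        using mult_right_mono[OF c2 that(2)] that(1) by simp
      have cs: "c n * e n \<le> \<eta> / 160" "c n * p n \<le> \<eta> / 160" "c n * (1 / n) \<le> \<eta> / 160" "c n * x n \<le> \<eta> / 160"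
        using ce[OF sm(1) ok(11)] ce[OF sm(2) p0] ce[OF sm(3)] ce[OF x3 order.strict_implies_order[OF ok(13)]] by simp_all
      have 1: "exp (- c n - \<eta>) \<le> (1 - p n) ^ s" if s: "s \<le> d n ^ i n * (1 + 2 * e n)" for s :: nat
      proof -
        have "c n * (1 + 8 * (e n + p n + 1 / n)) = c n + 8 * (c n * e n + c n * p n + c n * (1 / n))" by (simp add: algebra_simps)
        also have "\<dots> \<le> c n + \<eta>"
        proof -
          have "8 * (a + b + z) \<le> \<eta>" if "a \<le> \<eta> / 160" "b \<le> \<eta> / 160" "z \<le> \<eta> / 160" for a b z :: real
            using that \<eta> by (simp add: algebra_simps)
          from this[OF cs(1-3)] show ?thesis by (rule add_left_mono)
        qed
        finally have "exp (- c n - \<eta>) \<le> exp (- (c n * (1 + 8 * (e n + p n + 1 / n))))" by simp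
        also have "c n = d n ^ i n * d n / n" unfolding c_eq by simp
        hence "exp (- (c n * (1 + 8 * (e n + p n + 1 / n)))) \<le> (1 - p n) ^ s"
          using miss_ge[OF elim(1) _ _ elim(3) s] s1 \<eta> ok(5) by simp
        finally show ?thesis .
      qed
      have "c n * (40 * e n + 40 * x n) = 40 * (c n * e n) + 40 * (c n * x n)" by (simp only: distrib_left mult.left_commute)
      hence 2: "c n * (40 * e n + 40 * x n) \<le> \<eta>" using cs \<eta> by linarith
      have "8 * (a + b + z) \<le> \<eta>" if "a \<le> \<eta> / 320" "b \<le> \<eta> / 320" "z \<le> \<eta> / 320" for a b z :: real
        using that \<eta> by (simp add: algebra_simps)
      from this[OF s1] have 3: "8 * (e n + p n + 1 / n) \<le> \<eta>" .
      have 4: "p n \<le> 1 / 8" using s1(2) \<eta> by linarith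
      show "(\<forall>s :: nat. s \<le> d n ^ i n * (1 + 2 * e n) \<longrightarrow> exp (- c n - \<eta>) \<le> (1 - p n) ^ s) \<and>
        c n * (40 * e n + 40 * x n) \<le> \<eta> \<and> 8 * (e n + p n + 1 / n) \<le> \<eta> \<and> p n \<le> 1 / 8"
        using 1 2 3 4 by blast
    qed
  qed
qed

text \<open>The absolute value makes \<open>exp (- \<bar>c n\<bar>)\<close> a probability for every
  \<open>n\<close>, as \<open>upper_aas\<close> demands; eventually it is
  \<open>exp (- c n)\<close>.\<close>

lemma upper_sparse_aas:
  assumes i: "\<forall>\<^sub>F n in sequentially. 1 \<le> i n" and \<epsilon>: "0 < \<epsilon>" "\<epsilon> \<le> 1 / 2"
  shows "aas p (\<lambda>n E. beta n E \<le> 2 * ln (real n) /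
    (- ln (1 - (1 - \<epsilon>) * (2 * (x n + exp (- \<bar>c n\<bar>) * (1 - exp (- \<bar>c n\<bar>)))))) + 1)"
proof (rule upper_aas[OF _ \<epsilon>])
  show "0 \<le> exp (- \<bar>c n\<bar>) \<and> exp (- \<bar>c n\<bar>) \<le> 1" for n by simp
  show "\<forall>\<^sub>F n in sequentially. K * ln (real n) \<le> d n ^ i n + real n * (exp (- \<bar>c n\<bar>) * (1 - exp (- \<bar>c n\<bar>)))" for K
    using eventually_ok i d_pow[of 1 K, simplified]
  proof eventually_elim
    case (elim n)
    have "d n ^ 1 \<le> d n ^ i n" using elim(2) okD(5)[OF elim(1)] by (intro power_increasing) auto
    hence "d n \<le> d n ^ i n" by simp
    moreover have "0 \<le> real n * (exp (- \<bar>c n\<bar>) * (1 - exp (- \<bar>c n\<bar>)))" by simp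
    ultimately show ?case using elim(3) by linarith
  qed
  fix \<eta> :: real assume \<eta>: "0 < \<eta>"
  obtain c0 where c0: "0 < c0" "\<forall>\<^sub>F n in sequentially. c0 \<le> c n" using c_low by blast
  \<comment> \<open>A lower bound for \<open>1 - exp (- c)\<close>. The error
    \<open>2 * \<zeta>\<close> in a hit probability has to stay below the fraction
    \<open>\<eta>\<close> of it, hence the condition
    \<open>2 * \<zeta> \<le> \<eta> * k\<close>.\<close>
  define k where "k = 1 - exp (- c0)"
  have k: "0 < k" "k \<le> 1" using c0(1) by (auto simp: k_def)
  define Z where "Z = min (min \<eta> 1) (\<eta> * k)"
  have Z: "0 < Z" "Z \<le> 1" "Z \<le> \<eta>" "Z \<le> \<eta> * k" using \<eta> k by (auto simp: Z_def)
  define \<zeta> where "\<zeta> = Z / 4"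
  have \<zeta>: "0 < \<zeta>" "\<zeta> \<le> 1" "\<zeta> \<le> \<eta>" "2 * \<zeta> \<le> \<eta> * k" using Z unfolding \<zeta>_def by linarith+
  have "\<forall>\<^sub>F n in sequentially. 1 / real n \<le> \<eta>" using \<eta> by real_asymp
  with eventually_ok miss_close[OF i \<zeta>(1,2)] c0(2)
  show "\<forall>\<^sub>F n in sequentially. real n * exp (- \<bar>c n\<bar>) \<le> \<eta> * d n ^ i n \<or>
      ((\<forall>s :: nat. s \<le> d n ^ i n * (1 + 2 * e n) \<longrightarrow> (1 - \<eta>) * exp (- \<bar>c n\<bar>) \<le> (1 - p n) ^ s) \<and>
       (\<forall>s :: nat. d n ^ i n * (1 - 4 * e n - 40 * x n) \<le> s \<longrightarrow> (1 - \<eta>) * (1 - exp (- \<bar>c n\<bar>)) \<le> 1 - (1 - p n) ^ s) \<and>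
       (\<forall>s :: nat. s \<le> d n ^ i n * (6 * e n + 40 * x n) \<longrightarrow> 1 - \<eta> \<le> (1 - p n) ^ s))"
  proof eventually_elim
    case (elim n)
    note ok = okD[OF elim(1)]
    have cabs: "\<bar>c n\<bar> = c n" "0 \<le> c n" using elim(3) c0(1) by auto
    have x0: "0 \<le> x n" using ok(13) by linarith
    show ?case
    proof (cases "c n \<le> 2 * ln n")
      case False
      \<comment> \<open>Above the threshold \<open>n * exp (- c n)\<close> is at most
        \<open>1 / n\<close>, so the spheres alone decide and the first alternative holds.\<close>
      have "exp (- c n) \<le> exp (- (2 * ln n))" using False by simp
      also have "\<dots> = 1 / (real n)\<^sup>2"
        using ok(4) by (simp add: exp_minus exp_of_nat_mult[of 2 "ln (real n)", simplified] inverse_eq_divide)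
      finally have "real n * exp (- c n) \<le> real n * (1 / (real n)\<^sup>2)" by (intro mult_left_mono) auto
      also have "\<dots> = 1 / n" using ok(4) by (simp add: power2_eq_square)
      also have "\<dots> \<le> \<eta> * 1" using elim(4) by simp
      also have "\<dots> \<le> \<eta> * d n ^ i n" using \<eta> ok(5) by (intro mult_left_mono) auto
      finally show ?thesis unfolding cabs by blast
    next
      case True
      have sm: "\<And>s :: nat. s \<le> d n ^ i n * (1 + 2 * e n) \<Longrightarrow> exp (- c n - \<zeta>) \<le> (1 - p n) ^ s"
        "c n * (40 * e n + 40 * x n) \<le> \<zeta>" using elim(2) True by blast+
      have A: "(1 - \<eta>) * exp (- c n) \<le> (1 - p n) ^ s" if "s \<le> d n ^ i n * (1 + 2 * e n)" for s :: nat
      proof -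
        have "1 - \<eta> \<le> exp (- \<zeta>)" using exp_ge_add_one_self[of "- \<zeta>"] \<zeta>(3) by linarith
        hence "(1 - \<eta>) * exp (- c n) \<le> exp (- \<zeta>) * exp (- c n)" by (intro mult_right_mono) auto
        also have "\<dots> = exp (- c n - \<zeta>)" by (simp add: mult_exp_exp)
        finally show ?thesis using sm(1)[OF that] by linarith
      qed
      have cz: "c n * (4 * e n + 40 * x n) \<le> \<zeta>" "c n * (6 * e n + 40 * x n) \<le> \<zeta>"
        using ok(11) cabs(2) by (auto intro!: order.trans[OF mult_left_mono sm(2)])
      have B: "(1 - \<eta>) * (1 - exp (- c n)) \<le> 1 - (1 - p n) ^ s" if s: "d n ^ i n * (1 - 4 * e n - 40 * x n) \<le> s" for s :: nat
      proof -
        have "(1 - p n) ^ s \<le> exp (- c n + c n * (4 * e n + 40 * x n))"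
          by (rule miss_le[OF elim(1)]) (use s in \<open>simp add: diff_diff_eq\<close>)
        also have "\<dots> \<le> exp (- c n + \<zeta>)" using cz by simp
        also have "\<dots> = exp (- c n) * exp \<zeta>" by (simp add: mult_exp_exp)
        also have "\<dots> \<le> exp (- c n) * (1 + 2 * \<zeta>)" using \<zeta> by (intro mult_left_mono exp_small) auto
        also have "\<dots> \<le> exp (- c n) + 2 * \<zeta>"
        proof -
          have "exp (- c n) * (2 * \<zeta>) \<le> 1 * (2 * \<zeta>)" using cabs \<zeta> by (intro mult_right_mono) auto
          thus ?thesis by (simp add: distrib_left)
        qed
        also have "2 * \<zeta> \<le> \<eta> * (1 - exp (- c n))"
        proof -
          have "k \<le> 1 - exp (- c n)" using elim(3) by (simp add: k_def)
          hence "\<eta> * k \<le> \<eta> * (1 - exp (- c n))" using \<eta> by (intro mult_left_mono) auto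
          thus ?thesis using \<zeta>(4) by linarith
        qed
        finally show ?thesis by (simp add: algebra_simps)
      qed
      have C: "1 - \<eta> \<le> (1 - p n) ^ s" if s: "s \<le> d n ^ i n * (6 * e n + 40 * x n)" for s :: nat
      proof -
        have "2 * c n * (6 * e n + 40 * x n) \<le> \<eta>"
        proof -
          have "2 * \<zeta> \<le> \<eta> * 1" using \<zeta>(4) mult_left_mono[OF k(2), of \<eta>] \<eta> by linarith
          thus ?thesis using cz(2) by linarith
        qed
        thus ?thesis using miss_few[OF elim(1) s] by linarith
      qed
      show ?thesis unfolding cabs using A B C by blast
    qed
  qed
qed

end

section \<open>Asymptotic lower bounds\<close>

context gnp_seq begin

lemma beta_nat: "\<exists>k :: nat. beta n E = real k"
  by (simp add: beta_def)

lemma exp_log_sum: "0 < (r :: real) \<Longrightarrow> exp (real k * ln r + ln 2 - B) = r ^ k * (2 * exp (- B))"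
  by (simp add: exp_add exp_diff exp_minus exp_of_nat_mult field_simps)

text \<open>With \<open>\<rho>\<close> slightly below \<open>2 * ln n / (- ln q)\<close>, two
  patterns agree with probability of order at least \<open>n powr (- 2 + \<epsilon>)\<close>, so
  \<open>N * sqrt Q\<close> is a positive power of \<open>n\<close>. It beats the cost
  \<open>\<rho> * ln n\<close> of the union bound, which is polylogarithmic by \<open>size\<close>.
  The exponent \<open>1 + \<epsilon> / 2\<close> of \<open>q\<close> leaves room for inexact sphere
  sizes.\<close>

lemma lower_patterns_aas:
  fixes q :: "nat \<Rightarrow> real" and \<epsilon> C :: real
  assumes \<epsilon>: "0 < \<epsilon>" "\<epsilon> \<le> 1 / 2"
    and q: "\<forall>\<^sub>F n in sequentially. 1 / 2 \<le> q n \<and> q n < 1"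
    and size: "\<forall>\<^sub>F n in sequentially. 2 * ln (real n) / (- ln (q n)) \<le> C * ln (real n) ^ 2"
  defines "\<rho> \<equiv> \<lambda>n. nat \<lfloor>(1 - \<epsilon>) * (2 * ln (real n) / (- ln (q n)))\<rfloor>"
  defines "y \<equiv> \<lambda>n. 3 * e n + 10 * real (\<rho> n) * x n"
  assumes ap: "\<forall>\<^sub>F n in sequentially. 20 * real (\<rho> n) * x n \<le> 1 \<and>
      (\<forall>s :: nat. s \<le> real (\<rho> n) * d n ^ i n * y n \<longrightarrow> 1 / 4 \<le> (1 - p n) ^ (2 * s)) \<and>
      (\<forall>s :: nat. d n ^ i n * (1 - real (\<rho> n) * y n) \<le> s \<longrightarrow> s \<le> d n ^ i n * (1 + 2 * e n) \<longrightarrow>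
        q n powr (1 + \<epsilon> / 2) \<le> ((1 - p n) ^ s)\<^sup>2 + (1 - (1 - p n) ^ s)\<^sup>2)"
  shows "aas p (\<lambda>n E. (1 - \<epsilon>) * (2 * ln (real n) / (- ln (q n))) \<le> beta n E)"
proof (rule aas_boundI[OF p_bounds _ inverse_n_lim[of 4]])
  have big: "\<forall>\<^sub>F n in sequentially. \<bar>C\<bar> * ln (real n) ^ 2 \<le> real n \<and> 8 \<le> n \<and> 1 \<le> ln (real n)"
    by (intro eventually_conj eventually_ge_at_top) (real_asymp, real_asymp)
  have big2: "\<forall>\<^sub>F n in sequentially. \<bar>C\<bar> * ln (real n) ^ 3 + ln 2 + ln (real n) \<le> real n powr (\<epsilon> / 2) / 128"
    using \<epsilon>(1) by real_asymp
  show "\<forall>\<^sub>F n in sequentially. P n (\<lambda>f. \<not> (1 - \<epsilon>) * (2 * ln (real n) / (- ln (q n))) \<le> beta n (gr n f)) \<le> 4 / real n"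
    using eventually_good q size ap big big2
  proof eventually_elim
    case (elim n)
    interpret gnp n "p n" by (rule gnp)
    have okn: "ok n" using elim(1) by blast
    note ok = okD[OF okn]
    let ?L = "ln (real n)" and ?f = "2 * ln (real n) / (- ln (q n))"
    have L1: "1 \<le> ?L" by (rule ok(14))
    have n0: "0 < real n" using ok(4) by simp
    have lq: "0 < - ln (q n)" using elim(2) by simp
    have f0: "0 \<le> ?f" using L1 lq by (intro divide_nonneg_pos) auto
    have f1: "0 \<le> (1 - \<epsilon>) * ?f" using f0 \<epsilon> by (intro mult_nonneg_nonneg) auto
    have \<rho>1: "real (\<rho> n) \<le> (1 - \<epsilon>) * ?f" "(1 - \<epsilon>) * ?f < real (\<rho> n) + 1"
      using f1 unfolding \<rho>_def by linarith+
    have "(1 - \<epsilon>) * ?f \<le> 1 * ?f" using f0 \<epsilon> by (intro mult_right_mono) auto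
    hence \<rho>C: "real (\<rho> n) \<le> \<bar>C\<bar> * ?L ^ 2" using \<rho>1(1) elim(3) mult_right_mono[OF abs_ge_self[of C], of "?L ^ 2"] by simp
    hence \<rho>n: "\<rho> n \<le> n" using elim(5) by simp
    define N where "N = n div 4"
    have N8: "real n / 8 \<le> real N"
    proof -
      have "n \<le> 8 * (n div 4)" using elim(5) by linarith
      hence "real n \<le> real (8 * (n div 4))" by (rule of_nat_mono)
      thus ?thesis by (simp add: N_def)
    qed
    have N0: "0 < N" using elim(5) by (simp add: N_def div_greater_zero_iff)
    have N2: "2 * real N \<le> n * (1 - 4 * \<rho> n * x n)"
    proof -
      have "2 * N \<le> n div 2" by (simp add: N_def)
      hence "4 * N \<le> n" by linarith
      hence "4 * real N \<le> real n" by (metis of_nat_le_iff of_nat_mult of_nat_numeral)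
      moreover have "real n * (1 / 2) \<le> n * (1 - 4 * \<rho> n * x n)" using elim(4) by (intro mult_left_mono) auto
      ultimately show ?thesis by simp
    qed
    define \<kappa> where "\<kappa> = q n powr (1 + \<epsilon> / 2)"
    define Q where "Q = 1 / 4 * \<kappa> ^ \<rho> n"
    have q0: "0 < q n" using elim(2) by linarith
    have Q_ge: "1 / 4 * (real n powr (- 2 + \<epsilon>)) \<le> Q"
    proof -
      have "\<kappa> ^ \<rho> n = exp (real (\<rho> n) * ((1 + \<epsilon> / 2) * ln (q n)))"
        using q0 by (simp add: \<kappa>_def powr_def exp_of_nat_mult)
      moreover have "real (\<rho> n) * (- ln (q n)) \<le> (1 - \<epsilon>) * (2 * ?L)"
      proof -
        have "real (\<rho> n) * (- ln (q n)) \<le> (1 - \<epsilon>) * ?f * (- ln (q n))" by (rule mult_right_mono[OF \<rho>1(1)]) (use lq in linarith)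
        also have "\<dots> = (1 - \<epsilon>) * (2 * ?L)" using lq by simp
        finally show ?thesis .
      qed
      hence "(1 + \<epsilon> / 2) * (real (\<rho> n) * (- ln (q n))) \<le> (1 + \<epsilon> / 2) * ((1 - \<epsilon>) * (2 * ?L))" using \<epsilon> by (intro mult_left_mono) auto
      \<comment> \<open>The slack in the exponent of \<open>q\<close> uses up half of the slack in
        \<open>\<rho>\<close>; the other half remains for the birthday bound.\<close>
      moreover have "(1 + \<epsilon> / 2) * ((1 - \<epsilon>) * (2 * ?L)) \<le> (2 - \<epsilon>) * ?L"
      proof -
        have "(1 + \<epsilon> / 2) * ((1 - \<epsilon>) * 2) \<le> 2 - \<epsilon>" using \<epsilon> by (simp add: algebra_simps)
        hence "(1 + \<epsilon> / 2) * ((1 - \<epsilon>) * 2) * ?L \<le> (2 - \<epsilon>) * ?L" by (rule mult_right_mono) (use L1 in simp)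
        thus ?thesis by (simp only: mult.assoc)
      qed
      ultimately have "(- 2 + \<epsilon>) * ?L \<le> real (\<rho> n) * ((1 + \<epsilon> / 2) * ln (q n))" by (simp add: algebra_simps)
      hence "real n powr (- 2 + \<epsilon>) \<le> \<kappa> ^ \<rho> n"
        using n0 \<open>\<kappa> ^ \<rho> n = _\<close> by (simp add: powr_def)
      thus ?thesis unfolding Q_def by simp
    qed
    have sQ: "1 / 2 * real n powr (- 1 + \<epsilon> / 2) \<le> sqrt Q"
    proof (rule real_le_rsqrt)
      have "(real n powr (- 1 + \<epsilon> / 2))\<^sup>2 = real n powr (- 2 + \<epsilon>)"
        by (simp add: power2_eq_square powr_add[symmetric])
      thus "(1 / 2 * real n powr (- 1 + \<epsilon> / 2))\<^sup>2 \<le> Q" using Q_ge by (simp add: power_mult_distrib power_divide)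
    qed
    have NQ: "real n powr (\<epsilon> / 2) / 128 \<le> N * sqrt Q / 8"
    proof -
      have "real n / 8 * (1 / 2 * real n powr (- 1 + \<epsilon> / 2)) \<le> N * sqrt Q" by (rule mult_mono[OF N8 sQ]) auto
      moreover have "real n powr (1 + (- 1 + \<epsilon> / 2)) = real n powr 1 * real n powr (- 1 + \<epsilon> / 2)" by (rule powr_add)
      hence "real n * real n powr (- 1 + \<epsilon> / 2) = real n powr (\<epsilon> / 2)" using n0 by simp
      moreover have "real n / 8 * (1 / 2 * real n powr (- 1 + \<epsilon> / 2)) = (real n * real n powr (- 1 + \<epsilon> / 2)) / 16" by simp
      ultimately have "real n powr (\<epsilon> / 2) / 16 \<le> N * sqrt Q" by (simp only:)
      thus ?thesis by simp
    qed
    have b: "real n ^ \<rho> n * (2 * exp (- (N * sqrt Q) / 8)) \<le> 1 / n"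
    proof -
      have "real (\<rho> n) * ?L \<le> \<bar>C\<bar> * ?L ^ 2 * ?L" using \<rho>C L1 by (intro mult_right_mono) auto
      hence "real (\<rho> n) * ?L + ln 2 - N * sqrt Q / 8 \<le> - ?L"
        using NQ elim(6) by (simp add: power3_eq_cube power2_eq_square mult.assoc)
      hence "exp (real (\<rho> n) * ?L + ln 2 - N * sqrt Q / 8) \<le> exp (- ?L)" by simp
      moreover have "exp (real (\<rho> n) * ?L + ln 2 - N * sqrt Q / 8) = real n ^ \<rho> n * (2 * exp (- (N * sqrt Q) / 8))"
        unfolding minus_divide_left[symmetric] by (rule exp_log_sum[OF n0])
      moreover have "exp (- ?L) = 1 / n" using n0 by (simp add: exp_minus inverse_eq_divide)
      ultimately show ?thesis by simp
    qed
    have yn: "y n = 3 * e n + 10 * real (\<rho> n) * x n" by (simp only: y_def)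
    have "pr (\<lambda>f. \<not> real (\<rho> n) < beta n (gr n f)) \<le> 4 / n"
    proof (rule beta_lower_patterns[OF ok(1-9) _ \<rho>n _ N0 _ yn _ _ _ _ Q_def b])
      show "pr (\<lambda>f. \<not> good_graph (\<delta> n) (i n) f) \<le> 3 / n" using elim(1) by blast
      show "20 * real (\<rho> n) * x n \<le> 1" using elim(4) by blast
      show "1 / 4 \<le> (1 - p n) ^ (2 * s)" if "real s \<le> real (\<rho> n) * d n ^ i n * y n" for s
        using elim(4) that by blast
      show "2 * real N \<le> real n * (1 - real (4 * \<rho> n) * x n)" using N2 by simp
      show "\<kappa> \<le> ((1 - p n) ^ s)\<^sup>2 + (1 - (1 - p n) ^ s)\<^sup>2"
        if "d n ^ i n * (1 - real (\<rho> n) * y n) \<le> s" "real s \<le> d n ^ i n * (1 + 2 * e n)" for s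
        using elim(4) that unfolding \<kappa>_def by blast
    qed (use q0 in \<open>auto simp: \<kappa>_def\<close>)
    moreover have imp: "(1 - \<epsilon>) * ?f \<le> beta n E" if "real (\<rho> n) < beta n E" for E
    proof -
      obtain k where "beta n E = real k" using beta_nat by blast
      thus ?thesis using that \<rho>1(2) by simp
    qed
    moreover have "pr (\<lambda>f. \<not> (1 - \<epsilon>) * ?f \<le> beta n (gr n f)) \<le> pr (\<lambda>f. \<not> real (\<rho> n) < beta n (gr n f))"
      by (rule pr_mono) (metis imp)
    ultimately show ?case by linarith
  qed
qed

text \<open>After both stages at least \<open>n powr (1 - \<kappa> + \<epsilon> / 2) / 4\<close>
  vertices are left for the chosen \<open>\<rho>\<close>, the mean being about
  \<open>n * exp (- \<rho> * (x + exp (- c)))\<close>. They have to outweigh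
  \<open>\<rho> * ln n\<close> in the union bound, whence the condition \<open>size\<close>. It will
  be used with \<open>\<kappa> = 1\<close> when \<open>h\<close> is polylogarithmic and with
  \<open>\<kappa> = \<eta>\<close> in general.\<close>

lemma lower_hits_aas:
  fixes \<kappa> :: "nat \<Rightarrow> real" and \<epsilon> :: real
  assumes i: "\<forall>\<^sub>F n in sequentially. 1 \<le> i n" and c: "filterlim c at_top sequentially"
    and \<epsilon>: "0 < \<epsilon>" "\<epsilon> \<le> 1 / 4"
    and \<kappa>: "\<forall>\<^sub>F n in sequentially. 1 / 2 \<le> \<kappa> n \<and> \<kappa> n \<le> 1"
  defines "h \<equiv> \<lambda>n. ln (real n) / (x n + exp (- c n))"
  assumes size: "\<forall>\<^sub>F n in sequentially. h n \<le> real n powr (1 - \<kappa> n) * ln (real n) ^ 2"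
  shows "aas p (\<lambda>n E. (\<kappa> n - \<epsilon>) * h n \<le> beta n E)"
proof (rule aas_boundI[OF p_bounds _ inverse_n_lim[of 4]])
  define \<zeta> where "\<zeta> = \<epsilon> / 16"
  have \<zeta>: "0 < \<zeta>" "\<zeta> \<le> 1 / 64" using \<epsilon> by (auto simp: \<zeta>_def)
  have \<zeta>': "0 < \<zeta> / 400" "0 < \<zeta> * \<zeta> / 400" using \<zeta> by auto
  have c_ge: "\<forall>\<^sub>F n in sequentially. K \<le> c n" for K using c by (simp add: filterlim_at_top)
  have c_exp: "\<forall>\<^sub>F n in sequentially. exp (- (c n / 2)) \<le> \<zeta> * \<zeta> / 32"
  proof -
    have pos: "0 < \<zeta> * \<zeta> / 32" using \<zeta> by simp
    show ?thesis using c_ge[of "- 2 * ln (\<zeta> * \<zeta> / 32)"]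
    proof eventually_elim
      case (elim n)
      hence "- (c n / 2) \<le> ln (\<zeta> * \<zeta> / 32)" by simp
      hence "exp (- (c n / 2)) \<le> exp (ln (\<zeta> * \<zeta> / 32))" by (simp only: exp_le_cancel_iff)
      thus ?case using pos by (simp only: exp_ln)
    qed
  qed
  have asy: "\<forall>\<^sub>F n in sequentially. 8 \<le> n \<and> ln (real n) ^ 3 + 2 * ln (real n) \<le> real n powr (\<epsilon> / 2) / 32 \<and>
      8 * exp 2 * real n powr (\<epsilon> / 4) \<le> real n powr (\<epsilon> / 2) \<and> 20 \<le> \<zeta> * ln (real n) \<and> 1 / real n \<le> \<zeta> / 400"
    using \<epsilon>(1) \<zeta>(1) \<zeta>'(1) by (intro eventually_conj eventually_ge_at_top) (real_asymp+)
  have x2: "\<forall>\<^sub>F n in sequentially. x n \<le> \<zeta> / 400" by (rule x_small[OF \<zeta>'(1)])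
  show "\<forall>\<^sub>F n in sequentially. P n (\<lambda>f. \<not> (\<kappa> n - \<epsilon>) * h n \<le> beta n (gr n f)) \<le> 4 / real n"
    using eventually_good i \<kappa> size c_ge[of "64 / \<zeta>"] c_exp asy x2 e_small[OF \<zeta>'(1)] d_pow[of 2 "400 / \<zeta>", simplified]
      params_small[OF i \<zeta>'(2)]
  proof eventually_elim
    case (elim n)
    interpret gnp n "p n" by (rule gnp)
    have okn: "ok n" using elim(1) by blast
    note ok = okD[OF okn]
    let ?L = "ln (real n)"
    have L1: "1 \<le> ?L" by (rule ok(14))
    have n0: "0 < real n" using ok(4) by simp
    have d0: "0 < d n" using ok(5) by linarith
    have x0: "0 < x n" by (rule ok(13))
    have i1: "1 \<le> i n" by (rule elim(2))
    have p0: "0 \<le> p n" using p_bounds[of n] by simp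
    have e0: "0 \<le> e n" "e n \<le> \<zeta> / 400" using ok(11) elim(9) by auto
    have c64: "64 / \<zeta> \<le> c n" by (rule elim(5))
    have "64 \<le> 64 / \<zeta>" using \<zeta> by (simp add: field_simps)
    hence c1: "64 \<le> c n" using c64 by linarith
    have Lc: "?L / c n \<le> \<zeta> / 64 * ?L"
    proof -
      have "64 \<le> \<zeta> * c n" using c64 \<zeta> by (simp add: field_simps)
      hence "64 * ?L \<le> \<zeta> * c n * ?L" using L1 by (intro mult_right_mono) auto
      thus ?thesis using c1 by (simp add: field_simps)
    qed
    have dL: "?L / d n \<le> \<zeta> / 400"
    proof -
      have "400 * ?L \<le> 400 * ?L\<^sup>2" using L1 by (simp add: power2_eq_square)
      hence "400 * ?L \<le> \<zeta> * d n" using elim(10) \<zeta> by (simp add: field_simps)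
      thus ?thesis using d0 by (simp add: field_simps)
    qed
    have dx: "d n / n \<le> x n"
    proof -
      have "d n ^ 1 \<le> d n ^ i n" using i1 ok(5) by (intro power_increasing) auto
      thus ?thesis by (simp add: x_def divide_right_mono)
    qed
    have px: "p n \<le> 2 * x n"
    proof -
      have "p n * n \<le> p n * (2 * (real n - 1))" using p0 ok(4) by (intro mult_left_mono) auto
      hence "p n \<le> 2 * (d n / n)" using ok(1,4) by (simp add: field_simps)
      thus ?thesis using dx by linarith
    qed
    define a where "a = exp (- c n)"
    define v where "v = x n + a"
    have v0: "0 < v" "x n \<le> v" "a \<le> v" using x0 by (auto simp: v_def a_def intro: add_pos_pos)
    have hv: "h n * v = ?L" using v0 by (simp add: h_def v_def a_def)
    have h0: "0 \<le> h n" using L1 v0 by (simp add: h_def v_def a_def)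
    define \<rho> where "\<rho> = nat \<lfloor>(\<kappa> n - \<epsilon>) * h n\<rfloor>"
    have k0: "0 \<le> \<kappa> n - \<epsilon>" "\<kappa> n - \<epsilon> \<le> 1" using elim(3) \<epsilon> by auto
    have "0 \<le> (\<kappa> n - \<epsilon>) * h n" using k0 h0 by simp
    hence \<rho>1: "real \<rho> \<le> (\<kappa> n - \<epsilon>) * h n" "(\<kappa> n - \<epsilon>) * h n < real \<rho> + 1" unfolding \<rho>_def by linarith+
    have \<rho>h: "real \<rho> \<le> h n" using \<rho>1(1) mult_right_mono[OF k0(2) h0] by simp
    have \<rho>v: "real \<rho> * v \<le> (\<kappa> n - \<epsilon>) * ?L"
    proof -
      have "real \<rho> * v \<le> (\<kappa> n - \<epsilon>) * h n * v" by (rule mult_right_mono[OF \<rho>1(1)]) (use v0 in simp)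
      also have "\<dots> = (\<kappa> n - \<epsilon>) * (h n * v)" by simp
      finally show ?thesis unfolding hv .
    qed
    have \<rho>L: "real \<rho> * v \<le> ?L"
    proof -
      have "(\<kappa> n - \<epsilon>) * ?L \<le> 1 * ?L" by (rule mult_right_mono[OF k0(2)]) (use L1 in simp)
      thus ?thesis using \<rho>v by simp
    qed
    have \<rho>x: "real \<rho> * x n \<le> ?L" using mult_left_mono[OF v0(2), of "real \<rho>"] \<rho>L by simp
    have \<rho>c: "real \<rho> / d n \<le> ?L / c n"
    proof -
      have "real \<rho> \<le> ?L / x n" using \<rho>x x0 by (simp add: pos_le_divide_eq)
      hence "real \<rho> / d n \<le> ?L / x n / d n" using d0 by (intro divide_right_mono) auto
      thus ?thesis by (simp add: c_x)
    qed
    have \<rho>n: "\<rho> \<le> n"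
    proof -
      have "real \<rho> * (d n / n) \<le> ?L" using mult_left_mono[OF dx, of "real \<rho>"] \<rho>x by simp
      hence "real \<rho> \<le> ?L / d n * n" using d0 n0 by (simp add: field_simps)
      also have "\<dots> \<le> 1 * real n" using dL \<zeta> by (intro mult_right_mono) linarith+
      finally show ?thesis by simp
    qed
    have dpow: "d n ^ i n = d n ^ (i n - 1) * d n" using i1 by (simp add: power_eq_if)
    \<comment> \<open>All balls of radius \<open>i - 1\<close> together hold at most
      \<open>4 * ln n / c\<close> times the size of one sphere, because \<open>\<rho>\<close> is at
      most \<open>ln n / x\<close> and \<open>c = x * d\<close>.\<close>
    have W: "4 * \<rho> * d n ^ (i n - 1) \<le> 4 * (?L / c n) * d n ^ i n"
    proof -
      have "4 * \<rho> * d n ^ (i n - 1) = 4 * (real \<rho> / d n) * d n ^ i n" unfolding dpow using d0 by simp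
      also have "\<dots> \<le> 4 * (?L / c n) * d n ^ i n" using \<rho>c d0 by (intro mult_right_mono) auto
      finally show ?thesis .
    qed
    have Lcx: "?L / c n * x n = ?L / d n" using x0 d0 by (simp add: c_x)
    \<comment> \<open>After errors, a landmark without half of its sphere has
      \<open>d ^ i / 4\<close> of it in the inner balls, so \<open>16 * ln n / c\<close> is the
      limit. As \<open>c\<close> tends to infinity, \<open>2 ^ mb\<close> is at most a small power
      of \<open>n\<close>.\<close>
    define mb where "mb = nat \<lfloor>16 * (?L / c n)\<rfloor> + 1"
    have Lc0: "0 \<le> ?L / c n" using L1 c1 by simp
    have mb: "16 * (?L / c n) < mb" "mb \<le> 16 * (?L / c n) + 1" using Lc0 unfolding mb_def by linarith+
    have mbx: "mb * x n \<le> \<zeta> / 20"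
    proof -
      have "mb * x n \<le> (16 * (?L / c n) + 1) * x n" using mb(2) x0 by (intro mult_right_mono) auto
      also have "\<dots> = 16 * (?L / d n) + x n" using Lcx by (simp add: distrib_right)
      finally show ?thesis using dL elim(8) \<zeta> by linarith
    qed
    have mb1: "20 * real mb * x n \<le> 1" using mbx \<zeta> by (simp add: mult.assoc)
    have mb2: "4 * \<rho> * d n ^ (i n - 1) < mb * d n ^ i n * (1 / 2 - e n - 10 * mb * x n)"
    proof -
      have "4 * (?L / c n) * d n ^ i n < mb * (1 / 4) * d n ^ i n" using mb(1) d0 by (intro mult_strict_right_mono) auto
      also have "\<dots> \<le> mb * (1 / 2 - e n - 10 * mb * x n) * d n ^ i n"
        using mbx e0 \<zeta> d0 by (intro mult_right_mono mult_left_mono) (auto simp: mult.assoc)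
      finally show ?thesis using W by (simp add: mult_ac)
    qed
    \<comment> \<open>For \<open>c \<le> 2 * ln n\<close>, losing the fraction
      \<open>\<zeta> / c\<close> of a sphere changes \<open>exp (- c)\<close> only by the factor
      \<open>exp \<zeta>\<close>. For larger \<open>c\<close> even \<open>exp (- c / 2)\<close> is
      below \<open>1 / n\<close>, so half a sphere is good enough.\<close>
    define \<gamma> where "\<gamma> = (if c n \<le> 2 * ?L then \<zeta> / c n else 1 / 2)"
    \<comment> \<open>In the first case \<open>8 * ln n / \<zeta>\<close> comes from comparing
      \<open>mm * \<zeta> / (2 * c)\<close> with \<open>4 * ln n / c\<close>. The exceptional
      landmarks cost \<open>exp (- c / 2)\<close> each, in total at most
      \<open>\<zeta> * ln n\<close>.\<close>
    define mm where "mm = (if c n \<le> 2 * ?L then nat \<lfloor>8 * ?L / \<zeta>\<rfloor> + 1 else mb)"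
    have \<gamma>: "0 \<le> \<gamma>" "\<gamma> \<le> 1 / 2" using \<zeta> c1 by (auto simp: \<gamma>_def field_simps)
    have mm: "20 * real mm * x n \<le> 1" "4 * \<rho> * d n ^ (i n - 1) < mm * d n ^ i n * (\<gamma> - e n - 10 * mm * x n)"
      "mm * exp (- (c n / 2)) \<le> \<zeta> * ?L" "\<rho> * exp (- (c n * (1 - \<gamma>))) \<le> (1 + 2 * \<zeta>) * (\<rho> * a) + \<zeta> * ?L"
    proof -
      have "20 * real mm * x n \<le> 1 \<and> 4 * \<rho> * d n ^ (i n - 1) < mm * d n ^ i n * (\<gamma> - e n - 10 * mm * x n) \<and>
        mm * exp (- (c n / 2)) \<le> \<zeta> * ?L \<and> \<rho> * exp (- (c n * (1 - \<gamma>))) \<le> (1 + 2 * \<zeta>) * (\<rho> * a) + \<zeta> * ?L"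
      proof (cases "c n \<le> 2 * ?L")
        case True
        have sm: "?L * e n \<le> \<zeta> * \<zeta> / 400" "?L ^ 3 * x n \<le> \<zeta> * \<zeta> / 400" using elim(11) True by blast+
        have q0: "0 \<le> 8 * ?L / \<zeta>" using L1 \<zeta> by simp
        have mmb: "8 * ?L / \<zeta> < mm" "mm \<le> 8 * ?L / \<zeta> + 1" using q0 True unfolding mm_def by (simp_all, linarith+)
        have mm9: "mm \<le> 9 * ?L / \<zeta>"
        proof -
          have "1 * 1 \<le> ?L * (1 / \<zeta>)" using L1 \<zeta> by (intro mult_mono) (auto simp: field_simps)
          thus ?thesis using mmb(2) by simp
        qed
        have mmx: "?L * (mm * x n) \<le> \<zeta> * (9 / 400)"
        proof -
          have "?L * (mm * x n) \<le> ?L * (9 * ?L / \<zeta> * x n)" using mm9 L1 x0 by (intro mult_left_mono mult_right_mono) auto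
          also have "\<dots> = 9 / \<zeta> * (?L\<^sup>2 * x n)" by (simp add: power2_eq_square)
          also have "\<dots> \<le> 9 / \<zeta> * (?L ^ 3 * x n)" using L1 x0 \<zeta> by (intro mult_left_mono mult_right_mono power_increasing) auto
          also have "\<dots> \<le> 9 / \<zeta> * (\<zeta> * \<zeta> / 400)" using sm(2) \<zeta> by (intro mult_left_mono) auto
          also have "\<dots> = \<zeta> * (9 / 400)" using \<zeta> by simp
          finally show ?thesis .
        qed
        have "1 * (mm * x n) \<le> ?L * (mm * x n)" by (rule mult_right_mono[OF L1]) (use x0 in simp)
        hence mmx1: "mm * x n \<le> \<zeta> * (9 / 400)" using mmx by linarith
        have 1: "20 * real mm * x n \<le> 1" using mmx1 \<zeta> by (simp add: mult.assoc)
        have "c n * (e n + 10 * (mm * x n)) \<le> 2 * ?L * (e n + 10 * (mm * x n))"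
          using True e0 x0 by (intro mult_right_mono) auto
        also have "\<dots> = 2 * (?L * e n) + 20 * (?L * (mm * x n))" by (simp add: algebra_simps)
        also have "\<dots> \<le> \<zeta> / 2"
        proof -
          have "\<zeta> * \<zeta> \<le> \<zeta> * (1 / 64)" using \<zeta> by (intro mult_left_mono) auto
          thus ?thesis using sm(1) mmx \<zeta> by linarith
        qed
        finally have "e n + 10 * (mm * x n) \<le> \<zeta> / (2 * c n)" using c1 by (simp add: field_simps)
        hence g: "\<zeta> / (2 * c n) \<le> \<gamma> - e n - 10 * mm * x n" using True c1 unfolding \<gamma>_def by (simp add: field_simps)
        have "4 * (?L / c n) * d n ^ i n < mm * (\<zeta> / (2 * c n)) * d n ^ i n"
        proof (rule mult_strict_right_mono)
          have "8 * ?L / \<zeta> * (\<zeta> / (2 * c n)) < mm * (\<zeta> / (2 * c n))" using mmb(1) \<zeta> c1 by (intro mult_strict_right_mono) auto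
          moreover have "8 * ?L / \<zeta> * (\<zeta> / (2 * c n)) = 4 * (?L / c n)" using \<zeta> c1 by simp
          ultimately show "4 * (?L / c n) < mm * (\<zeta> / (2 * c n))" by linarith
        qed (use d0 in simp)
        also have "\<dots> \<le> mm * (\<gamma> - e n - 10 * mm * x n) * d n ^ i n" using g d0 by (intro mult_right_mono mult_left_mono) auto
        finally have 2: "4 * \<rho> * d n ^ (i n - 1) < mm * d n ^ i n * (\<gamma> - e n - 10 * mm * x n)" using W by (simp add: mult_ac)
        have "mm * exp (- (c n / 2)) \<le> 9 * ?L / \<zeta> * (\<zeta> * \<zeta> / 32)" using mm9 elim(6) L1 \<zeta> by (intro mult_mono) auto
        also have "\<dots> = 9 / 32 * (\<zeta> * ?L)" using \<zeta> by simp
        also have "\<dots> \<le> 1 * (\<zeta> * ?L)" using \<zeta> L1 by (intro mult_right_mono) auto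
        finally have 3: "mm * exp (- (c n / 2)) \<le> \<zeta> * ?L" by simp
        have "c n * (1 - \<gamma>) = c n - \<zeta>" using True c1 unfolding \<gamma>_def by (simp add: field_simps)
        hence "exp (- (c n * (1 - \<gamma>))) = exp \<zeta> * a" by (simp add: a_def mult_exp_exp)
        also have "\<dots> \<le> (1 + 2 * \<zeta>) * a" using \<zeta> by (intro mult_right_mono exp_small) (auto simp: a_def)
        finally have "\<rho> * exp (- (c n * (1 - \<gamma>))) \<le> \<rho> * ((1 + 2 * \<zeta>) * a)" by (intro mult_left_mono) auto
        moreover have "0 \<le> \<zeta> * ?L" using \<zeta> L1 by simp
        ultimately have 4: "\<rho> * exp (- (c n * (1 - \<gamma>))) \<le> (1 + 2 * \<zeta>) * (\<rho> * a) + \<zeta> * ?L" by (simp add: mult.left_commute)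
        show ?thesis using 1 2 3 4 by blast
      next
        case False
        have mmb: "mm = mb" and \<gamma>h: "\<gamma> = 1 / 2" using False by (simp_all add: mm_def \<gamma>_def)
        have 2: "4 * \<rho> * d n ^ (i n - 1) < mm * d n ^ i n * (\<gamma> - e n - 10 * mm * x n)" unfolding mmb \<gamma>h by (rule mb2)
        have "?L / c n \<le> 1" using False L1 c1 by (simp add: field_simps)
        hence "mb \<le> 17" using mb(2) by linarith
        hence "mb * exp (- (c n / 2)) \<le> 17 * 1" using c1 by (intro mult_mono) auto
        hence 3: "mm * exp (- (c n / 2)) \<le> \<zeta> * ?L" using elim(7) unfolding mmb by linarith
        have "exp (- (c n * (1 - \<gamma>))) \<le> exp (- ?L)" using False unfolding \<gamma>h by simp
        also have "\<dots> = 1 / n" using n0 by (simp add: exp_minus inverse_eq_divide)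
        finally have "\<rho> * exp (- (c n * (1 - \<gamma>))) \<le> n * (1 / n)" using \<rho>n by (intro mult_mono) auto
        moreover have "0 \<le> (1 + 2 * \<zeta>) * (\<rho> * a)" using \<zeta> by (simp add: a_def)
        ultimately have 4: "\<rho> * exp (- (c n * (1 - \<gamma>))) \<le> (1 + 2 * \<zeta>) * (\<rho> * a) + \<zeta> * ?L" using elim(7) n0 by simp
        show ?thesis using 2 3 4 mb1 unfolding mmb by blast
      qed
      thus "20 * real mm * x n \<le> 1" "4 * \<rho> * d n ^ (i n - 1) < mm * d n ^ i n * (\<gamma> - e n - 10 * mm * x n)"
        "mm * exp (- (c n / 2)) \<le> \<zeta> * ?L" "\<rho> * exp (- (c n * (1 - \<gamma>))) \<le> (1 + 2 * \<zeta>) * (\<rho> * a) + \<zeta> * ?L" by blast+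
    qed
    have Wn: "4 * \<rho> * d n ^ (i n - 1) \<le> n / 2"
    proof -
      have "4 * (?L / c n) * d n ^ i n = 4 * (?L / c n * x n) * n" using n0 by (simp add: x_def)
      also have "\<dots> \<le> 4 * (\<zeta> / 400) * n" unfolding Lcx using dL by (intro mult_right_mono mult_left_mono) auto
      also have "\<dots> \<le> 1 / 2 * n" using \<zeta> by (intro mult_right_mono) auto
      finally show ?thesis using W by simp
    qed
    \<comment> \<open>By \<open>Wn\<close> the inner balls take at most half of the vertices; the
      exponential is the chance of missing the inner sphere, as
      \<open>\<rho> * d ^ (i - 1) * d / n = \<rho> * x\<close>.\<close>
    define m1 where "m1 = n / 2 * exp (- ((1 + \<zeta>) * (\<rho> * x n)))"
    define S where "S = \<rho> * exp (- (c n * (1 - \<gamma>))) + mm * exp (- (c n / 2))"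
    define m2 where "m2 = m1 / 2 * exp (- ((1 + \<zeta>) * S))"
    have m1: "m1 \<le> (n - 4 * \<rho> * d n ^ (i n - 1)) * (1 - p n) ^ s" if s: "s \<le> \<rho> * d n ^ (i n - 1) * (1 + 2 * e n)" for s :: nat
    proof -
      have pe: "p n \<le> 1 / 8" "e n \<le> 1 / 8" using px elim(8) e0 \<zeta> by linarith+
      have "exp (- (\<rho> * d n ^ (i n - 1) * d n / n * (1 + 8 * (e n + p n + 1 / n)))) \<le> (1 - p n) ^ s"
        by (rule miss_ge[OF okn pe _ s]) (use elim(7) d0 in auto)
      moreover have "\<rho> * d n ^ (i n - 1) * d n / n = \<rho> * x n" unfolding x_def dpow by simp
      moreover have "\<rho> * x n * (1 + 8 * (e n + p n + 1 / n)) \<le> \<rho> * x n * (1 + \<zeta>)"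
      proof (rule mult_left_mono)
        have "8 * (u + w + z) \<le> \<zeta>" if "u \<le> \<zeta> / 400" "w \<le> 2 * (\<zeta> / 400)" "z \<le> \<zeta> / 400" for u w z :: real
          using that \<zeta> by (simp add: algebra_simps)
        from this[of "e n" "p n" "1 / n"] show "1 + 8 * (e n + p n + 1 / n) \<le> 1 + \<zeta>" using e0 px elim(7,8) by linarith
      qed (use x0 in simp)
      ultimately have ex1: "exp (- ((1 + \<zeta>) * (\<rho> * x n))) \<le> (1 - p n) ^ s"
        by (intro order.trans[OF _ \<open>exp _ \<le> (1 - p n) ^ s\<close>]) (simp add: mult.commute)
      show ?thesis unfolding m1_def by (intro mult_mono[OF _ ex1]) (use Wn in auto)
    qed
    have m2_ge: "real n powr (1 - \<kappa> n + \<epsilon> / 2) / 4 \<le> m2"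
    proof -
      have S: "S \<le> (1 + 2 * \<zeta>) * (\<rho> * a) + 2 * \<zeta> * ?L" unfolding S_def using mm(3,4) by linarith
      have "(1 + \<zeta>) * (\<rho> * x n) + (1 + \<zeta>) * S \<le> (1 + \<zeta>) * ((1 + 2 * \<zeta>) * (\<rho> * v) + 2 * \<zeta> * ?L)"
      proof -
        have "1 * (\<rho> * x n) \<le> (1 + 2 * \<zeta>) * (\<rho> * x n)" by (rule mult_right_mono) (use x0 \<zeta> in auto)
        hence "\<rho> * x n \<le> (1 + 2 * \<zeta>) * (\<rho> * x n)" by simp
        hence "\<rho> * x n + S \<le> (1 + 2 * \<zeta>) * (\<rho> * v) + 2 * \<zeta> * ?L" using S unfolding v_def by (simp add: algebra_simps)
        hence "(1 + \<zeta>) * (\<rho> * x n + S) \<le> (1 + \<zeta>) * ((1 + 2 * \<zeta>) * (\<rho> * v) + 2 * \<zeta> * ?L)" using \<zeta> by (intro mult_left_mono) auto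
        thus ?thesis by (simp add: distrib_left)
      qed
      also have "\<dots> \<le> (1 + \<zeta>) * ((1 + 2 * \<zeta>) * ((\<kappa> n - \<epsilon>) * ?L) + 2 * \<zeta> * ?L)"
        using \<rho>v \<zeta> by (intro mult_left_mono add_right_mono) auto
      also have "\<dots> \<le> (\<kappa> n - \<epsilon> / 2) * ?L"
      proof -
        have "(1 + \<zeta>) * (1 + 2 * \<zeta>) \<le> 1 + 4 * \<zeta>"
        proof -
          have "\<zeta> * \<zeta> \<le> \<zeta> * (1 / 64)" using \<zeta> by (intro mult_left_mono) auto
          thus ?thesis using \<zeta> by (simp add: algebra_simps)
        qed
        hence "(1 + \<zeta>) * (1 + 2 * \<zeta>) * (\<kappa> n - \<epsilon>) \<le> (1 + 4 * \<zeta>) * (\<kappa> n - \<epsilon>)" using k0 by (intro mult_right_mono) auto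
        also have "\<dots> \<le> (\<kappa> n - \<epsilon>) + 4 * \<zeta>"
        proof -
          have "4 * \<zeta> * (\<kappa> n - \<epsilon>) \<le> 4 * \<zeta> * 1" by (rule mult_left_mono[OF k0(2)]) (use \<zeta> in simp)
          moreover have "(1 + 4 * \<zeta>) * (\<kappa> n - \<epsilon>) = (\<kappa> n - \<epsilon>) + 4 * \<zeta> * (\<kappa> n - \<epsilon>)" by (simp only: distrib_right mult_1_left)
          ultimately show ?thesis by linarith
        qed
        finally have A: "(1 + \<zeta>) * (1 + 2 * \<zeta>) * (\<kappa> n - \<epsilon>) \<le> (\<kappa> n - \<epsilon>) + 4 * \<zeta>" .
        have "(1 + \<zeta>) * (2 * \<zeta>) \<le> 2 * (2 * \<zeta>)" by (rule mult_right_mono) (use \<zeta> in auto)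
        hence B: "(1 + \<zeta>) * (2 * \<zeta>) \<le> 4 * \<zeta>" by simp
        have "((1 + \<zeta>) * (1 + 2 * \<zeta>) * (\<kappa> n - \<epsilon>) + (1 + \<zeta>) * (2 * \<zeta>)) * ?L \<le> (\<kappa> n - \<epsilon> / 2) * ?L"
        proof (rule mult_right_mono)
          have "\<epsilon> = 16 * \<zeta>" by (simp add: \<zeta>_def)
          thus "(1 + \<zeta>) * (1 + 2 * \<zeta>) * (\<kappa> n - \<epsilon>) + (1 + \<zeta>) * (2 * \<zeta>) \<le> \<kappa> n - \<epsilon> / 2" using A B by linarith
        qed (use L1 in simp)
        thus ?thesis by (simp only: distrib_left distrib_right mult.assoc mult.left_commute)
      qed
      finally have ex: "(1 + \<zeta>) * (\<rho> * x n) + (1 + \<zeta>) * S \<le> (\<kappa> n - \<epsilon> / 2) * ?L" .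
      have "m2 = n / 4 * exp (- ((1 + \<zeta>) * (\<rho> * x n) + (1 + \<zeta>) * S))"
        unfolding m2_def m1_def by (simp add: exp_add exp_minus exp_diff field_simps)
      moreover have "n / 4 * exp (- ((\<kappa> n - \<epsilon> / 2) * ?L)) \<le> n / 4 * exp (- ((1 + \<zeta>) * (\<rho> * x n) + (1 + \<zeta>) * S))"
        using ex by (intro mult_left_mono) auto
      moreover have "n / 4 * exp (- ((\<kappa> n - \<epsilon> / 2) * ?L)) = real n powr (1 - \<kappa> n + \<epsilon> / 2) / 4"
      proof -
        have "real n powr (1 + (- (\<kappa> n - \<epsilon> / 2))) = real n powr 1 * real n powr (- (\<kappa> n - \<epsilon> / 2))" by (rule powr_add)
        moreover have "real n powr (- (\<kappa> n - \<epsilon> / 2)) = exp (- ((\<kappa> n - \<epsilon> / 2) * ?L))" using n0 by (simp add: powr_def algebra_simps)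
        moreover have "real n powr (1 + (- (\<kappa> n - \<epsilon> / 2))) = real n powr (1 - \<kappa> n + \<epsilon> / 2)"
          by (rule arg_cong[where f = "\<lambda>t. real n powr t"]) simp
        ultimately have "real n powr (1 - \<kappa> n + \<epsilon> / 2) = real n * exp (- ((\<kappa> n - \<epsilon> / 2) * ?L))"
          using n0 by (simp only: powr_one[OF less_imp_le[OF n0]])
        thus ?thesis by (simp only: times_divide_eq_left)
      qed
      ultimately show ?thesis by linarith
    qed
    have nk: "real n powr (1 - \<kappa> n + \<epsilon> / 2) = real n powr (1 - \<kappa> n) * real n powr (\<epsilon> / 2)" by (rule powr_add)
    have nk1: "1 \<le> real n powr (1 - \<kappa> n)" using elim(3) ok(4) by (intro ge_one_powr_ge_zero) auto
    have m2': "2 * 2 ^ mb \<le> m2"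
    proof -
      have "(2 :: real) ^ mb \<le> exp 1 ^ mb" using exp_ge_add_one_self[of 1] by (intro power_mono) auto
      also have "\<dots> = exp (real mb)" by (simp add: exp_of_nat_mult[symmetric])
      also have "\<dots> \<le> exp (2 + \<epsilon> / 4 * ?L)"
      proof -
        have "16 * (?L / c n) \<le> \<epsilon> / 4 * ?L"
        proof -
          have "16 * (?L / c n) \<le> 16 * (\<zeta> / 64 * ?L)" using Lc by linarith
          also have "\<dots> = \<epsilon> / 64 * ?L" by (simp add: \<zeta>_def)
          also have "\<dots> \<le> \<epsilon> / 4 * ?L" using \<epsilon> L1 by (intro mult_right_mono) auto
          finally show ?thesis .
        qed
        thus ?thesis using mb(2) by simp
      qed
      also have "\<dots> = exp 2 * real n powr (\<epsilon> / 4)" using n0 by (simp add: exp_add powr_def)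
      finally have "2 * 2 ^ mb \<le> real n powr (\<epsilon> / 2) / 4" using elim(7) by linarith
      also have "\<dots> \<le> real n powr (1 - \<kappa> n + \<epsilon> / 2) / 4" unfolding nk using mult_right_mono[OF nk1, of "real n powr (\<epsilon> / 2)"] by simp
      finally show ?thesis using m2_ge by linarith
    qed
    have b: "real n ^ \<rho> * (2 * exp (- m2 / 8)) \<le> 1 / n"
    proof -
      have "real \<rho> * ?L + 2 * ?L \<le> real n powr (1 - \<kappa> n) * (?L ^ 3 + 2 * ?L)"
      proof -
        have "real \<rho> * ?L \<le> real n powr (1 - \<kappa> n) * ?L ^ 2 * ?L" using \<rho>h elim(4) L1 by (intro mult_right_mono) auto
        moreover have "1 * (2 * ?L) \<le> real n powr (1 - \<kappa> n) * (2 * ?L)" using nk1 L1 by (intro mult_right_mono) auto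
        ultimately show ?thesis by (simp add: distrib_left power3_eq_cube power2_eq_square mult.assoc)
      qed
      also have "\<dots> \<le> real n powr (1 - \<kappa> n) * (real n powr (\<epsilon> / 2) / 32)" using elim(7) by (intro mult_left_mono) auto
      also have "\<dots> = real n powr (1 - \<kappa> n + \<epsilon> / 2) / 32" unfolding nk by simp
      also have "\<dots> \<le> m2 / 8" using m2_ge by simp
      finally have "real \<rho> * ?L + ln 2 - m2 / 8 \<le> - ?L" using L1 ln_2_less_1 by linarith
      hence "exp (real \<rho> * ?L + ln 2 - m2 / 8) \<le> exp (- ?L)" by simp
      moreover have "exp (real \<rho> * ?L + ln 2 - m2 / 8) = real n ^ \<rho> * (2 * exp (- m2 / 8))"
        unfolding minus_divide_left[symmetric] by (rule exp_log_sum[OF n0])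
      moreover have "exp (- ?L) = 1 / n" using n0 by (simp add: exp_minus inverse_eq_divide)
      ultimately show ?thesis by simp
    qed
    have m10: "0 \<le> m1" by (simp add: m1_def)
    have S0: "0 \<le> S" by (simp add: S_def)
    have m21: "m2 \<le> m1"
    proof -
      have "m2 \<le> m1 / 2 * 1" unfolding m2_def using m10 S0 \<zeta> by (intro mult_left_mono) auto
      thus ?thesis using m10 by linarith
    qed
    have "pr (\<lambda>f. \<not> real \<rho> < beta n (gr n f)) \<le> 4 / n"
    proof (rule beta_lower_hits[OF ok(1-9) _ c_x i1 \<rho>n mb1 mb2 mm(1,2) \<gamma> _ _ m1 _ m2' _ m21 b, where \<epsilon> = \<zeta>])
      show "pr (\<lambda>f. \<not> good_graph (\<delta> n) (i n) f) \<le> 3 / n" using elim(1) by blast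
      have "\<zeta> * \<zeta> \<le> \<zeta> * (1 / 64)" using \<zeta> by (intro mult_left_mono) auto
      thus "2 * exp (- (c n / 2)) \<le> \<zeta>" using elim(6) \<zeta> by linarith
      show "m2 \<le> m1 / 2 * exp (- ((1 + \<zeta>) * (\<rho> * exp (- (c n * (1 - \<gamma>))) + mm * exp (- (c n / 2)))))"
        unfolding m2_def S_def by simp
      show "4 * \<rho> * d n ^ (i n - 1) \<le> n" using Wn n0 by linarith
    qed (use \<zeta> in auto)
    moreover have imp: "(\<kappa> n - \<epsilon>) * h n \<le> beta n E" if "real \<rho> < beta n E" for E
    proof -
      obtain k where "beta n E = real k" using beta_nat by blast
      thus ?thesis using that \<rho>1(2) by simp
    qed
    moreover have "pr (\<lambda>f. \<not> (\<kappa> n - \<epsilon>) * h n \<le> beta n (gr n f)) \<le> pr (\<lambda>f. \<not> real \<rho> < beta n (gr n f))"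
      by (rule pr_mono) (metis imp)
    ultimately show ?case by linarith
  qed
qed

end

section \<open>From fixed tolerances to asymptotic statements\<close>

lemma prob_inter_ge: "measure_pmf.prob M A + measure_pmf.prob M B - 1 \<le> measure_pmf.prob M (A \<inter> B)"
proof -
  have "measure_pmf.prob M A \<le> measure_pmf.prob M ((A \<inter> B) \<union> - B)" by (rule measure_pmf.finite_measure_mono) auto
  also have "\<dots> \<le> measure_pmf.prob M (A \<inter> B) + measure_pmf.prob M (- B)" by (rule measure_Un_le) auto
  also have "measure_pmf.prob M (- B) = 1 - measure_pmf.prob M B"
    using measure_pmf.prob_compl[of B M] by (simp add: Compl_eq_Diff_UNIV)
  finally show ?thesis by simp
qed

lemma aas_mono:
  assumes "aas p Q" "\<forall>\<^sub>F n in sequentially. \<forall>E. Q n E \<longrightarrow> Q' n E" shows "aas p Q'"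
  unfolding aas_def
proof (rule tendsto_sandwich[where h = "\<lambda>_. 1"])
  show "(\<lambda>n. measure_pmf.prob (random_graph n (p n)) {E. Q n E}) \<longlonglongrightarrow> 1" using assms(1) by (simp add: aas_def)
  show "\<forall>\<^sub>F n in sequentially. measure_pmf.prob (random_graph n (p n)) {E. Q n E} \<le> measure_pmf.prob (random_graph n (p n)) {E. Q' n E}"
    using assms(2) by eventually_elim (auto intro: measure_pmf.finite_measure_mono)
qed auto

lemma aas_conj:
  assumes "aas p Q" "aas p Q'" shows "aas p (\<lambda>n E. Q n E \<and> Q' n E)"
  unfolding aas_def
proof (rule tendsto_sandwich[where h = "\<lambda>_. 1"])
  let ?P = "\<lambda>Q n. measure_pmf.prob (random_graph n (p n)) {E. Q n E}"
  have "(\<lambda>n. ?P Q n + ?P Q' n - 1) \<longlonglongrightarrow> 1 + 1 - 1"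
    using assms unfolding aas_def by (intro tendsto_intros)
  thus "(\<lambda>n. ?P Q n + ?P Q' n - 1) \<longlonglongrightarrow> 1" by simp
  show "\<forall>\<^sub>F n in sequentially. ?P Q n + ?P Q' n - 1 \<le> ?P (\<lambda>n E. Q n E \<and> Q' n E) n"
  proof (rule always_eventually, rule allI)
    fix n
    have "{E. Q n E \<and> Q' n E} = {E. Q n E} \<inter> {E. Q' n E}" by auto
    thus "?P Q n + ?P Q' n - 1 \<le> ?P (\<lambda>n E. Q n E \<and> Q' n E) n" using prob_inter_ge[of "random_graph n (p n)"] by simp
  qed
qed auto

lemma aas_diagonal:
  fixes Q :: "real \<Rightarrow> nat \<Rightarrow> nat set set \<Rightarrow> bool"
  assumes Q: "\<And>\<epsilon>. 0 < \<epsilon> \<Longrightarrow> aas p (Q \<epsilon>)"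
  shows "\<exists>\<delta> :: nat \<Rightarrow> real. \<delta> \<longlonglongrightarrow> 0 \<and> (\<forall>n. 0 < \<delta> n) \<and> aas p (\<lambda>n. Q (\<delta> n) n)"
proof -
  let ?\<epsilon> = "\<lambda>k :: nat. 1 / (real k + 1)"
  let ?P = "\<lambda>\<epsilon> n. measure_pmf.prob (random_graph n (p n)) {E. Q \<epsilon> n E}"
  have "\<exists>N. \<forall>n\<ge>N. 1 - ?\<epsilon> k < ?P (?\<epsilon> k) n" for k
  proof -
    have "(\<lambda>n. ?P (?\<epsilon> k) n) \<longlonglongrightarrow> 1" using Q[of "?\<epsilon> k"] by (simp add: aas_def)
    hence "\<forall>\<^sub>F n in sequentially. 1 - ?\<epsilon> k < ?P (?\<epsilon> k) n" by (rule order_tendstoD(1)) simp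
    thus ?thesis by (simp add: eventually_sequentially)
  qed
  then obtain N where N: "\<And>k n. N k \<le> n \<Longrightarrow> 1 - ?\<epsilon> k < ?P (?\<epsilon> k) n" by metis
  define S where "S n = {k. k \<le> n \<and> N k \<le> n}" for n
  \<comment> \<open>Inserting 0 keeps the maximum defined for the \<open>n\<close> that have passed
    no threshold.\<close>
  define m where "m n = Max (insert 0 (S n))" for n
  have fS: "finite (insert 0 (S n))" for n unfolding S_def by simp
  have m_ge: "K \<le> m n" if "K \<le> n" "N K \<le> n" for K n
    unfolding m_def by (rule Max_ge[OF fS]) (use that in \<open>simp add: S_def\<close>)
  have m_in: "N (m n) \<le> n" if "N 0 \<le> n" for n
  proof -
    have "m n \<in> insert 0 (S n)" unfolding m_def by (rule Max_in[OF fS]) simp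
    thus ?thesis using that by (auto simp: S_def)
  qed
  have "filterlim m at_top sequentially"
    unfolding filterlim_at_top
  proof
    fix K show "\<forall>\<^sub>F n in sequentially. K \<le> m n"
      using eventually_ge_at_top[of K] eventually_ge_at_top[of "N K"] by eventually_elim (rule m_ge)
  qed
  hence lim: "(\<lambda>n. ?\<epsilon> (m n)) \<longlonglongrightarrow> 0"
    by (rule filterlim_compose[rotated]) real_asymp
  have "aas p (\<lambda>n. Q (?\<epsilon> (m n)) n)"
    unfolding aas_def
  proof (rule tendsto_sandwich[where h = "\<lambda>_. 1"])
    show "(\<lambda>n. 1 - ?\<epsilon> (m n)) \<longlonglongrightarrow> 1" using tendsto_diff[OF tendsto_const[of 1] lim] by simp
    show "\<forall>\<^sub>F n in sequentially. 1 - ?\<epsilon> (m n) \<le> ?P (?\<epsilon> (m n)) n"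
      using eventually_ge_at_top[of "N 0"] by eventually_elim (rule less_imp_le, rule N, rule m_in)
  qed auto
  thus ?thesis using lim by (intro exI[of _ "\<lambda>n. ?\<epsilon> (m n)"]) auto
qed

lemma smallo_1I: "\<delta> \<longlonglongrightarrow> 0 \<Longrightarrow> (\<delta> :: nat \<Rightarrow> real) \<in> o(\<lambda>_. 1)"
  by (rule smalloI_tendsto) auto

text \<open>The form in which \<open>X = (1 + o(1)) f\<close> is proved and transferred, one
  tolerance at a time; for eventually nonnegative \<open>f\<close> it yields
  \<open>aas_asymp_eq\<close>.\<close>

definition near :: "(nat \<Rightarrow> real) \<Rightarrow> (nat \<Rightarrow> nat set set \<Rightarrow> real) \<Rightarrow> (nat \<Rightarrow> real) \<Rightarrow> bool" where
  "near p X f \<longleftrightarrow> (\<forall>\<epsilon>>0. aas p (\<lambda>n E. (1 - \<epsilon>) * f n \<le> X n E \<and> X n E \<le> (1 + \<epsilon>) * f n))"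

lemma nearD_asymp_eq:
  assumes "near p X f" "\<forall>\<^sub>F n in sequentially. 0 \<le> f n" shows "aas_asymp_eq p X f"
proof -
  have "aas p (\<lambda>n E. \<bar>X n E - f n\<bar> \<le> \<epsilon> * \<bar>f n\<bar>)" if "0 < \<epsilon>" for \<epsilon>
  proof (rule aas_mono)
    show "aas p (\<lambda>n E. (1 - \<epsilon>) * f n \<le> X n E \<and> X n E \<le> (1 + \<epsilon>) * f n)" using assms(1) that by (simp add: near_def)
    show "\<forall>\<^sub>F n in sequentially. \<forall>E. (1 - \<epsilon>) * f n \<le> X n E \<and> X n E \<le> (1 + \<epsilon>) * f n \<longrightarrow> \<bar>X n E - f n\<bar> \<le> \<epsilon> * \<bar>f n\<bar>"
      using assms(2) by eventually_elim (auto simp: abs_le_iff algebra_simps)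
  qed
  from aas_diagonal[of p "\<lambda>\<epsilon> n E. \<bar>X n E - f n\<bar> \<le> \<epsilon> * \<bar>f n\<bar>", OF this]
  show ?thesis unfolding aas_asymp_eq_def using smallo_1I by blast
qed

lemma near_transfer:
  assumes h: "near p X h" and hg: "\<And>\<epsilon>. 0 < \<epsilon> \<Longrightarrow> \<forall>\<^sub>F n in sequentially. (1 - \<epsilon>) * g n \<le> h n \<and> h n \<le> (1 + \<epsilon>) * g n"
    and g0: "\<forall>\<^sub>F n in sequentially. 0 \<le> g n"
  shows "near p X g"
  unfolding near_def
proof (intro allI impI)
  fix \<epsilon> :: real assume \<epsilon>: "0 < \<epsilon>"
  define \<eta> where "\<eta> = min \<epsilon> 1 / 3"
  have \<eta>: "0 < \<eta>" "3 * \<eta> \<le> \<epsilon>" "3 * \<eta> \<le> 1" using \<epsilon> by (auto simp: \<eta>_def)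
  have \<eta>2: "\<eta> * \<eta> \<le> \<eta>" using mult_left_mono[of \<eta> 1 \<eta>] \<eta> by simp
  show "aas p (\<lambda>n E. (1 - \<epsilon>) * g n \<le> X n E \<and> X n E \<le> (1 + \<epsilon>) * g n)"
  proof (rule aas_mono)
    show "aas p (\<lambda>n E. (1 - \<eta>) * h n \<le> X n E \<and> X n E \<le> (1 + \<eta>) * h n)" using h \<eta>(1) by (simp add: near_def)
    show "\<forall>\<^sub>F n in sequentially. \<forall>E. (1 - \<eta>) * h n \<le> X n E \<and> X n E \<le> (1 + \<eta>) * h n \<longrightarrow> (1 - \<epsilon>) * g n \<le> X n E \<and> X n E \<le> (1 + \<epsilon>) * g n"
      using hg[OF \<eta>(1)] g0
    proof eventually_elim
      case (elim n)
      have "(1 - \<eta>) * (1 - \<eta>) = 1 - 2 * \<eta> + \<eta> * \<eta>" by (simp add: algebra_simps)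
      hence "1 - \<epsilon> \<le> (1 - \<eta>) * (1 - \<eta>)" using \<eta> zero_le_square[of \<eta>] by linarith
      hence "(1 - \<epsilon>) * g n \<le> ((1 - \<eta>) * (1 - \<eta>)) * g n" by (rule mult_right_mono) (use elim in simp)
      also have "\<dots> \<le> (1 - \<eta>) * h n" using elim \<eta> mult_left_mono[of "(1 - \<eta>) * g n" "h n" "1 - \<eta>"] by (simp add: mult.assoc)
      finally have 1: "(1 - \<epsilon>) * g n \<le> (1 - \<eta>) * h n" .
      have "(1 + \<eta>) * h n \<le> (1 + \<eta>) * ((1 + \<eta>) * g n)" using elim \<eta> by (intro mult_left_mono) auto
      also have "\<dots> = ((1 + \<eta>) * (1 + \<eta>)) * g n" by simp
      also have "\<dots> \<le> (1 + \<epsilon>) * g n"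
      proof (rule mult_right_mono)
        have "(1 + \<eta>) * (1 + \<eta>) = 1 + 2 * \<eta> + \<eta> * \<eta>" by (simp add: algebra_simps)
        thus "(1 + \<eta>) * (1 + \<eta>) \<le> 1 + \<epsilon>" using \<eta> \<eta>2 by linarith
      qed (use elim in simp)
      finally show ?case using 1 by (meson order.trans)
    qed
  qed
qed

lemma aas_bigthetaI:
  assumes "aas p (\<lambda>n E. l n \<le> X n E \<and> X n E \<le> u n)" and a: "0 < a" "0 < b"
    and "\<forall>\<^sub>F n in sequentially. 0 \<le> g n \<and> a * g n \<le> l n \<and> u n \<le> b * g n \<and> 0 \<le> l n"
  shows "aas_bigtheta p X g"
  unfolding aas_bigtheta_def
proof (rule exI[of _ a], rule exI[of _ b], intro conjI a)
  show "aas p (\<lambda>n E. a * \<bar>g n\<bar> \<le> \<bar>X n E\<bar> \<and> \<bar>X n E\<bar> \<le> b * \<bar>g n\<bar>)"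
  proof (rule aas_mono[OF assms(1)])
    show "\<forall>\<^sub>F n in sequentially. \<forall>E. l n \<le> X n E \<and> X n E \<le> u n \<longrightarrow> a * \<bar>g n\<bar> \<le> \<bar>X n E\<bar> \<and> \<bar>X n E\<bar> \<le> b * \<bar>g n\<bar>"
      using assms(4) by eventually_elim auto
  qed
qed

text \<open>Since \<open>1 - z\<close> is at least 1/2, shrinking \<open>z\<close> by the factor
  \<open>1 - \<epsilon>\<close> raises \<open>ln (1 - z)\<close> by at most
  \<open>2 * \<epsilon> * z\<close>, and \<open>z\<close> is at most
  \<open>- ln (1 - z)\<close>.\<close>

lemma neg_ln_scale:
  fixes z :: real
  assumes "0 \<le> z" "z \<le> 1 / 2" "0 \<le> \<epsilon>" "\<epsilon> \<le> 1"
  shows "(1 - 2 * \<epsilon>) * (- ln (1 - z)) \<le> - ln (1 - (1 - \<epsilon>) * z)"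
proof -
  have eq: "1 - (1 - \<epsilon>) * z = (1 - z) * (1 + \<epsilon> * z / (1 - z))" using assms by (simp add: field_simps)
  have p: "0 \<le> \<epsilon> * z / (1 - z)" using assms by simp
  have pos: "0 < 1 - z" "0 < 1 + \<epsilon> * z / (1 - z)" using assms p by linarith+
  have "ln (1 - (1 - \<epsilon>) * z) = ln (1 - z) + ln (1 + \<epsilon> * z / (1 - z))" unfolding eq by (rule ln_mult_pos[OF pos])
  also have "ln (1 + \<epsilon> * z / (1 - z)) \<le> \<epsilon> * z / (1 - z)" by (rule ln_add_one_self_le_self[OF p])
  also have "\<epsilon> * z / (1 - z) \<le> \<epsilon> * z / (1 / 2)" using assms by (intro divide_left_mono) auto
  also have "\<epsilon> * z / (1 / 2) = 2 * (\<epsilon> * z)" by simp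
  finally have 1: "ln (1 - (1 - \<epsilon>) * z) \<le> ln (1 - z) + 2 * (\<epsilon> * z)" by linarith
  define w where "w = - ln (1 - z)"
  have "z \<le> w" using ln_add_one_self_le_self2[of "- z"] assms unfolding w_def by simp
  hence "\<epsilon> * z \<le> \<epsilon> * w" using assms by (intro mult_left_mono) auto
  moreover have "(1 - 2 * \<epsilon>) * w = w - 2 * (\<epsilon> * w)" by (simp add: algebra_simps)
  ultimately show ?thesis using 1 unfolding w_def by linarith
qed

lemma neg_ln_bounds:
  fixes z :: real
  assumes "0 \<le> z" "z \<le> 1 / 2" shows "z \<le> - ln (1 - z)" "- ln (1 - z) \<le> z / (1 - z)"
proof -
  show "z \<le> - ln (1 - z)" using ln_add_one_self_le_self2[of "- z"] assms by simp
  have "1 / (1 - z) = 1 + z / (1 - z)" using assms by (simp add: field_simps)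
  moreover have "ln (1 / (1 - z)) = - ln (1 - z)" using assms by (simp add: ln_div)
  ultimately have "- ln (1 - z) = ln (1 + z / (1 - z))" by simp
  also have "\<dots> \<le> z / (1 - z)" using assms by (intro ln_add_one_self_le_self) auto
  finally show "- ln (1 - z) \<le> z / (1 - z)" .
qed

section \<open>Two-sided bounds in terms of q\<close>

context gnp_seq begin

text \<open>\<open>1 - q\<close> equals \<open>2 * a * (1 - a)\<close>, so dropping the contribution
  \<open>x\<close> of the spheres only weakens the bound. The additive 1 from rounding is absorbed,
  because \<open>- ln q\<close> is at most 1 and the main term at least
  \<open>2 * ln n\<close>.\<close>

lemma upper_theta:
  fixes a q :: "nat \<Rightarrow> real"
  assumes up: "\<And>\<epsilon>. 0 < \<epsilon> \<Longrightarrow> \<epsilon> \<le> 1 / 2 \<Longrightarrow> aas p (\<lambda>n E. beta n E \<le> 2 * ln (real n) /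
      (- ln (1 - (1 - \<epsilon>) * (2 * (x n + a n * (1 - a n))))) + 1)"
    and q: "\<forall>\<^sub>F n in sequentially. q n = (a n)\<^sup>2 + (1 - a n)\<^sup>2 \<and> 0 \<le> a n \<and> a n \<le> 1 \<and> q n < 1"
    and \<epsilon>: "0 < \<epsilon>"
  shows "aas p (\<lambda>n E. beta n E \<le> (1 + \<epsilon>) * (2 * ln (real n) / (- ln (q n))))"
proof -
  define \<eta> where "\<eta> = min \<epsilon> 1 / 16"
  have \<eta>: "0 < \<eta>" "\<eta> \<le> 1 / 16" "16 * \<eta> \<le> \<epsilon>" using \<epsilon> by (auto simp: \<eta>_def)
  have "\<forall>\<^sub>F n in sequentially. 1 / \<eta> \<le> ln (real n)" using \<eta>(1) by real_asymp
  hence "\<forall>\<^sub>F n in sequentially. \<forall>E. beta n E \<le> 2 * ln (real n) / (- ln (1 - (1 - \<eta>) * (2 * (x n + a n * (1 - a n))))) + 1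
     \<longrightarrow> beta n E \<le> (1 + \<epsilon>) * (2 * ln (real n) / (- ln (q n)))"
    using q eventually_ok
  proof eventually_elim
    case (elim n)
    note ok = okD[OF elim(3)]
    let ?L = "ln (real n)"
    define z where "z = 2 * (a n * (1 - a n))"
    define y where "y = (1 - \<eta>) * (2 * (x n + a n * (1 - a n)))"
    have "0 \<le> (1 - 2 * a n)\<^sup>2" by simp
    hence z: "0 \<le> z" "z \<le> 1 / 2" "q n = 1 - z" using elim(2) by (auto simp: z_def power2_eq_square algebra_simps)
    have z0: "0 < z" using z elim(2) by simp
    have yz: "y = (1 - \<eta>) * (2 * x n + z)" by (simp add: y_def z_def algebra_simps)
    have y1: "(1 - \<eta>) * z \<le> y" unfolding yz using \<eta> ok(13) by (intro mult_left_mono) auto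
    have "y \<le> 1 * (2 * x n + z)" unfolding yz using \<eta> ok(13) z by (intro mult_right_mono) auto
    hence y2: "y < 1" using ok(9) z unfolding mult_1_left by linarith
    define w where "w = - ln (q n)"
    have w: "0 < w" "w \<le> 1"
    proof -
      show "0 < w" using z z0 by (simp add: w_def)
      have "- ln (1 - z) \<le> z / (1 - z)" by (rule neg_ln_bounds[OF z(1,2)])
      also have "\<dots> \<le> 1" using z by (simp add: divide_le_eq)
      finally show "w \<le> 1" by (simp add: w_def z)
    qed
    have "(1 - 2 * \<eta>) * w \<le> - ln (1 - (1 - \<eta>) * z)" unfolding w_def z(3) by (rule neg_ln_scale) (use z \<eta> in auto)
    also have "\<dots> \<le> - ln (1 - y)" using y1 y2 by simp
    finally have lw: "(1 - 2 * \<eta>) * w \<le> - ln (1 - y)" .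
    have p0: "0 < (1 - 2 * \<eta>) * w" using w \<eta> by simp
    have L0: "0 \<le> ?L" using ok(14) by simp
    have "2 * ?L / (- ln (1 - y)) \<le> 2 * ?L / ((1 - 2 * \<eta>) * w)"
    proof (rule divide_left_mono[OF lw])
      show "0 < - ln (1 - y) * ((1 - 2 * \<eta>) * w)" by (rule mult_pos_pos[OF _ p0]) (use p0 lw in linarith)
    qed (use L0 in simp)
    also have "\<dots> = 1 / (1 - 2 * \<eta>) * (2 * ?L / w)" by simp
    also have "\<dots> \<le> (1 + 4 * \<eta>) * (2 * ?L / w)"
    proof (rule mult_right_mono)
      have "1 \<le> (1 + 4 * \<eta>) * (1 - 2 * \<eta>)" using \<eta> mult_left_mono[of \<eta> "1 / 16" \<eta>] by (simp add: algebra_simps)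
      thus "1 / (1 - 2 * \<eta>) \<le> 1 + 4 * \<eta>" using \<eta> by (simp add: divide_le_eq)
    qed (use L0 w in auto)
    finally have 1: "2 * ?L / (- ln (1 - y)) \<le> (1 + 4 * \<eta>) * (2 * ?L / w)" .
    have "1 \<le> \<eta> * ?L" using elim(1) \<eta> by (simp add: field_simps)
    also have "\<dots> \<le> \<eta> * (2 * ?L / w)"
    proof (rule mult_left_mono)
      have "?L * w \<le> ?L * 1" using w L0 by (intro mult_left_mono) auto
      hence "?L * w \<le> 2 * ?L" using L0 by linarith
      thus "?L \<le> 2 * ?L / w" using w by (simp add: le_divide_eq)
    qed (use \<eta> in simp)
    finally have 2: "1 \<le> \<eta> * (2 * ?L / w)" .
    have f0: "0 \<le> 2 * ?L / w" using L0 w by simp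
    have "(1 + 4 * \<eta>) * F + \<eta> * F = (1 + 5 * \<eta>) * F" for F by (simp add: algebra_simps)
    hence "(1 + 4 * \<eta>) * (2 * ?L / w) + \<eta> * (2 * ?L / w) = (1 + 5 * \<eta>) * (2 * ?L / w)" .
    also have "\<dots> \<le> (1 + \<epsilon>) * (2 * ?L / w)" using \<eta> f0 by (intro mult_right_mono) auto
    finally have "2 * ?L / (- ln (1 - y)) + 1 \<le> (1 + \<epsilon>) * (2 * ?L / w)" using 1 2 by linarith
    thus ?case unfolding y_def w_def by (auto intro: order.trans)
  qed
  moreover have "aas p (\<lambda>n E. beta n E \<le> 2 * ln (real n) / (- ln (1 - (1 - \<eta>) * (2 * (x n + a n * (1 - a n))))) + 1)"
    by (rule up) (use \<eta> in auto)
  ultimately show ?thesis by (rule aas_mono[rotated])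
qed

lemma near_theta:
  fixes q :: "nat \<Rightarrow> real"
  assumes up: "\<And>\<epsilon>. 0 < \<epsilon> \<Longrightarrow> aas p (\<lambda>n E. beta n E \<le> (1 + \<epsilon>) * (2 * ln (real n) / (- ln (q n))))"
    and low: "\<And>\<epsilon>. 0 < \<epsilon> \<Longrightarrow> \<epsilon> \<le> 1 / 2 \<Longrightarrow> aas p (\<lambda>n E. (1 - \<epsilon>) * (2 * ln (real n) / (- ln (q n))) \<le> beta n E)"
    and q: "\<forall>\<^sub>F n in sequentially. 1 / 2 \<le> q n \<and> q n < 1"
  shows "near p beta (\<lambda>n. 2 * ln (real n) / ln (1 / q n))"
  unfolding near_def
proof (intro allI impI)
  fix \<epsilon> :: real assume \<epsilon>: "0 < \<epsilon>"
  have m: "0 < min \<epsilon> (1/2)" "min \<epsilon> (1/2) \<le> 1 / 2" using \<epsilon> by auto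
  show "aas p (\<lambda>n E. (1 - \<epsilon>) * (2 * ln (real n) / ln (1 / q n)) \<le> beta n E \<and> beta n E \<le> (1 + \<epsilon>) * (2 * ln (real n) / ln (1 / q n)))"
  proof (rule aas_mono[OF aas_conj[OF low[OF m] up[OF \<epsilon>]]])
    have "\<forall>\<^sub>F n in sequentially. (1::nat) \<le> n" by (rule eventually_ge_at_top)
    with q show "\<forall>\<^sub>F n in sequentially. \<forall>E. (1 - min \<epsilon> (1/2)) * (2 * ln (real n) / (- ln (q n))) \<le> beta n E \<and> beta n E \<le> (1 + \<epsilon>) * (2 * ln (real n) / (- ln (q n))) \<longrightarrow>
      (1 - \<epsilon>) * (2 * ln (real n) / ln (1 / q n)) \<le> beta n E \<and> beta n E \<le> (1 + \<epsilon>) * (2 * ln (real n) / ln (1 / q n))"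
    proof eventually_elim
      case (elim n)
      have e: "ln (1 / q n) = - ln (q n)" using elim by (simp add: ln_div)
      have "0 \<le> 2 * ln (real n) / (- ln (q n))" using elim by (intro divide_nonneg_pos) auto
      hence "(1 - \<epsilon>) * (2 * ln (real n) / (- ln (q n))) \<le> (1 - min \<epsilon> (1/2)) * (2 * ln (real n) / (- ln (q n)))" by (intro mult_right_mono) auto
      thus ?case unfolding e by (auto intro: order.trans)
    qed
  qed
qed

end

text \<open>With \<open>a = exp (- c)\<close> tending to 0 this makes
  \<open>2 * ln n / ln (1 / q)\<close> and \<open>exp c * ln n\<close> asymptotically equal.\<close>

lemma neg_ln_q:
  fixes a :: real
  assumes a: "0 < a" "a \<le> 1 / 8"
  shows "2 * a * (1 - a) \<le> - ln (a\<^sup>2 + (1 - a)\<^sup>2)" "- ln (a\<^sup>2 + (1 - a)\<^sup>2) \<le> 2 * a * (1 + 4 * a)"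
    "ln (1 / (a\<^sup>2 + (1 - a)\<^sup>2)) = - ln (a\<^sup>2 + (1 - a)\<^sup>2)"
proof -
  define z where "z = 2 * a * (1 - a)"
  have q: "a\<^sup>2 + (1 - a)\<^sup>2 = 1 - z" by (simp add: z_def power2_eq_square algebra_simps)
  have aa: "a * a \<le> a * (1 / 8)" using a by (intro mult_left_mono) auto
  have zz: "z = 2 * a - 2 * (a * a)" by (simp add: z_def algebra_simps)
  have z: "0 \<le> z" "z \<le> 1 / 2" "z \<le> 2 * a" using a aa zero_le_square[of a] unfolding zz by linarith+
  show "2 * a * (1 - a) \<le> - ln (a\<^sup>2 + (1 - a)\<^sup>2)" unfolding q z_def[symmetric] by (rule neg_ln_bounds(1)[OF z(1,2)])
  have "- ln (1 - z) \<le> z / (1 - z)" by (rule neg_ln_bounds(2)[OF z(1,2)])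
  also have "\<dots> \<le> 2 * a / (1 - 2 * a)" by (rule frac_le) (use a z in auto)
  also have "\<dots> \<le> 2 * a * (1 + 4 * a)"
  proof -
    have "(1 + 4 * a) * (1 - 2 * a) = 1 + 2 * a - 8 * (a * a)" by (simp add: algebra_simps)
    hence "1 \<le> (1 + 4 * a) * (1 - 2 * a)" using a aa by linarith
    hence "2 * a * 1 \<le> 2 * a * ((1 + 4 * a) * (1 - 2 * a))" using a by (intro mult_left_mono) auto
    hence "2 * a \<le> (2 * a * (1 + 4 * a)) * (1 - 2 * a)" by (simp only: mult.assoc mult_1_right)
    moreover have "0 < 1 - 2 * a" using a by simp
    ultimately show ?thesis by (simp only: pos_divide_le_eq)
  qed
  finally show "- ln (a\<^sup>2 + (1 - a)\<^sup>2) \<le> 2 * a * (1 + 4 * a)" unfolding q .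
  show "ln (1 / (a\<^sup>2 + (1 - a)\<^sup>2)) = - ln (a\<^sup>2 + (1 - a)\<^sup>2)" unfolding q using z by (simp add: ln_div)
qed

section \<open>The regime of c tending to infinity\<close>

context gnp_seq begin

lemma p_le_x: "ok n \<Longrightarrow> 1 \<le> i n \<Longrightarrow> p n \<le> 2 * x n"
proof -
  assume n: "ok n" and i1: "1 \<le> i n"
  note ok = okD[OF n]
  have "d n ^ 1 \<le> d n ^ i n" using i1 ok(5) by (intro power_increasing) auto
  hence "d n / n \<le> x n" by (simp add: x_def divide_right_mono)
  moreover have "p n \<le> 2 * (d n / n)"
  proof -
    have "p n * n \<le> p n * (2 * (real n - 1))" using p_bounds[of n] ok(4) by (intro mult_left_mono) auto
    thus ?thesis using ok(1,4) by (simp add: field_simps)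
  qed
  ultimately show ?thesis by linarith
qed

lemma p_smallo: "\<forall>\<^sub>F n in sequentially. 1 \<le> i n \<Longrightarrow> p \<in> o(\<lambda>_. 1)"
proof (rule smallo_1I)
  assume i: "\<forall>\<^sub>F n in sequentially. 1 \<le> i n"
  show "p \<longlonglongrightarrow> 0"
  proof (rule tendsto_sandwich[where f = "\<lambda>_. 0" and h = "\<lambda>n. 2 * x n"])
    show "\<forall>\<^sub>F n in sequentially. p n \<le> 2 * x n" using i eventually_ok by eventually_elim (rule p_le_x)
    show "(\<lambda>n. 2 * x n) \<longlonglongrightarrow> 0" using tendsto_mult_right_zero[OF x_lim] by simp
  qed (use p_bounds in auto)
qed

context
  assumes c_lim: "filterlim c at_top sequentially"
begin

lemma c_ge: "\<forall>\<^sub>F n in sequentially. K \<le> c n"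
  using c_lim by (simp add: filterlim_at_top)

text \<open>With \<open>i = 0\<close> the value \<open>c\<close> would be \<open>d / n\<close>,
  which is at most 1.\<close>

lemma i_pos: "\<forall>\<^sub>F n in sequentially. 1 \<le> i n"
  using c_ge[of 2] eventually_ok
proof eventually_elim
  case (elim n)
  note ok = okD[OF elim(2)]
  show ?case
  proof (rule ccontr)
    assume "\<not> 1 \<le> i n"
    hence "i n = 0" by simp
    hence "c n = d n / n" by (simp add: c_eq)
    moreover have "d n \<le> n"
    proof -
      have "p n * (real n - 1) \<le> 1 * (real n - 1)" using p_bounds[of n] ok(4) by (intro mult_right_mono) auto
      thus ?thesis using ok(1) unfolding mult_1_left by linarith
    qed
    hence "d n / n \<le> 1" using ok(4) by (simp add: divide_le_eq)
    ultimately show False using elim(1) by linarith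
  qed
qed

lemma exp_c_lim: "(\<lambda>n. exp (- c n)) \<longlonglongrightarrow> 0"
  by (rule filterlim_compose[OF exp_at_bot filterlim_compose[OF filterlim_uminus_at_bot_at_top c_lim]])

lemma exp_c_small: "0 < \<epsilon> \<Longrightarrow> \<forall>\<^sub>F n in sequentially. exp (- c n) \<le> \<epsilon>"
  using order_tendstoD(2)[OF exp_c_lim, of \<epsilon>] by (auto elim: eventually_mono)

text \<open>The scale of (iii). For small \<open>exp (- c)\<close> a landmark separates a pair with
  probability about \<open>2 * (x + exp (- c))\<close>: it lies in one of the two spheres, or it
  misses exactly one of them.\<close>

definition "h n = ln (real n) / (x n + exp (- c n))"

lemma h_props:
  assumes "ok n"
  shows "0 < x n + exp (- c n)" "h n * (x n + exp (- c n)) = ln (real n)" "0 \<le> h n" "h n \<le> exp (c n) * ln (real n)"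
    "h n \<le> ln (real n) / x n"
proof -
  note ok = okD[OF assms]
  show v: "0 < x n + exp (- c n)" using ok(13) by (intro add_pos_pos) auto
  show "h n * (x n + exp (- c n)) = ln (real n)" using v by (simp add: h_def)
  show "0 \<le> h n" using v ok(14) by (simp add: h_def)
  have "h n \<le> ln (real n) / exp (- c n)" unfolding h_def by (rule divide_left_mono) (use ok(13,14) v in auto)
  thus "h n \<le> exp (c n) * ln (real n)" by (simp add: exp_minus divide_inverse mult.commute)
  show "h n \<le> ln (real n) / x n" unfolding h_def by (rule divide_left_mono) (use ok(13,14) v in auto)
qed

text \<open>The separation probability \<open>y\<close> tends to 0, so \<open>- ln (1 - y)\<close>
  may be replaced by \<open>y\<close>, which is about \<open>2 * (x + exp (- c))\<close>.\<close>

lemma upper_h: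
  assumes \<epsilon>: "0 < \<epsilon>"
  shows "aas p (\<lambda>n E. beta n E \<le> (1 + \<epsilon>) * h n)"
proof -
  define \<eta> where "\<eta> = min \<epsilon> 1 / 16"
  have \<eta>: "0 < \<eta>" "\<eta> \<le> 1 / 16" "16 * \<eta> \<le> \<epsilon>" using \<epsilon> by (auto simp: \<eta>_def)
  have L_big: "\<forall>\<^sub>F n in sequentially. 1 / \<eta> \<le> ln (real n)" using \<eta>(1) by real_asymp
  have "\<forall>\<^sub>F n in sequentially. \<forall>E. beta n E \<le> 2 * ln (real n) / (- ln (1 - (1 - \<eta>) * (2 * (x n + exp (- \<bar>c n\<bar>) * (1 - exp (- \<bar>c n\<bar>)))))) + 1
     \<longrightarrow> beta n E \<le> (1 + \<epsilon>) * h n"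
    using L_big eventually_ok c_ge[of 0] exp_c_small[OF \<eta>(1)] x_small[OF \<eta>(1)]
  proof eventually_elim
    case (elim n)
    note ok = okD[OF elim(2)]
    note h = h_props[OF elim(2)]
    let ?L = "ln (real n)"
    define a where "a = exp (- c n)"
    define v where "v = x n + a"
    have a: "0 < a" "a \<le> \<eta>" using elim by (auto simp: a_def)
    have v: "0 < v" "v \<le> 2 * \<eta>" using h(1) a elim(5) by (auto simp: v_def a_def)
    have hv: "h n = ?L / v" by (simp add: h_def v_def a_def)
    define y where "y = (1 - \<eta>) * (2 * (x n + a * (1 - a)))"
    have "(1 - \<eta>) * v \<le> x n + a * (1 - a)"
    proof -
      have "a * a \<le> \<eta> * a" using a by (intro mult_right_mono) auto
      moreover have "0 \<le> \<eta> * x n" using \<eta> ok(13) by simp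
      moreover have "(1 - \<eta>) * v = x n - \<eta> * x n + a - \<eta> * a" "a * (1 - a) = a - a * a" by (simp_all add: v_def algebra_simps)
      ultimately show ?thesis by linarith
    qed
    hence "(1 - \<eta>) * (2 * ((1 - \<eta>) * v)) \<le> y" unfolding y_def using \<eta> by (intro mult_left_mono) auto
    moreover have "(1 - 2 * \<eta>) * (2 * v) \<le> (1 - \<eta>) * (2 * ((1 - \<eta>) * v))"
    proof -
      have "(1 - \<eta>) * (1 - \<eta>) = 1 - 2 * \<eta> + \<eta> * \<eta>" by (simp add: algebra_simps)
      hence "1 - 2 * \<eta> \<le> (1 - \<eta>) * (1 - \<eta>)" using zero_le_square[of \<eta>] by linarith
      hence "(1 - 2 * \<eta>) * (2 * v) \<le> (1 - \<eta>) * (1 - \<eta>) * (2 * v)" using v by (intro mult_right_mono) auto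
      thus ?thesis by (simp only: mult.assoc mult.left_commute)
    qed
    ultimately have y1: "(1 - 2 * \<eta>) * (2 * v) \<le> y" by linarith
    have y2: "y \<le> 1 / 2"
    proof -
      have "a * (1 - a) \<le> a * 1" using a by (intro mult_left_mono) auto
      hence "2 * (x n + a * (1 - a)) \<le> 2 * v" by (simp add: v_def)
      moreover have "0 \<le> 2 * (x n + a * (1 - a))" using a ok(13) \<eta> by simp
      hence "y \<le> 1 * (2 * (x n + a * (1 - a)))" unfolding y_def using \<eta> by (intro mult_right_mono) auto
      ultimately show ?thesis using v \<eta> unfolding mult_1_left by linarith
    qed
    have p0: "0 < (1 - 2 * \<eta>) * (2 * v)" using v \<eta> by simp
    have "y \<le> - ln (1 - y)" by (rule neg_ln_bounds(1)) (use p0 y1 y2 in linarith)+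
    hence lw: "(1 - 2 * \<eta>) * (2 * v) \<le> - ln (1 - y)" using y1 by linarith
    have L0: "0 \<le> ?L" using ok(14) by simp
    have "2 * ?L / (- ln (1 - y)) \<le> 2 * ?L / ((1 - 2 * \<eta>) * (2 * v))"
    proof (rule divide_left_mono[OF lw])
      show "0 < - ln (1 - y) * ((1 - 2 * \<eta>) * (2 * v))" by (rule mult_pos_pos[OF _ p0]) (use p0 lw in linarith)
    qed (use L0 in simp)
    also have "\<dots> = 1 / (1 - 2 * \<eta>) * h n" using v by (simp add: hv)
    also have "\<dots> \<le> (1 + 4 * \<eta>) * h n"
    proof (rule mult_right_mono)
      have "1 \<le> (1 + 4 * \<eta>) * (1 - 2 * \<eta>)" using \<eta> mult_left_mono[of \<eta> "1 / 16" \<eta>] by (simp add: algebra_simps)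
      thus "1 / (1 - 2 * \<eta>) \<le> 1 + 4 * \<eta>" using \<eta> by (simp add: divide_le_eq)
    qed (rule h(3))
    finally have 1: "2 * ?L / (- ln (1 - y)) \<le> (1 + 4 * \<eta>) * h n" .
    have 2: "1 \<le> \<eta> * h n"
    proof -
      have "1 \<le> \<eta> * ?L" using elim(1) \<eta> by (simp add: field_simps)
      also have "?L \<le> h n"
      proof -
        have "h n * v \<le> h n * 1" using h(3) v \<eta> by (intro mult_left_mono) auto
        thus ?thesis using h(2) by (simp add: v_def a_def)
      qed
      hence "\<eta> * ?L \<le> \<eta> * h n" using \<eta> by (intro mult_left_mono) auto
      finally show ?thesis .
    qed
    have "(1 + 4 * \<eta>) * h n + \<eta> * h n = (1 + 5 * \<eta>) * h n" by (simp add: distrib_right)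
    also have "\<dots> \<le> (1 + \<epsilon>) * h n" using \<eta> h(3) by (intro mult_right_mono) auto
    finally have "2 * ?L / (- ln (1 - y)) + 1 \<le> (1 + \<epsilon>) * h n" using 1 2 by linarith
    moreover have "\<bar>c n\<bar> = c n" using elim(3) by simp
    ultimately show ?case unfolding y_def a_def by (auto intro: order.trans)
  qed
  moreover have "aas p (\<lambda>n E. beta n E \<le> 2 * ln (real n) / (- ln (1 - (1 - \<eta>) * (2 * (x n + exp (- \<bar>c n\<bar>) * (1 - exp (- \<bar>c n\<bar>)))))) + 1)"
    by (rule upper_sparse_aas[OF i_pos]) (use \<eta> in auto)
  ultimately show ?thesis by (rule aas_mono[rotated])
qed

text \<open>Both \<open>x\<close> and \<open>exp (- c)\<close> tend to 0, and four times their sum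
  is the required error function.\<close>

lemma much_greater_h:
  assumes "aas p (\<lambda>n E. h n / 4 \<le> beta n E)"
  shows "aas_much_greater p beta (\<lambda>n. ln (real n))"
  unfolding aas_much_greater_def
proof (rule exI[of _ "\<lambda>n. 4 * (x n + exp (- c n))"], rule conjI)
  have "(\<lambda>n. 4 * (x n + exp (- c n))) \<longlonglongrightarrow> 4 * (0 + 0)" by (intro tendsto_intros x_lim exp_c_lim)
  thus "(\<lambda>n. 4 * (x n + exp (- c n))) \<in> o(\<lambda>_. 1)" by (intro smallo_1I) simp
  show "aas p (\<lambda>n E. \<bar>ln (real n)\<bar> \<le> 4 * (x n + exp (- c n)) * \<bar>beta n E\<bar>)"
  proof (rule aas_mono[OF assms])
    show "\<forall>\<^sub>F n in sequentially. \<forall>E. h n / 4 \<le> beta n E \<longrightarrow> \<bar>ln (real n)\<bar> \<le> 4 * (x n + exp (- c n)) * \<bar>beta n E\<bar>"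
      using eventually_ok
    proof eventually_elim
      case (elim n)
      note h = h_props[OF elim]
      have "\<bar>ln (real n)\<bar> \<le> 4 * (x n + exp (- c n)) * \<bar>\<beta>\<bar>" if "h n / 4 \<le> \<beta>" for \<beta>
      proof -
        have "h n * (x n + exp (- c n)) \<le> 4 * \<beta> * (x n + exp (- c n))" using that h(1) by (intro mult_right_mono) auto
        moreover have "0 \<le> \<beta>" using that h(3) by linarith
        moreover have "0 \<le> ln (real n)" using okD(14)[OF elim] by linarith
        ultimately show ?thesis using h(2) by (simp add: mult_ac)
      qed
      thus ?case by blast
    qed
  qed
qed

text \<open>If \<open>exp c\<close> is at most \<open>ln n\<close>, then \<open>h\<close> is at most
  \<open>ln n\<close> squared, so the union bound is cheap and the full factor
  \<open>\<kappa> = 1\<close> is admissible.\<close>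

lemma near_h:
  assumes "\<forall>\<^sub>F n in sequentially. exp (c n) \<le> ln (real n)"
  shows "near p beta h"
  unfolding near_def
proof (intro allI impI)
  fix \<epsilon> :: real assume \<epsilon>: "0 < \<epsilon>"
  define \<epsilon>' where "\<epsilon>' = min \<epsilon> (1 / 4)"
  have \<epsilon>': "0 < \<epsilon>'" "\<epsilon>' \<le> 1 / 4" "\<epsilon>' \<le> \<epsilon>" using \<epsilon> by (auto simp: \<epsilon>'_def)
  have "aas p (\<lambda>n E. (1 - \<epsilon>') * (ln (real n) / (x n + exp (- c n))) \<le> beta n E)"
  proof (rule lower_hits_aas[OF i_pos c_lim \<epsilon>'(1,2)])
    show "\<forall>\<^sub>F n in sequentially. ln (real n) / (x n + exp (- c n)) \<le> real n powr (1 - 1) * ln (real n) ^ 2"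
      using assms eventually_ok
    proof eventually_elim
      case (elim n)
      note ok = okD[OF elim(2)]
      have "exp (c n) * ln (real n) \<le> ln (real n) * ln (real n)" using elim(1) ok(14) by (intro mult_right_mono) auto
      hence "h n \<le> ln (real n) * ln (real n)" using h_props(4)[OF elim(2)] by linarith
      thus ?case using ok(4) by (simp add: h_def power2_eq_square)
    qed
  qed auto
  hence "aas p (\<lambda>n E. (1 - \<epsilon>') * h n \<le> beta n E)" by (simp only: h_def)
  from aas_conj[OF this upper_h[OF \<epsilon>]]
  show "aas p (\<lambda>n E. (1 - \<epsilon>) * h n \<le> beta n E \<and> beta n E \<le> (1 + \<epsilon>) * h n)"
  proof (rule aas_mono)
    show "\<forall>\<^sub>F n in sequentially. \<forall>E. (1 - \<epsilon>') * h n \<le> beta n E \<and> beta n E \<le> (1 + \<epsilon>) * h n \<longrightarrow>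
       (1 - \<epsilon>) * h n \<le> beta n E \<and> beta n E \<le> (1 + \<epsilon>) * h n"
      using eventually_ok
    proof eventually_elim
      case (elim n)
      have "(1 - \<epsilon>) * h n \<le> (1 - \<epsilon>') * h n" using h_props(3)[OF elim] \<epsilon>' by (intro mult_right_mono) auto
      thus ?case by (auto intro: order.trans)
    qed
  qed
qed

text \<open>Here \<open>x * exp c = c * exp c / d\<close> is at most \<open>ln n ^ 2 / d\<close>,
  which tends to 0. The spheres themselves are negligible beside \<open>exp (- c)\<close>.\<close>

lemma near_exp_c:
  assumes ec: "\<forall>\<^sub>F n in sequentially. exp (c n) \<le> ln (real n)"
  shows "near p beta (\<lambda>n. exp (c n) * ln (real n))"
proof (rule near_transfer[OF near_h[OF ec]])
  fix \<epsilon> :: real assume \<epsilon>: "0 < \<epsilon>"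
  show "\<forall>\<^sub>F n in sequentially. (1 - \<epsilon>) * (exp (c n) * ln (real n)) \<le> h n \<and> h n \<le> (1 + \<epsilon>) * (exp (c n) * ln (real n))"
    using eventually_ok ec d_pow[of 2 "1 / \<epsilon>", simplified] c_ge[of 0]
  proof eventually_elim
    case (elim n)
    note ok = okD[OF elim(1)]
    note h = h_props[OF elim(1)]
    let ?L = "ln (real n)"
    have g0: "0 \<le> exp (c n) * ?L" using ok(14) by simp
    have d0: "0 < d n" using ok(5) by linarith
    have x\<epsilon>: "x n * exp (c n) \<le> \<epsilon>"
    proof -
      have "c n \<le> exp (c n)" using exp_ge_add_one_self[of "c n"] by linarith
      hence "c n \<le> ?L" using elim(2) by linarith
      hence "c n * exp (c n) \<le> ?L * ?L" using elim(2,4) by (intro mult_mono) auto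
      hence "x n * exp (c n) * d n \<le> ?L\<^sup>2" by (simp add: c_x power2_eq_square mult_ac)
      also have "\<dots> \<le> \<epsilon> * d n" using elim(3) \<epsilon> by (simp add: field_simps)
      finally show ?thesis using d0 by simp
    qed
    have "h n * (x n * exp (c n) + 1) = h n * (x n + exp (- c n)) * exp (c n)"
      by (simp add: algebra_simps mult_exp_exp)
    hence e: "h n * (x n * exp (c n) + 1) = exp (c n) * ?L" using h(2) by simp
    have "h n * (x n * exp (c n) + 1) \<le> h n * (1 + \<epsilon>)" using x\<epsilon> h(3) by (intro mult_left_mono) auto
    hence le: "exp (c n) * ?L \<le> (1 + \<epsilon>) * h n" unfolding e by (simp only: mult.commute)
    have "(1 - \<epsilon>) * (exp (c n) * ?L) \<le> h n"
    proof (cases "\<epsilon> \<le> 1")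
      case True
      have "(1 - \<epsilon>) * (exp (c n) * ?L) \<le> (1 - \<epsilon>) * ((1 + \<epsilon>) * h n)" using True le by (intro mult_left_mono) auto
      also have "\<dots> = h n - \<epsilon> * \<epsilon> * h n" by (simp add: algebra_simps)
      also have "\<dots> \<le> h n" using h(3) by simp
      finally show ?thesis .
    next
      case False
      hence "(1 - \<epsilon>) * (exp (c n) * ?L) \<le> 0" using g0 by (intro mult_nonpos_nonneg) auto
      thus ?thesis using h(3) by linarith
    qed
    moreover have "1 * (exp (c n) * ?L) \<le> (1 + \<epsilon>) * (exp (c n) * ?L)" using g0 \<epsilon> by (intro mult_right_mono) auto
    ultimately show ?case using h(4) by linarith
  qed
next
  show "\<forall>\<^sub>F n in sequentially. 0 \<le> exp (c n) * ln (real n)" using eventually_ok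
  proof eventually_elim
    case (elim n)
    have "0 \<le> ln (real n)" using okD(14)[OF elim] by linarith
    thus ?case by simp
  qed
qed

lemma near_ln_q:
  assumes ec: "\<forall>\<^sub>F n in sequentially. exp (c n) \<le> ln (real n)"
  shows "near p beta (\<lambda>n. 2 * ln (real n) / ln (1 / ((exp (- c n))\<^sup>2 + (1 - exp (- c n))\<^sup>2)))"
proof (rule near_transfer[OF near_exp_c[OF ec]])
  fix \<epsilon> :: real assume \<epsilon>: "0 < \<epsilon>"
  define \<zeta> where "\<zeta> = min \<epsilon> (1 / 8) / 4"
  have \<zeta>: "0 < \<zeta>" "\<zeta> \<le> 1 / 8" "4 * \<zeta> \<le> \<epsilon>" using \<epsilon> by (auto simp: \<zeta>_def)
  let ?g = "\<lambda>n. 2 * ln (real n) / ln (1 / ((exp (- c n))\<^sup>2 + (1 - exp (- c n))\<^sup>2))"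
  show "\<forall>\<^sub>F n in sequentially. (1 - \<epsilon>) * ?g n \<le> exp (c n) * ln (real n) \<and> exp (c n) * ln (real n) \<le> (1 + \<epsilon>) * ?g n"
    using eventually_ok exp_c_small[OF \<zeta>(1)]
  proof eventually_elim
    case (elim n)
    note ok = okD[OF elim(1)]
    define a where "a = exp (- c n)"
    have a: "0 < a" "a \<le> \<zeta>" "a \<le> 1 / 8" using elim \<zeta> by (auto simp: a_def)
    define w where "w = - ln (a\<^sup>2 + (1 - a)\<^sup>2)"
    have w: "2 * a * (1 - a) \<le> w" "w \<le> 2 * a * (1 + 4 * a)" "ln (1 / (a\<^sup>2 + (1 - a)\<^sup>2)) = w"
      using neg_ln_q[OF a(1,3)] unfolding w_def by auto
    let ?L = "ln (real n)"
    have L0: "0 \<le> ?L" using ok(14) by linarith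
    have "0 < 2 * a * (1 - a)" using a by simp
    hence w0: "0 < w" using w(1) by linarith
    have e: "exp (c n) * ?L = ?L / a" by (simp add: a_def exp_minus divide_inverse mult.commute)
    have "(1 - \<epsilon>) * (2 * a) \<le> 2 * a * (1 - a)"
    proof -
      have "(1 - \<epsilon>) * (2 * a) \<le> (1 - a) * (2 * a)" using a \<zeta> by (intro mult_right_mono) auto
      thus ?thesis by (simp only: mult.commute)
    qed
    hence 1: "(1 - \<epsilon>) * (2 * a) \<le> w" using w(1) by linarith
    have "2 * a * (1 + 4 * a) \<le> 2 * a * (1 + \<epsilon>)" using a \<zeta> by (intro mult_left_mono) auto
    moreover have "2 * a * (1 + \<epsilon>) = (1 + \<epsilon>) * (2 * a)" by (rule mult.commute)
    ultimately have 2: "w \<le> (1 + \<epsilon>) * (2 * a)" using w(2) by linarith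
    have "?L * ((1 - \<epsilon>) * (2 * a)) \<le> ?L * w" by (rule mult_left_mono[OF 1 L0])
    hence "(1 - \<epsilon>) * (2 * ?L / w) \<le> ?L / a" using w0 a by (simp add: field_simps)
    moreover have "?L * w \<le> ?L * ((1 + \<epsilon>) * (2 * a))" by (rule mult_left_mono[OF 2 L0])
    hence "?L / a \<le> (1 + \<epsilon>) * (2 * ?L / w)" using w0 a by (simp add: field_simps)
    ultimately show ?case unfolding e a_def[symmetric] w(3) by blast
  qed
next
  let ?g = "\<lambda>n. 2 * ln (real n) / ln (1 / ((exp (- c n))\<^sup>2 + (1 - exp (- c n))\<^sup>2))"
  show "\<forall>\<^sub>F n in sequentially. 0 \<le> ?g n"
    using eventually_ok exp_c_small[of "1 / 8", simplified]
  proof eventually_elim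
    case (elim n)
    have "exp (- c n) \<le> 1 / 8" using elim(2) by simp
    hence "0 < 1 - exp (- c n)" by linarith
    hence "0 < 2 * exp (- c n) * (1 - exp (- c n))" by (intro mult_pos_pos) auto
    hence "0 \<le> ln (1 / ((exp (- c n))\<^sup>2 + (1 - exp (- c n))\<^sup>2))" using neg_ln_q[of "exp (- c n)"] elim(2) by simp
    thus ?case using okD(14)[OF elim(1)] by (intro divide_nonneg_nonneg) auto
  qed
qed

end

end

section \<open>Lower bound with the factor eta and the orders of magnitude in (iii)\<close>

context gnp_seq begin

context
  assumes c_lim: "filterlim c at_top sequentially"
begin

text \<open>By the choice of \<open>\<eta>\<close>, \<open>n powr (1 - \<eta>)\<close> is
  \<open>1 / x\<close>, and \<open>h\<close> is at most \<open>ln n / x\<close>; so the size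
  condition holds with \<open>\<kappa> = \<eta>\<close>. From \<open>c \<ge> 1\<close> and
  \<open>i \<ge> 1\<close> it follows that \<open>n \<le> d ^ i * d \<le> (d ^ i)\<^sup>2\<close>,
  hence \<open>\<eta> \<ge> 1 / 2\<close>.\<close>

lemma lower_eta:
  assumes \<eta>: "\<And>n. 1 \<le> i n \<Longrightarrow> \<eta> n = log (real n) (d n ^ i n)" and \<epsilon>: "0 < \<epsilon>" "\<epsilon> \<le> 1 / 4"
  shows "\<forall>\<^sub>F n in sequentially. 1 / 2 \<le> \<eta> n \<and> \<eta> n \<le> 1" "aas p (\<lambda>n E. (\<eta> n - \<epsilon>) * h n \<le> beta n E)"
proof -
  have ev: "\<forall>\<^sub>F n in sequentially. (1 / 2 \<le> \<eta> n \<and> \<eta> n \<le> 1) \<and> real n powr (1 - \<eta> n) = 1 / x n"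
    using eventually_ok i_pos[OF c_lim] c_ge[OF c_lim, of 1]
  proof eventually_elim
    case (elim n)
    note ok = okD[OF elim(1)]
    let ?L = "ln (real n)"
    have n0: "0 < real n" using ok(4) by simp
    have L0: "0 < ?L" using ok(14) by linarith
    define z where "z = d n ^ i n"
    have z0: "1 \<le> z" unfolding z_def using ok(5) by (intro one_le_power) linarith
    have e: "\<eta> n * ?L = ln z" using \<eta>[OF elim(2)] L0 by (simp add: log_def z_def)
    have xz: "x n = z / n" by (simp add: x_def z_def)
    have "z \<le> n" using ok(9) n0 unfolding xz by (simp add: field_simps)
    hence "ln z \<le> 1 * ?L" using z0 by simp
    hence 1: "\<eta> n \<le> 1" using L0 unfolding e[symmetric] by (simp only: mult_le_cancel_right_pos)
    have "d n ^ 1 \<le> d n ^ i n" using elim(2) ok(5) by (intro power_increasing) auto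
    hence dz: "d n \<le> z" by (simp add: z_def)
    have "real n \<le> z * d n" using elim(3) n0 unfolding c_eq by (simp add: z_def field_simps)
    also have "\<dots> \<le> z * z" using dz z0 by (intro mult_left_mono) auto
    finally have "?L \<le> ln (z * z)" using n0 z0 by simp
    also have "\<dots> = 2 * ln z" using z0 by (simp add: ln_mult_pos)
    finally have "1 / 2 * ?L \<le> \<eta> n * ?L" unfolding e by simp
    hence 2: "1 / 2 \<le> \<eta> n" using L0 by (simp only: mult_le_cancel_right_pos)
    have "real n powr (1 - \<eta> n) = exp (?L - \<eta> n * ?L)" using n0 by (simp add: powr_def algebra_simps)
    also have "\<dots> = 1 / x n" unfolding e xz using n0 z0 by (simp add: exp_diff)
    finally show ?case using 1 2 by blast
  qed
  show e: "\<forall>\<^sub>F n in sequentially. 1 / 2 \<le> \<eta> n \<and> \<eta> n \<le> 1" using ev by eventually_elim blast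
  have "aas p (\<lambda>n E. (\<eta> n - \<epsilon>) * (ln (real n) / (x n + exp (- c n))) \<le> beta n E)"
  proof (rule lower_hits_aas[OF i_pos[OF c_lim] c_lim \<epsilon> e])
    show "\<forall>\<^sub>F n in sequentially. ln (real n) / (x n + exp (- c n)) \<le> real n powr (1 - \<eta> n) * ln (real n) ^ 2"
      using ev eventually_ok
    proof eventually_elim
      case (elim n)
      note ok = okD[OF elim(2)]
      have "ln (real n) ^ 1 \<le> ln (real n) ^ 2" using ok(14) by (intro power_increasing) auto
      hence "ln (real n) / x n \<le> ln (real n) ^ 2 / x n" using ok(13) by (intro divide_right_mono) auto
      thus ?case using h_props(5)[OF c_lim elim(2)] elim(1) by (simp add: h_def[OF c_lim])
    qed
  qed
  thus "aas p (\<lambda>n E. (\<eta> n - \<epsilon>) * h n \<le> beta n E)" by (simp only: h_def[OF c_lim])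
qed

lemma eta_bounds:
  assumes \<eta>: "\<And>n. 1 \<le> i n \<Longrightarrow> \<eta> n = log (real n) (d n ^ i n)"
  shows "\<exists>\<delta>\<^sub>1 \<delta>\<^sub>2 :: nat \<Rightarrow> real. \<delta>\<^sub>1 \<in> o(\<lambda>_. 1) \<and> \<delta>\<^sub>2 \<in> o(\<lambda>_. 1) \<and>
           aas p (\<lambda>n E.
             (\<eta> n + \<delta>\<^sub>1 n) * inverse (d n ^ i n / real n + exp (- c n)) * ln (real n) \<le> beta n E \<and>
             beta n E \<le> (1 + \<delta>\<^sub>2 n) * inverse (d n ^ i n / real n + exp (- c n)) * ln (real n))"
proof -
  have "aas p (\<lambda>n E. (\<eta> n - \<epsilon>) * h n \<le> beta n E \<and> beta n E \<le> (1 + \<epsilon>) * h n)" if \<epsilon>: "0 < \<epsilon>" for \<epsilon>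
  proof -
    define \<epsilon>' where "\<epsilon>' = min \<epsilon> (1 / 4)"
    have \<epsilon>': "0 < \<epsilon>'" "\<epsilon>' \<le> 1 / 4" "\<epsilon>' \<le> \<epsilon>" using \<epsilon> by (auto simp: \<epsilon>'_def)
    show ?thesis
    proof (rule aas_mono[OF aas_conj[OF lower_eta(2)[OF \<eta> \<epsilon>'(1,2)] upper_h[OF c_lim \<epsilon>]]])
      show "\<forall>\<^sub>F n in sequentially. \<forall>E. (\<eta> n - \<epsilon>') * h n \<le> beta n E \<and> beta n E \<le> (1 + \<epsilon>) * h n \<longrightarrow>
         (\<eta> n - \<epsilon>) * h n \<le> beta n E \<and> beta n E \<le> (1 + \<epsilon>) * h n"
        using eventually_ok
      proof eventually_elim
        case (elim n)
        have "(\<eta> n - \<epsilon>) * h n \<le> (\<eta> n - \<epsilon>') * h n" using h_props(3)[OF c_lim elim] \<epsilon>' by (intro mult_right_mono) auto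
        thus ?case by (auto intro: order.trans)
      qed
    qed
  qed
  from aas_diagonal[of p "\<lambda>\<epsilon> n E. (\<eta> n - \<epsilon>) * h n \<le> beta n E \<and> beta n E \<le> (1 + \<epsilon>) * h n", OF this]
  obtain \<tau> :: "nat \<Rightarrow> real" where \<tau>: "\<tau> \<longlonglongrightarrow> 0" "aas p (\<lambda>n E. (\<eta> n - \<tau> n) * h n \<le> beta n E \<and> beta n E \<le> (1 + \<tau> n) * h n)" by blast
  have "(\<lambda>n. - \<tau> n) \<in> o(\<lambda>_. 1)" using tendsto_minus[OF \<tau>(1)] by (intro smallo_1I) simp
  moreover have "aas p (\<lambda>n E. (\<eta> n + - \<tau> n) * inverse (d n ^ i n / real n + exp (- c n)) * ln (real n) \<le> beta n E \<and>
             beta n E \<le> (1 + \<tau> n) * inverse (d n ^ i n / real n + exp (- c n)) * ln (real n))"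
  proof -
    have "inverse (d n ^ i n / real n + exp (- c n)) * ln (real n) = h n" for n
      by (simp add: h_def[OF c_lim] x_def divide_inverse mult.commute)
    thus ?thesis using \<tau>(2) by (simp add: mult.assoc)
  qed
  ultimately show ?thesis using smallo_1I[OF \<tau>(1)] by blast
qed

text \<open>As \<open>\<eta> \<ge> 1 / 2\<close>, the tolerance 1/4 leaves the positive factor 1/4
  in the lower bound.\<close>

lemma beta_h:
  assumes \<eta>: "\<And>n. 1 \<le> i n \<Longrightarrow> \<eta> n = log (real n) (d n ^ i n)"
  shows "aas p (\<lambda>n E. h n / 4 \<le> beta n E \<and> beta n E \<le> 2 * h n)"
proof -
  have q: "0 < (1 / 4 :: real)" "(1 / 4 :: real) \<le> 1 / 4" by auto
  have \<eta>b: "\<forall>\<^sub>F n in sequentially. 1 / 2 \<le> \<eta> n \<and> \<eta> n \<le> 1" by (rule lower_eta(1)[OF _ q]) (rule \<eta>)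
  show ?thesis
  proof (rule aas_mono[OF aas_conj[OF lower_eta(2)[OF \<eta> q] upper_h[OF c_lim zero_less_one]]])
    show "\<forall>\<^sub>F n in sequentially. \<forall>E. (\<eta> n - 1 / 4) * h n \<le> beta n E \<and> beta n E \<le> (1 + 1) * h n \<longrightarrow>
       h n / 4 \<le> beta n E \<and> beta n E \<le> 2 * h n"
      using eventually_ok \<eta>b
    proof eventually_elim
      case (elim n)
      have "1 / 4 * h n \<le> (\<eta> n - 1 / 4) * h n" using h_props(3)[OF c_lim elim(1)] elim(2) by (intro mult_right_mono) auto
      thus ?case by (auto intro: order.trans)
    qed
  qed
qed

text \<open>If \<open>x\<close> is at most a constant times \<open>exp (- c)\<close>, then the sum
  in \<open>h\<close> is of order \<open>exp (- c)\<close>, and so is \<open>- ln q\<close>.\<close>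

lemma theta_exp_c:
  assumes \<eta>: "\<And>n. 1 \<le> i n \<Longrightarrow> \<eta> n = log (real n) (d n ^ i n)"
    and \<Omega>: "(\<lambda>n. exp (- c n)) \<in> \<Omega>(\<lambda>n. d n ^ i n / real n)"
  shows "aas_bigtheta p beta (\<lambda>n. exp (c n) * ln (real n))"
    "aas_bigtheta p beta (\<lambda>n. ln (real n) / ln (1 / ((exp (- c n))\<^sup>2 + (1 - exp (- c n))\<^sup>2)))"
proof -
  have bh: "aas p (\<lambda>n E. h n / 4 \<le> beta n E \<and> beta n E \<le> 2 * h n)" by (rule beta_h) (rule \<eta>)
  obtain k where k: "0 < k" "\<forall>\<^sub>F n in sequentially. k * norm (d n ^ i n / real n) \<le> norm (exp (- c n))"
    using \<Omega> by (rule landau_omega.bigE)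
  \<comment> \<open>\<open>1 / k + 1\<close> bounds the ratio of \<open>x + exp (- c)\<close> to
    \<open>exp (- c)\<close>; the 4 matches the lower bound \<open>h / 4\<close>.\<close>
  define K where "K = 1 / (4 * (1 / k + 1))"
  have K: "0 < K" using k(1) by (simp add: K_def add_pos_pos)
  have main: "\<forall>\<^sub>F n in sequentially. ok n \<and> exp (- c n) \<le> 1 / 8 \<and> K * (exp (c n) * ln (real n)) \<le> h n / 4"
    using eventually_ok k(2) exp_c_small[OF c_lim, of "1 / 8", simplified]
  proof eventually_elim
    case (elim n)
    note ok = okD[OF elim(1)]
    note h = h_props[OF c_lim elim(1)]
    have "k * x n \<le> exp (- c n)" using elim(2) ok(13) by (simp add: x_def[symmetric])
    hence "x n \<le> 1 / k * exp (- c n)" using k(1) by (simp add: field_simps)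
    hence "x n + exp (- c n) \<le> (1 / k + 1) * exp (- c n)" by (simp add: distrib_right)
    hence "h n * (x n + exp (- c n)) \<le> h n * ((1 / k + 1) * exp (- c n))" by (rule mult_left_mono[OF _ h(3)])
    hence "ln (real n) * exp (c n) \<le> h n * ((1 / k + 1) * exp (- c n)) * exp (c n)" unfolding h(2) by (rule mult_right_mono) simp
    also have "\<dots> = h n * (1 / k + 1)" by (simp add: mult.assoc mult_exp_exp)
    finally have "K * (exp (c n) * ln (real n)) \<le> K * (h n * (1 / k + 1))" using K by (simp add: mult.commute)
    also have "\<dots> = h n / 4"
    proof -
      have "1 / (4 * m) * (H * m) = H / 4" if "0 < m" for m H :: real using that by simp
      from this[of "1 / k + 1" "h n"] show ?thesis using k(1) unfolding K_def by (simp only: add_pos_pos zero_less_divide_1_iff zero_less_one)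
    qed
    finally show ?case using elim(1,3) by simp
  qed
  show "aas_bigtheta p beta (\<lambda>n. exp (c n) * ln (real n))"
  proof (rule aas_bigthetaI[OF bh K, of 2])
    show "\<forall>\<^sub>F n in sequentially. 0 \<le> exp (c n) * ln (real n) \<and> K * (exp (c n) * ln (real n)) \<le> h n / 4 \<and>
       2 * h n \<le> 2 * (exp (c n) * ln (real n)) \<and> 0 \<le> h n / 4" using main
    proof eventually_elim
      case (elim n)
      thus ?case using h_props[OF c_lim, of n] okD(14)[of n] by auto
    qed
  qed auto
  let ?g = "\<lambda>n. ln (real n) / ln (1 / ((exp (- c n))\<^sup>2 + (1 - exp (- c n))\<^sup>2))"
  show "aas_bigtheta p beta ?g"
  proof (rule aas_bigthetaI[OF bh K, of 6])
    show "\<forall>\<^sub>F n in sequentially. 0 \<le> ?g n \<and> K * ?g n \<le> h n / 4 \<and> 2 * h n \<le> 6 * ?g n \<and> 0 \<le> h n / 4" using main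
    proof eventually_elim
      case (elim n)
      define a where "a = exp (- c n)"
      have a: "0 < a" "a \<le> 1 / 8" using elim by (auto simp: a_def)
      define w where "w = - ln (a\<^sup>2 + (1 - a)\<^sup>2)"
      have w: "2 * a * (1 - a) \<le> w" "w \<le> 2 * a * (1 + 4 * a)" "ln (1 / (a\<^sup>2 + (1 - a)\<^sup>2)) = w"
        using neg_ln_q[OF a] unfolding w_def by auto
      have okn: "ok n" using elim by blast
      have L0: "0 \<le> ln (real n)" using okD(14)[OF okn] by linarith
      have aa: "a * a \<le> a * (1 / 8)" using a by (intro mult_left_mono) auto
      have e1: "2 * a * (1 - a) = 2 * a - 2 * (a * a)" by (simp add: algebra_simps)
      have e2: "2 * a * (1 + 4 * a) = 2 * a + 8 * (a * a)" by (simp add: algebra_simps)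
      have "2 * a - 2 * (a * a) \<le> w" "w \<le> 2 * a + 8 * (a * a)" using w(1,2) by (simp_all only: e1 e2)
      hence wa: "a \<le> w" "w \<le> 3 * a" using aa a(1) by linarith+
      have e: "exp (c n) * ln (real n) = ln (real n) / a" by (simp add: a_def exp_minus divide_inverse mult.commute)
      have g: "?g n = ln (real n) / w" unfolding a_def[symmetric] w(3) ..
      have 1: "?g n \<le> exp (c n) * ln (real n)" unfolding g e by (rule divide_left_mono) (use wa a L0 in auto)
      have "ln (real n) / (3 * a) \<le> ln (real n) / w" by (rule divide_left_mono) (use wa a L0 in auto)
      hence 2: "exp (c n) * ln (real n) \<le> 3 * ?g n" unfolding g e by simp
      have "K * ?g n \<le> K * (exp (c n) * ln (real n))" using 1 K by (intro mult_left_mono) auto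
      moreover have "0 \<le> ?g n" unfolding g using L0 wa a by simp
      ultimately show ?case using elim 2 h_props(3,4)[OF c_lim okn] by linarith
    qed
  qed auto
qed

lemma theta_sphere:
  assumes \<eta>: "\<And>n. 1 \<le> i n \<Longrightarrow> \<eta> n = log (real n) (d n ^ i n)"
    and small: "(\<lambda>n. exp (- c n)) \<in> o(\<lambda>n. d n ^ i n / real n)"
  shows "aas_bigtheta p beta (\<lambda>n. real n * ln (real n) / d n ^ i n)"
proof -
  have bh: "aas p (\<lambda>n E. h n / 4 \<le> beta n E \<and> beta n E \<le> 2 * h n)" by (rule beta_h) (rule \<eta>)
  show ?thesis
  proof (rule aas_bigthetaI[OF bh, of "1 / 8" 2])
  have "\<forall>\<^sub>F n in sequentially. norm (exp (- c n)) \<le> 1 * norm (d n ^ i n / real n)"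
    by (rule landau_o.smallD[OF small zero_less_one])
  with eventually_ok
  show "\<forall>\<^sub>F n in sequentially. 0 \<le> real n * ln (real n) / d n ^ i n \<and> 1 / 8 * (real n * ln (real n) / d n ^ i n) \<le> h n / 4 \<and>
     2 * h n \<le> 2 * (real n * ln (real n) / d n ^ i n) \<and> 0 \<le> h n / 4"
  proof eventually_elim
    case (elim n)
    note ok = okD[OF elim(1)]
    note h = h_props[OF c_lim elim(1)]
    have e: "real n * ln (real n) / d n ^ i n = ln (real n) / x n" by (simp add: x_def)
    have "exp (- c n) \<le> x n" using elim(2) ok(13) by (simp add: x_def[symmetric])
    hence "x n + exp (- c n) \<le> 2 * x n" by simp
    hence "h n * (x n + exp (- c n)) \<le> h n * (2 * x n)" by (rule mult_left_mono[OF _ h(3)])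
    hence "ln (real n) / x n \<le> 2 * h n" unfolding h(2) using ok(13) by (simp add: divide_le_eq mult_ac)
    moreover have "0 \<le> ln (real n) / x n" using ok(13,14) by simp
    ultimately show ?case unfolding e using h(3,5) by linarith
  qed
  qed auto
qed

end

end

section \<open>Bounded c: the sparse and the dense case\<close>

lemma q_eq: "(a :: real)\<^sup>2 + (1 - a)\<^sup>2 = 1 - 2 * (a * (1 - a))"
  by (simp add: power2_eq_square algebra_simps)

lemma q_ge_half: "1 / 2 \<le> (a :: real)\<^sup>2 + (1 - a)\<^sup>2"
proof -
  have "0 \<le> (1 - 2 * a)\<^sup>2" by simp
  thus ?thesis by (simp add: power2_eq_square algebra_simps)
qed

text \<open>On [0, 1] the derivative of the quadratic is at most 2 in absolute value.\<close>

lemma q_diff: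
  fixes a b :: real
  assumes "0 \<le> a" "a \<le> 1" "0 \<le> b" "b \<le> 1" "\<bar>b - a\<bar> \<le> \<zeta>"
  shows "a\<^sup>2 + (1 - a)\<^sup>2 - 2 * \<zeta> \<le> b\<^sup>2 + (1 - b)\<^sup>2"
proof -
  have "b\<^sup>2 + (1 - b)\<^sup>2 - (a\<^sup>2 + (1 - a)\<^sup>2) = 2 * ((b - a) * (b + a - 1))" by (simp add: power2_eq_square algebra_simps)
  moreover have "\<bar>(b - a) * (b + a - 1)\<bar> \<le> \<zeta> * 1" unfolding abs_mult using assms by (intro mult_mono) auto
  ultimately show ?thesis by linarith
qed

text \<open>While \<open>q\<close> stays away from 1, the power \<open>1 + \<epsilon> / 2\<close>
  lowers it by a fixed amount. This amount absorbs the error that inexact sphere sizes cause in the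
  agreement probability.\<close>

lemma powr_gap:
  fixes q :: real
  assumes "0 < \<epsilon>" "0 < k" "1 / 2 \<le> q" "q \<le> 1 - k"
  shows "q powr (1 + \<epsilon> / 2) \<le> q - (1 - exp (- (\<epsilon> / 2 * k))) / 2"
proof -
  define r where "r = exp (- (\<epsilon> / 2 * k))"
  have r1: "r \<le> 1" using assms by (simp add: r_def)
  have q0: "0 < q" using assms by linarith
  have "ln q \<le> q - 1" by (rule ln_le_minus_one[OF q0])
  hence "ln q \<le> - k" using assms by linarith
  hence "\<epsilon> / 2 * ln q \<le> \<epsilon> / 2 * (- k)" using assms by (intro mult_left_mono) auto
  hence "q powr (\<epsilon> / 2) \<le> r" using q0 by (simp add: powr_def r_def)
  hence "q * q powr (\<epsilon> / 2) \<le> q * r" using q0 by (intro mult_left_mono) auto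
  moreover have "q powr (1 + \<epsilon> / 2) = q * q powr (\<epsilon> / 2)" using q0 by (simp add: powr_add)
  moreover have "1 / 2 * (1 - r) \<le> q * (1 - r)" using assms r1 by (intro mult_right_mono) auto
  moreover have "q * (1 - r) = q - q * r" by (simp add: algebra_simps)
  ultimately show ?thesis unfolding r_def[symmetric] by linarith
qed

context gnp_seq begin

lemma theta_ln:
  assumes near: "near p beta (\<lambda>n. 2 * ln (real n) / ln (1 / q n))"
    and q: "\<forall>\<^sub>F n in sequentially. 1 / 2 \<le> q n \<and> q n \<le> 1 - k" and k: "0 < k"
  shows "aas_bigtheta p beta (\<lambda>n. ln (real n))"
proof (rule aas_bigthetaI[of p _ beta _ 1 "3 / k"])
  let ?f = "\<lambda>n. 2 * ln (real n) / ln (1 / q n)"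
  show "aas p (\<lambda>n E. (1 - 1 / 2) * ?f n \<le> beta n E \<and> beta n E \<le> (1 + 1 / 2) * ?f n)"
    using near[unfolded near_def, rule_format, of "1 / 2"] by simp
  show "\<forall>\<^sub>F n in sequentially. 0 \<le> ln (real n) \<and> 1 * ln (real n) \<le> (1 - 1 / 2) * ?f n \<and>
     (1 + 1 / 2) * ?f n \<le> 3 / k * ln (real n) \<and> 0 \<le> (1 - 1 / 2) * ?f n"
    using q eventually_ok
  proof eventually_elim
    case (elim n)
    have L0: "0 \<le> ln (real n)" using okD(14)[OF elim(2)] by linarith
    define z where "z = 1 - q n"
    define w where "w = - ln (1 - z)"
    have z: "0 \<le> z" "z \<le> 1 / 2" "k \<le> z" using elim(1) k by (auto simp: z_def)
    have w1: "k \<le> w" using neg_ln_bounds(1)[OF z(1,2)] z(3) unfolding w_def by linarith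
    have "z / (1 - z) \<le> 1" using z by (simp add: divide_le_eq)
    hence w2: "w \<le> 1" using neg_ln_bounds(2)[OF z(1,2)] unfolding w_def by linarith
    have e: "ln (1 / q n) = w" using elim(1) by (simp add: w_def z_def ln_div)
    have "2 * ln (real n) / 1 \<le> 2 * ln (real n) / w" by (rule divide_left_mono) (use w1 w2 k L0 in auto)
    moreover have "2 * ln (real n) / w \<le> 2 * ln (real n) / k" by (rule divide_left_mono) (use w1 k L0 in auto)
    ultimately have F: "2 * ln (real n) \<le> 2 * ln (real n) / w" "2 * ln (real n) / w \<le> 2 * (ln (real n) / k)" by simp_all
    have gen: "0 \<le> L \<and> 1 * L \<le> (1 - 1 / 2) * F \<and> (1 + 1 / 2) * F \<le> 3 * G \<and> 0 \<le> (1 - 1 / 2) * F"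
      if "0 \<le> L" "2 * L \<le> F" "F \<le> 2 * G" for L F G :: real using that by auto
    have e3: "3 / k * ln (real n) = 3 * (ln (real n) / k)" by simp
    show ?case unfolding e e3 by (rule gen[OF L0 F])
  qed
qed (use k in auto)

text \<open>With \<open>p = o(1)\<close>, \<open>i = 0\<close> would make \<open>c\<close> at most
  \<open>p\<close>, so \<open>i \<ge> 1\<close>. Then \<open>\<rho>\<close> is of order
  \<open>ln n\<close>, and the overlap error \<open>3 * \<rho> * e + 10 * \<rho>\<^sup>2 * x\<close>
  tends to 0, because \<open>ln n * e\<close> and \<open>ln n ^ 3 * x\<close> do.\<close>

lemma sparse_theta:
  assumes p0: "p \<in> o(\<lambda>_. 1)" and c\<Theta>: "c \<in> \<Theta>(\<lambda>_. 1)"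
  defines "q \<equiv> \<lambda>n. (exp (- c n))\<^sup>2 + (1 - exp (- c n))\<^sup>2"
  shows "near p beta (\<lambda>n. 2 * ln (real n) / ln (1 / q n))" "\<exists>k>0. \<forall>\<^sub>F n in sequentially. 1 / 2 \<le> q n \<and> q n \<le> 1 - k"
proof -
  obtain c0 where c0: "0 < c0" "\<forall>\<^sub>F n in sequentially. c0 \<le> c n" using c_low by blast
  have "c \<in> O(\<lambda>_. 1)" using c\<Theta> by (rule bigthetaD1)
  then obtain C where C: "0 < C" "\<forall>\<^sub>F n in sequentially. norm (c n) \<le> C * norm (1 :: real)" by (rule landau_o.bigE)
  define C1 where "C1 = max C 1"
  have C1: "1 \<le> C1" "C \<le> C1" by (auto simp: C1_def)
  have c0': "0 < c0 / 2" using c0 by simp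
  have i: "\<forall>\<^sub>F n in sequentially. 1 \<le> i n"
    using landau_o.smallD[OF p0 c0'] c0(2) eventually_ok
  proof eventually_elim
    case (elim n)
    show ?case
    proof (rule ccontr)
      assume "\<not> 1 \<le> i n"
      hence "i n = 0" by simp
      hence "c n = d n / n" by (simp add: c_eq)
      moreover have "d n / n \<le> p n" using okD(1,4)[OF elim(3)] p_bounds[of n] by (simp add: field_simps)
      ultimately show False using elim c0(1) by simp
    qed
  qed
  define k where "k = 2 * (exp (- C1) * (1 - exp (- c0)))"
  have k: "0 < k" using c0(1) by (simp add: k_def)
  have q: "\<forall>\<^sub>F n in sequentially. 1 / 2 \<le> q n \<and> q n \<le> 1 - k"
    using C(2) c0(2)
  proof eventually_elim
    case (elim n)
    have "exp (- C1) * (1 - exp (- c0)) \<le> exp (- c n) * (1 - exp (- c n))"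
      using elim C1 c0(1) by (intro mult_mono) auto
    thus ?case unfolding q_def using q_ge_half[of "exp (- c n)"] by (simp add: q_eq k_def)
  qed
  thus "\<exists>k>0. \<forall>\<^sub>F n in sequentially. 1 / 2 \<le> q n \<and> q n \<le> 1 - k" using k by blast
  have q1: "\<forall>\<^sub>F n in sequentially. 1 / 2 \<le> q n \<and> q n < 1" using q by eventually_elim (use k in auto)
  show "near p beta (\<lambda>n. 2 * ln (real n) / ln (1 / q n))"
  proof (rule near_theta[OF _ _ q1])
    fix \<epsilon> :: real assume \<epsilon>: "0 < \<epsilon>"
    show "aas p (\<lambda>n E. beta n E \<le> (1 + \<epsilon>) * (2 * ln (real n) / - ln (q n)))"
    proof (rule upper_theta[OF _ _ \<epsilon>, of "\<lambda>n. exp (- \<bar>c n\<bar>)"])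
      fix \<epsilon> :: real assume "0 < \<epsilon>" "\<epsilon> \<le> 1 / 2"
      thus "aas p (\<lambda>n E. beta n E \<le> 2 * ln (real n) /
        (- ln (1 - (1 - \<epsilon>) * (2 * (x n + exp (- \<bar>c n\<bar>) * (1 - exp (- \<bar>c n\<bar>)))))) + 1)" by (rule upper_sparse_aas[OF i])
    next
      show "\<forall>\<^sub>F n in sequentially. q n = (exp (- \<bar>c n\<bar>))\<^sup>2 + (1 - exp (- \<bar>c n\<bar>))\<^sup>2 \<and> 0 \<le> exp (- \<bar>c n\<bar>) \<and> exp (- \<bar>c n\<bar>) \<le> 1 \<and> q n < 1"
        using q1 c0(2)
      proof eventually_elim
        case (elim n)
        hence "\<bar>c n\<bar> = c n" using c0(1) by linarith
        thus ?case using elim by (simp add: q_def)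
      qed
    qed
  next
    fix \<epsilon> :: real assume \<epsilon>: "0 < \<epsilon>" "\<epsilon> \<le> 1 / 2"
    define r where "r = exp (- (\<epsilon> / 2 * k))"
    have r: "r < 1" using \<epsilon> k by (simp add: r_def)
    \<comment> \<open>A bound for the overlap error \<open>\<theta>\<close>. The first term keeps
      the chance that two vertices miss the shared part at 1/4 or more; the second keeps the change
      of the agreement probability within the gap of \<open>powr_gap\<close>.\<close>
    define \<zeta> where "\<zeta> = min (1 / (4 * C1)) ((1 - r) / (4 * (2 * C1 + 1)))"
    have \<zeta>0: "0 < \<zeta>" using r C1 by (simp add: \<zeta>_def)
    have "\<zeta> \<le> 1 / (4 * C1)" by (simp add: \<zeta>_def)
    hence \<zeta>1: "C1 * \<zeta> \<le> 1 / 4" using C1 by (simp add: field_simps)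
    have "\<zeta> \<le> (1 - r) / (4 * (2 * C1 + 1))" by (simp add: \<zeta>_def)
    hence \<zeta>2: "2 * ((2 * C1 + 1) * \<zeta>) \<le> (1 - r) / 2" using C1 by (simp add: pos_le_divide_eq algebra_simps)
    have "1 * \<zeta> \<le> C1 * \<zeta>" using C1 \<zeta>0 by (intro mult_right_mono) auto
    hence \<zeta>3: "\<zeta> \<le> 1" using \<zeta>1 by linarith
    define K1 where "K1 = 2 / k"
    have K1: "0 < K1" using k by (simp add: K1_def)
    \<comment> \<open>Adds the coefficients \<open>3 * K1 + 10 * K1\<^sup>2\<close> from the overlap
      error and \<open>20 * K1\<close> from the condition on \<open>20 * \<rho> * x\<close>.\<close>
    define K where "K = 23 * K1 + 10 * K1\<^sup>2"
    have K: "0 < K" using K1 by (simp add: K_def add_pos_nonneg)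
    have \<zeta>': "0 < \<zeta> / K" using \<zeta>0 K by simp
    define \<rho> where "\<rho> n = nat \<lfloor>(1 - \<epsilon>) * (2 * ln (real n) / (- ln (q n)))\<rfloor>" for n
    define y where "y n = 3 * e n + 10 * real (\<rho> n) * x n" for n
    have w_ge: "\<forall>\<^sub>F n in sequentially. k \<le> - ln (q n)"
      using q
    proof eventually_elim
      case (elim n)
      have "0 < q n" using elim by linarith
      from ln_le_minus_one[OF this] show ?case using elim by linarith
    qed
    have size: "\<forall>\<^sub>F n in sequentially. 2 * ln (real n) / (- ln (q n)) \<le> K1 * ln (real n)"
      using w_ge eventually_ok
    proof eventually_elim
      case (elim n)
      have w0: "0 < - ln (q n)" using elim(1) k by linarith
      have "2 * ln (real n) / (- ln (q n)) \<le> 2 * ln (real n) / k"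
        by (rule divide_left_mono[OF elim(1) _ mult_pos_pos[OF w0 k]]) (use okD(14)[OF elim(2)] in simp)
      thus ?case by (simp add: K1_def)
    qed
    \<comment> \<open>The squared logarithm is the form of \<open>lower_patterns_aas\<close>, made
      for the dense case, where \<open>- ln q\<close> may be as small as the order of
      \<open>1 / ln n\<close>.\<close>
    have size2: "\<forall>\<^sub>F n in sequentially. 2 * ln (real n) / (- ln (q n)) \<le> K1 * ln (real n) ^ 2"
      using size eventually_ok
    proof eventually_elim
      case (elim n)
      have "ln (real n) ^ 1 \<le> ln (real n) ^ 2" using okD(14)[OF elim(2)] by (intro power_increasing) auto
      hence "K1 * ln (real n) \<le> K1 * ln (real n) ^ 2" using K1 by simp
      thus ?case using elim(1) by linarith
    qed
    have C_ln: "\<forall>\<^sub>F n in sequentially. C1 \<le> ln (real n)" by real_asymp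
    have ap: "\<forall>\<^sub>F n in sequentially. 20 * real (\<rho> n) * x n \<le> 1 \<and>
      (\<forall>s :: nat. s \<le> real (\<rho> n) * d n ^ i n * y n \<longrightarrow> 1 / 4 \<le> (1 - p n) ^ (2 * s)) \<and>
      (\<forall>s :: nat. d n ^ i n * (1 - real (\<rho> n) * y n) \<le> s \<longrightarrow> s \<le> d n ^ i n * (1 + 2 * e n) \<longrightarrow>
        q n powr (1 + \<epsilon> / 2) \<le> ((1 - p n) ^ s)\<^sup>2 + (1 - (1 - p n) ^ s)\<^sup>2)"
      using eventually_ok C(2) c0(2) C_ln params_small[OF i \<zeta>'] miss_close[OF i \<zeta>0 \<zeta>3] size w_ge q
    proof eventually_elim
      case (elim n)
      note ok = okD[OF elim(1)]
      let ?L = "ln (real n)"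
      have p01: "0 \<le> p n" "p n \<le> 1" using p_bounds[of n] by auto
      have c: "0 \<le> c n" "c n \<le> C1" "c n \<le> 2 * ?L" using elim(2-4) C1 c0(1) by auto
      have L1: "1 \<le> ?L" by (rule ok(14))
      have x0: "0 < x n" by (rule ok(13))
      have sm: "?L * e n \<le> \<zeta> / K" "?L ^ 3 * x n \<le> \<zeta> / K" using elim(5) c(3) by auto
      have "?L ^ 1 * x n \<le> ?L ^ 3 * x n" using L1 x0 by (intro mult_right_mono power_increasing) auto
      hence x1: "?L * x n \<le> \<zeta> / K" using sm(2) by simp
      have "?L ^ 2 * x n \<le> ?L ^ 3 * x n" using L1 x0 by (intro mult_right_mono power_increasing) auto
      hence x2: "?L ^ 2 * x n \<le> \<zeta> / K" using sm(2) by linarith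
      define R where "R = real (\<rho> n)"
      have f0: "0 \<le> 2 * ?L / (- ln (q n))" using elim(8) k L1 by (intro divide_nonneg_pos) auto
      have "R \<le> (1 - \<epsilon>) * (2 * ?L / (- ln (q n)))" unfolding R_def \<rho>_def by (rule of_nat_floor) (use f0 \<epsilon> in \<open>intro mult_nonneg_nonneg; simp\<close>)
      also have "\<dots> \<le> 1 * (2 * ?L / (- ln (q n)))" using f0 \<epsilon> by (intro mult_right_mono) auto
      finally have R: "R \<le> K1 * ?L" using elim(7) by linarith
      have R0: "0 \<le> R" by (simp add: R_def)
      have "R * x n \<le> K1 * ?L * x n" using R x0 by (intro mult_right_mono) auto
      also have "\<dots> = K1 * (?L * x n)" by simp
      also have "\<dots> \<le> K1 * (\<zeta> / K)" using x1 K1 by (intro mult_left_mono) auto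
      finally have b1: "R * x n \<le> K1 * (\<zeta> / K)" .
      have "R * e n \<le> K1 * ?L * e n" using R ok(11) by (intro mult_right_mono) auto
      also have "\<dots> = K1 * (?L * e n)" by simp
      also have "\<dots> \<le> K1 * (\<zeta> / K)" using sm(1) K1 by (intro mult_left_mono) auto
      finally have b2: "R * e n \<le> K1 * (\<zeta> / K)" .
      have "R * R * x n \<le> (K1 * ?L) * (K1 * ?L) * x n" using R R0 K1 L1 x0 by (intro mult_right_mono mult_mono) auto
      also have "\<dots> = K1\<^sup>2 * (?L ^ 2 * x n)" by (simp add: power2_eq_square)
      also have "\<dots> \<le> K1\<^sup>2 * (\<zeta> / K)" using x2 by (intro mult_left_mono) auto
      finally have b3: "R * R * x n \<le> K1\<^sup>2 * (\<zeta> / K)" .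
      have KK: "23 * (K1 * (\<zeta> / K)) + 10 * (K1\<^sup>2 * (\<zeta> / K)) = \<zeta>"
      proof -
        have "23 * (K1 * (\<zeta> / K)) + 10 * (K1\<^sup>2 * (\<zeta> / K)) = K * (\<zeta> / K)" unfolding K_def by (simp only: distrib_right mult.assoc)
        also have "\<dots> = \<zeta>" using K by simp
        finally show ?thesis .
      qed
      have nn: "0 \<le> K1 * (\<zeta> / K)" by (rule mult_nonneg_nonneg) (use K1 \<zeta>' in linarith)+
      have nn2: "0 \<le> K1\<^sup>2 * (\<zeta> / K)" by (rule mult_nonneg_nonneg[OF zero_le_power2]) (use \<zeta>' in linarith)
      note nn = nn nn2
      define \<theta> where "\<theta> = R * y n"
      have "\<theta> = 3 * (R * e n) + 10 * (R * R * x n)" by (simp add: \<theta>_def y_def R_def algebra_simps)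
      hence \<theta>1: "\<theta> \<le> \<zeta>" using b2 b3 KK nn by linarith
      have \<theta>0: "0 \<le> \<theta>" using R0 ok(11) x0 by (simp add: \<theta>_def y_def)
      have "c n * \<theta> \<le> C1 * \<zeta>" using c \<theta>0 \<theta>1 C1 by (intro mult_mono) auto
      hence c\<theta>: "c n * \<theta> \<le> C1 * \<zeta>" "0 \<le> c n * \<theta>" using c \<theta>0 by auto
      have A: "20 * real (\<rho> n) * x n \<le> 1" using b1 KK nn \<zeta>3 unfolding R_def mult.assoc by linarith
      have B: "1 / 4 \<le> (1 - p n) ^ (2 * s)" if s: "s \<le> real (\<rho> n) * d n ^ i n * y n" for s :: nat
      proof -
        have "real (\<rho> n) * d n ^ i n * y n = d n ^ i n * \<theta>" by (simp add: \<theta>_def R_def)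
        hence "1 - 2 * c n * \<theta> \<le> (1 - p n) ^ s" using s by (intro miss_few[OF elim(1)]) linarith
        moreover have "2 * c n * \<theta> = 2 * (c n * \<theta>)" by simp
        ultimately have "1 / 2 \<le> (1 - p n) ^ s" using c\<theta> \<zeta>1 by linarith
        hence "(1 / 2) ^ 2 \<le> ((1 - p n) ^ s)\<^sup>2" by (rule power_mono) simp
        thus ?thesis by (simp only: power_even_eq) (simp add: power2_eq_square)
      qed
      have D: "q n powr (1 + \<epsilon> / 2) \<le> ((1 - p n) ^ s)\<^sup>2 + (1 - (1 - p n) ^ s)\<^sup>2"
        if s: "d n ^ i n * (1 - real (\<rho> n) * y n) \<le> s" "s \<le> d n ^ i n * (1 + 2 * e n)" for s :: nat
      proof -
        define a where "a = exp (- c n)"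
        define b where "b = (1 - p n) ^ s"
        have a: "0 < a" "a \<le> 1" using c by (auto simp: a_def)
        have b01: "0 \<le> b" "b \<le> 1" using p01 by (auto simp: b_def power_le_one)
        have "b \<le> exp (- c n + c n * \<theta>)" unfolding b_def by (rule miss_le[OF elim(1)]) (use s(1) in \<open>simp add: \<theta>_def R_def\<close>)
        also have "\<dots> = a * exp (c n * \<theta>)" by (simp only: a_def exp_add)
        also have "\<dots> \<le> a * (1 + 2 * (c n * \<theta>))" using a c\<theta> \<zeta>1 by (intro mult_left_mono exp_small) auto
        finally have "b \<le> a + a * (2 * (c n * \<theta>))" by (simp add: distrib_left)
        moreover have "a * (2 * (c n * \<theta>)) \<le> 1 * (2 * (C1 * \<zeta>))" by (rule mult_mono) (use a c\<theta> in linarith)+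
        ultimately have up: "b - a \<le> 2 * (C1 * \<zeta>)" unfolding mult_1_left by linarith
        have "exp (- c n - \<zeta>) \<le> b" unfolding b_def using elim(6) c(3) s(2) by blast
        moreover have "exp (- c n - \<zeta>) = a * exp (- \<zeta>)" by (simp add: a_def exp_diff exp_minus divide_inverse)
        moreover have "a * (1 - \<zeta>) \<le> a * exp (- \<zeta>)" using a exp_ge_add_one_self[of "- \<zeta>"] by (intro mult_left_mono) auto
        moreover have "a * (1 - \<zeta>) = a - a * \<zeta>" by (simp add: algebra_simps)
        moreover have "a * \<zeta> \<le> 1 * \<zeta>" using a \<zeta>0 by (intro mult_right_mono) auto
        ultimately have lo: "a - b \<le> \<zeta>" by linarith
        have e: "(2 * C1 + 1) * \<zeta> = 2 * (C1 * \<zeta>) + \<zeta>" by (simp add: algebra_simps)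
        have "0 \<le> C1 * \<zeta>" using C1 \<zeta>0 by simp
        hence "\<bar>b - a\<bar> \<le> (2 * C1 + 1) * \<zeta>" unfolding e using up lo \<zeta>0 by linarith
        from q_diff[OF less_imp_le[OF a(1)] a(2) b01 this]
        have "q n - 2 * ((2 * C1 + 1) * \<zeta>) \<le> b\<^sup>2 + (1 - b)\<^sup>2" by (simp only: q_def a_def)
        moreover have "q n powr (1 + \<epsilon> / 2) \<le> q n - (1 - r) / 2" unfolding r_def
          by (rule powr_gap[OF \<epsilon>(1) k]) (use elim(9) in auto)
        ultimately show ?thesis unfolding b_def using \<zeta>2 by linarith
      qed
      show ?case using A B D by blast
    qed
    show "aas p (\<lambda>n E. (1 - \<epsilon>) * (2 * ln (real n) / - ln (q n)) \<le> beta n E)"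
      by (rule lower_patterns_aas[OF \<epsilon> q1 size2 ap[unfolded y_def \<rho>_def]])
  qed
qed

text \<open>For \<open>p\<close> of constant order \<open>i\<close> is 0: spheres are single
  vertices, \<open>e\<close> is 0 and \<open>x\<close> is \<open>1 / n\<close>. The size estimates
  then force own parts of size 1 and empty shared parts, so the miss probability is exactly
  \<open>1 - p\<close>. The upper bound on \<open>d\<close> keeps \<open>1 - p\<close> above
  \<open>1 / ln n\<close>, and so \<open>\<rho>\<close> polylogarithmic.\<close>

lemma dense_theta:
  assumes p\<Theta>: "p \<in> \<Theta>(\<lambda>_. 1)"
    and d_upper: "\<forall>\<^sub>F n in sequentially. d n \<le> real n * (1 - 3 * ln (ln (real n)) / ln (real n))"
  defines "q \<equiv> \<lambda>n. (p n)\<^sup>2 + (1 - p n)\<^sup>2"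
  shows "near p beta (\<lambda>n. 2 * ln (real n) / ln (1 / q n))" "\<forall>\<^sub>F n in sequentially. 1 / 2 \<le> q n \<and> q n < 1"
    "(\<lambda>n. 1 - p n) \<in> \<Omega>(\<lambda>_. 1) \<Longrightarrow> \<exists>k>0. \<forall>\<^sub>F n in sequentially. 1 / 2 \<le> q n \<and> q n \<le> 1 - k"
proof -
  have "p \<in> \<Omega>(\<lambda>_. 1)" using p\<Theta> by (rule bigthetaD2)
  then obtain p0 where p0': "0 < p0" "\<forall>\<^sub>F n in sequentially. p0 * norm (1 :: real) \<le> norm (p n)" by (rule landau_omega.bigE)
  have p0: "\<forall>\<^sub>F n in sequentially. p0 \<le> p n" using p0'(2) by eventually_elim (use p_bounds in auto)
  have half: "0 < p0 / 4" using p0'(1) by simp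
  have i0: "\<forall>\<^sub>F n in sequentially. ok n \<and> i n = 0 \<and> e n = 0 \<and> x n = 1 / n"
    using eventually_ok p0 x_small[OF half]
  proof eventually_elim
    case (elim n)
    \<comment> \<open>A positive \<open>i\<close> would give \<open>p \<le> 2 * x\<close>, but
      \<open>x\<close> tends to 0.\<close>
    have "\<not> 1 \<le> i n" using p_le_x[OF elim(1)] elim p0'(1) by fastforce
    hence "i n = 0" by simp
    thus ?case using elim(1) by (simp add: e_def x_def)
  qed
  have gap: "\<forall>\<^sub>F n in sequentially. 3 * ln (ln (real n)) / ln (real n) - 1 / real n \<le> 1 - p n"
    using d_upper eventually_ok
  proof eventually_elim
    case (elim n)
    have n0: "0 < real n" using okD(4)[OF elim(2)] by simp
    define t where "t = 3 * ln (ln (real n)) / ln (real n)"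
    have "p n * (real n - 1) \<le> real n * (1 - t)" using elim(1) okD(1)[OF elim(2)] by (simp add: t_def)
    hence "real n * t - 1 \<le> real n * (1 - p n)" using p_bounds[of n] by (simp add: algebra_simps)
    hence "(real n * t - 1) / n \<le> 1 - p n" using n0 by (simp add: divide_le_eq mult.commute)
    moreover have "(real n * t - 1) / n = t - 1 / n" using n0 by (simp add: diff_divide_distrib)
    ultimately show ?case by (simp add: t_def)
  qed
  have gap2: "\<forall>\<^sub>F n in sequentially. 1 / ln (real n) \<le> 1 - p n"
  proof -
    have "\<forall>\<^sub>F n in sequentially. 1 / ln (real n) \<le> 3 * ln (ln (real n)) / ln (real n) - 1 / real n" by real_asymp
    with gap show ?thesis by eventually_elim linarith
  qed
  have q_p: "q n = 1 - 2 * (p n * (1 - p n))" for n by (simp add: q_def q_eq)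
  show q1: "\<forall>\<^sub>F n in sequentially. 1 / 2 \<le> q n \<and> q n < 1"
    using gap2 p0 eventually_ok
  proof eventually_elim
    case (elim n)
    have "0 < 1 / ln (real n)" using okD(14)[OF elim(3)] by simp
    hence "0 < p n * (1 - p n)" using elim p0'(1) by (intro mult_pos_pos) linarith+
    thus ?case using q_ge_half[of "p n"] unfolding q_p by (simp add: q_eq)
  qed
  show "\<exists>k>0. \<forall>\<^sub>F n in sequentially. 1 / 2 \<le> q n \<and> q n \<le> 1 - k" if \<Omega>: "(\<lambda>n. 1 - p n) \<in> \<Omega>(\<lambda>_. 1)"
  proof -
    obtain k where k: "0 < k" "\<forall>\<^sub>F n in sequentially. k * norm (1 :: real) \<le> norm (1 - p n)" using \<Omega> by (rule landau_omega.bigE)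
    have "\<forall>\<^sub>F n in sequentially. 1 / 2 \<le> q n \<and> q n \<le> 1 - 2 * (p0 * k)"
      using k(2) p0 q1
    proof eventually_elim
      case (elim n)
      have "k \<le> 1 - p n" using elim(1) p_bounds[of n] by simp
      hence "p0 * k \<le> p n * (1 - p n)" using elim(2) p0'(1) k(1) by (intro mult_mono) auto
      thus ?case using elim(3) unfolding q_p by linarith
    qed
    moreover have "0 < 2 * (p0 * k)" using p0'(1) k(1) by simp
    ultimately show ?thesis by blast
  qed
  show "near p beta (\<lambda>n. 2 * ln (real n) / ln (1 / q n))"
  proof (rule near_theta[OF _ _ q1])
    fix \<epsilon> :: real assume \<epsilon>: "0 < \<epsilon>"
    show "aas p (\<lambda>n E. beta n E \<le> (1 + \<epsilon>) * (2 * ln (real n) / - ln (q n)))"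
    proof (rule upper_theta[OF _ _ \<epsilon>, of "\<lambda>n. 1 - p n"])
      show "\<forall>\<^sub>F n in sequentially. q n = (1 - p n)\<^sup>2 + (1 - (1 - p n))\<^sup>2 \<and> 0 \<le> 1 - p n \<and> 1 - p n \<le> 1 \<and> q n < 1"
        using q1 by eventually_elim (use p_bounds in \<open>auto simp: q_def\<close>)
    next
      fix \<epsilon> :: real assume \<epsilon>: "0 < \<epsilon>" "\<epsilon> \<le> 1 / 2"
      show "aas p (\<lambda>n E. beta n E \<le> 2 * ln (real n) / (- ln (1 - (1 - \<epsilon>) * (2 * (x n + (1 - p n) * (1 - (1 - p n)))))) + 1)"
      proof (rule upper_aas[OF _ \<epsilon>])
        show "0 \<le> 1 - p n \<and> 1 - p n \<le> 1" for n using p_bounds[of n] by auto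
        show "\<forall>\<^sub>F n in sequentially. K * ln (real n) \<le> d n ^ i n + real n * ((1 - p n) * (1 - (1 - p n)))" for K
        proof -
          \<comment> \<open>With \<open>i = 0\<close> the spheres contribute only 1, so the fresh
            vertices must supply the mean: \<open>n * p * (1 - p)\<close> is of order at least
            \<open>n * ln (ln n) / ln n\<close>.\<close>
          have "\<forall>\<^sub>F n in sequentially. \<bar>K\<bar> * ln (real n) \<le> p0 * (real n * (3 * ln (ln (real n)) / ln (real n) - 1 / real n))"
            using p0'(1) by real_asymp
          with gap p0 i0 show ?thesis
          proof eventually_elim
            case (elim n)
            have n0: "0 \<le> real n" by simp
            have "real n * (3 * ln (ln (real n)) / ln (real n) - 1 / real n) \<le> real n * (1 - p n)" by (rule mult_left_mono[OF elim(1) n0])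
            hence "p0 * (real n * (3 * ln (ln (real n)) / ln (real n) - 1 / real n)) \<le> p0 * (real n * (1 - p n))"
              by (rule mult_left_mono) (use p0'(1) in linarith)
            also have "\<dots> \<le> p n * (real n * (1 - p n))" using elim(2) p_bounds[of n] by (intro mult_right_mono) auto
            finally have 1: "\<bar>K\<bar> * ln (real n) \<le> p n * (real n * (1 - p n))" using elim(4) by linarith
            have "0 \<le> ln (real n)" using elim(3) okD(14)[of n] by linarith
            hence "K * ln (real n) \<le> \<bar>K\<bar> * ln (real n)" by (intro mult_right_mono) auto
            moreover have "real n * ((1 - p n) * (1 - (1 - p n))) = p n * (real n * (1 - p n))" by simp
            moreover have "d n ^ i n = 1" using elim(3) by simp
            ultimately show ?case using 1 by linarith
          qed
        qed
        fix \<eta> :: real assume \<eta>: "0 < \<eta>"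
        show "\<forall>\<^sub>F n in sequentially. real n * (1 - p n) \<le> \<eta> * d n ^ i n \<or>
          ((\<forall>s :: nat. s \<le> d n ^ i n * (1 + 2 * e n) \<longrightarrow> (1 - \<eta>) * (1 - p n) \<le> (1 - p n) ^ s) \<and>
           (\<forall>s :: nat. d n ^ i n * (1 - 4 * e n - 40 * x n) \<le> s \<longrightarrow> (1 - \<eta>) * (1 - (1 - p n)) \<le> 1 - (1 - p n) ^ s) \<and>
           (\<forall>s :: nat. s \<le> d n ^ i n * (6 * e n + 40 * x n) \<longrightarrow> 1 - \<eta> \<le> (1 - p n) ^ s))"
          using i0 eventually_ge_at_top[of 41]
        proof eventually_elim
          case (elim n)
          have p01: "0 \<le> p n" "p n \<le> 1" using p_bounds[of n] by auto
          have x40: "40 * x n < 1" using elim by simp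
          have dd: "d n ^ i n = 1" "e n = 0" using elim by auto
          have A: "(1 - \<eta>) * (1 - p n) \<le> (1 - p n) ^ s" if "real s \<le> d n ^ i n * (1 + 2 * e n)" for s
          proof -
            have "real s \<le> 1" using that dd by simp
            hence "(1 - p n) ^ 1 \<le> (1 - p n) ^ s" using p01 by (intro power_decreasing) auto
            moreover have "(1 - \<eta>) * (1 - p n) \<le> 1 * (1 - p n)" using \<eta> p01 by (intro mult_right_mono) auto
            ultimately show ?thesis by simp
          qed
          have B: "(1 - \<eta>) * (1 - (1 - p n)) \<le> 1 - (1 - p n) ^ s" if "d n ^ i n * (1 - 4 * e n - 40 * x n) \<le> real s" for s
          proof -
            have "0 < real s" using that dd x40 by simp
            hence "(1 - p n) ^ s \<le> (1 - p n) ^ 1" using p01 by (intro power_decreasing) auto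
            moreover have "(1 - \<eta>) * p n \<le> 1 * p n" using \<eta> p01 by (intro mult_right_mono) auto
            ultimately show ?thesis by simp
          qed
          have D: "1 - \<eta> \<le> (1 - p n) ^ s" if "real s \<le> d n ^ i n * (6 * e n + 40 * x n)" for s
          proof -
            have "real s < 1" using that dd x40 by simp
            hence "s = 0" by simp
            thus ?thesis using \<eta> by simp
          qed
          show ?case using A B D by blast
        qed
      qed
    qed
  next
    fix \<epsilon> :: real assume \<epsilon>: "0 < \<epsilon>" "\<epsilon> \<le> 1 / 2"
    define \<rho> where "\<rho> n = nat \<lfloor>(1 - \<epsilon>) * (2 * ln (real n) / (- ln (q n)))\<rfloor>" for n
    define y where "y n = 3 * e n + 10 * real (\<rho> n) * x n" for n
    have size: "\<forall>\<^sub>F n in sequentially. 2 * ln (real n) / (- ln (q n)) \<le> 1 / p0 * ln (real n) ^ 2"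
      using gap2 p0 eventually_ok q1
    proof eventually_elim
      case (elim n)
      let ?L = "ln (real n)"
      have L0: "0 < ?L" using okD(14)[OF elim(3)] by linarith
      have "0 < q n" using elim(4) by linarith
      hence "ln (q n) \<le> q n - 1" by (rule ln_le_minus_one)
      moreover have "p0 * (1 / ?L) \<le> p n * (1 - p n)" using elim(1,2) p0'(1) L0 p_bounds[of n] by (intro mult_mono) auto
      ultimately have w: "2 * (p0 / ?L) \<le> - ln (q n)" unfolding q_p by simp
      have pos: "0 < 2 * (p0 / ?L)" using p0'(1) L0 by simp
      have w0: "0 < - ln (q n)" using w pos by linarith
      have "2 * ?L / (- ln (q n)) \<le> 2 * ?L / (2 * (p0 / ?L))" by (rule divide_left_mono[OF w _ mult_pos_pos[OF w0 pos]]) (use L0 in simp)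
      also have "\<dots> = 1 / p0 * ?L ^ 2" by (simp add: power2_eq_square)
      finally show ?case .
    qed
    have "\<forall>\<^sub>F n in sequentially. 20 * (1 / p0 * ln (real n) ^ 2) * (1 / real n) \<le> 1 \<and>
        10 * (1 / p0 * ln (real n) ^ 2)\<^sup>2 * (1 / real n) \<le> 1 / 2"
      using p0'(1) by (intro eventually_conj) (real_asymp+)
    hence ap: "\<forall>\<^sub>F n in sequentially. 20 * real (\<rho> n) * x n \<le> 1 \<and>
      (\<forall>s :: nat. s \<le> real (\<rho> n) * d n ^ i n * y n \<longrightarrow> 1 / 4 \<le> (1 - p n) ^ (2 * s)) \<and>
      (\<forall>s :: nat. d n ^ i n * (1 - real (\<rho> n) * y n) \<le> s \<longrightarrow> s \<le> d n ^ i n * (1 + 2 * e n) \<longrightarrow>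
        q n powr (1 + \<epsilon> / 2) \<le> ((1 - p n) ^ s)\<^sup>2 + (1 - (1 - p n) ^ s)\<^sup>2)"
      using i0 size q1
    proof eventually_elim
      case (elim n)
      define M where "M = 1 / p0 * ln (real n) ^ 2"
      define R where "R = real (\<rho> n)"
      have dd: "d n ^ i n = 1" "e n = 0" "x n = 1 / n" using elim(2) by auto
      have "0 < q n" "q n < 1" using elim(4) by auto
      hence w0: "0 < - ln (q n)" by simp
      have L0: "0 \<le> ln (real n)" using okD(14)[of n] elim(2) by linarith
      have f0: "0 \<le> 2 * ln (real n) / (- ln (q n))" using w0 L0 by (intro divide_nonneg_pos) auto
      have "R \<le> (1 - \<epsilon>) * (2 * ln (real n) / (- ln (q n)))" unfolding R_def \<rho>_def by (rule of_nat_floor) (use f0 \<epsilon> in \<open>intro mult_nonneg_nonneg; simp\<close>)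
      also have "\<dots> \<le> 1 * (2 * ln (real n) / (- ln (q n)))" using f0 \<epsilon> by (intro mult_right_mono) auto
      finally have R: "R \<le> M" using elim(3) unfolding M_def by linarith
      have R0: "0 \<le> R" by (simp add: R_def)
      have "R * (1 / n) \<le> M * (1 / n)" using R by (intro mult_right_mono) auto
      moreover have "20 * M * (1 / n) = 20 * (M * (1 / n))" "20 * R * (1 / n) = 20 * (R * (1 / n))" by simp_all
      ultimately have A: "20 * real (\<rho> n) * x n \<le> 1" using elim(1) unfolding M_def[symmetric] R_def[symmetric] dd(3) by linarith
      have "R * R * (1 / n) \<le> M * M * (1 / n)" using R R0 by (intro mult_right_mono mult_mono) auto
      moreover have "10 * M\<^sup>2 * (1 / n) = 10 * (M * M * (1 / n))" by (simp add: power2_eq_square)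
      moreover have "R * y n = 10 * (R * R * (1 / n))" by (simp add: y_def dd R_def)
      ultimately have y1: "R * y n \<le> 1 / 2" using elim(1) unfolding M_def[symmetric] by linarith
      have B: "1 / 4 \<le> (1 - p n) ^ (2 * s)" if "real s \<le> real (\<rho> n) * d n ^ i n * y n" for s
      proof -
        have "real s < 1" using that y1 by (simp add: dd R_def)
        thus ?thesis by simp
      qed
      have D: "q n powr (1 + \<epsilon> / 2) \<le> ((1 - p n) ^ s)\<^sup>2 + (1 - (1 - p n) ^ s)\<^sup>2"
        if s: "d n ^ i n * (1 - real (\<rho> n) * y n) \<le> real s" "real s \<le> d n ^ i n * (1 + 2 * e n)" for s
      proof -
        have "0 < real s" "real s \<le> 1" using s y1 by (simp_all add: dd R_def)
        hence "s = 1" by simp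
        moreover have "q n powr (1 + \<epsilon> / 2) \<le> q n powr 1" using elim(4) \<epsilon> by (intro powr_mono') auto
        ultimately show ?thesis using elim(4) by (simp add: q_def)
      qed
      show ?case using A B D by blast
    qed
    show "aas p (\<lambda>n E. (1 - \<epsilon>) * (2 * ln (real n) / - ln (q n)) \<le> beta n E)"
      by (rule lower_patterns_aas[OF \<epsilon> q1 size ap[unfolded y_def \<rho>_def]])
  qed
qed

lemma asymp_eq_of_near:
  assumes "near p beta (\<lambda>n. 2 * ln (real n) / ln (1 / q n))" "\<forall>\<^sub>F n in sequentially. 1 / 2 \<le> q n \<and> q n < 1"
  shows "aas_asymp_eq p beta (\<lambda>n. 2 * ln (real n) / ln (1 / q n))"
proof (rule nearD_asymp_eq[OF assms(1)])
  show "\<forall>\<^sub>F n in sequentially. 0 \<le> 2 * ln (real n) / ln (1 / q n)" using assms(2) eventually_ok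
  proof eventually_elim
    case (elim n)
    have "0 \<le> ln (1 / q n)" using elim(1) by simp
    thus ?case using okD(14)[OF elim(2)] by (intro divide_nonneg_nonneg) auto
  qed
qed

end

theorem theorem1p1:
  fixes p d c q \<eta> :: "nat \<Rightarrow> real" and i :: "nat \<Rightarrow> nat"
  assumes p_range: "\<And>n. 0 \<le> p n \<and> p n \<le> 1"
    and d_eq: "\<And>n. d n = p n * (real n - 1)"
    and d_lower: "(\<lambda>n. ln (real n) ^ 5) \<in> o(d)"
    and d_upper: "\<forall>\<^sub>F n in sequentially. d n \<le> real n * (1 - 3 * ln (ln (real n)) / ln (real n))"
    and i_largest: "largest_exponent d i"
    and c_eq: "\<And>n. c n = d n ^ (i n + 1) / real n"
    and q_sparse: "p \<in> o(\<lambda>_. 1) \<Longrightarrow> q = (\<lambda>n. (exp (- c n))\<^sup>2 + (1 - exp (- c n))\<^sup>2)"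
    and q_dense: "p \<in> \<Theta>(\<lambda>_. 1) \<Longrightarrow> q = (\<lambda>n. (p n)\<^sup>2 + (1 - p n)\<^sup>2)"
    and eta_eq: "\<And>n. 1 \<le> i n \<Longrightarrow> \<eta> n = log (real n) (d n ^ i n)"
  shows
    "(c \<in> \<Theta>(\<lambda>_. 1) \<and> (p \<in> o(\<lambda>_. 1) \<or> p \<in> \<Theta>(\<lambda>_. 1)) \<longrightarrow>
        aas_asymp_eq p beta (\<lambda>n. 2 * ln (real n) / ln (1 / q n)) \<and>
        ((\<lambda>n. 1 - p n) \<in> \<Omega>(\<lambda>_. 1) \<longrightarrow> aas_bigtheta p beta (\<lambda>n. ln (real n))))
     \<and>
     (filterlim c at_top sequentially \<and>
      (\<forall>\<^sub>F n in sequentially. exp (c n) \<le> ln (real n) / (3 * ln (ln (real n)))) \<longrightarrow>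
        aas_asymp_eq p beta (\<lambda>n. 2 * ln (real n) / ln (1 / q n)) \<and>
        aas_asymp_eq p beta (\<lambda>n. exp (c n) * ln (real n)) \<and>
        aas_much_greater p beta (\<lambda>n. ln (real n)))
     \<and>
     ((\<forall>\<^sub>F n in sequentially. exp (c n) > ln (real n) / (3 * ln (ln (real n)))) \<longrightarrow>
        (\<exists>\<delta>\<^sub>1 \<delta>\<^sub>2 :: nat \<Rightarrow> real. \<delta>\<^sub>1 \<in> o(\<lambda>_. 1) \<and> \<delta>\<^sub>2 \<in> o(\<lambda>_. 1) \<and>
           aas p (\<lambda>n E.
             (\<eta> n + \<delta>\<^sub>1 n) * inverse (d n ^ i n / real n + exp (- c n)) * ln (real n) \<le> beta n E \<and>
             beta n E \<le> (1 + \<delta>\<^sub>2 n) * inverse (d n ^ i n / real n + exp (- c n)) * ln (real n))) \<and>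
        ((\<lambda>n. exp (- c n)) \<in> \<Omega>(\<lambda>n. d n ^ i n / real n) \<longrightarrow>
           aas_bigtheta p beta (\<lambda>n. exp (c n) * ln (real n)) \<and>
           aas_bigtheta p beta (\<lambda>n. ln (real n) / ln (1 / q n))) \<and>
        ((\<lambda>n. exp (- c n)) \<in> o(\<lambda>n. d n ^ i n / real n) \<longrightarrow>
           aas_bigtheta p beta (\<lambda>n. real n * ln (real n) / d n ^ i n)) \<and>
        aas_much_greater p beta (\<lambda>n. ln (real n)))"
proof -
  interpret gnp_seq p d c i by (rule gnp_seq.intro[OF p_range d_eq d_lower i_largest c_eq])
  show ?thesis
  proof (rule conjI[OF impI conjI[OF impI impI]], goal_cases)
    case 1
    then consider (sparse) "p \<in> o(\<lambda>_. 1)" | (dense) "p \<in> \<Theta>(\<lambda>_. 1)" by blast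
    thus ?case
    proof cases
      case sparse
      have c\<Theta>: "c \<in> \<Theta>(\<lambda>_. 1)" using 1 by blast
      have near: "near p beta (\<lambda>n. 2 * ln (real n) / ln (1 / q n))"
        unfolding q_sparse[OF sparse] by (rule sparse_theta(1)[OF sparse c\<Theta>])
      have "\<exists>k>0. \<forall>\<^sub>F n in sequentially. 1 / 2 \<le> q n \<and> q n \<le> 1 - k"
        unfolding q_sparse[OF sparse] by (rule sparse_theta(2)[OF sparse c\<Theta>])
      then obtain k where k: "0 < k" "\<forall>\<^sub>F n in sequentially. 1 / 2 \<le> q n \<and> q n \<le> 1 - k" by blast
      have "\<forall>\<^sub>F n in sequentially. 1 / 2 \<le> q n \<and> q n < 1" using k(2) by eventually_elim (use k(1) in auto)
      thus ?thesis using asymp_eq_of_near[OF near] theta_ln[OF near k(2,1)] by blast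
    next
      case dense
      note D = dense_theta[OF dense d_upper]
      have near: "near p beta (\<lambda>n. 2 * ln (real n) / ln (1 / q n))"
        unfolding q_dense[OF dense] by (rule D(1))
      have q: "\<forall>\<^sub>F n in sequentially. 1 / 2 \<le> q n \<and> q n < 1"
        unfolding q_dense[OF dense] by (rule D(2))
      \<comment> \<open>If \<open>p\<close> approaches 1, then \<open>q\<close> tends to 1 and
        \<open>2 * ln n / ln (1 / q)\<close> exceeds the order of \<open>ln n\<close>; this is why
        the claim is tied to \<open>1 - p\<close> being bounded below.\<close>
      have "aas_bigtheta p beta (\<lambda>n. ln (real n))" if \<Omega>: "(\<lambda>n. 1 - p n) \<in> \<Omega>(\<lambda>_. 1)"
      proof -
        have "\<exists>k>0. \<forall>\<^sub>F n in sequentially. 1 / 2 \<le> q n \<and> q n \<le> 1 - k"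
          unfolding q_dense[OF dense] by (rule D(3)[OF \<Omega>])
        then obtain k where k: "0 < k" "\<forall>\<^sub>F n in sequentially. 1 / 2 \<le> q n \<and> q n \<le> 1 - k" by blast
        show ?thesis by (rule theta_ln[OF near k(2,1)])
      qed
      thus ?thesis using asymp_eq_of_near[OF near q] by blast
    qed
  next
    case 2
    hence c_lim: "filterlim c at_top sequentially"
      and c_le: "\<forall>\<^sub>F n in sequentially. exp (c n) \<le> ln (real n) / (3 * ln (ln (real n)))" by blast+
    have "\<forall>\<^sub>F n in sequentially. ln (real n) / (3 * ln (ln (real n))) \<le> ln (real n)" by real_asymp
    with c_le have ec: "\<forall>\<^sub>F n in sequentially. exp (c n) \<le> ln (real n)" by eventually_elim linarith
    \<comment> \<open>\<open>c\<close> tending to infinity forces \<open>i \<ge> 1\<close> and hence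
      \<open>p = o(1)\<close>, which selects the sparse formula for \<open>q\<close>.\<close>
    note q = q_sparse[OF p_smallo[OF i_pos[OF c_lim]]]
    have near: "near p beta (\<lambda>n. 2 * ln (real n) / ln (1 / q n))"
      unfolding q by (rule near_ln_q[OF c_lim ec])
    have q1: "\<forall>\<^sub>F n in sequentially. 1 / 2 \<le> q n \<and> q n < 1"
      using c_ge[OF c_lim, of 1]
    proof eventually_elim
      case (elim n)
      have "exp (- c n) < 1" using elim by simp
      hence "0 < exp (- c n) * (1 - exp (- c n))" by (intro mult_pos_pos) auto
      moreover have "q n = (exp (- c n))\<^sup>2 + (1 - exp (- c n))\<^sup>2" by (simp add: q)
      ultimately show ?case using q_ge_half[of "exp (- c n)"] q_eq[of "exp (- c n)"] by linarith
    qed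
    have nn: "\<forall>\<^sub>F n in sequentially. 0 \<le> exp (c n) * ln (real n)"
      using eventually_ge_at_top[of 1] by eventually_elim simp
    have "aas p (\<lambda>n E. h n / 4 \<le> beta n E)"
      by (rule aas_mono[OF near_h[OF c_lim ec, unfolded near_def, rule_format, of "3 / 4"]]) simp_all
    from much_greater_h[OF c_lim this] nearD_asymp_eq[OF near_exp_c[OF c_lim ec] nn] asymp_eq_of_near[OF near q1]
    show ?case by blast
  next
    case 3
    \<comment> \<open>The threshold \<open>ln n / (3 * ln (ln n))\<close> itself tends to infinity,
      so (iii) falls into the regime of growing \<open>c\<close>.\<close>
    have c_lim: "filterlim c at_top sequentially"
    proof (rule filterlim_at_top_mono)
      show "filterlim (\<lambda>n. ln (ln (real n) / (3 * ln (ln (real n))))) at_top sequentially" by real_asymp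
      have "\<forall>\<^sub>F n in sequentially. 0 < ln (real n) / (3 * ln (ln (real n)))" by real_asymp
      with 3 show "\<forall>\<^sub>F n in sequentially. ln (ln (real n) / (3 * ln (ln (real n)))) \<le> c n"
      proof eventually_elim
        case (elim n)
        have "ln (ln (real n) / (3 * ln (ln (real n)))) \<le> ln (exp (c n))" using elim by (subst ln_le_cancel_iff) auto
        thus ?case by simp
      qed
    qed
    note q = q_sparse[OF p_smallo[OF i_pos[OF c_lim]]]
    have b: "aas p (\<lambda>n E. h n / 4 \<le> beta n E \<and> beta n E \<le> 2 * h n)" by (rule beta_h[OF c_lim]) (rule eta_eq)
    have "aas p (\<lambda>n E. h n / 4 \<le> beta n E)" by (rule aas_mono[OF b]) simp
    note mg = much_greater_h[OF c_lim this]
    show ?case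
    proof (intro conjI impI)
      show "\<exists>\<delta>\<^sub>1 \<delta>\<^sub>2 :: nat \<Rightarrow> real. \<delta>\<^sub>1 \<in> o(\<lambda>_. 1) \<and> \<delta>\<^sub>2 \<in> o(\<lambda>_. 1) \<and>
           aas p (\<lambda>n E.
             (\<eta> n + \<delta>\<^sub>1 n) * inverse (d n ^ i n / real n + exp (- c n)) * ln (real n) \<le> beta n E \<and>
             beta n E \<le> (1 + \<delta>\<^sub>2 n) * inverse (d n ^ i n / real n + exp (- c n)) * ln (real n))"
        by (rule eta_bounds[OF c_lim]) (rule eta_eq)
    next
      assume \<Omega>: "(\<lambda>n. exp (- c n)) \<in> \<Omega>(\<lambda>n. d n ^ i n / real n)"
      show "aas_bigtheta p beta (\<lambda>n. exp (c n) * ln (real n))" by (rule theta_exp_c(1)[OF c_lim _ \<Omega>]) (rule eta_eq)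
      show "aas_bigtheta p beta (\<lambda>n. ln (real n) / ln (1 / q n))"
        unfolding q by (rule theta_exp_c(2)[OF c_lim _ \<Omega>]) (rule eta_eq)
    next
      assume small: "(\<lambda>n. exp (- c n)) \<in> o(\<lambda>n. d n ^ i n / real n)"
      show "aas_bigtheta p beta (\<lambda>n. real n * ln (real n) / d n ^ i n)" by (rule theta_sphere[OF c_lim _ small]) (rule eta_eq)
    qed (rule mg)
  qed
qed

end
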